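(* Let a root datum of finite type be given, with modified quantized enveloping algebra $\dot{\mathbf{U}}$ over $\mathbb{Q}(v)$, generalized $q$-Schur algebras $\mathbf{S}(\pi)$ ($\pi$ ranging over the finite saturated subsets of $X^+$), and $\widehat{\mathbf{U}}=\varprojlim_\pi\mathbf{S}(\pi)$. Let $\dot{\theta}:\dot{\mathbf{U}}\to\widehat{\mathbf{U}}$ be the unique algebra map with $\widehat{p}_\pi\circ\dot{\theta}=\dot{p}_\pi$ for every finite saturated $\pi\subset X^+$. Then $\dot{\theta}$ is an algebra embedding of $\dot{\mathbf{U}}$ into $\widehat{\mathbf{U}}$ sending $E_{\pm i}1_\lambda$ to $\widehat{E}_{\pm i}\widehat{1}_\lambda$ for all $i\in I$, $\lambda\in X$. Hence, the subalgebra of $\widehat{\mathbf{U}}$ generated by the products $\widehat{E}_{\pm i}\widehat{1}_\lambda$ ($i\in I$, $\lambda\in X$) is isomorphic with $\dot{\mathbf{U}}$.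
   Context: **Root datum.** A Cartan datum is a finite set $I$ with a symmetric $\mathbb{Z}$-valued bilinear form $(\ ,\ )$ on $\mathbb{Z}[I]$ such that $(i,i)\in\{2,4,6,\dots\}$ for $i\in I$ and $2(i,j)/(i,i)\in\{0,-1,-2,\dots\}$ for $i\neq j$. It is of finite type if the matrix $((i,j))_{i,j\in I}$ is positive definite. A root datum for it consists of finitely generated free abelian groups $X,Y$, a perfect pairing $\langle\ ,\ \rangle:Y\times X\to\mathbb{Z}$, and embeddings $I\to Y$ ($i\mapsto h_i$), $I\to X$ ($i\mapsto\alpha_i$) with $\langle h_i,\alpha_j\rangle=2(i,j)/(i,i)$. Throughout it is of finite type. Put $d_i=(i,i)/2$; $\mathbb{N}=\{0,1,2,\dots\}$; $X^+=\{\lambda\in X:\langle h_i,\lambda\rangle\in\mathbb{N}\ \forall i\in I\}$; $\lambda\le\lambda'$ iff $\lambda'-\lambda\in\sum_i\mathbb{N}\alpha_i$. $W$ is the (finite) Weyl group acting on $X$, generated by $\lambda\mapsto\lambda-\langle h_i,\lambda\rangle\alpha_i$. **Quantum numbers.** $v$ is an indeterminate, $v_i=v^{d_i}$; for $P\in\mathbb{Q}(v)$, $P_i$ is $P$ with $v$ replaced by $v_i$. $[n]=(v^n-v^{-n})/(v-v^{-1})$ for $n\in\mathbb{Z}$, $[n]^!=[1][2]\cdots[n]$ for $n\in\mathbb{N}$. Divided powers: $E_{\pm i}^{(m)}=E_{\pm i}^m/[m]_i^!$. **The algebra $\mathbf{U}$** is the unital associative $\mathbb{Q}(v)$-algebra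 with generators $E_i,E_{-i}$ ($i\in I$), $K_h$ ($h\in Y$) and relations: $K_hK_{h'}=K_{h+h'}$, $K_0=1$; $K_hE_{\pm i}=v^{\pm\langle h,\alpha_i\rangle}E_{\pm i}K_h$; $E_iE_{-j}-E_{-j}E_i=\delta_{ij}\frac{K_{d_ih_i}-K_{-d_ih_i}}{v_i-v_i^{-1}}$; $\sum_{s+s'=1-\langle h_i,\alpha_j\rangle}(-1)^{s'}E_{\pm i}^{(s)}E_{\pm j}E_{\pm i}^{(s')}=0$ for $i\ne j$. It is graded, $\mathbf{U}=\bigoplus_{\nu\in\sum\mathbb{Z}\alpha_i}\mathbf{U}(\nu)$, with $K_h\in\mathbf{U}(0)$, $E_{\pm i}\in\mathbf{U}(\pm\alpha_i)$. **The modified form $\dot{\mathbf{U}}$.** For $\lambda,\lambda'\in X$ let ${}_\lambda\mathbf{U}_{\lambda'}=\mathbf{U}/\big(\sum_{h\in Y}(K_h-v^{\langle h,\lambda\rangle})\mathbf{U}+\sum_{h\in Y}\mathbf{U}(K_h-v^{\langle h,\lambda'\rangle})\big)$ (quotient vector space) with canonical projection $\pi_{\lambda,\lambda'}$, and $\dot{\mathbf{U}}=\bigoplus_{\lambda,\lambda'\in X}{}_\lambda\mathbf{U}_{\lambda'}$. Multiplication: for $t\in\mathbf{U}(\lambda_1-\lambda_1')$, $s\in\mathbf{U}(\lambda_2-\lambda_2')$, $\pi_{\lambda_1,\lambda_1'}(t)\pi_{\lambda_2,\lambda_2'}(s)=\pi_{\lambda_1,\lambda_2'}(ts)$ if $\lambda_1'=\lambda_2$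 and $0$ otherwise. Put $1_\lambda=\pi_{\lambda,\lambda}(1)$ and $E_{\pm i}1_\lambda=\pi_{\lambda\pm\alpha_i,\lambda}(E_{\pm i})$. **The algebras $\mathbf{S}(\pi)$.** A nonempty subset $\pi\subset X^+$ is saturated if $\lambda\in X^+$, $\mu\in\pi$, $\lambda\le\mu$ imply $\lambda\in\pi$. For finite saturated $\pi$, $\mathbf{S}(\pi)$ is the unital associative $\mathbb{Q}(v)$-algebra with generators $E_i,E_{-i}$ ($i\in I$), $1_\lambda$ ($\lambda\in W\pi$) and, with the convention $1_\lambda=0$ for $\lambda\in X\setminus W\pi$, relations (for all $i,j\in I$, $\lambda,\lambda'\in X$): $1_\lambda1_{\lambda'}=\delta_{\lambda,\lambda'}1_\lambda$, $\sum_{\lambda\in X}1_\lambda=1$; $E_{\pm i}1_\lambda=1_{\lambda\pm\alpha_i}E_{\pm i}$; $E_iE_{-j}-E_{-j}E_i=\delta_{ij}\sum_{\lambda\in X}[\langle h_i,\lambda\rangle]_i1_\lambda$; $\sum_{s+s'=1-\langle h_i,\alpha_j\rangle}(-1)^{s'}E_{\pm i}^{(s)}E_{\pm j}E_{\pm i}^{(s')}=0$ for $i\neq j$. It is finite dimensional. In $\mathbf{S}(\pi)$ put $K_h=\sum_{\lambda\in W\pi}v^{\langle h,\lambda\rangle}1_\lambda$ ($h\in Y$). **Inverse limit.** For $\pi\subset\pi'$, $f_{\pi,\pi'}:\mathbf{S}(\pi')\to\mathbf{S}(\pi)$ is the surjective algebra map $E_{\pm i}\mapsto E_{\pm i}$,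 $1_\lambda\mapsto1_\lambda$. $\widehat{\mathbf{U}}=\varprojlim\mathbf{S}(\pi)=\{(a_\pi)_\pi\in\prod_\pi\mathbf{S}(\pi): a_\pi=f_{\pi,\pi'}(a_{\pi'})\text{ for }\pi\subset\pi'\}$, over all finite saturated $\pi\subset X^+$, with componentwise operations; $\widehat{p}_\pi:\widehat{\mathbf{U}}\to\mathbf{S}(\pi)$ is the projection. Put $\widehat{E}_{\pm i}=(E_{\pm i})_\pi$, $\widehat{1}_\lambda=(1_\lambda)_\pi$. **The maps $\dot{p}_\pi$.** $p_\pi:\mathbf{U}\to\mathbf{S}(\pi)$ is the algebra map $E_{\pm i}\mapsto E_{\pm i}$, $K_h\mapsto K_h$. $\dot{p}_\pi:\dot{\mathbf{U}}\to\mathbf{S}(\pi)$ is the surjective algebra map $\pi_{\lambda,\lambda'}(u)\mapsto1_\lambda p_\pi(u)1_{\lambda'}$; it sends $E_{\pm i}1_\lambda\mapsto E_{\pm i}1_\lambda$. These maps satisfy $f_{\pi,\pi'}\circ\dot{p}_{\pi'}=\dot{p}_\pi$ for $\pi\subset\pi'$, so $\dot{\theta}$ exists and is unique by the universal property of inverse limits.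
   Formalization: The last sentence is corrected: the subalgebra is generated by the products Ê_{±i}1̂_λ together with the idempotents 1̂_λ for those λ with ⟨h_i,λ⟩=0 for all i; the products alone do not generate 1̂_0, and that smaller algebra is not isomorphic with U̇ (e.g. for sl_2). *)

theory Defs
  imports
    "HOL-Algebra.Free_Abelian_Groups"
    "HOL-Algebra.Bij"
    "HOL-Algebra.QuotRing"
    "HOL-Algebra.Module"
    "HOL-Algebra.Generated_Groups"
    "HOL-Library.Poly_Mapping"
    "HOL-Computational_Algebra.Polynomial"
    "HOL-Computational_Algebra.Fraction_Field"
begin

section \<open>Root data of finite type\<close>

definition add_grp :: "'a::ab_group_add monoid" where
  "add_grp = \<lparr>carrier = UNIV, monoid.mult = (+), one = 0\<rparr>"

abbreviation zmul :: "int \<Rightarrow> 'a::ab_group_add \<Rightarrow> 'a" where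
  "zmul n x \<equiv> x [^]\<^bsub>add_grp\<^esub> n"

text \<open>Finitely generated free: isomorphic to the free abelian group on a finite set, which can be
  taken to be a basis and hence a set of elements of the group.\<close>

definition fg_free_abelian :: "'a::ab_group_add itself \<Rightarrow> bool" where
  "fg_free_abelian _ \<longleftrightarrow>
     (\<exists>B::'a set. finite B \<and> free_Abelian_group B \<cong> (add_grp :: 'a monoid))"

text \<open>The lattices \<open>X\<close> and \<open>Y\<close> are the universes of the types \<^typ>\<open>'x\<close> and \<^typ>\<open>'y\<close>. The bilinear
  form on \<open>\<int>[I]\<close> is given by its Gram matrix \<open>form i j = (i, j)\<close>.\<close>

record ('i, 'x, 'y) root_datum =
  simples :: "'i set"
  form :: "'i \<Rightarrow> 'i \<Rightarrow> int"
  pair :: "'y \<Rightarrow> 'x \<Rightarrow> int"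
  coroot :: "'i \<Rightarrow> 'y"
  simple_root :: "'i \<Rightarrow> 'x"

definition cartan_datum :: "'i set \<Rightarrow> ('i \<Rightarrow> 'i \<Rightarrow> int) \<Rightarrow> bool" where
  "cartan_datum I b \<longleftrightarrow>
     finite I \<and>
     (\<forall>i\<in>I. \<forall>j\<in>I. b i j = b j i) \<and>
     (\<forall>i\<in>I. even (b i i) \<and> b i i > 0) \<and>
     (\<forall>i\<in>I. \<forall>j\<in>I. i \<noteq> j \<longrightarrow> b i i dvd 2 * b i j \<and> 2 * b i j div b i i \<le> 0)"

definition finite_type :: "'i set \<Rightarrow> ('i \<Rightarrow> 'i \<Rightarrow> int) \<Rightarrow> bool" where
  "finite_type I b \<longleftrightarrow>
     (\<forall>x::'i \<Rightarrow> real. (\<exists>i\<in>I. x i \<noteq> 0) \<longrightarrow> (\<Sum>i\<in>I. \<Sum>j\<in>I. x i * of_int (b i j) * x j) > 0)"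

definition perfect_pairing :: "('y::ab_group_add \<Rightarrow> 'x::ab_group_add \<Rightarrow> int) \<Rightarrow> bool" where
  "perfect_pairing p \<longleftrightarrow>
     (\<forall>h. Modules.additive (\<lambda>l. p h l)) \<and> (\<forall>l. Modules.additive (\<lambda>h. p h l)) \<and>
     (\<forall>\<phi>. Modules.additive \<phi> \<longrightarrow> (\<exists>!h. \<phi> = (\<lambda>l. p h l))) \<and>
     (\<forall>\<psi>. Modules.additive \<psi> \<longrightarrow> (\<exists>!l. \<psi> = (\<lambda>h. p h l)))"

definition root_datum_finite_type :: "('i, 'x::ab_group_add, 'y::ab_group_add) root_datum \<Rightarrow> bool" where
  "root_datum_finite_type D \<longleftrightarrow>
     cartan_datum (simples D) (form D) \<and> finite_type (simples D) (form D) \<and>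
     fg_free_abelian TYPE('x) \<and> fg_free_abelian TYPE('y) \<and>
     perfect_pairing (pair D) \<and>
     inj_on (coroot D) (simples D) \<and> inj_on (simple_root D) (simples D) \<and>
     (\<forall>i\<in>simples D. \<forall>j\<in>simples D.
        pair D (coroot D i) (simple_root D j) = 2 * form D i j div form D i i)"

definition half_norm :: "('i, 'x, 'y) root_datum \<Rightarrow> 'i \<Rightarrow> int" where
  "half_norm D i = form D i i div 2"

definition dominant :: "('i, 'x, 'y) root_datum \<Rightarrow> 'x set" where
  "dominant D = {l. \<forall>i\<in>simples D. pair D (coroot D i) l \<ge> 0}"

definition dom_le :: "('i, 'x::ab_group_add, 'y) root_datum \<Rightarrow> 'x \<Rightarrow> 'x \<Rightarrow> bool" where
  "dom_le D l l' \<longleftrightarrow> (\<exists>c::'i \<Rightarrow> nat. l' - l = (\<Sum>i\<in>simples D. zmul (int (c i)) (simple_root D i)))"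

definition reflection :: "('i, 'x::ab_group_add, 'y) root_datum \<Rightarrow> 'i \<Rightarrow> 'x \<Rightarrow> 'x" where
  "reflection D i l = l - zmul (pair D (coroot D i) l) (simple_root D i)"

definition weyl_group :: "('i, 'x::ab_group_add, 'y) root_datum \<Rightarrow> ('x \<Rightarrow> 'x) set" where
  "weyl_group D = generate (BijGroup UNIV) (reflection D ` simples D)"

definition weyl_orbits :: "('i, 'x::ab_group_add, 'y) root_datum \<Rightarrow> 'x set \<Rightarrow> 'x set" where
  "weyl_orbits D P = (\<Union>w\<in>weyl_group D. w ` P)"

definition finite_saturated :: "('i, 'x::ab_group_add, 'y) root_datum \<Rightarrow> 'x set set" where
  "finite_saturated D =
     {P. finite P \<and> P \<noteq> {} \<and> P \<subseteq> dominant D \<and>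
         (\<forall>l\<in>dominant D. \<forall>m\<in>P. dom_le D l m \<longrightarrow> l \<in> P)}"


section \<open>Quantum numbers\<close>

type_synonym qv = "rat poly fract"

definition v_ind :: qv where
  "v_ind = Fract [:0, 1:] 1"

definition v_sub :: "('i, 'x, 'y) root_datum \<Rightarrow> 'i \<Rightarrow> qv" where
  "v_sub D i = v_ind powi half_norm D i"

text \<open>The parameter \<open>q\<close> stands for the value substituted for \<open>v\<close>: \<open>[n]\<close> is \<open>qnum v_ind n\<close> and
  \<open>[n]\<^sub>i\<close> is \<open>qnum (v_sub D i) n\<close>.\<close>

definition qnum :: "qv \<Rightarrow> int \<Rightarrow> qv" where
  "qnum q n = (q powi n - q powi (- n)) / (q - inverse q)"

definition qfact :: "qv \<Rightarrow> nat \<Rightarrow> qv" where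
  "qfact q m = (\<Prod>k=1..m. qnum q (int k))"


section \<open>Algebras by generators and relations\<close>

text \<open>A wrapper around lists, so that the finitely supported functions on words, with the
  convolution product of \<^typ>\<open>'a \<Rightarrow>\<^sub>0 'b\<close>, form the free unital associative algebra.\<close>

datatype 'g word = Word (letters: "'g list")

instantiation word :: (type) monoid_add
begin
definition zero_word :: "'a word" where "zero_word = Word []"
definition plus_word :: "'a word \<Rightarrow> 'a word \<Rightarrow> 'a word" where
  "plus_word u w = Word (letters u @ letters w)"
instance
  by standard (simp_all add: zero_word_def plus_word_def)
end

type_synonym 'g free = "'g word \<Rightarrow>\<^sub>0 qv"

definition scal :: "qv \<Rightarrow> 'g free" where
  "scal c = Poly_Mapping.single 0 c"

definition gen_elt :: "'g \<Rightarrow> 'g free" where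
  "gen_elt g = Poly_Mapping.single (Word [g]) 1"

definition free_alg :: "'g set \<Rightarrow> (qv, 'g free) module" where
  "free_alg G = \<lparr>carrier = {p. \<forall>w\<in>Poly_Mapping.keys p. set (letters w) \<subseteq> G},
     monoid.mult = (*), one = 1, zero = 0, add = (+), module.smult = (\<lambda>c p. scal c * p)\<rparr>"

text \<open>For a two-sided ideal \<open>N\<close> this is the quotient algebra. For a mere linear subspace \<open>N\<close> it is
  the quotient vector space, and the multiplicative fields are meaningless.\<close>

definition quot_alg :: "('k, 'a) module \<Rightarrow> 'a set \<Rightarrow> ('k, 'a set) module" where
  "quot_alg A N = ring.extend (A Quot N)
     (module.fields (\<lambda>c Z. \<Union>x\<in>Z. N +>\<^bsub>A\<^esub> (c \<odot>\<^bsub>A\<^esub> x)))"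

definition presented_alg :: "'g set \<Rightarrow> 'g free set \<Rightarrow> (qv, 'g free set) module" where
  "presented_alg G R = quot_alg (free_alg G) (Idl\<^bsub>free_alg G\<^esub> R)"

definition cls :: "'g set \<Rightarrow> 'g free set \<Rightarrow> 'g free \<Rightarrow> 'g free set" where
  "cls G R p = (Idl\<^bsub>free_alg G\<^esub> R) +>\<^bsub>free_alg G\<^esub> p"

text \<open>The homomorphism from the free algebra to \<open>A\<close> with prescribed values on the generators.\<close>

definition eval_free :: "(qv, 'a) module \<Rightarrow> ('g \<Rightarrow> 'a) \<Rightarrow> 'g free \<Rightarrow> 'a" where
  "eval_free A \<phi> p = (\<Oplus>\<^bsub>A\<^esub>w\<in>Poly_Mapping.keys p.
     Poly_Mapping.lookup p w \<odot>\<^bsub>A\<^esub> foldr (\<lambda>g a. \<phi> g \<otimes>\<^bsub>A\<^esub> a) (letters w) \<one>\<^bsub>A\<^esub>)"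

text \<open>The map induced on residue classes; it is meaningful if \<^term>\<open>eval_free A \<phi>\<close> kills the
  relations, so that the image of a class is a singleton.\<close>

definition induced_map :: "(qv, 'a) module \<Rightarrow> ('g \<Rightarrow> 'a) \<Rightarrow> 'g free set \<Rightarrow> 'a" where
  "induced_map A \<phi> Z = the_elem (eval_free A \<phi> ` Z)"


section \<open>Homomorphisms and subalgebras of algebras not necessarily having a unit\<close>

definition alg_hom :: "('k, 'a) module \<Rightarrow> ('k, 'b) module \<Rightarrow> ('a \<Rightarrow> 'b) set" where
  "alg_hom A B = {f \<in> carrier A \<rightarrow> carrier B.
     (\<forall>x\<in>carrier A. \<forall>y\<in>carrier A. f (x \<oplus>\<^bsub>A\<^esub> y) = f x \<oplus>\<^bsub>B\<^esub> f y) \<and>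
     (\<forall>x\<in>carrier A. \<forall>y\<in>carrier A. f (x \<otimes>\<^bsub>A\<^esub> y) = f x \<otimes>\<^bsub>B\<^esub> f y) \<and>
     (\<forall>c. \<forall>x\<in>carrier A. f (c \<odot>\<^bsub>A\<^esub> x) = c \<odot>\<^bsub>B\<^esub> f x)}"

definition alg_embedding :: "('k, 'a) module \<Rightarrow> ('k, 'b) module \<Rightarrow> ('a \<Rightarrow> 'b) set" where
  "alg_embedding A B = {f \<in> alg_hom A B. inj_on f (carrier A)}"

definition alg_isomorphic :: "('k, 'a) module \<Rightarrow> ('k, 'b) module \<Rightarrow> bool" where
  "alg_isomorphic A B \<longleftrightarrow> (\<exists>f\<in>alg_hom A B. bij_betw f (carrier A) (carrier B))"

definition subalg :: "('k, 'a) module \<Rightarrow> 'a set \<Rightarrow> bool" where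
  "subalg B H \<longleftrightarrow> H \<subseteq> carrier B \<and> \<zero>\<^bsub>B\<^esub> \<in> H \<and>
     (\<forall>x\<in>H. \<forall>y\<in>H. x \<oplus>\<^bsub>B\<^esub> y \<in> H \<and> x \<otimes>\<^bsub>B\<^esub> y \<in> H) \<and> (\<forall>c. \<forall>x\<in>H. c \<odot>\<^bsub>B\<^esub> x \<in> H)"

definition generated_subalg :: "('k, 'a) module \<Rightarrow> 'a set \<Rightarrow> ('k, 'a) module" where
  "generated_subalg B S = B\<lparr>carrier := \<Inter>{H. subalg B H \<and> S \<subseteq> H}\<rparr>"


section \<open>The algebra \<open>U\<close>\<close>

datatype sign = Plus | Minus

primrec signed :: "sign \<Rightarrow> 'a::uminus \<Rightarrow> 'a" where
  "signed Plus x = x"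
| "signed Minus x = - x"

text \<open>\<open>E s i\<close> is \<open>E\<^sub>i\<close> or \<open>E\<^bsub>-i\<^esub>\<close> according to the sign \<open>s\<close>. \<open>T\<close> is used for the generators
  \<open>K\<^sub>h\<close> (\<open>h \<in> Y\<close>) of \<open>U\<close> and for the generators \<open>1\<^sub>\<lambda>\<close> (\<open>\<lambda> \<in> W\<pi>\<close>) of \<open>S(\<pi>)\<close>.\<close>

datatype ('i, 't) gen = E sign 'i | T 't

definition div_pow :: "('i, 'x, 'y) root_datum \<Rightarrow> sign \<Rightarrow> 'i \<Rightarrow> nat \<Rightarrow> ('i, 't) gen free" where
  "div_pow D s i m = scal (inverse (qfact (v_sub D i) m)) * gen_elt (E s i) ^ m"

definition serre_rels :: "('i, 'x, 'y) root_datum \<Rightarrow> ('i, 't) gen free set" where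
  "serre_rels D =
     {\<Sum>r\<le>nat (1 - pair D (coroot D i) (simple_root D j)).
        (-1) ^ r * div_pow D s i (nat (1 - pair D (coroot D i) (simple_root D j)) - r)
          * gen_elt (E s j) * div_pow D s i r
      | s i j. i \<in> simples D \<and> j \<in> simples D \<and> i \<noteq> j}"

definition U_gens :: "('i, 'x, 'y) root_datum \<Rightarrow> ('i, 'y) gen set" where
  "U_gens D = {E s i | s i. i \<in> simples D} \<union> range T"

definition U_rels :: "('i, 'x, 'y::ab_group_add) root_datum \<Rightarrow> ('i, 'y) gen free set" where
  "U_rels D =
     {gen_elt (T h) * gen_elt (T h') - gen_elt (T (h + h')) | h h'. True} \<union>
     {gen_elt (T 0) - 1} \<union>
     {gen_elt (T h) * gen_elt (E s i)
        - scal (v_ind powi signed s (pair D h (simple_root D i))) * gen_elt (E s i) * gen_elt (T h)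
      | h s i. i \<in> simples D} \<union>
     {gen_elt (E Plus i) * gen_elt (E Minus j) - gen_elt (E Minus j) * gen_elt (E Plus i)
        - (if i = j then scal (inverse (v_sub D i - inverse (v_sub D i)))
             * (gen_elt (T (zmul (half_norm D i) (coroot D i)))
                - gen_elt (T (- zmul (half_norm D i) (coroot D i)))) else 0)
      | i j. i \<in> simples D \<and> j \<in> simples D} \<union>
     serre_rels D"

definition U_alg :: "('i, 'x, 'y::ab_group_add) root_datum \<Rightarrow> (qv, ('i, 'y) gen free set) module" where
  "U_alg D = presented_alg (U_gens D) (U_rels D)"

definition U_E :: "('i, 'x, 'y::ab_group_add) root_datum \<Rightarrow> sign \<Rightarrow> 'i \<Rightarrow> ('i, 'y) gen free set" where
  "U_E D s i = cls (U_gens D) (U_rels D) (gen_elt (E s i))"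

definition U_K :: "('i, 'x, 'y::ab_group_add) root_datum \<Rightarrow> 'y \<Rightarrow> ('i, 'y) gen free set" where
  "U_K D h = cls (U_gens D) (U_rels D) (gen_elt (T h))"

primrec gen_weight :: "('i, 'x::ab_group_add, 'y) root_datum \<Rightarrow> ('i, 'y) gen \<Rightarrow> 'x" where
  "gen_weight D (E s i) = signed s (simple_root D i)"
| "gen_weight D (T h) = 0"

text \<open>The graded piece \<open>U(\<nu>)\<close>, which is \<open>0\<close> if \<open>\<nu>\<close> is not in the root lattice.\<close>

definition U_graded ::
  "('i, 'x::ab_group_add, 'y::ab_group_add) root_datum \<Rightarrow> 'x \<Rightarrow> ('i, 'y) gen free set set" where
  "U_graded D \<nu> = cls (U_gens D) (U_rels D) `
     {p \<in> carrier (free_alg (U_gens D)).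
        \<forall>w\<in>Poly_Mapping.keys p. sum_list (map (gen_weight D) (letters w)) = \<nu>}"


section \<open>The modified form\<close>

text \<open>A sum of linear subspaces is the additive subgroup generated by their union.\<close>

definition block_ker ::
  "('i, 'x, 'y::ab_group_add) root_datum \<Rightarrow> 'x \<Rightarrow> 'x \<Rightarrow> ('i, 'y) gen free set set" where
  "block_ker D l l' =
     (let U = U_alg D; k = (\<lambda>h m. U_K D h \<ominus>\<^bsub>U\<^esub> ((v_ind powi pair D h m) \<odot>\<^bsub>U\<^esub> \<one>\<^bsub>U\<^esub>))
      in generate (add_monoid U)
           ({k h l \<otimes>\<^bsub>U\<^esub> u | h u. u \<in> carrier U} \<union> {u \<otimes>\<^bsub>U\<^esub> k h l' | h u. u \<in> carrier U}))"

definition block ::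
  "('i, 'x, 'y::ab_group_add) root_datum \<Rightarrow> 'x \<Rightarrow> 'x \<Rightarrow> (qv, ('i, 'y) gen free set set) module" where
  "block D l l' = quot_alg (U_alg D) (block_ker D l l')"

definition block_proj ::
  "('i, 'x, 'y::ab_group_add) root_datum \<Rightarrow> 'x \<Rightarrow> 'x \<Rightarrow> ('i, 'y) gen free set
     \<Rightarrow> ('i, 'y) gen free set set" where
  "block_proj D l l' u = block_ker D l l' +>\<^bsub>U_alg D\<^esub> u"

text \<open>The product of \<open>a\<close> in block \<open>(l, m)\<close> and \<open>b\<close> in block \<open>(m, n)\<close>, computed on homogeneous
  representatives; these exist and the result does not depend on them.\<close>

definition block_mult ::
  "('i, 'x::ab_group_add, 'y::ab_group_add) root_datum \<Rightarrow> 'x \<Rightarrow> 'x \<Rightarrow> 'x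
     \<Rightarrow> ('i, 'y) gen free set set \<Rightarrow> ('i, 'y) gen free set set \<Rightarrow> ('i, 'y) gen free set set" where
  "block_mult D l m n a b = the_elem
     {block_proj D l n (t \<otimes>\<^bsub>U_alg D\<^esub> s) | t s.
        t \<in> U_graded D (l - m) \<and> s \<in> U_graded D (m - n) \<and>
        block_proj D l m t = a \<and> block_proj D m n s = b}"

type_synonym ('i, 'x, 'y) udot = "'x \<Rightarrow> 'x \<Rightarrow> ('i, 'y) gen free set set"

text \<open>The direct sum of the blocks, as finitely supported families. The algebra has no unit in
  general, so the field \<^const>\<open>monoid.one\<close> is left unspecified.\<close>

definition Udot :: "('i, 'x::ab_group_add, 'y::ab_group_add) root_datum
    \<Rightarrow> (qv, ('i, 'x, 'y) udot) module" where
  "Udot D =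
    \<lparr>carrier = {f. (\<forall>l m. f l m \<in> carrier (block D l m)) \<and>
                   finite {(l, m). f l m \<noteq> \<zero>\<^bsub>block D l m\<^esub>}},
     monoid.mult = (\<lambda>f g l n. \<Oplus>\<^bsub>block D l n\<^esub>
               m\<in>{m. f l m \<noteq> \<zero>\<^bsub>block D l m\<^esub> \<and> g m n \<noteq> \<zero>\<^bsub>block D m n\<^esub>}.
                 block_mult D l m n (f l m) (g m n)),
     one = undefined,
     zero = (\<lambda>l m. \<zero>\<^bsub>block D l m\<^esub>),
     add = (\<lambda>f g l m. f l m \<oplus>\<^bsub>block D l m\<^esub> g l m),
     module.smult = (\<lambda>c f l m. c \<odot>\<^bsub>block D l m\<^esub> f l m)\<rparr>"

definition udot_proj :: "('i, 'x, 'y::ab_group_add) root_datum \<Rightarrow> 'x \<Rightarrow> 'x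
    \<Rightarrow> ('i, 'y) gen free set \<Rightarrow> ('i, 'x, 'y) udot" where
  "udot_proj D l m u =
     (\<lambda>l' m'. if l' = l \<and> m' = m then block_proj D l m u else \<zero>\<^bsub>block D l' m'\<^esub>)"

text \<open>The element \<open>E\<^sub>i 1\<^sub>\<lambda>\<close> or \<open>E\<^bsub>-i\<^esub> 1\<^sub>\<lambda>\<close>.\<close>

definition udot_E1 :: "('i, 'x::ab_group_add, 'y::ab_group_add) root_datum \<Rightarrow> sign \<Rightarrow> 'i \<Rightarrow> 'x
    \<Rightarrow> ('i, 'x, 'y) udot" where
  "udot_E1 D s i l = udot_proj D (l + signed s (simple_root D i)) l (U_E D s i)"


section \<open>The generalized \<open>q\<close>-Schur algebras\<close>

definition S_gens :: "('i, 'x::ab_group_add, 'y) root_datum \<Rightarrow> 'x set \<Rightarrow> ('i, 'x) gen set" where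
  "S_gens D P = {E s i | s i. i \<in> simples D} \<union> T ` weyl_orbits D P"

definition idem :: "('i, 'x::ab_group_add, 'y) root_datum \<Rightarrow> 'x set \<Rightarrow> 'x \<Rightarrow> ('i, 'x) gen free" where
  "idem D P l = (if l \<in> weyl_orbits D P then gen_elt (T l) else 0)"

definition S_rels :: "('i, 'x::ab_group_add, 'y) root_datum \<Rightarrow> 'x set \<Rightarrow> ('i, 'x) gen free set" where
  "S_rels D P =
     {idem D P l * idem D P l' - (if l = l' then idem D P l else 0) | l l'. True} \<union>
     {(\<Sum>l\<in>weyl_orbits D P. idem D P l) - 1} \<union>
     {gen_elt (E s i) * idem D P l - idem D P (l + signed s (simple_root D i)) * gen_elt (E s i)
      | s i l. i \<in> simples D} \<union>
     {gen_elt (E Plus i) * gen_elt (E Minus j) - gen_elt (E Minus j) * gen_elt (E Plus i)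
        - (if i = j then \<Sum>l\<in>weyl_orbits D P.
             scal (qnum (v_sub D i) (pair D (coroot D i) l)) * idem D P l else 0)
      | i j. i \<in> simples D \<and> j \<in> simples D} \<union>
     serre_rels D"

definition S_alg :: "('i, 'x::ab_group_add, 'y) root_datum \<Rightarrow> 'x set
    \<Rightarrow> (qv, ('i, 'x) gen free set) module" where
  "S_alg D P = presented_alg (S_gens D P) (S_rels D P)"

definition S_E :: "('i, 'x::ab_group_add, 'y) root_datum \<Rightarrow> 'x set \<Rightarrow> sign \<Rightarrow> 'i
    \<Rightarrow> ('i, 'x) gen free set" where
  "S_E D P s i = cls (S_gens D P) (S_rels D P) (gen_elt (E s i))"

definition S_one :: "('i, 'x::ab_group_add, 'y) root_datum \<Rightarrow> 'x set \<Rightarrow> 'x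
    \<Rightarrow> ('i, 'x) gen free set" where
  "S_one D P l = cls (S_gens D P) (S_rels D P) (idem D P l)"

definition S_K :: "('i, 'x::ab_group_add, 'y) root_datum \<Rightarrow> 'x set \<Rightarrow> 'y
    \<Rightarrow> ('i, 'x) gen free set" where
  "S_K D P h = (\<Oplus>\<^bsub>S_alg D P\<^esub>l\<in>weyl_orbits D P. (v_ind powi pair D h l) \<odot>\<^bsub>S_alg D P\<^esub> S_one D P l)"

text \<open>The map \<open>f\<^bsub>\<pi>,\<pi>'\<^esub> : S(\<pi>') \<rightarrow> S(\<pi>)\<close>; it does not mention \<open>\<pi>'\<close>, as it acts on
  residue classes.\<close>

definition S_trans :: "('i, 'x::ab_group_add, 'y) root_datum \<Rightarrow> 'x set
    \<Rightarrow> ('i, 'x) gen free set \<Rightarrow> ('i, 'x) gen free set" where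
  "S_trans D P = induced_map (S_alg D P) (case_gen (S_E D P) (S_one D P))"

definition p_map :: "('i, 'x::ab_group_add, 'y) root_datum \<Rightarrow> 'x set
    \<Rightarrow> ('i, 'y) gen free set \<Rightarrow> ('i, 'x) gen free set" where
  "p_map D P = induced_map (S_alg D P) (case_gen (S_E D P) (S_K D P))"

text \<open>The map sending \<open>\<pi>\<^bsub>\<lambda>,\<lambda>'\<^esub>(u)\<close> to \<open>1\<^sub>\<lambda> p\<^sub>\<pi>(u) 1\<^bsub>\<lambda>'\<^esub>\<close>, extended linearly; each \<open>f l m\<close> is the set
  of all \<open>u\<close> representing it.\<close>

definition pdot_map :: "('i, 'x::ab_group_add, 'y::ab_group_add) root_datum \<Rightarrow> 'x set
    \<Rightarrow> ('i, 'x, 'y) udot \<Rightarrow> ('i, 'x) gen free set" where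
  "pdot_map D P f =
     finsum (S_alg D P)
       (\<lambda>(l, m). the_elem
          ((\<lambda>u. S_one D P l \<otimes>\<^bsub>S_alg D P\<^esub> p_map D P u \<otimes>\<^bsub>S_alg D P\<^esub> S_one D P m) ` f l m))
       {(l, m). f l m \<noteq> \<zero>\<^bsub>block D l m\<^esub>}"


section \<open>The inverse limit\<close>

definition Uhat :: "('i, 'x::ab_group_add, 'y) root_datum
    \<Rightarrow> (qv, 'x set \<Rightarrow> ('i, 'x) gen free set) module" where
  "Uhat D =
    \<lparr>carrier = {a \<in> \<Pi>\<^sub>E P\<in>finite_saturated D. carrier (S_alg D P).
                  \<forall>P\<in>finite_saturated D. \<forall>P'\<in>finite_saturated D.
                    P \<subseteq> P' \<longrightarrow> a P = S_trans D P (a P')},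
     monoid.mult = (\<lambda>a b. \<lambda>P\<in>finite_saturated D. a P \<otimes>\<^bsub>S_alg D P\<^esub> b P),
     one = (\<lambda>P\<in>finite_saturated D. \<one>\<^bsub>S_alg D P\<^esub>),
     zero = (\<lambda>P\<in>finite_saturated D. \<zero>\<^bsub>S_alg D P\<^esub>),
     add = (\<lambda>a b. \<lambda>P\<in>finite_saturated D. a P \<oplus>\<^bsub>S_alg D P\<^esub> b P),
     module.smult = (\<lambda>c a. \<lambda>P\<in>finite_saturated D. c \<odot>\<^bsub>S_alg D P\<^esub> a P)\<rparr>"

definition phat :: "'x set \<Rightarrow> ('x set \<Rightarrow> ('i, 'x) gen free set) \<Rightarrow> ('i, 'x) gen free set" where
  "phat P a = a P"

definition hat_E :: "('i, 'x::ab_group_add, 'y) root_datum \<Rightarrow> sign \<Rightarrow> 'i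
    \<Rightarrow> 'x set \<Rightarrow> ('i, 'x) gen free set" where
  "hat_E D s i = (\<lambda>P\<in>finite_saturated D. S_E D P s i)"

definition hat_one :: "('i, 'x::ab_group_add, 'y) root_datum \<Rightarrow> 'x
    \<Rightarrow> 'x set \<Rightarrow> ('i, 'x) gen free set" where
  "hat_one D l = (\<lambda>P\<in>finite_saturated D. S_one D P l)"

definition is_theta_dot :: "('i, 'x::ab_group_add, 'y::ab_group_add) root_datum
    \<Rightarrow> (('i, 'x, 'y) udot \<Rightarrow> 'x set \<Rightarrow> ('i, 'x) gen free set) \<Rightarrow> bool" where
  "is_theta_dot D \<theta> \<longleftrightarrow>
     \<theta> \<in> alg_hom (Udot D) (Uhat D) \<and>
     (\<forall>P\<in>finite_saturated D. \<forall>f\<in>carrier (Udot D). phat P (\<theta> f) = pdot_map D P f)"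

definition hat_products :: "('i, 'x::ab_group_add, 'y) root_datum
    \<Rightarrow> ('x set \<Rightarrow> ('i, 'x) gen free set) set" where
  "hat_products D = {hat_E D s i \<otimes>\<^bsub>Uhat D\<^esub> hat_one D l | s i l. i \<in> simples D}"

text \<open>The products \<open>E\<^bsub>\<plusminus>i\<^esub> 1\<^sub>\<lambda>\<close> alone do not generate the image of the modified form: if
  \<open>\<langle>h\<^sub>i, \<lambda>\<rangle> = 0\<close> for all \<open>i\<close>, then \<open>\<pi> = {\<lambda>}\<close> is saturated and the projection to \<open>S(\<pi>)\<close>
  kills all of them but not \<open>1\<^sub>\<lambda>\<close>. For every other \<open>\<lambda>\<close> the idempotent \<open>1\<^sub>\<lambda>\<close> is obtained from the
  products via the commutator relation, so that exactly the following elements have to be added.\<close>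

definition hat_invariant_ones :: "('i, 'x::ab_group_add, 'y) root_datum
    \<Rightarrow> ('x set \<Rightarrow> ('i, 'x) gen free set) set" where
  "hat_invariant_ones D = {hat_one D l | l. \<forall>i\<in>simples D. pair D (coroot D i) l = 0}"

end

theory Submission imports Defs begin

text \<open>The point is the injectivity of \<open>\<theta>\<close>. The block of weights \<open>\<lambda>, \<mu>\<close> is spanned by products of a
  monomial in the raising and a monomial in the lowering operators. Suppose that an element of the
  block is killed in every \<open>S(\<pi>)\<close> and let \<open>t\<close> be its part of greatest length \<open>N\<close> in the raising
  operators. If \<open>t \<noteq> 0\<close>, a linear functional on the block is \<open>1\<close> on \<open>t\<close>. Its values on the products of
  raising length \<open>N\<close> are a vector in the dual of a tensor product of an integrable lowest weight
  module of lowest weight \<open>-a\<close> and an integrable highest weight module of highest weight \<open>b\<close>, where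
  \<open>b - a = \<mu>\<close> and \<open>a\<close>, \<open>b\<close> are so large that the integrability relations are not seen in the lengths that
  occur. Reflecting in \<open>sl\<^sub>2\<close>-strings bounds the norms of the weights of such a module, so that the
  module is one over \<open>S(\<pi>)\<close> for some \<open>\<pi>\<close>, in which the element acts nontrivially. This needs neither a
  basis theorem for \<open>U\<close> nor complete reducibility.

  The identity \<open>E\<^sub>i E\<^bsub>-i\<^esub> 1\<^sub>\<lambda> - E\<^bsub>-i\<^esub> E\<^sub>i 1\<^sub>\<lambda> = [\<langle>h\<^sub>i, \<lambda>\<rangle>]\<^sub>i 1\<^sub>\<lambda>\<close> recovers \<open>1\<^sub>\<lambda>\<close> from the products \<open>E\<^bsub>\<plusminus>i\<^esub> 1\<^sub>\<mu>\<close>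
  unless \<open>\<lambda>\<close> is orthogonal to all coroots; these exceptional idempotents have to be adjoined to the
  generators of the image.\<close>

text \<open>Everything is transposed: vectors are functions on words, and operators act on them from
  the right (\<open>lop\<close>). A linear functional on a block, given by its values on monomials,
  is then itself a vector, and it satisfies the Serre relations simply because it kills the ideal
  defining U; no module has to be built as a quotient. Integrability becomes a list of linear
  vanishing conditions (\<open>lowest\<close>), and the work is to show that the transposed lowering
  operators preserve them, which rests on the commutation of quantum Serre elements with lowering
  operators. Two tensor factors are needed because a lowest weight module is spanned by raising
  monomials alone and a highest weight module by lowering ones. The coproduct then causes the
  obstacle: its mixed terms connect different raising lengths. They disappear on functions supported
  in a single raising length \<open>N\<close> when evaluated at words of length at most
  \<open>N\<close>, which is why the element is attacked from its top length downwards. Positive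
  definiteness of the form turns the bound on norms into finitely many weights, hence one finite
  saturated set for the whole module.\<close>

section \<open>Free algebras and the evaluation of their elements in rings with central
  scalars\<close>

lemma letters_zero [simp]: "letters 0 = []"
  by (simp add: zero_word_def)

lemma letters_plus [simp]: "letters (u + w) = letters u @ letters w"
  by (simp add: plus_word_def)

lemma scal_0 [simp]: "scal 0 = 0"
  by (simp add: scal_def)

lemma scal_1 [simp]: "scal 1 = 1"
  by (simp add: scal_def)

lemma scal_add: "scal (a + b) = scal a + scal b"
  by (simp add: scal_def single_add)

lemma scal_mult: "scal (a * b) = scal a * scal b"
  by (simp add: scal_def mult_single)

lemma poly_mapping_sum_single: "p = (\<Sum>w\<in>Poly_Mapping.keys p. Poly_Mapping.single w (Poly_Mapping.lookup p w))"
  by (rule poly_mapping_eqI)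
    (auto simp: lookup_sum lookup_single when_def sum.delta not_in_keys_iff_lookup_eq_zero)

lemma scal_comm: "scal c * (p :: 'g free) = p * scal c"
proof -
  have "scal c * (\<Sum>w\<in>A. Poly_Mapping.single w (f w)) = (\<Sum>w\<in>A. Poly_Mapping.single w (f w)) * scal c"
    for A :: "'g word set" and f
    by (simp add: sum_distrib_left sum_distrib_right scal_def mult_single mult.commute)
  from this[of "Poly_Mapping.lookup p" "Poly_Mapping.keys p"] show ?thesis
    by (simp flip: poly_mapping_sum_single)
qed

lemma single_conv: "Poly_Mapping.single w c = scal c * prod_list (map gen_elt (letters w))"
proof -
  have "prod_list (map gen_elt xs) = Poly_Mapping.single (Word xs) 1" for xs :: "'a list"
    by (induction xs)
      (auto simp: gen_elt_def mult_single plus_word_def simp flip: single_one zero_word_def)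
  then show ?thesis by (cases w) (simp add: scal_def mult_single)
qed

text \<open>A ring with a central homomorphism from Q(v). One set of computations then serves both
  the free algebras (\<open>scal\<close>) and the rings of operators
  (\<open>sc_lop\<close>).\<close>

locale central_scalars =
  fixes sc :: "qv \<Rightarrow> 'b::ring_1"
  assumes sc_add: "sc (a + b) = sc a + sc b"
    and sc_mult: "sc (a * b) = sc a * sc b"
    and sc_1 [simp]: "sc 1 = 1"
    and sc_comm: "sc c * x = x * sc c"
begin

lemma sc_0 [simp]: "sc 0 = 0"
  using sc_add[of 0 0] by simp

lemma sc_minus: "sc (- a) = - sc a"
  using sc_add[of a "- a"] by (simp add: eq_neg_iff_add_eq_0 add.commute)

lemma sc_diff: "sc (a - b) = sc a - sc b"
  using sc_add[of a "- b"] by (simp add: sc_minus)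

lemma sc_sum: "sc (sum f A) = (\<Sum>x\<in>A. sc (f x))"
  by (induction A rule: infinite_finite_induct) (auto simp: sc_add)

lemma sc_power: "sc (a ^ n) = sc a ^ n"
  by (induction n) (auto simp: sc_mult)

lemma sc_left_comm: "x * (sc c * y) = sc c * (x * y)"
  by (simp only: mult.assoc[symmetric] sc_comm[of c x])

lemma sc_neg_1_power: "sc ((- 1) ^ r) = (- 1) ^ r"
  by (simp add: sc_power sc_minus)

end

interpretation free: central_scalars "scal :: qv \<Rightarrow> 'g free"
  by standard (simp_all add: scal_add scal_mult, rule scal_comm)

text \<open>Evaluation of noncommutative polynomials in a type-class ring, the computational
  counterpart of \<open>eval_free\<close>; \<open>eval_free_presented\<close> connects the two. With
  \<open>scal\<close> it is a homomorphism between free algebras and describes maps between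
  presented algebras on representatives.\<close>

definition lift :: "(qv \<Rightarrow> 'b::ring_1) \<Rightarrow> ('g \<Rightarrow> 'b) \<Rightarrow> 'g free \<Rightarrow> 'b" where
  "lift sc \<phi> p = (\<Sum>w\<in>Poly_Mapping.keys p. sc (Poly_Mapping.lookup p w) * prod_list (map \<phi> (letters w)))"

context central_scalars
begin

lemma lift_superset:
  assumes "finite A" "Poly_Mapping.keys p \<subseteq> A"
  shows "lift sc \<phi> p = (\<Sum>w\<in>A. sc (Poly_Mapping.lookup p w) * prod_list (map \<phi> (letters w)))"
  unfolding lift_def using assms
  by (intro sum.mono_neutral_left) (auto simp: not_in_keys_iff_lookup_eq_zero)

lemma lift_0 [simp]: "lift sc \<phi> 0 = 0"
  by (simp add: lift_def)

lemma lift_add: "lift sc \<phi> (p + q) = lift sc \<phi> p + lift sc \<phi> q"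
proof -
  let ?A = "Poly_Mapping.keys p \<union> Poly_Mapping.keys q"
  have *: "finite ?A" "Poly_Mapping.keys (p + q) \<subseteq> ?A" using keys_add[of p q] by auto
  show ?thesis
    unfolding lift_superset[OF *] lift_superset[OF *(1) Un_upper1] lift_superset[OF *(1) Un_upper2]
    by (simp add: lookup_add sc_add distrib_right sum.distrib)
qed

lemma lift_sum: "lift sc \<phi> (sum f A) = (\<Sum>x\<in>A. lift sc \<phi> (f x))"
  by (induction A rule: infinite_finite_induct) (auto simp: lift_add)

lemma lift_uminus [simp]: "lift sc \<phi> (- p) = - lift sc \<phi> p"
  using lift_add[of \<phi> p "- p"] by (simp add: eq_neg_iff_add_eq_0 add.commute)

lemma lift_diff: "lift sc \<phi> (p - q) = lift sc \<phi> p - lift sc \<phi> q"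
  using lift_add[of \<phi> p "- q"] by simp

lemma lift_single: "lift sc \<phi> (Poly_Mapping.single w c) = sc c * prod_list (map \<phi> (letters w))"
  by (subst lift_superset[of "{w}"]) auto

lemma lift_scal [simp]: "lift sc \<phi> (scal c) = sc c"
  by (simp add: scal_def lift_single)

lemma lift_1 [simp]: "lift sc \<phi> 1 = 1"
  using lift_scal[of \<phi> 1] by simp

lemma lift_gen [simp]: "lift sc \<phi> (gen_elt g) = \<phi> g"
  by (simp add: gen_elt_def lift_single)

lemma lift_mult: "lift sc \<phi> (p * q) = lift sc \<phi> p * lift sc \<phi> q"
proof -
  have single: "lift sc \<phi> (Poly_Mapping.single u a * Poly_Mapping.single w b) =
      lift sc \<phi> (Poly_Mapping.single u a) * lift sc \<phi> (Poly_Mapping.single w b)" for u w a b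
  proof -
    have "sc (a * b) * (x * y) = (sc a * x) * (sc b * y)" for x y
      by (simp only: sc_mult mult.assoc sc_left_comm[of x])
    then show ?thesis by (simp add: mult_single lift_single)
  qed
  have "lift sc \<phi> ((\<Sum>u\<in>A. Poly_Mapping.single u (f u)) * (\<Sum>w\<in>B. Poly_Mapping.single w (g w))) =
      lift sc \<phi> (\<Sum>u\<in>A. Poly_Mapping.single u (f u)) * lift sc \<phi> (\<Sum>w\<in>B. Poly_Mapping.single w (g w))"
    for A B f g
    by (simp add: sum_product lift_sum single)
  from this[of "Poly_Mapping.lookup p" "Poly_Mapping.keys p" "Poly_Mapping.lookup q" "Poly_Mapping.keys q"]
  show ?thesis by (simp flip: poly_mapping_sum_single)
qed

lemma lift_power: "lift sc \<phi> (p ^ n) = lift sc \<phi> p ^ n"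
  by (induction n) (auto simp: lift_mult)

lemma lift_prod_list: "lift sc \<phi> (prod_list ps) = prod_list (map (lift sc \<phi>) ps)"
  by (induction ps) (auto simp: lift_mult)

lemma lift_lift: "lift sc \<phi> (lift scal \<psi> p) = lift sc (\<lambda>g. lift sc \<phi> (\<psi> g)) p"
  by (simp add: lift_def[of scal] lift_def[of sc "\<lambda>g. lift sc \<phi> (\<psi> g)"] lift_sum lift_mult
      lift_prod_list o_def)

end


section \<open>Free algebras and their quotients\<close>

abbreviation car :: "'g set \<Rightarrow> 'g free set" where
  "car G \<equiv> carrier (free_alg G)"

lemma car_iff: "p \<in> car G \<longleftrightarrow> (\<forall>w\<in>Poly_Mapping.keys p. set (letters w) \<subseteq> G)"
  by (simp add: free_alg_def)

lemma free_alg_simps [simp]: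
  "monoid.mult (free_alg G) = (*)" "one (free_alg G) = 1" "zero (free_alg G) = 0"
  "add (free_alg G) = (+)" "module.smult (free_alg G) = (\<lambda>c p. scal c * p)"
  by (simp_all add: free_alg_def)

lemma car_single: "set (letters w) \<subseteq> G \<Longrightarrow> Poly_Mapping.single w c \<in> car G"
  by (auto simp: car_iff)

lemma car_0 [simp]: "0 \<in> car G"
  by (simp add: car_iff)

lemma car_1 [simp]: "1 \<in> car G"
  by (simp add: car_iff)

lemma car_scal [simp]: "scal c \<in> car G"
  by (simp add: scal_def car_single)

lemma car_gen [simp]: "g \<in> G \<Longrightarrow> gen_elt g \<in> car G"
  by (simp add: gen_elt_def car_single)

lemma car_add [intro, simp]: "p \<in> car G \<Longrightarrow> q \<in> car G \<Longrightarrow> p + q \<in> car G"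
  using keys_add[of p q] by (fastforce simp: car_iff)

lemma car_uminus [intro, simp]: "p \<in> car G \<Longrightarrow> - p \<in> car G"
  by (simp add: car_iff in_keys_iff)

lemma car_diff [intro, simp]: "p \<in> car G \<Longrightarrow> q \<in> car G \<Longrightarrow> p - q \<in> car G"
  using car_add[of p G "- q"] by auto

lemma car_mult [intro, simp]: "p \<in> car G \<Longrightarrow> q \<in> car G \<Longrightarrow> p * q \<in> car G"
  using keys_mult[of p q] by (fastforce simp: car_iff)

lemma car_sum [intro, simp]: "(\<And>x. x \<in> A \<Longrightarrow> f x \<in> car G) \<Longrightarrow> sum f A \<in> car G"
  by (induction A rule: infinite_finite_induct) auto

lemma car_power [intro, simp]: "p \<in> car G \<Longrightarrow> p ^ n \<in> car G"
  by (induction n) auto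

lemma car_prod_list: "(\<And>x. x \<in> set ps \<Longrightarrow> x \<in> car G) \<Longrightarrow> prod_list ps \<in> car G"
  by (induction ps) auto

lemma car_lift: "(\<And>g. g \<in> H \<Longrightarrow> \<phi> g \<in> car G) \<Longrightarrow> p \<in> car H \<Longrightarrow> lift scal \<phi> p \<in> car G"
  unfolding lift_def by (intro car_sum car_mult car_prod_list) (auto simp: car_iff[of _ H])

text \<open>Words grow by a letter on the left, so linear combinations and left multiplication by
  generators reach every element.\<close>

lemma car_induct [consumes 1, case_names add scal one gen]:
  assumes "p \<in> car G"
    and add: "\<And>p q. p \<in> car G \<Longrightarrow> q \<in> car G \<Longrightarrow> P p \<Longrightarrow> P q \<Longrightarrow> P (p + q)"
    and scal: "\<And>c p. p \<in> car G \<Longrightarrow> P p \<Longrightarrow> P (scal c * p)"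
    and one: "P 1"
    and gen: "\<And>g p. g \<in> G \<Longrightarrow> p \<in> car G \<Longrightarrow> P p \<Longrightarrow> P (gen_elt g * p)"
  shows "P p"
proof -
  have word: "prod_list (map gen_elt xs) \<in> car G \<and> P (prod_list (map gen_elt xs))"
    if "set xs \<subseteq> G" for xs
    using that by (induction xs) (simp_all add: one gen)
  have zero: "P 0" using scal[OF car_1 one, of 0] by simp
  have sum: "sum f A \<in> car G \<and> P (sum f A)" if "\<And>w. w \<in> A \<Longrightarrow> f w \<in> car G \<and> P (f w)"
    for A :: "'a word set" and f
    using that by (induction A rule: infinite_finite_induct) (simp_all add: zero add)
  have "P (\<Sum>w\<in>Poly_Mapping.keys p. Poly_Mapping.single w (Poly_Mapping.lookup p w))"
  proof (rule sum[THEN conjunct2])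
    fix w assume "w \<in> Poly_Mapping.keys p"
    then have w: "set (letters w) \<subseteq> G" using assms(1) by (simp add: car_iff)
    then show "Poly_Mapping.single w (Poly_Mapping.lookup p w) \<in> car G \<and>
        P (Poly_Mapping.single w (Poly_Mapping.lookup p w))"
      using scal[of "prod_list (map gen_elt (letters w))"] word[OF w]
      by (simp add: single_conv)
  qed
  then show ?thesis by (simp flip: poly_mapping_sum_single)
qed

lemma ring_free_alg: "ring (free_alg G)"
proof (rule ringI)
  show "abelian_group (free_alg G)"
  proof (rule abelian_groupI)
    show "\<exists>y\<in>carrier (free_alg G). y \<oplus>\<^bsub>free_alg G\<^esub> x = \<zero>\<^bsub>free_alg G\<^esub>" if "x \<in> car G" for x
      using that by (intro bexI[of _ "- x"]) auto
  qed (auto simp: algebra_simps)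
  show "Group.monoid (free_alg G)"
    by (rule monoidI) (auto simp: algebra_simps)
qed (auto simp: algebra_simps)

lemma free_alg_a_inv: "p \<in> car G \<Longrightarrow> \<ominus>\<^bsub>free_alg G\<^esub> p = - p"
proof -
  interpret ring "free_alg G" by (rule ring_free_alg)
  show "p \<in> car G \<Longrightarrow> \<ominus>\<^bsub>free_alg G\<^esub> p = - p"
    by (rule minus_equality) auto
qed

lemma free_alg_minus: "p \<in> car G \<Longrightarrow> q \<in> car G \<Longrightarrow> p \<ominus>\<^bsub>free_alg G\<^esub> q = p - q"
  by (simp add: a_minus_def free_alg_a_inv)

abbreviation ideal_of :: "'g set \<Rightarrow> 'g free set \<Rightarrow> 'g free set" where
  "ideal_of G R \<equiv> Idl\<^bsub>free_alg G\<^esub> R"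

lemma ideal_of_ideal: "R \<subseteq> car G \<Longrightarrow> ideal (ideal_of G R) (free_alg G)"
  by (rule ring.genideal_ideal[OF ring_free_alg])

lemma ideal_of_car: "R \<subseteq> car G \<Longrightarrow> p \<in> ideal_of G R \<Longrightarrow> p \<in> car G"
  by (rule additive_subgroup.a_Hcarr[OF ideal.axioms(1)[OF ideal_of_ideal]])

lemma ideal_of_gen: "R \<subseteq> car G \<Longrightarrow> p \<in> R \<Longrightarrow> p \<in> ideal_of G R"
  by (rule subsetD[OF ring.genideal_self[OF ring_free_alg]])

lemma ideal_of_0: "R \<subseteq> car G \<Longrightarrow> 0 \<in> ideal_of G R"
  using additive_subgroup.zero_closed[OF ideal.axioms(1)[OF ideal_of_ideal[of R G]]] by simp

lemma ideal_of_add: "R \<subseteq> car G \<Longrightarrow> p \<in> ideal_of G R \<Longrightarrow> q \<in> ideal_of G R \<Longrightarrow> p + q \<in> ideal_of G R"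
  using additive_subgroup.a_closed[OF ideal.axioms(1)[OF ideal_of_ideal[of R G]]] by simp

lemma ideal_of_mult_left: "R \<subseteq> car G \<Longrightarrow> p \<in> ideal_of G R \<Longrightarrow> q \<in> car G \<Longrightarrow> q * p \<in> ideal_of G R"
  using ideal.I_l_closed[OF ideal_of_ideal[of R G], of p q] by simp

lemma ideal_of_mult_right: "R \<subseteq> car G \<Longrightarrow> p \<in> ideal_of G R \<Longrightarrow> q \<in> car G \<Longrightarrow> p * q \<in> ideal_of G R"
  using ideal.I_r_closed[OF ideal_of_ideal[of R G], of p q] by simp

lemma ideal_of_uminus: "R \<subseteq> car G \<Longrightarrow> p \<in> ideal_of G R \<Longrightarrow> - p \<in> ideal_of G R"
  using ideal_of_mult_left[of R G p "scal (- 1)"] by (simp add: free.sc_minus)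

lemma ideal_of_diff: "R \<subseteq> car G \<Longrightarrow> p \<in> ideal_of G R \<Longrightarrow> q \<in> ideal_of G R \<Longrightarrow> p - q \<in> ideal_of G R"
  using ideal_of_add[of R G p "- q"] by (simp add: ideal_of_uminus)

lemma ideal_of_sum:
  "R \<subseteq> car G \<Longrightarrow> (\<And>x. x \<in> A \<Longrightarrow> f x \<in> ideal_of G R) \<Longrightarrow> sum f A \<in> ideal_of G R"
  by (induction A rule: infinite_finite_induct) (auto simp: ideal_of_0 ideal_of_add)

lemma ideal_of_subset:
  assumes "R \<subseteq> car G" "J \<subseteq> car G" "R \<subseteq> J" "0 \<in> J"
    and add: "\<And>p q. p \<in> J \<Longrightarrow> q \<in> J \<Longrightarrow> p + q \<in> J"
    and mult: "\<And>p q. p \<in> J \<Longrightarrow> q \<in> car G \<Longrightarrow> q * p \<in> J \<and> p * q \<in> J"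
  shows "ideal_of G R \<subseteq> J"
proof (rule ring.genideal_minimal[OF ring_free_alg _ assms(3)])
  have neg: "- p \<in> J" if "p \<in> J" for p
    using mult[OF that, of "scal (- 1)"] by (simp add: free.sc_minus)
  have inv: "inv\<^bsub>add_monoid (free_alg G)\<^esub> p \<in> J" if "p \<in> J" for p
  proof -
    have "\<ominus>\<^bsub>free_alg G\<^esub> p \<in> J" using that assms(2) neg by (simp add: subset_iff free_alg_a_inv)
    then show ?thesis unfolding a_inv_def .
  qed
  have "subgroup J (add_monoid (free_alg G))"
    using inv add assms(2,4)
    by (intro group.subgroupI abelian_group.a_group ring.is_abelian_group[OF ring_free_alg])
      auto
  then show "ideal J (free_alg G)"
    by (intro idealI ring_free_alg) (use mult in auto)
qed

lemma quot_alg_simps [simp]: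
  "carrier (quot_alg A N) = a_rcosets\<^bsub>A\<^esub> N"
  "monoid.mult (quot_alg A N) = rcoset_mult A N"
  "one (quot_alg A N) = N +>\<^bsub>A\<^esub> \<one>\<^bsub>A\<^esub>"
  "zero (quot_alg A N) = N"
  "add (quot_alg A N) = set_add A"
  "module.smult (quot_alg A N) = (\<lambda>c Z. \<Union>x\<in>Z. N +>\<^bsub>A\<^esub> (c \<odot>\<^bsub>A\<^esub> x))"
  by (simp_all add: quot_alg_def ring.defs module.defs FactRing_def)

text \<open>\<open>quot_alg\<close> adds a scalar multiplication to the record of the quotient ring.
  The ring axioms do not look at that field, but have to be carried over to the larger record
  type.\<close>

lemma ring_extend:
  assumes "ring A"
  shows "ring (ring.extend A m)"
proof -
  interpret ring A by (rule assms)
  have ext [simp]: "carrier (ring.extend A m) = carrier A" "monoid.mult (ring.extend A m) = monoid.mult A"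
    "one (ring.extend A m) = one A" "zero (ring.extend A m) = zero A" "add (ring.extend A m) = add A"
    by (simp_all add: ring.defs)
  have "abelian_group (ring.extend A m)"
  proof (rule abelian_groupI)
    fix x assume "x \<in> carrier (ring.extend A m)"
    then show "\<exists>y\<in>carrier (ring.extend A m). y \<oplus>\<^bsub>ring.extend A m\<^esub> x = \<zero>\<^bsub>ring.extend A m\<^esub>"
      by (intro bexI[of _ "\<ominus>\<^bsub>A\<^esub> x"]) (simp_all add: l_neg)
  qed (simp_all add: a_ac)
  moreover have "Group.monoid (ring.extend A m)"
    by (rule monoidI) (simp_all add: m_assoc)
  ultimately show ?thesis
    by (rule ringI) (simp_all add: l_distr r_distr)
qed

lemma carrier_presented: "carrier (presented_alg G R) = cls G R ` car G"
  by (auto simp: presented_alg_def A_RCOSETS_def' cls_def image_iff)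

context
  fixes G :: "'g set" and R :: "'g free set"
  assumes R: "R \<subseteq> car G"
begin

interpretation ideal "ideal_of G R" "free_alg G"
  by (rule ideal_of_ideal[OF R])

interpretation abelian_subgroup "ideal_of G R" "free_alg G"
  by (rule abelian_subgroupI3[OF additive_subgroup_axioms is_abelian_group])

lemma cls_eq_iff:
  assumes "p \<in> car G" "q \<in> car G"
  shows "cls G R p = cls G R q \<longleftrightarrow> p - q \<in> ideal_of G R"
proof -
  have "cls G R p = cls G R q \<longleftrightarrow> p \<in> cls G R q"
    unfolding cls_def using a_repr_independence'[of p q] a_rcos_self[of p] assms by auto
  also have "\<dots> \<longleftrightarrow> p \<ominus>\<^bsub>free_alg G\<^esub> q \<in> ideal_of G R"
    unfolding cls_def by (rule a_rcos_module_minus[OF ring_axioms assms(2,1)])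
  finally show ?thesis by (simp add: free_alg_minus assms)
qed

lemma cls_memD:
  assumes "p \<in> car G" "q \<in> cls G R p"
  shows "q \<in> car G" "q - p \<in> ideal_of G R"
proof -
  show q: "q \<in> car G" using assms a_elemrcos_carrier unfolding cls_def by blast
  show "q - p \<in> ideal_of G R"
    using a_rcos_module_minus[OF ring_axioms assms(1) q] assms(2) free_alg_minus[OF q assms(1)]
    by (simp add: cls_def)
qed

lemma cls_self: "p \<in> car G \<Longrightarrow> p \<in> cls G R p"
  unfolding cls_def by (rule a_rcos_self)

lemma cls_add [simp]:
  "p \<in> car G \<Longrightarrow> q \<in> car G \<Longrightarrow> cls G R p \<oplus>\<^bsub>presented_alg G R\<^esub> cls G R q = cls G R (p + q)"
  using a_rcos_sum[of p q] by (simp add: presented_alg_def cls_def)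

lemma cls_mult [simp]:
  "p \<in> car G \<Longrightarrow> q \<in> car G \<Longrightarrow> cls G R p \<otimes>\<^bsub>presented_alg G R\<^esub> cls G R q = cls G R (p * q)"
  using rcoset_mult_add[of p q] by (simp add: presented_alg_def cls_def)

lemma presented_zero: "\<zero>\<^bsub>presented_alg G R\<^esub> = cls G R 0"
  using a_coset_add_zero[OF a_subset] by (simp add: presented_alg_def cls_def)

lemma presented_one: "\<one>\<^bsub>presented_alg G R\<^esub> = cls G R 1"
  by (simp add: presented_alg_def cls_def)

lemma cls_smult [simp]:
  assumes "p \<in> car G"
  shows "c \<odot>\<^bsub>presented_alg G R\<^esub> cls G R p = cls G R (scal c * p)"
proof -
  have "cls G R (scal c * q) = cls G R (scal c * p)" if "q \<in> cls G R p" for q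
  proof (subst cls_eq_iff)
    show "scal c * q - scal c * p \<in> ideal_of G R"
      using cls_memD[OF assms that] ideal_of_mult_left[OF R, of "q - p" "scal c"]
      by (simp add: right_diff_distrib)
  qed (use assms cls_memD[OF assms that] in auto)
  then have "(\<Union>q\<in>cls G R p. cls G R (scal c * q)) = cls G R (scal c * p)"
    using cls_self[OF assms] by blast
  then show ?thesis by (simp add: presented_alg_def cls_def)
qed

lemma ring_presented: "ring (presented_alg G R)"
  unfolding presented_alg_def quot_alg_def using quotient_is_ring by (rule ring_extend)

lemma cls_finsum:
  "finite A \<Longrightarrow> (\<And>x. x \<in> A \<Longrightarrow> f x \<in> car G) \<Longrightarrow>
    (\<Oplus>\<^bsub>presented_alg G R\<^esub>x\<in>A. cls G R (f x)) = cls G R (sum f A)"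
proof (induction A rule: finite_induct)
  interpret Q: ring "presented_alg G R" by (rule ring_presented)
  case empty
  then show ?case by (simp add: presented_zero)
next
  interpret Q: ring "presented_alg G R" by (rule ring_presented)
  case (insert x F)
  then show ?case
    by (subst Q.finsum_insert) (auto simp: carrier_presented intro!: cls_add)
qed

lemma eval_free_presented:
  fixes \<phi> :: "'h \<Rightarrow> 'g free"
  assumes "\<And>g. g \<in> H \<Longrightarrow> \<phi> g \<in> car G" "\<And>g. g \<in> H \<Longrightarrow> \<psi> g = cls G R (\<phi> g)" "p \<in> car H"
  shows "eval_free (presented_alg G R) \<psi> p = cls G R (lift scal \<phi> p)"
proof -
  have word: "foldr (\<lambda>g a. \<psi> g \<otimes>\<^bsub>presented_alg G R\<^esub> a) xs \<one>\<^bsub>presented_alg G R\<^esub> =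
      cls G R (prod_list (map \<phi> xs)) \<and> prod_list (map \<phi> xs) \<in> car G" if "set xs \<subseteq> H" for xs
    using that by (induction xs) (auto simp: presented_one assms intro!: cls_mult)
  have keys: "set (letters w) \<subseteq> H" if "w \<in> Poly_Mapping.keys p" for w
    using that assms(3) by (auto simp: car_iff)
  interpret Q: ring "presented_alg G R" by (rule ring_presented)
  have "eval_free (presented_alg G R) \<psi> p = (\<Oplus>\<^bsub>presented_alg G R\<^esub>w\<in>Poly_Mapping.keys p.
      cls G R (scal (Poly_Mapping.lookup p w) * prod_list (map \<phi> (letters w))))"
    unfolding eval_free_def using word keys
    by (intro Q.finsum_cong') (auto simp: carrier_presented intro!: imageI)
  also have "\<dots> = cls G R (lift scal \<phi> p)"
    unfolding lift_def using word[OF keys] by (intro cls_finsum) auto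
  finally show ?thesis .
qed

text \<open>The polynomials sent into \<open>ideal_of G R\<close> form an ideal of the source. Once
  it contains the relations, evaluation is constant on residue classes, which makes
  \<open>the_elem\<close> in \<open>induced_map\<close> meaningful.\<close>

lemma induced_map_presented:
  fixes \<phi> :: "'h \<Rightarrow> 'g free"
  assumes \<phi>: "\<And>g. g \<in> H \<Longrightarrow> \<phi> g \<in> car G" "\<And>g. g \<in> H \<Longrightarrow> \<psi> g = cls G R (\<phi> g)"
    and S: "S \<subseteq> car H" "\<And>r. r \<in> S \<Longrightarrow> lift scal \<phi> r \<in> ideal_of G R" and "p \<in> car H"
  shows "induced_map (presented_alg G R) \<psi> (ideal_of H S +>\<^bsub>free_alg H\<^esub> p) = cls G R (lift scal \<phi> p)"
    and "\<And>q. q \<in> ideal_of H S \<Longrightarrow> lift scal \<phi> q \<in> ideal_of G R"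
proof -
  have "ideal_of H S \<subseteq> {q \<in> car H. lift scal \<phi> q \<in> ideal_of G R}"
  proof (rule ideal_of_subset)
    fix p q assume "p \<in> {q \<in> car H. lift scal \<phi> q \<in> ideal_of G R}" "q \<in> car H"
    moreover from this have "lift scal \<phi> q \<in> car G" by (intro car_lift[OF \<phi>(1)])
    ultimately show "q * p \<in> {q \<in> car H. lift scal \<phi> q \<in> ideal_of G R} \<and>
        p * q \<in> {q \<in> car H. lift scal \<phi> q \<in> ideal_of G R}"
      by (simp add: free.lift_mult ideal_of_mult_left[OF R] ideal_of_mult_right[OF R])
  qed (use S in \<open>auto simp: free.lift_add ideal_of_0[OF R] ideal_of_add[OF R]\<close>)
  then show *: "lift scal \<phi> q \<in> ideal_of G R" if "q \<in> ideal_of H S" for q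
    using that by auto
  have "eval_free (presented_alg G R) \<psi> ` (ideal_of H S +>\<^bsub>free_alg H\<^esub> p) = {cls G R (lift scal \<phi> p)}"
  proof -
    have "eval_free (presented_alg G R) \<psi> (q + p) = cls G R (lift scal \<phi> p)"
      if q: "q \<in> ideal_of H S" for q
    proof -
      have c: "q + p \<in> car H" using ideal_of_car[OF S(1) q] assms(5) by auto
      have "eval_free (presented_alg G R) \<psi> (q + p) = cls G R (lift scal \<phi> (q + p))"
        using \<phi> c by (rule eval_free_presented)
      also have "\<dots> = cls G R (lift scal \<phi> p)"
        using *[OF q]
        by (subst cls_eq_iff[OF car_lift[OF \<phi>(1) c] car_lift[OF \<phi>(1) assms(5)]])
          (simp_all add: free.lift_add)
      finally show ?thesis .
    qed
    moreover have "ideal_of H S +>\<^bsub>free_alg H\<^esub> p = (\<lambda>q. q + p) ` ideal_of H S"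
      by (auto simp: a_r_coset_def')
    ultimately show ?thesis
      using ideal_of_0[OF S(1)] by (simp add: image_image image_constant)
  qed
  then show "induced_map (presented_alg G R) \<psi> (ideal_of H S +>\<^bsub>free_alg H\<^esub> p) = cls G R (lift scal \<phi> p)"
    by (simp add: induced_map_def)
qed

end


section \<open>Commutation of quantum Serre elements\<close>

text \<open>Nonzero and not a root of unity, so that \<open>[n]\<close> for
  \<open>n \<noteq> 0\<close> and all quantum factorials are invertible.\<close>

definition generic :: "qv \<Rightarrow> bool" where
  "generic q \<longleftrightarrow> q \<noteq> 0 \<and> (\<forall>n::int. q powi n = 1 \<longrightarrow> n = 0)"

lemma generic_nz: "generic q \<Longrightarrow> q \<noteq> 0"
  by (simp add: generic_def)

lemma generic_powi_eq_iff: "generic q \<Longrightarrow> q powi m = q powi n \<longleftrightarrow> m = n"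
  by (metis diff_eq_diff_eq diff_self eq_iff_diff_eq_0 generic_def power_int_diff power_int_not_zero
      right_inverse_eq)

lemma generic_diff_nz: "generic q \<Longrightarrow> q - inverse q \<noteq> 0"
  using generic_powi_eq_iff[of q 1 "-1"] by (simp add: power_int_minus)

lemma qnum_0 [simp]: "qnum q 0 = 0"
  by (simp add: qnum_def)

lemma qnum_1: "generic q \<Longrightarrow> qnum q 1 = 1"
  using generic_diff_nz[of q] by (simp add: qnum_def power_int_minus)

lemma qnum_minus: "qnum q (- n) = - qnum q n"
  unfolding qnum_def by (metis minus_diff_eq minus_divide_left minus_minus)

lemma qnum_nz: "generic q \<Longrightarrow> n \<noteq> 0 \<Longrightarrow> qnum q n \<noteq> 0"
  using generic_powi_eq_iff[of q n "- n"] generic_diff_nz[of q] by (simp add: qnum_def)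

lemma qnum_add:
  assumes "q \<noteq> 0"
  shows "qnum q (m + n) = q powi n * qnum q m + q powi (- m) * qnum q n"
proof -
  have "q powi (m + n) - q powi (- (m + n)) =
      q powi n * (q powi m - q powi (- m)) + q powi (- m) * (q powi n - q powi (- n))"
    using assms by (simp add: algebra_simps flip: power_int_add)
  then show ?thesis by (simp add: qnum_def add_divide_distrib)
qed

lemma qnum_inverse: "qnum (inverse q) n = qnum q n"
proof -
  have "inverse q powi n - inverse q powi (- n) = - (q powi n - q powi (- n))"
    by (simp add: power_int_minus power_int_inverse)
  moreover have "inverse q - inverse (inverse q) = - (q - inverse q)" by simp
  ultimately show ?thesis unfolding qnum_def by (metis minus_divide_divide)
qed

lemma qfact_0 [simp]: "qfact q 0 = 1"
  by (simp add: qfact_def)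

lemma qfact_Suc: "qfact q (Suc m) = qfact q m * qnum q (int (Suc m))"
  by (simp add: qfact_def)

lemma qfact_nz: "generic q \<Longrightarrow> qfact q m \<noteq> 0"
  by (induction m) (auto simp: qfact_Suc qnum_nz)

lemma qfact_inverse: "qfact (inverse q) m = qfact q m"
  by (simp add: qfact_def qnum_inverse)

lemma generic_inverse: "generic q \<Longrightarrow> generic (inverse q)"
  by (auto simp: generic_def power_int_inverse)

text \<open>The summands of a polynomial G_n(z). By the quantum binomial theorem \<open>[n]!\<close>
  G_n(z) is the product of the factors 1 - q^(n-1-2k) z for 0 \<le> k < n, so z = q^(n-1) and z =
  q^(1-n) are roots; these two values arise from moving \<open>K\<close> and \<open>K'\<close>
  through a Serre element.\<close>

definition qbin_term :: "qv \<Rightarrow> qv \<Rightarrow> nat \<Rightarrow> nat \<Rightarrow> qv" where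
  "qbin_term q z n r = (- z) ^ r * inverse (qfact q (n - r)) * inverse (qfact q r)"

text \<open>The left-hand side satisfies \<open>[n] G\<^sub>n(z) = (1 - q\<^bsup>1-n\<^esup> z) G\<^sub>n\<^sub>-\<^sub>1(qz)\<close>.\<close>

lemma qbin_sum_zero:
  assumes q: "generic q"
  shows "(\<Sum>r\<le>Suc n. qbin_term q (q powi int n) (Suc n) r) = 0"
proof -
  let ?z = "q powi int n" and ?N = "int (Suc n)"
  define f where "f r = qbin_term q (q * ?z) n r" for r
  have nz: "q \<noteq> 0" "qfact q k \<noteq> 0" for k using q by (auto simp: generic_nz qfact_nz)
  \<comment> \<open>Splitting [N] as q^r [N-r] + q^(r-N) [r] lets each part cancel a factor of one
    factorial. At z = q^n the factor q^(1-N) z equals 1, so the second part is minus the first part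
    for r - 1 and the sum telescopes.\<close>
  have split: "qnum q ?N * qbin_term q ?z (Suc n) r =
      (if r \<le> n then f r else 0) - (case r of 0 \<Rightarrow> 0 | Suc s \<Rightarrow> f s)" if "r \<le> Suc n" for r
  proof -
    have num: "qnum q ?N = q ^ r * qnum q (int (Suc n - r)) + q powi (int r - ?N) * qnum q (int r)"
      using qnum_add[OF nz(1), of "?N - int r" "int r"] that by (simp add: of_nat_diff)
    have 1: "qnum q (int (Suc n - r)) * inverse (qfact q (Suc n - r)) =
        (if r \<le> n then inverse (qfact q (n - r)) else 0)"
    proof (cases "r \<le> n")
      case True
      then show ?thesis
        using qnum_nz[OF q, of "int (Suc (n - r))"] by (simp add: Suc_diff_le qfact_Suc del: of_nat_Suc)
    next
      case False
      then have "r = Suc n" using that by simp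
      then show ?thesis by simp
    qed
    have 2: "qnum q (int r) * inverse (qfact q r) = (case r of 0 \<Rightarrow> 0 | Suc s \<Rightarrow> inverse (qfact q s))"
      using q qnum_nz[of q "1 + int (r - 1)"] by (auto simp: qfact_Suc split: nat.split)
    have 3: "q powi (int (Suc s) - ?N) * (- ?z) ^ Suc s = - ((- (q * ?z)) ^ s)" for s
    proof -
      have "q powi (int (Suc s) - ?N) * ?z = q ^ s"
        using nz(1) by (simp flip: power_int_add power_int_of_nat)
      then have "q powi (int (Suc s) - ?N) * (- ?z) ^ Suc s = - (q ^ s * (- ?z) ^ s)"
        by (simp add: mult.assoc[symmetric])
      then show ?thesis by (simp flip: power_mult_distrib)
    qed
    have "qnum q ?N * qbin_term q ?z (Suc n) r =
        (q ^ r * (- ?z) ^ r) * (qnum q (int (Suc n - r)) * inverse (qfact q (Suc n - r))) * inverse (qfact q r)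
        + (q powi (int r - ?N) * (- ?z) ^ r) * inverse (qfact q (Suc n - r)) * (qnum q (int r) * inverse (qfact q r))"
      unfolding qbin_term_def num by (simp add: algebra_simps)
    also have "q ^ r * (- ?z) ^ r = (- (q * ?z)) ^ r" by (simp flip: power_mult_distrib)
    finally show ?thesis
      unfolding 1 2
    proof (cases r)
      case (Suc s)
      assume "qnum q ?N * qbin_term q ?z (Suc n) r = (- (q * ?z)) ^ r * (if r \<le> n then inverse (qfact q (n - r)) else 0)
          * inverse (qfact q r) + q powi (int r - ?N) * (- ?z) ^ r * inverse (qfact q (Suc n - r)) *
          (case r of 0 \<Rightarrow> 0 | Suc s \<Rightarrow> inverse (qfact q s))"
      then show ?thesis using 3[of s] unfolding Suc by (simp add: f_def qbin_term_def)
    qed (simp add: f_def qbin_term_def)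
  qed
  have "qnum q ?N * (\<Sum>r\<le>Suc n. qbin_term q ?z (Suc n) r) =
      (\<Sum>r\<le>Suc n. (if r \<le> n then f r else 0)) - (\<Sum>r\<le>Suc n. case r of 0 \<Rightarrow> 0 | Suc s \<Rightarrow> f s)"
    unfolding sum_distrib_left sum_subtractf[symmetric] by (intro sum.cong refl split) simp
  also have "(\<Sum>r\<le>Suc n. (if r \<le> n then f r else 0)) = (\<Sum>r\<le>n. f r)" by simp
  also have "(\<Sum>r\<le>Suc n. case r of 0 \<Rightarrow> 0 | Suc s \<Rightarrow> f s) = (\<Sum>r\<le>n. f r)"
    by (simp add: sum.atMost_Suc_shift del: sum.atMost_Suc)
  finally show ?thesis using qnum_nz[OF q, of ?N] by simp
qed

text \<open>Quantum numbers are invariant under inverting \<open>q\<close>, so this is the previous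
  identity for \<open>inverse q\<close>.\<close>

lemma qbin_sum_zero':
  assumes q: "generic q"
  shows "(\<Sum>r\<le>Suc n. qbin_term q (q powi (- int n)) (Suc n) r) = 0"
proof -
  have "inverse q powi int n = q powi (- int n)" by (simp add: power_int_minus power_inverse)
  then show ?thesis
    using qbin_sum_zero[OF generic_inverse[OF q], of n] unfolding qbin_term_def qfact_inverse by simp
qed

context central_scalars
begin

definition dpow :: "qv \<Rightarrow> 'b \<Rightarrow> nat \<Rightarrow> 'b" where
  "dpow q e m = sc (inverse (qfact q m)) * e ^ m"

definition serre :: "qv \<Rightarrow> nat \<Rightarrow> 'b \<Rightarrow> 'b \<Rightarrow> 'b" where
  "serre q n e x = (\<Sum>r\<le>n. (- 1) ^ r * dpow q e (n - r) * x * dpow q e r)"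

text \<open>The usual bracket [K; t], with \<open>K'\<close> in the role of the inverse of
  \<open>K\<close>. Moving it past an element of weight \<open>c\<close> shifts \<open>t\<close> by
  \<open>c\<close>.\<close>

definition brk :: "qv \<Rightarrow> 'b \<Rightarrow> 'b \<Rightarrow> int \<Rightarrow> 'b" where
  "brk q K K' t = sc (inverse (q - inverse q)) * (sc (q powi t) * K - sc (q powi (- t)) * K')"

lemma dpow_0 [simp]: "dpow q e 0 = 1"
  by (simp add: dpow_def)

lemma brk_shift:
  assumes "K * x = sc (q powi c) * (x * K)" "K' * x = sc (q powi (- c)) * (x * K')" "q \<noteq> 0"
  shows "brk q K K' t * x = x * brk q K K' (t + c)"
proof -
  have add: "sc (q powi (a + b)) = sc (q powi a) * sc (q powi b)" for a b
    using assms(3) by (simp add: power_int_add sc_mult)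
  have 1: "sc (q powi t) * (K * x) = x * (sc (q powi (t + c)) * K)"
    by (simp only: mult.assoc sc_left_comm[of x] add assms(1))
  have 2: "sc (q powi (- t)) * (K' * x) = x * (sc (q powi (- (t + c))) * K')"
    by (simp only: mult.assoc sc_left_comm[of x] add assms(2) minus_add_distrib)
  show ?thesis
    unfolding brk_def mult.assoc left_diff_distrib 1 2 by (simp only: sc_left_comm[of x] right_diff_distrib)
qed

lemma pow_shift:
  assumes "K * x = sc c * (x * K)"
  shows "K * x ^ m = sc (c ^ m) * (x ^ m * K)"
proof (induction m)
  case (Suc m)
  have "K * x ^ Suc m = sc c * (x * (K * x ^ m))"
    using assms by (simp add: mult.assoc flip: mult.assoc[of K x])
  then show ?case
    by (simp only: Suc sc_left_comm[of x] power_Suc sc_mult mult.assoc)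
qed simp

lemma powi_shift:
  assumes "K * x = sc (q powi c) * (x * K)" "q \<noteq> 0"
  shows "K * x ^ m = sc (q powi (c * int m)) * (x ^ m * K)"
  using pow_shift[OF assms(1), of m] assms(2) by (simp add: power_int_mult)

context
  fixes q :: qv and e f K K' :: 'b
  assumes q: "generic q"
    and K: "K * e = sc (q powi 2) * (e * K)" "K' * e = sc (q powi (-2)) * (e * K')"
    and ef: "e * f - f * e = brk q K K' 0"
begin

text \<open>The sl_2 identity for E^(m+1) and F. It is stated for arbitrary elements because it is
  applied to transposed operators, once with \<open>e\<close> raising and once with \<open>e\<close>
  lowering.\<close>

lemma pow_commutator: "e ^ Suc m * f - f * e ^ Suc m = sc (qnum q (int (Suc m))) * (e ^ m * brk q K K' (int m))"
proof (induction m)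
  case 0
  then show ?case using ef qnum_1[OF q] by simp
next
  case (Suc m)
  have nz: "q \<noteq> 0" using q by (rule generic_nz)
  let ?c = "inverse (q - inverse q)"
  have br0: "brk q K K' 0 * e ^ Suc m = e ^ Suc m * brk q K K' (2 * int (Suc m))"
    using brk_shift[of K "e ^ Suc m" q "2 * int (Suc m)" K' 0]
      powi_shift[OF K(1) nz, of "Suc m"] powi_shift[OF K(2) nz, of "Suc m"] nz by simp
  have "e ^ Suc (Suc m) * f - f * e ^ Suc (Suc m) =
      e * (e ^ Suc m * f - f * e ^ Suc m) + (e * f - f * e) * e ^ Suc m"
    by (simp only: power_Suc right_diff_distrib left_diff_distrib mult.assoc) simp
  also have "\<dots> = e ^ Suc m * (sc (qnum q (int (Suc m))) * brk q K K' (int m)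
      + brk q K K' (2 * int (Suc m)))"
    unfolding Suc ef br0 by (simp only: power_Suc sc_left_comm mult.assoc distrib_left)
  also have "sc (qnum q (int (Suc m))) * brk q K K' (int m) + brk q K K' (2 * int (Suc m)) =
      sc (qnum q (int (Suc (Suc m)))) * brk q K K' (int (Suc m))"
  proof -
    let ?M = "int (Suc m)"
    \<comment> \<open>Comparison of the coefficients of \<open>K\<close> here and of
      \<open>K'\<close> in \<open>b\<close>: the two expansions of [M + 1] that
      \<open>qnum_add\<close> provides.\<close>
    have a: "qnum q ?M * q powi int m + q powi (2 * ?M) = qnum q (?M + 1) * q powi ?M"
    proof -
      have "qnum q (1 + ?M) * q powi ?M = (q powi ?M * qnum q 1 + q powi (- 1) * qnum q ?M) * q powi ?M"
        by (subst qnum_add[OF nz]) simp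
      also have "\<dots> = q powi (?M + ?M) + qnum q ?M * (q powi (-1) * q powi ?M)"
        using nz by (subst power_int_add) (auto simp: algebra_simps qnum_1[OF q])
      also have "q powi (-1) * q powi ?M = q powi int m"
        using nz by (subst power_int_add[symmetric]) auto
      finally show ?thesis by (simp add: algebra_simps)
    qed
    have b: "qnum q ?M * q powi (- int m) + q powi (- (2 * ?M)) = qnum q (?M + 1) * q powi (- ?M)"
    proof -
      have "qnum q (?M + 1) * q powi (- ?M) = (q powi 1 * qnum q ?M + q powi (- ?M) * qnum q 1) * q powi (- ?M)"
        by (subst qnum_add[OF nz]) simp
      also have "\<dots> = q powi (- ?M + - ?M) + qnum q ?M * (q powi 1 * q powi (- ?M))"
        using nz by (subst power_int_add) (auto simp: algebra_simps qnum_1[OF q])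
      also have "q powi 1 * q powi (- ?M) = q powi (- int m)"
        using nz by (subst power_int_add[symmetric]) auto
      finally show ?thesis by (simp add: algebra_simps)
    qed
    have *: "sc u * (sc ?c * (sc x * K - sc y * K')) + sc ?c * (sc x' * K - sc y' * K') =
        sc ?c * (sc (u * x + x') * K - sc (u * y + y') * K')" for u x y x' y'
      by (simp only: sc_left_comm[of "sc u"] sc_add sc_mult distrib_right right_diff_distrib
          mult.assoc distrib_left) (simp add: algebra_simps)
    have **: "sc u * (sc ?c * (sc x * K - sc y * K')) = sc ?c * (sc (u * x) * K - sc (u * y) * K')" for u x y
      by (simp only: sc_left_comm[of "sc u"] sc_mult right_diff_distrib mult.assoc)
    have M: "int (Suc (Suc m)) = ?M + 1" by simp
    show ?thesis unfolding M by (simp only: brk_def * a b) (simp only: **)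
  qed
  finally show ?case by (simp only: sc_left_comm)
qed

lemma dpow_commutator: "dpow q e (Suc m) * f - f * dpow q e (Suc m) = dpow q e m * brk q K K' (int m)"
proof -
  have "dpow q e (Suc m) * f - f * dpow q e (Suc m) =
      sc (inverse (qfact q (Suc m))) * (e ^ Suc m * f - f * e ^ Suc m)"
    by (simp only: dpow_def right_diff_distrib mult.assoc sc_left_comm[of f])
  also have "\<dots> = sc (inverse (qfact q (Suc m)) * qnum q (int (Suc m))) * (e ^ m * brk q K K' (int m))"
    unfolding pow_commutator by (simp only: sc_mult mult.assoc)
  also have "inverse (qfact q (Suc m)) * qnum q (int (Suc m)) = inverse (qfact q m)"
    using qnum_nz[OF q, of "int (Suc m)"] by (simp add: qfact_Suc)
  finally show ?thesis by (simp only: dpow_def mult.assoc)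
qed

text \<open>Commuting \<open>f\<close> through the divided powers on either side of \<open>x\<close>
  gives two families of terms ending in a bracket. Because \<open>x\<close> has weight -n, the
  brackets agree after being moved to the right, and the families cancel by telescoping.\<close>

lemma serre_comm_same:
  assumes xf: "x * f = f * x"
    and Kx: "K * x = sc (q powi (- int n)) * (x * K)" "K' * x = sc (q powi int n) * (x * K')"
  shows "serre q (Suc n) e x * f = f * serre q (Suc n) e x"
proof -
  have nz: "q \<noteq> 0" using q by (rule generic_nz)
  let ?N = "Suc n"
  \<comment> \<open>The bracket from the left power starts as [K; n-r] and is moved past
    \<open>x\<close> (shift -n) and \<open>dpow q e r\<close> (shift 2r), so it arrives as [K; r].
    The right power in term r yields the bracket with r - 1, which is \<open>g\<close> at the
    preceding index with opposite sign.\<close>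
  define g where "g r = (- 1) ^ r * dpow q e (n - r) * x * dpow q e r * brk q K K' (int r)" for r
  have c: "dpow q e m * f = f * dpow q e m + (case m of 0 \<Rightarrow> 0 | Suc k \<Rightarrow> dpow q e k * brk q K K' (int k))" for m
    using dpow_commutator[of "m - 1"] by (cases m) (auto simp: algebra_simps)
  have brx: "brk q K K' t * x = x * brk q K K' (t - int n)" for t
    using brk_shift[of K x q "- int n" K' t] Kx nz by simp
  have bre: "brk q K K' t * dpow q e r = dpow q e r * brk q K K' (t + 2 * int r)" for t r
    using brk_shift[of K "e ^ r" q "2 * int r" K' t] powi_shift[OF K(1) nz, of r] powi_shift[OF K(2) nz, of r] nz
    by (simp only: dpow_def sc_left_comm mult.assoc) simp
  have sgn: "(-1) ^ r * (y::'b) = y * (-1) ^ r" for r y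
    by (metis sc_comm sc_neg_1_power)
  have term_eq: "(- 1) ^ r * dpow q e (?N - r) * x * dpow q e r * f =
      f * ((- 1) ^ r * dpow q e (?N - r) * x * dpow q e r) +
      ((if r \<le> n then g r else 0) - (case r of 0 \<Rightarrow> 0 | Suc s \<Rightarrow> g s))" if r: "r \<le> ?N" for r
  proof -
    have "dpow q e (?N - r) * x * dpow q e r * f = dpow q e (?N - r) * x *
        (f * dpow q e r + (case r of 0 \<Rightarrow> 0 | Suc k \<Rightarrow> dpow q e k * brk q K K' (int k)))"
      by (simp only: c[of r] mult.assoc)
    also have "\<dots> = dpow q e (?N - r) * f * x * dpow q e r +
        dpow q e (?N - r) * x * (case r of 0 \<Rightarrow> 0 | Suc k \<Rightarrow> dpow q e k * brk q K K' (int k))"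
      by (simp only: distrib_left mult.assoc xf) (simp only: mult.assoc[symmetric] xf)
    also have "dpow q e (?N - r) * f * x * dpow q e r = f * dpow q e (?N - r) * x * dpow q e r +
        (if r \<le> n then dpow q e (n - r) * x * dpow q e r * brk q K K' (int r) else 0)"
    proof (cases "r \<le> n")
      case True
      have "dpow q e (n - r) * brk q K K' (int (n - r)) * x * dpow q e r =
         dpow q e (n - r) * x * dpow q e r * brk q K K' (int (n - r) - int n + 2 * int r)"
        by (simp only: mult.assoc brx bre)
      then show ?thesis using True c[of "?N - r"] by (simp add: Suc_diff_le distrib_right)
    next
      case False
      then show ?thesis using r by (simp add: le_Suc_eq)
    qed
    finally have "(- 1) ^ r * (dpow q e (?N - r) * x * dpow q e r * f) = (- 1) ^ r * (f * dpow q e (?N - r) * x * dpow q e r +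
        (if r \<le> n then dpow q e (n - r) * x * dpow q e r * brk q K K' (int r) else 0) +
        dpow q e (?N - r) * x * (case r of 0 \<Rightarrow> 0 | Suc k \<Rightarrow> dpow q e k * brk q K K' (int k)))" by simp
    then have "(- 1) ^ r * dpow q e (?N - r) * x * dpow q e r * f =
        (- 1) ^ r * f * dpow q e (?N - r) * x * dpow q e r + (if r \<le> n then g r else 0) +
        (- 1) ^ r * dpow q e (?N - r) * x * (case r of 0 \<Rightarrow> 0 | Suc k \<Rightarrow> dpow q e k * brk q K K' (int k))"
      by (simp add: distrib_left mult.assoc g_def)
    also have "(- 1) ^ r * f * dpow q e (?N - r) * x * dpow q e r =
        f * ((- 1) ^ r * dpow q e (?N - r) * x * dpow q e r)"
      by (simp only: sgn[of r f] mult.assoc)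
    also have "(- 1) ^ r * dpow q e (?N - r) * x * (case r of 0 \<Rightarrow> 0 | Suc k \<Rightarrow> dpow q e k * brk q K K' (int k)) =
        - (case r of 0 \<Rightarrow> 0 | Suc s \<Rightarrow> g s)"
      by (cases r) (simp_all add: g_def mult.assoc)
    finally show ?thesis by simp
  qed
  have "serre q ?N e x * f = f * serre q ?N e x +
     ((\<Sum>r\<le>?N. if r \<le> n then g r else 0) - (\<Sum>r\<le>?N. case r of 0 \<Rightarrow> 0 | Suc s \<Rightarrow> g s))"
    unfolding serre_def sum_distrib_right sum_distrib_left sum_subtractf[symmetric] sum.distrib[symmetric]
    by (intro sum.cong refl term_eq) simp
  also have "(\<Sum>r\<le>?N. if r \<le> n then g r else 0) = (\<Sum>r\<le>n. g r)" by simp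
  also have "(\<Sum>r\<le>?N. case r of 0 \<Rightarrow> 0 | Suc s \<Rightarrow> g s) = (\<Sum>r\<le>n. g r)"
    by (simp add: sum.atMost_Suc_shift del: sum.atMost_Suc)
  finally show ?thesis by simp
qed

end

text \<open>Here \<open>f\<close> is the partner of \<open>x\<close>: commuting replaces
  \<open>x\<close> by a multiple of \<open>K - K'\<close>. Collecting all powers of \<open>e\<close>
  on the left leaves e^(n+1) times the two sums that vanish by \<open>qbin_sum_zero\<close> and
  \<open>qbin_sum_zero'\<close>.\<close>

lemma serre_comm_other:
  assumes q: "generic q" and ef: "e * f = f * e" and xf: "x * f - f * x = sc c * (K - K')"
    and K: "K * e = sc (q powi (- int n)) * (e * K)" "K' * e = sc (q powi int n) * (e * K')"
  shows "serre q (Suc n) e x * f = f * serre q (Suc n) e x"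
proof -
  have nz: "q \<noteq> 0" using q by (rule generic_nz)
  let ?N = "Suc n"
  have fe: "dpow q e m * f = f * dpow q e m" for m
  proof -
    have "f * e ^ m = e ^ m * f" 
    proof (induction m)
      case (Suc m)
      then show ?case
        by (simp only: power_Suc mult.assoc[symmetric] ef[symmetric]) (simp only: mult.assoc)
    qed simp
    then show ?thesis by (simp only: dpow_def mult.assoc sc_left_comm[of f])
  qed
  have sgn: "(-1) ^ r * (y::'b) = y * (-1) ^ r" for r y
    by (metis sc_comm sc_neg_1_power)
  have xf': "x * f = f * x + sc c * (K - K')" using xf by (simp add: algebra_simps)
  have mid: "dpow q e (?N - r) * (sc c * (K - K')) * dpow q e r =
     sc (inverse (qfact q (?N - r)) * inverse (qfact q r)) * (sc c * (e ^ ?N * (sc ((q powi (- int n)) ^ r) * K - sc ((q powi int n) ^ r) * K')))"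
    if "r \<le> ?N" for r
  proof -
    have "(K - K') * e ^ r = e ^ r * (sc ((q powi (- int n)) ^ r) * K - sc ((q powi int n) ^ r) * K')"
      by (simp only: left_diff_distrib right_diff_distrib pow_shift[OF K(1)] pow_shift[OF K(2)] sc_left_comm[of "e ^ r"])
    then have "e ^ (?N - r) * ((K - K') * e ^ r) = e ^ ?N * (sc ((q powi (- int n)) ^ r) * K - sc ((q powi int n) ^ r) * K')"
      using that by (simp only: mult.assoc[symmetric] power_add[symmetric]) simp
    then show ?thesis
      by (simp only: dpow_def mult.assoc sc_left_comm[of "K - K'"] sc_left_comm[of "e ^ (?N - r)"] sc_mult)
        (simp only: sc_left_comm[of "sc c"] mult.assoc)
  qed
  have term_eq: "(- 1) ^ r * dpow q e (?N - r) * x * dpow q e r * f =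
      f * ((- 1) ^ r * dpow q e (?N - r) * x * dpow q e r) +
      sc c * (e ^ ?N * (sc (qbin_term q (q powi (- int n)) ?N r) * K - sc (qbin_term q (q powi int n) ?N r) * K'))"
    if r: "r \<le> ?N" for r
  proof -
    have "dpow q e (?N - r) * x * dpow q e r * f = dpow q e (?N - r) * (x * f) * dpow q e r"
      by (simp only: mult.assoc fe)
    also have "\<dots> = dpow q e (?N - r) * f * x * dpow q e r + dpow q e (?N - r) * (sc c * (K - K')) * dpow q e r"
      by (simp only: xf' distrib_left distrib_right mult.assoc)
    also have "dpow q e (?N - r) * f * x * dpow q e r = f * (dpow q e (?N - r) * x * dpow q e r)"
      by (simp only: fe mult.assoc)
    finally have "(- 1) ^ r * (dpow q e (?N - r) * x * dpow q e r * f) =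
       (- 1) ^ r * (f * (dpow q e (?N - r) * x * dpow q e r)) + (-1) ^ r * (dpow q e (?N - r) * (sc c * (K - K')) * dpow q e r)"
      by (simp only: distrib_left)
    moreover have "(- 1) ^ r * (f * (dpow q e (?N - r) * x * dpow q e r)) = f * ((- 1) ^ r * (dpow q e (?N - r) * x * dpow q e r))"
      by (simp only: mult.assoc[symmetric] sgn[of r f])
    moreover have "(-1) ^ r * (dpow q e (?N - r) * (sc c * (K - K')) * dpow q e r) =
       sc c * (e ^ ?N * (sc (qbin_term q (q powi (- int n)) ?N r) * K - sc (qbin_term q (q powi int n) ?N r) * K'))"
    proof -
      have "qbin_term q z ?N r = (-1) ^ r * (inverse (qfact q (?N - r)) * inverse (qfact q r)) * z ^ r" for z
        by (simp add: qbin_term_def power_minus[of z])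
      then have "sc (qbin_term q z ?N r) = sc ((-1) ^ r * (inverse (qfact q (?N - r)) * inverse (qfact q r))) * sc (z ^ r)" for z
        by (simp only: sc_mult)
      then show ?thesis
        unfolding mid[OF r] sc_neg_1_power[symmetric]
        by (simp only: mult.assoc right_diff_distrib[symmetric] sc_left_comm[of "e ^ ?N"] sc_left_comm[of "sc c"] sc_mult)
    qed
    ultimately show ?thesis by (simp only: mult.assoc)
  qed
  have "serre q ?N e x * f = f * serre q ?N e x + sc c * (e ^ ?N *
      (sc (\<Sum>r\<le>?N. qbin_term q (q powi (- int n)) ?N r) * K - sc (\<Sum>r\<le>?N. qbin_term q (q powi int n) ?N r) * K'))"
    unfolding serre_def sum_distrib_right sum_distrib_left sum_subtractf[symmetric] sum.distrib[symmetric] sc_sum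
    by (intro sum.cong refl term_eq) simp
  then show ?thesis unfolding qbin_sum_zero[OF q] qbin_sum_zero'[OF q] by simp
qed

lemma serre_comm_zero:
  assumes "e * f = f * e" "x * f = f * x"
  shows "serre q n e x * f = f * serre q n e x"
proof -
  have "e ^ m * f = f * e ^ m" for m
    by (induction m) (simp_all add: mult.assoc assms, simp add: assms flip: mult.assoc)
  then have dp: "dpow q e m * f = f * dpow q e m" for m
    by (simp only: dpow_def mult.assoc sc_left_comm[of f])
  have sgn: "(-1) ^ r * (y::'b) = y * (-1) ^ r" for r y
    by (metis sc_comm sc_neg_1_power)
  have "(- 1) ^ r * dpow q e (n - r) * x * dpow q e r * f = f * ((- 1) ^ r * dpow q e (n - r) * x * dpow q e r)" for r
  proof -
    have "(- 1) ^ r * dpow q e (n - r) * x * dpow q e r * f = (- 1) ^ r * (f * (dpow q e (n - r) * x * dpow q e r))"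
      by (simp only: mult.assoc dp assms) (simp only: mult.assoc[symmetric] dp assms)
    also have "\<dots> = f * ((- 1) ^ r * dpow q e (n - r) * x * dpow q e r)"
      by (simp only: mult.assoc[symmetric] sgn[of r f])
    finally show ?thesis .
  qed
  then show ?thesis unfolding serre_def sum_distrib_right sum_distrib_left by simp
qed

end


section \<open>Linear operators acting from the right\<close>

text \<open>Linear endomorphisms of the space of all functions, made into a type so that
  \<open>ring_1\<close> and \<open>central_scalars\<close> apply. Supports are unrestricted because
  the functions are functionals on a space with basis \<open>'a\<close>.\<close>

typedef 'a lop = "{f :: ('a \<Rightarrow> qv) \<Rightarrow> ('a \<Rightarrow> qv).
    \<forall>\<phi> \<psi> c. f (\<lambda>x. \<phi> x + c * \<psi> x) = (\<lambda>x. f \<phi> x + c * f \<psi> x)}"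
  morphisms app Lop
  by (rule exI[of _ "\<lambda>\<phi>. \<phi>"]) simp

lemma app_lin: "app f (\<lambda>x. \<phi> x + c * \<psi> x) = (\<lambda>x. app f \<phi> x + c * app f \<psi> x)"
  using app[of f] by blast

lemma app_Lop:
  "(\<And>\<phi> \<psi> c x. f (\<lambda>x. \<phi> x + c * \<psi> x) x = f \<phi> x + c * f \<psi> x) \<Longrightarrow> app (Lop f) = f"
  by (intro Lop_inverse) auto

lemma lop_eqI: "(\<And>\<phi> x. app f \<phi> x = app g \<phi> x) \<Longrightarrow> f = g"
  by (simp add: app_inject[symmetric] fun_eq_iff)

lemma app_add: "app f (\<lambda>x. \<phi> x + \<psi> x) = (\<lambda>x. app f \<phi> x + app f \<psi> x)"
  using app_lin[of f \<phi> 1 \<psi>] by simp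

lemma app_zero: "app f (\<lambda>x. 0) = (\<lambda>x. 0)"
  using app_lin[of f "\<lambda>x. 0" "-1" "\<lambda>x. 0"] by (auto simp: fun_eq_iff)

lemma app_scale: "app f (\<lambda>x. c * \<psi> x) = (\<lambda>x. c * app f \<psi> x)"
  using app_lin[of f "\<lambda>x. 0" c \<psi>] by (simp add: app_zero)

instantiation lop :: (type) ring_1
begin
definition zero_lop :: "'a lop" where "zero_lop = Lop (\<lambda>\<phi> x. 0)"
definition one_lop :: "'a lop" where "one_lop = Lop (\<lambda>\<phi>. \<phi>)"
definition plus_lop :: "'a lop \<Rightarrow> 'a lop \<Rightarrow> 'a lop" where
  "plus_lop f g = Lop (\<lambda>\<phi> x. app f \<phi> x + app g \<phi> x)"
definition uminus_lop :: "'a lop \<Rightarrow> 'a lop" where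
  "uminus_lop f = Lop (\<lambda>\<phi> x. - app f \<phi> x)"
definition minus_lop :: "'a lop \<Rightarrow> 'a lop \<Rightarrow> 'a lop" where
  "minus_lop f g = Lop (\<lambda>\<phi> x. app f \<phi> x - app g \<phi> x)"
text \<open>Composition in reversed order: transposition turns a left action into a right action,
  and with this product the assignment of operators to algebra elements is multiplicative.\<close>

definition times_lop :: "'a lop \<Rightarrow> 'a lop \<Rightarrow> 'a lop" where
  "times_lop f g = Lop (\<lambda>\<phi>. app g (app f \<phi>))"

lemma app_lop_simps:
  "app (0 :: 'a lop) = (\<lambda>\<phi> x. 0)" "app (1 :: 'a lop) = (\<lambda>\<phi>. \<phi>)"
  "app (f + g) = (\<lambda>\<phi> x. app f \<phi> x + app g \<phi> x)" "app (- f) = (\<lambda>\<phi> x. - app f \<phi> x)"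
  "app (f - g) = (\<lambda>\<phi> x. app f \<phi> x - app g \<phi> x)" "app (f * g) = (\<lambda>\<phi>. app g (app f \<phi>))"
  for f g :: "'a lop"
  unfolding zero_lop_def one_lop_def plus_lop_def uminus_lop_def minus_lop_def times_lop_def
  by (intro app_Lop; simp add: app_lin algebra_simps)+

instance
proof
  fix a b c :: "'a lop"
  show "(a + b) * c = a * c + b * c"
    by (rule lop_eqI) (simp add: app_lop_simps app_add)
  show "(0 :: 'a lop) \<noteq> 1"
  proof
    assume "(0 :: 'a lop) = 1"
    then have "app (0 :: 'a lop) (\<lambda>x. 1) = app 1 (\<lambda>x. 1)" by simp
    then show False by (simp add: app_lop_simps fun_eq_iff)
  qed
qed (rule lop_eqI, simp add: app_lop_simps algebra_simps)+
end

definition sc_lop :: "qv \<Rightarrow> 'a lop" where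
  "sc_lop c = Lop (\<lambda>\<phi> x. c * \<phi> x)"

lemma app_sc [simp]: "app (sc_lop c) \<phi> x = c * \<phi> x"
  unfolding sc_lop_def by (subst app_Lop) (simp_all add: algebra_simps)

declare app_lop_simps [simp]

interpretation lop: central_scalars "sc_lop :: qv \<Rightarrow> 'a lop"
proof
  fix c and x :: "'a lop"
  have sc: "app (sc_lop c) \<phi> = (\<lambda>y. c * \<phi> y)" for \<phi> :: "'a \<Rightarrow> qv" by (rule ext) simp
  show "sc_lop c * x = x * sc_lop c" by (rule lop_eqI) (simp add: sc app_scale)
qed (rule lop_eqI; simp add: algebra_simps)+

lemma app_sum: "app (sum f A) \<phi> x = (\<Sum>i\<in>A. app (f i) \<phi> x)"
  by (induction A rule: infinite_finite_induct) auto

lemma app_neg_1_power: "app ((- 1) ^ r * f) \<phi> x = (- 1) ^ r * app f \<phi> x"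
proof -
  have sc: "app (sc_lop c) \<phi> = (\<lambda>y. c * \<phi> y)" for c by (rule ext) simp
  show ?thesis by (simp add: sc app_scale flip: lop.sc_neg_1_power)
qed

lemma app_sc_mult: "app (sc_lop c * f) \<phi> x = c * app f \<phi> x"
  by (simp only: lop.sc_comm) simp

definition diag :: "('a \<Rightarrow> qv) \<Rightarrow> 'a lop" where
  "diag g = Lop (\<lambda>\<phi> x. g x * \<phi> x)"

lemma app_diag: "app (diag g) \<phi> x = g x * \<phi> x"
  unfolding diag_def by (subst app_Lop) (simp_all add: algebra_simps)

lemma brk_diag: "lop.brk q (diag (\<lambda>w. q powi g w)) (diag (\<lambda>w. q powi (- g w))) t = diag (\<lambda>w. qnum q (t + g w))"
  if "q \<noteq> 0"
proof (rule lop_eqI)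
  fix \<phi> x
  have "q powi (t + g x) = q powi t * q powi g x" "q powi (- (t + g x)) = q powi (- t) * q powi (- g x)"
    using that by (simp_all add: power_int_add flip: power_int_add)
  then show "app (lop.brk q (diag (\<lambda>w. q powi g w)) (diag (\<lambda>w. q powi (- g w))) t) \<phi> x =
      app (diag (\<lambda>w. qnum q (t + g w))) \<phi> x"
    unfolding lop.brk_def app_sc_mult app_diag qnum_def app_lop_simps(5) divide_inverse
    by (simp only: algebra_simps)
qed

section \<open>Root data\<close>

lemma v_ind_powi_eq_1: "v_ind powi n = 1 \<longleftrightarrow> n = 0"
proof -
  have pow: "v_ind ^ k = Fract ([:0, 1:] ^ k) 1" for k
    by (induction k) (auto simp: v_ind_def One_fract_def)
  have *: "v_ind ^ k = 1 \<Longrightarrow> k = 0" for k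
  proof -
    assume "v_ind ^ k = 1"
    then have "[:0, 1 :: rat:] ^ k = 1"
      unfolding pow One_fract_def by (simp add: eq_fract)
    moreover have "degree ([:0, 1 :: rat:] ^ k) = k" by (simp add: degree_power_eq)
    ultimately show "k = 0" by simp
  qed
  show ?thesis
  proof (cases "n \<ge> 0")
    case True
    then show ?thesis using *[of "nat n"] by (auto simp: power_int_def)
  next
    case False
    then show ?thesis using *[of "nat (- n)"] by (auto simp: power_int_def power_inverse)
  qed
qed

lemma v_ind_nz: "v_ind \<noteq> 0"
  using v_ind_powi_eq_1[of 1] by (auto simp: v_ind_def Zero_fract_def eq_fract)

lemma generic_v: "generic v_ind"
  by (simp add: generic_def v_ind_powi_eq_1 v_ind_nz)

lemma replicate_mset_plus: "replicate_mset (m + n) x = replicate_mset m x + replicate_mset n x"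
  by (rule multiset_eqI) simp

locale datum =
  fixes D :: "('i, 'x::ab_group_add, 'y::ab_group_add) root_datum"
  assumes datum: "root_datum_finite_type D"
begin

abbreviation "I \<equiv> simples D"
abbreviation "A i j \<equiv> pair D (coroot D i) (simple_root D j)"
abbreviation "q \<equiv> v_sub D"
abbreviation "d \<equiv> half_norm D"

lemma cartan: "cartan_datum I (form D)" and fin_type: "finite_type I (form D)"
  and perfect: "perfect_pairing (pair D)"
  and A_def: "\<And>i j. i \<in> I \<Longrightarrow> j \<in> I \<Longrightarrow> A i j = 2 * form D i j div form D i i"
  using datum by (auto simp: root_datum_finite_type_def)

lemma finite_I [simp]: "finite I"
  using cartan by (simp add: cartan_datum_def)

lemma form_sym: "i \<in> I \<Longrightarrow> j \<in> I \<Longrightarrow> form D i j = form D j i"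
  using cartan by (simp add: cartan_datum_def)

lemma form_diag: "i \<in> I \<Longrightarrow> form D i i = 2 * d i" and d_pos: "i \<in> I \<Longrightarrow> d i > 0"
proof -
  assume "i \<in> I"
  then have "even (form D i i)" "form D i i > 0"
    using cartan unfolding cartan_datum_def by blast+
  then show "form D i i = 2 * d i" "d i > 0" by (auto simp: half_norm_def)
qed

lemma A_diag: "i \<in> I \<Longrightarrow> A i i = 2"
  using form_diag[of i] d_pos[of i] by (simp add: A_def)

lemma A_nonpos: "i \<in> I \<Longrightarrow> j \<in> I \<Longrightarrow> i \<noteq> j \<Longrightarrow> A i j \<le> 0"
  using cartan by (auto simp: cartan_datum_def A_def)

lemma d_A: "i \<in> I \<Longrightarrow> j \<in> I \<Longrightarrow> d i * A i j = form D i j"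
proof (cases "i = j")
  case False
  assume "i \<in> I" "j \<in> I"
  moreover from this have "form D i i dvd 2 * form D i j"
    using cartan False by (auto simp: cartan_datum_def)
  ultimately have "form D i i * A i j = 2 * form D i j" by (simp add: A_def)
  then show ?thesis using form_diag[OF \<open>i \<in> I\<close>] by simp
qed (simp add: A_diag form_diag)

lemma d_A_sym: "i \<in> I \<Longrightarrow> j \<in> I \<Longrightarrow> d i * A i j = d j * A j i"
  by (simp add: d_A form_sym)

lemma q_powi: "q i powi n = v_ind powi (d i * n)"
  by (simp add: v_sub_def power_int_mult)

lemma generic_q: "i \<in> I \<Longrightarrow> generic (q i)"
  using d_pos[of i] by (auto simp: generic_def q_powi v_ind_powi_eq_1) (simp add: v_sub_def v_ind_nz)

lemma q_nz: "i \<in> I \<Longrightarrow> q i \<noteq> 0"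
  by (rule generic_nz[OF generic_q])

lemma q_A_sym: "i \<in> I \<Longrightarrow> j \<in> I \<Longrightarrow> q i powi A i j = q j powi A j i"
  by (simp add: q_powi d_A_sym)

definition sl :: "'i \<Rightarrow> 'i \<Rightarrow> nat" where
  "sl i j = nat (1 - A i j)"

lemma sl_Suc: "i \<in> I \<Longrightarrow> j \<in> I \<Longrightarrow> i \<noteq> j \<Longrightarrow> sl i j = Suc (nat (- A i j))"
  using A_nonpos[of i j] by (simp add: sl_def)

lemma pair_add [simp]: "pair D h (l + m) = pair D h l + pair D h m"
  "pair D (h + h') l = pair D h l + pair D h' l"
  using perfect by (auto simp: perfect_pairing_def Modules.additive_def)

lemma pair_zero [simp]: "pair D h 0 = 0" "pair D 0 l = 0"
  using pair_add(1)[of h 0 0] pair_add(2)[of 0 0 l] by auto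

lemma pair_minus [simp]: "pair D h (- l) = - pair D h l" "pair D (- h) l = - pair D h l"
  using pair_add(1)[of h l "- l"] pair_add(2)[of h "- h" l] by auto

lemma pair_diff [simp]: "pair D h (l - m) = pair D h l - pair D h m"
  using pair_add(1)[of h l "- m"] by simp

lemma pair_sum: "pair D h (sum f B) = (\<Sum>x\<in>B. pair D h (f x))"
  by (induction B rule: infinite_finite_induct) auto

lemma pair_sum_list: "pair D h (sum_list xs) = sum_list (map (pair D h) xs)"
  by (induction xs) auto

text \<open>The uniqueness half of perfectness: weights with equal pairings represent the same
  functional on \<open>Y\<close>.\<close>

lemma pair_separates: "l \<noteq> m \<Longrightarrow> \<exists>h. pair D h l \<noteq> pair D h m"
proof (rule ccontr)
  assume "l \<noteq> m" "\<nexists>h. pair D h l \<noteq> pair D h m"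
  then have eq: "(\<lambda>h. pair D h l) = (\<lambda>h. pair D h m)" by simp
  have uniq: "\<exists>!x. P x \<Longrightarrow> P a \<Longrightarrow> P b \<Longrightarrow> a = b" for P and a b :: 'x by blast
  have add: "Modules.additive (\<lambda>h. pair D h l)" by unfold_locales simp
  have "\<exists>!k. (\<lambda>h. pair D h l) = (\<lambda>h. pair D h k)"
    by (rule perfect[unfolded perfect_pairing_def, THEN conjunct2, THEN conjunct2, THEN conjunct2,
          THEN spec, THEN mp, OF add])
  from uniq[OF this refl eq] show False using \<open>l \<noteq> m\<close> by simp
qed


section \<open>The dual of an integrable lowest weight module\<close>

text \<open>A function \<open>\<phi>\<close> on words is a functional on the lowest weight module with lowest weight
  \<open>-a\<close>, through its values on the monomials in the raising operators applied to the lowest weight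
  vector. The number \<open>ht a i w\<close> is minus the weight of the monomial \<open>w\<close> at \<open>i\<close>, and \<open>dn a i\<close> is the
  transpose of the lowering operator.\<close>

definition ht :: "('i \<Rightarrow> int) \<Rightarrow> 'i \<Rightarrow> 'i list \<Rightarrow> int" where
  "ht a i w = a i - (\<Sum>j\<leftarrow>w. A i j)"

primrec dn :: "('i \<Rightarrow> int) \<Rightarrow> 'i \<Rightarrow> ('i list \<Rightarrow> qv) \<Rightarrow> 'i list \<Rightarrow> qv" where
  "dn a i \<phi> [] = 0"
| "dn a i \<phi> (j # w) = dn a i (\<lambda>u. \<phi> (j # u)) w + (if i = j then qnum (q i) (ht a i w) * \<phi> w else 0)"

lemma ht_simps [simp]: "ht a i [] = a i" "ht a i (j # w) = ht a i w - A i j"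
  "ht a i (u @ w) = ht a i u + ht a i w - a i"
  by (simp_all add: ht_def)

lemma ht_mset: "mset u = mset w \<Longrightarrow> ht a i u = ht a i w"
  unfolding ht_def sum_mset_sum_list[symmetric] mset_map by simp

lemma dn_lin: "dn a i (\<lambda>x. \<phi> x + c * \<psi> x) w = dn a i \<phi> w + c * dn a i \<psi> w"
proof (induction w arbitrary: \<phi> \<psi>)
  case (Cons j w)
  show ?case by (simp add: Cons[of "\<lambda>u. \<phi> (j # u)" "\<lambda>u. \<psi> (j # u)"] algebra_simps)
qed simp

text \<open>Every term of \<open>dn\<close> evaluates \<open>\<phi>\<close> at \<open>w\<close> with
  one letter \<open>i\<close> deleted. The multiset of letters is all that later arguments
  use.\<close>

lemma dn_zero: "(\<And>u. mset w = add_mset i (mset u) \<Longrightarrow> \<phi> u = 0) \<Longrightarrow> dn a i \<phi> w = 0"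
proof (induction w arbitrary: \<phi>)
  case (Cons j w)
  have "dn a i (\<lambda>u. \<phi> (j # u)) w = 0"
    using Cons.prems by (intro Cons.IH) simp
  then show ?case using Cons.prems[of w] by simp
qed simp

lemma dn_cong: "(\<And>u. mset w = add_mset i (mset u) \<Longrightarrow> \<phi> u = \<psi> u) \<Longrightarrow> dn a i \<phi> w = dn a i \<psi> w"
  using dn_zero[of w i "\<lambda>u. \<phi> u + (- 1) * \<psi> u" a] dn_lin[of a i \<phi> "-1" \<psi> w] by simp

lemma dn_scale: "dn a i (\<lambda>x. c * \<psi> x) w = c * dn a i \<psi> w"
  using dn_lin[of a i "\<lambda>x. 0" c \<psi> w] dn_zero[of w i "\<lambda>x. 0" a] by simp

definition Up :: "'i \<Rightarrow> 'i list lop" where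
  "Up i = Lop (\<lambda>\<phi> w. \<phi> (i # w))"

definition Dn :: "('i \<Rightarrow> int) \<Rightarrow> 'i \<Rightarrow> 'i list lop" where
  "Dn a i = Lop (dn a i)"

lemma app_Up [simp]: "app (Up i) \<phi> w = \<phi> (i # w)"
  unfolding Up_def by (subst app_Lop) simp_all

lemma app_Dn: "app (Dn a i) = dn a i"
  unfolding Dn_def by (rule app_Lop) (rule dn_lin)

lemma app_Up_pow: "app (Up i ^ m) \<phi> w = \<phi> (replicate m i @ w)"
proof (induction m arbitrary: \<phi>)
  case (Suc m)
  then show ?case by (simp add: power_Suc del: power_Suc2)
qed simp

text \<open>The quantum Serre element for \<open>i\<close>, \<open>j\<close>, paired with a
  functional that is given by its values on monomials.\<close>

definition ser :: "'i \<Rightarrow> 'i \<Rightarrow> ('i list \<Rightarrow> qv) \<Rightarrow> qv" where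
  "ser i j \<psi> = (\<Sum>r\<le>sl i j. (- 1) ^ r * (inverse (qfact (q i) (sl i j - r)) *
     (inverse (qfact (q i) r) * \<psi> (replicate (sl i j - r) i @ [j] @ replicate r i))))"

lemma app_serre: "app (lop.serre (q i) (sl i j) (Up i) (Up j)) \<phi> w = ser i j (\<lambda>v. \<phi> (v @ w))"
proof -
  have "app (lop.dpow (q i) (Up i) k * Up j * lop.dpow (q i) (Up i) r) \<phi> w =
      inverse (qfact (q i) k) * (inverse (qfact (q i) r) * \<phi> (replicate k i @ [j] @ replicate r i @ w))" for k r
  proof -
    have "lop.dpow (q i) (Up i) k * Up j * lop.dpow (q i) (Up i) r =
        sc_lop (inverse (qfact (q i) k)) * (sc_lop (inverse (qfact (q i) r)) * (Up i ^ k * Up j * Up i ^ r))"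
      by (simp only: lop.dpow_def mult.assoc lop.sc_left_comm[of "Up j"] lop.sc_left_comm[of "Up i ^ k"])
    then show ?thesis by (simp only: app_sc_mult) (simp add: app_Up_pow)
  qed
  then show ?thesis
    unfolding lop.serre_def ser_def app_sum by (simp add: app_neg_1_power mult.assoc del: app_lop_simps(6))
qed

lemma ser_lin: "ser i j (\<lambda>v. \<phi> v + c * \<psi> v) = ser i j \<phi> + c * ser i j \<psi>"
  unfolding ser_def by (simp add: algebra_simps sum.distrib sum_distrib_left)

text \<open>All words in a Serre element have the same letters with multiplicity, so a factor that
  depends only on the weight can be pulled out.\<close>

lemma ser_homogeneous:
  assumes "\<And>v. mset v = add_mset j (replicate_mset (sl i j) i) \<Longrightarrow> \<phi> v = c * \<psi> v"
  shows "ser i j \<phi> = c * ser i j \<psi>"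
proof -
  have "\<phi> (replicate (sl i j - r) i @ [j] @ replicate r i) = c * \<psi> (replicate (sl i j - r) i @ [j] @ replicate r i)"
    if "r \<le> sl i j" for r
    using that by (intro assms) (simp flip: replicate_mset_plus)
  then show ?thesis unfolding ser_def sum_distrib_left by (intro sum.cong) auto
qed

text \<open>The dual of the module generated by a vector of weight -a with the relations E_i^(a_i +
  1) = 0 on that vector and the Serre relations. The rightmost letter acts first, so the
  integrability condition sits at the end of the word; arbitrary prefixes \<open>u\<close> make the
  conditions those of a left submodule.\<close>

definition lowest :: "('i \<Rightarrow> int) \<Rightarrow> ('i list \<Rightarrow> qv) set" where
  "lowest a = {\<phi>. (\<forall>w. \<phi> w \<noteq> 0 \<longrightarrow> set w \<subseteq> I) \<and>
     (\<forall>u. \<forall>i\<in>I. \<phi> (u @ replicate (Suc (nat (a i))) i) = 0) \<and>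
     (\<forall>u w. \<forall>i\<in>I. \<forall>j\<in>I. i \<noteq> j \<longrightarrow> ser i j (\<lambda>v. \<phi> (u @ v @ w)) = 0)}"

lemma lowestD:
  assumes "\<phi> \<in> lowest a"
  shows "\<phi> w \<noteq> 0 \<Longrightarrow> set w \<subseteq> I"
    and "i \<in> I \<Longrightarrow> \<phi> (u @ replicate (Suc (nat (a i))) i) = 0"
    and "i \<in> I \<Longrightarrow> j \<in> I \<Longrightarrow> i \<noteq> j \<Longrightarrow> ser i j (\<lambda>v. \<phi> (u @ v @ w)) = 0"
  using assms unfolding lowest_def by blast+

lemma lowest_zero: "(\<lambda>w. 0) \<in> lowest a"
  by (simp add: lowest_def ser_def)

lemma lowest_lin: "\<phi> \<in> lowest a \<Longrightarrow> \<psi> \<in> lowest a \<Longrightarrow> (\<lambda>w. \<phi> w + c * \<psi> w) \<in> lowest a"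
proof -
  assume "\<phi> \<in> lowest a" "\<psi> \<in> lowest a"
  note \<phi> = lowestD[OF this(1)] and \<psi> = lowestD[OF this(2)]
  have "set w \<subseteq> I" if "\<phi> w + c * \<psi> w \<noteq> 0" for w
    using \<phi>(1)[of w] \<psi>(1)[of w] that by (cases "\<phi> w = 0") auto
  then show "(\<lambda>w. \<phi> w + c * \<psi> w) \<in> lowest a"
    unfolding lowest_def using \<phi>(2,3) \<psi>(2,3) by (simp add: ser_lin)
qed

lemma lowest_Up: "\<phi> \<in> lowest a \<Longrightarrow> (\<lambda>w. \<phi> (k # w)) \<in> lowest a"
proof -
  assume \<phi>: "\<phi> \<in> lowest a"
  show ?thesis
    unfolding lowest_def
    using lowestD(1)[OF \<phi>, of "k # _"] lowestD(2)[OF \<phi>, of _ "k # _"] lowestD(3)[OF \<phi>, of _ _ "k # _"]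
    by auto
qed

lemma lowest_weight:
  assumes \<phi>: "\<phi> \<in> lowest a" and g: "\<And>u w. mset u = mset w \<Longrightarrow> g u = g w"
  shows "(\<lambda>w. g w * \<phi> w) \<in> lowest a"
proof -
  have "ser i j (\<lambda>v. g (u @ v @ w) * \<phi> (u @ v @ w)) = 0" if "i \<in> I" "j \<in> I" "i \<noteq> j" for u w i j
  proof -
    let ?v = "j # replicate (sl i j) i"
    have "ser i j (\<lambda>v. g (u @ v @ w) * \<phi> (u @ v @ w)) = g (u @ ?v @ w) * ser i j (\<lambda>v. \<phi> (u @ v @ w))"
      by (rule ser_homogeneous) (auto intro: g)
    then show ?thesis using lowestD(3)[OF \<phi> that] by simp
  qed
  then show ?thesis using lowestD(1,2)[OF \<phi>] unfolding lowest_def by auto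
qed

text \<open>The recursion of \<open>dn\<close> is the rule for moving a lowering operator past a
  raising one. The weight of \<open>w\<close> at \<open>i\<close> is \<open>- ht a i w\<close>,
  which explains the exponents on the right.\<close>

lemma Up_Dn: "i \<in> I \<Longrightarrow> Up i * Dn a i - Dn a i * Up i =
    lop.brk (q i) (diag (\<lambda>w. q i powi (- ht a i w))) (diag (\<lambda>w. q i powi (- (- ht a i w)))) 0"
  by (rule lop_eqI, subst brk_diag) (simp_all add: q_nz app_diag app_Dn app_Up[abs_def] qnum_minus)

lemma app_Up_fun: "app (Up i) \<phi> = (\<lambda>w. \<phi> (i # w))"
  by (rule ext) simp

lemma Up_Dn_other: "i \<noteq> j \<Longrightarrow> Up i * Dn a j = Dn a j * Up i"
  by (rule lop_eqI) (simp add: app_Dn app_Up_fun)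

lemma diag_Up:
  assumes "\<And>w. g (j # w) = c * g w"
  shows "diag g * Up j = sc_lop c * (Up j * diag g)"
  by (rule lop_eqI, subst app_sc_mult) (simp add: app_diag assms app_Up_fun)

lemma diag_q_Up:
  assumes "i \<in> I" "j \<in> I"
  shows "diag (\<lambda>w. q i powi (- ht a i w)) * Up j = sc_lop (q j powi (A j i)) * (Up j * diag (\<lambda>w. q i powi (- ht a i w)))"
    and "diag (\<lambda>w. q i powi (ht a i w)) * Up j = sc_lop (q j powi (- A j i)) * (Up j * diag (\<lambda>w. q i powi (ht a i w)))"
proof -
  have nz: "q i \<noteq> 0" using assms q_nz by blast
  show "diag (\<lambda>w. q i powi (- ht a i w)) * Up j = sc_lop (q j powi (A j i)) * (Up j * diag (\<lambda>w. q i powi (- ht a i w)))"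
    using nz by (intro diag_Up) (simp add: power_int_diff power_int_minus divide_simps flip: q_A_sym[OF assms])
  show "diag (\<lambda>w. q i powi (ht a i w)) * Up j = sc_lop (q j powi (- A j i)) * (Up j * diag (\<lambda>w. q i powi (ht a i w)))"
    using nz by (intro diag_Up) (simp add: power_int_diff power_int_minus divide_simps flip: q_A_sym[OF assms])
qed

text \<open>\<open>Up\<close>, \<open>Dn\<close> and the diagonal operators satisfy the relations of
  E, F and K, so the three commutation lemmas apply according to whether \<open>k\<close> is
  \<open>i\<close>, \<open>j\<close> or neither.\<close>

lemma serre_Dn:
  assumes ij: "i \<in> I" "j \<in> I" "i \<noteq> j" and k: "k \<in> I"
  shows "lop.serre (q i) (sl i j) (Up i) (Up j) * Dn a k = Dn a k * lop.serre (q i) (sl i j) (Up i) (Up j)"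
proof -
  note nz = q_nz[OF ij(1)] q_nz[OF ij(2)] generic_q[OF ij(1)]
  consider "k = i" | "k = j" | "k \<noteq> i" "k \<noteq> j" by blast
  then show ?thesis
  proof cases
    case 1
    show ?thesis
      unfolding 1 sl_Suc[OF ij]
      by (rule lop.serre_comm_same[OF nz(3) _ _ Up_Dn[OF ij(1), of a]])
        (use diag_q_Up[OF ij(1,1), of a] diag_q_Up[OF ij(1,2), of a] Up_Dn_other[of j i a] ij(3)
         in \<open>simp_all add: A_diag[OF ij(1)] A_nonpos[OF ij] q_A_sym[OF ij(2,1)] power_int_minus\<close>)
  next
    case 2
    show ?thesis
      unfolding 2 sl_Suc[OF ij]
      by (rule lop.serre_comm_other[OF nz(3) _ Up_Dn[OF ij(2), of a, unfolded lop.brk_def, simplified]])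
        (use diag_q_Up[OF ij(2,1), of a] Up_Dn_other[of i j a] ij(3) in \<open>simp_all add: A_nonpos[OF ij] power_int_minus\<close>)
  next
    case 3
    show ?thesis
      by (rule lop.serre_comm_zero) (use 3 Up_Dn_other in auto)
  qed
qed

text \<open>The vectors imposed as relations are singular: lowering E_i^(a_i + 1) applied to the
  lowest weight vector gives zero, and lowering operators commute with Serre elements. Prefixes are
  then added letter by letter with the recursion of \<open>dn\<close>.\<close>

lemma lowest_Dn:
  assumes "\<phi> \<in> lowest a" "k \<in> I" "\<And>i. i \<in> I \<Longrightarrow> a i \<ge> 0"
  shows "dn a k \<phi> \<in> lowest a"
proof -
  have "set w \<subseteq> I" if "dn a k \<phi> w \<noteq> 0" for w
  proof -
    obtain u where u: "mset w = add_mset k (mset u)" "\<phi> u \<noteq> 0"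
      using dn_zero[of w k \<phi> a] \<open>dn a k \<phi> w \<noteq> 0\<close> by blast
    have "set w = insert k (set u)" by (metis set_mset_add_mset_insert set_mset_mset u(1))
    then show ?thesis using lowestD(1)[OF assms(1) u(2)] assms(2) by simp
  qed
  moreover have "dn a k \<phi> (u @ replicate (Suc (nat (a i))) i) = 0" if i: "i \<in> I" for u i
    using assms(1)
  proof (induction u arbitrary: \<phi>)
    case Nil
    let ?m = "nat (a i)"
    have "app (Dn a k * Up i ^ Suc ?m) \<phi> [] = app (Up i ^ Suc ?m * Dn a k) \<phi> []"
    proof (cases "k = i")
      case True
      have c: "Up i ^ Suc ?m * Dn a i - Dn a i * Up i ^ Suc ?m = sc_lop (qnum (q i) (int (Suc ?m))) *
          (Up i ^ ?m * lop.brk (q i) (diag (\<lambda>w. q i powi (- ht a i w))) (diag (\<lambda>w. q i powi (- (- ht a i w)))) (int ?m))"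
        using diag_q_Up[OF i i, of a] generic_q[OF i] Up_Dn[OF i, of a]
        by (intro lop.pow_commutator) (simp_all add: A_diag[OF i])
      \<comment> \<open>At the empty word \<open>ht\<close> is \<open>a i\<close>, so the bracket is
        the quantum number of \<open>?m - a i = 0\<close>. This is what dictates the exponent
        \<open>Suc (nat (a i))\<close>.\<close>
      have "app (Up i ^ Suc ?m * Dn a i - Dn a i * Up i ^ Suc ?m) \<phi> [] = 0"
        unfolding c app_sc_mult brk_diag[OF q_nz[OF i]] using assms(3)[OF i] by (simp add: app_diag)
      then show ?thesis using True by simp
    next
      case False
      have "Up i ^ m * Dn a k = Dn a k * Up i ^ m" for m
      proof (induction m)
        case (Suc m)
        show ?case
          by (simp only: power_Suc mult.assoc Suc)
            (simp only: mult.assoc[symmetric] Up_Dn_other[OF False[symmetric]])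
      qed simp
      from this[of "Suc ?m"] show ?thesis by simp
    qed
    then show ?case by (simp add: app_Dn app_Up_pow del: power_Suc replicate_Suc)
  next
    case (Cons j u)
    show ?case
      using Cons.IH[OF lowest_Up[OF Cons.prems, of j]] lowestD(2)[OF Cons.prems i, of u] by simp
  qed
  moreover have "ser i j (\<lambda>v. dn a k \<phi> (u @ v @ w)) = 0" if ij: "i \<in> I" "j \<in> I" "i \<noteq> j" for u w i j
    using assms(1)
  proof (induction u arbitrary: \<phi>)
    case Nil
    let ?S = "lop.serre (q i) (sl i j) (Up i) (Up j)"
    have "app ?S \<phi> = (\<lambda>w. 0)"
      using lowestD(3)[OF Nil ij, of "[]"] by (intro ext) (simp add: app_serre)
    then have "app (Dn a k * ?S) \<phi> w = 0"
      unfolding serre_Dn[OF ij assms(2), symmetric] by (simp add: app_zero)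
    then show ?case by (simp add: app_serre app_Dn)
  next
    case (Cons l u)
    define c where "c = (if k = l then qnum (q k) (ht a k (u @ (j # replicate (sl i j) i) @ w)) else 0)"
    have "ser i j (\<lambda>v. if k = l then qnum (q k) (ht a k (u @ v @ w)) * \<phi> (u @ v @ w) else 0) =
        c * ser i j (\<lambda>v. \<phi> (u @ v @ w))"
    proof (rule ser_homogeneous)
      fix v assume "mset v = add_mset j (replicate_mset (sl i j) i)"
      then have "ht a k (u @ v @ w) = ht a k (u @ (j # replicate (sl i j) i) @ w)"
        by (intro ht_mset) simp
      then show "(if k = l then qnum (q k) (ht a k (u @ v @ w)) * \<phi> (u @ v @ w) else 0) =
          c * \<phi> (u @ v @ w)"
        by (cases "k = l") (simp_all add: c_def del: ht_simps)
    qed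
    then show ?case
      using Cons.IH[OF lowest_Up[OF Cons.prems, of l]] lowestD(3)[OF Cons.prems ij, of u w]
        ser_lin[of i j "\<lambda>v. dn a k (\<lambda>x. \<phi> (l # x)) (u @ v @ w)" 1]
      by simp
  qed
  ultimately show ?thesis unfolding lowest_def by blast
qed

lemma replicate_split: "m \<le> n \<Longrightarrow> replicate n x = replicate (n - m) x @ replicate m x"
  by (simp flip: replicate_add)

text \<open>Local nilpotency of E_i, by induction along the monomial: the Serre relation moves
  powers of E_i to the right past a letter \<open>j\<close>. The bound depends on \<open>w\<close>
  only, not on \<open>\<phi>\<close> or the prefix.\<close>

lemma lowest_nilpotent:
  assumes "i \<in> I" "set w \<subseteq> I"
  shows "\<exists>N. \<forall>M\<ge>N. \<forall>\<phi>\<in>lowest a. \<forall>u. \<phi> (u @ replicate M i @ w) = 0"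
  using assms(2)
proof (induction w)
  case Nil
  have "\<phi> (u @ replicate M i @ []) = 0" if "M \<ge> Suc (nat (a i))" "\<phi> \<in> lowest a" for M \<phi> u
    using lowestD(2)[OF that(2) assms(1), of "u @ replicate (M - Suc (nat (a i))) i"]
      replicate_split[OF that(1), of i]
    by (simp del: replicate_Suc)
  then show ?case by blast
next
  case (Cons j w)
  then obtain N where N: "\<And>M \<phi> u. M \<ge> N \<Longrightarrow> \<phi> \<in> lowest a \<Longrightarrow> \<phi> (u @ replicate M i @ w) = 0" by auto
  show ?case
  proof (cases "j = i")
    case True
    have "\<phi> (u @ replicate M i @ j # w) = 0" if "M \<ge> N" "\<phi> \<in> lowest a" for M \<phi> u
      using N[of "Suc M" \<phi> u] that True by (simp add: replicate_app_Cons_same)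
    then show ?thesis by blast
  next
    case False
    let ?n = "sl i j"
    have ij: "i \<in> I" "j \<in> I" "i \<noteq> j" using assms(1) Cons.prems False by auto
    \<comment> \<open>With fewer than \<open>?n\<close> letters \<open>i\<close> in front of
      \<open>j\<close>, at least \<open>N\<close> stand behind it and the bound for \<open>w\<close>
      applies. Otherwise the Serre relation trades the word for ones with smaller \<open>p\<close>
      and the same \<open>p + t\<close>.\<close>
    have "\<phi> (u @ replicate p i @ j # replicate t i @ w) = 0" if "p + t \<ge> N + ?n" "\<phi> \<in> lowest a" for p t \<phi> u
      using that
    proof (induction p arbitrary: t rule: less_induct)
      case (less p)
      show ?case
      proof (cases "p < ?n")
        case True
        then have "t \<ge> N" using less.prems by simp
        then show ?thesis using N[of t \<phi> "u @ replicate p i @ [j]"] less.prems by simp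
      next
        case False
        let ?u = "u @ replicate (p - ?n) i"
        have "ser i j (\<lambda>v. \<phi> (?u @ v @ replicate t i @ w)) = inverse (qfact (q i) ?n) * \<phi> (?u @ (replicate ?n i @ [j]) @ replicate t i @ w)"
          unfolding ser_def
        proof (subst sum.mono_neutral_right[of _ "{0}"], simp_all, intro ballI)
          fix r assume r: "r \<in> {..?n} - {0}"
          have "\<phi> (u @ replicate (p - r) i @ j # replicate (t + r) i @ w) = 0"
            using r False less.prems by (intro less.IH) auto
          moreover have "replicate (p - r) i = replicate (p - ?n) i @ replicate (?n - r) i"
            using r False replicate_split[of "?n - r" "p - r" i] by simp
          moreover have "replicate (t + r) i = replicate r i @ replicate t i"
            by (simp add: add.commute flip: replicate_add)
          ultimately have "\<phi> (u @ replicate (p - ?n) i @ replicate (?n - r) i @ j # replicate r i @ replicate t i @ w) = 0"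
            by simp
          then show "qfact (q i) (?n - r) = 0 \<or> qfact (q i) r = 0 \<or>
              \<phi> (u @ replicate (p - ?n) i @ replicate (?n - r) i @ j # replicate r i @ replicate t i @ w) = 0"
            by blast
        qed
        moreover have "replicate p i = replicate (p - ?n) i @ replicate ?n i"
          using False by (intro replicate_split) simp
        ultimately show ?thesis
          using lowestD(3)[OF less.prems(2) ij, of ?u "replicate t i @ w"] qfact_nz[OF generic_q[OF ij(1)], of ?n]
          by simp
      qed
    qed
    from this[of _ 0] show ?thesis by (intro exI[of _ "N + ?n"]) auto
  qed
qed

lemma dn_pow_zero:
  "(\<And>u. mset w = mset u + replicate_mset m i \<Longrightarrow> \<phi> u = 0) \<Longrightarrow> app (Dn a i ^ m) \<phi> w = 0"
proof (induction m arbitrary: w)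
  case (Suc m)
  have "app (Dn a i ^ Suc m) \<phi> w = dn a i (app (Dn a i ^ m) \<phi>) w"
    by (simp only: power_Suc2) (simp add: app_Dn)
  also have "\<dots> = 0"
    using Suc.prems by (intro dn_zero Suc.IH) auto
  finally show ?case .
qed (auto intro: arg_cong[where f = \<phi>])

lemma lowest_Dn_pow:
  assumes "\<phi> \<in> lowest a" "k \<in> I" "\<And>i. i \<in> I \<Longrightarrow> a i \<ge> 0"
  shows "app (Dn a k ^ m) \<phi> \<in> lowest a"
proof (induction m)
  case (Suc m)
  have "app (Dn a k ^ Suc m) \<phi> = dn a k (app (Dn a k ^ m) \<phi>)"
    by (simp only: power_Suc2) (simp add: app_Dn)
  then show ?case using lowest_Dn[OF Suc assms(2,3)] by simp
qed (simp add: assms)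

text \<open>The sl_2 identity with raising and lowering exchanged; deleting a letter
  \<open>i\<close> raises \<open>ht a i\<close> by 2, so the diagonal operators are inverted as
  well.\<close>

lemma Dn_pow_Up:
  assumes i: "i \<in> I"
  shows "Dn a i ^ Suc m * Up i - Up i * Dn a i ^ Suc m =
     sc_lop (qnum (q i) (int (Suc m))) * (Dn a i ^ m * diag (\<lambda>w. qnum (q i) (int m + ht a i w)))"
proof -
  have shift: "diag (\<lambda>w. q i powi (c * ht a i w)) * Dn a i = sc_lop (q i powi (2 * c)) * (Dn a i * diag (\<lambda>w. q i powi (c * ht a i w)))" for c
  proof (rule lop_eqI, subst app_sc_mult)
    fix \<phi> w
    have "dn a i (\<lambda>u. q i powi (c * ht a i u) * \<phi> u) w = dn a i (\<lambda>u. q i powi (2 * c + c * ht a i w) * \<phi> u) w"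
    proof (rule dn_cong)
      fix u assume "mset w = add_mset i (mset u)"
      then have "ht a i w = ht a i (i # u)" by (intro ht_mset) simp
      then have "ht a i u = 2 + ht a i w" by (simp add: A_diag[OF i])
      then have "c * ht a i u = 2 * c + c * ht a i w" by (simp only: distrib_left)
      then show "q i powi (c * ht a i u) * \<phi> u = q i powi (2 * c + c * ht a i w) * \<phi> u"
        by simp
    qed
    also have "\<dots> = q i powi (2 * c) * (q i powi (c * ht a i w) * dn a i \<phi> w)"
      using q_nz[OF i] by (simp add: dn_scale power_int_add)
    finally show "app (diag (\<lambda>w. q i powi (c * ht a i w)) * Dn a i) \<phi> w =
        q i powi (2 * c) * app (Dn a i * diag (\<lambda>w. q i powi (c * ht a i w))) \<phi> w"
      by (simp add: app_Dn app_diag[abs_def])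
  qed
  have "Dn a i * Up i - Up i * Dn a i = - (Up i * Dn a i - Dn a i * Up i)" by simp
  also have "\<dots> = lop.brk (q i) (diag (\<lambda>w. q i powi ht a i w)) (diag (\<lambda>w. q i powi (- ht a i w))) 0"
    unfolding Up_Dn[OF i] lop.brk_def by (simp flip: mult_minus_right)
  finally have "Dn a i ^ Suc m * Up i - Up i * Dn a i ^ Suc m = sc_lop (qnum (q i) (int (Suc m))) *
      (Dn a i ^ m * lop.brk (q i) (diag (\<lambda>w. q i powi ht a i w)) (diag (\<lambda>w. q i powi (- ht a i w))) (int m))"
    using shift[of 1] shift[of "-1"] by (intro lop.pow_commutator generic_q[OF i]) simp_all
  then show ?thesis unfolding brk_diag[OF q_nz[OF i]] .
qed

text \<open>A nonzero weight space of weight \<open>\<mu>\<close> with \<open>\<langle>h\<^sub>i, \<mu>\<rangle> = n > 0\<close> forces that of \<open>\<mu> - n \<alpha>\<^sub>i\<close> to be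
  nonzero: raise to the top of the \<open>i\<close>-string and lower again.\<close>

lemma lowest_reflect:
  assumes a: "\<And>i. i \<in> I \<Longrightarrow> a i \<ge> 0" and \<phi>: "\<phi> \<in> lowest a" "\<phi> w \<noteq> 0" and i: "i \<in> I"
    and n: "ht a i w = - int n"
  shows "\<exists>\<psi>\<in>lowest a. \<exists>u. mset w = mset u + replicate_mset n i \<and> \<psi> u \<noteq> 0"
proof (rule ccontr)
  assume neg: "\<not> ?thesis"
  define ex where "ex k \<longleftrightarrow> (\<exists>\<psi>\<in>lowest a. \<psi> (replicate k i @ w) \<noteq> 0)" for k
  obtain N where N: "\<And>M \<psi> u. M \<ge> N \<Longrightarrow> \<psi> \<in> lowest a \<Longrightarrow> \<psi> (u @ replicate M i @ w) = 0"
    using lowest_nilpotent[OF i lowestD(1)[OF \<phi>], of a] by blast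
  have bound: "k < N" if k: "ex k" for k
  proof -
    obtain \<psi> where "\<psi> \<in> lowest a" "\<psi> (replicate k i @ w) \<noteq> 0" using k unfolding ex_def by blast
    then show ?thesis using N[of k \<psi> "[]"] by (cases "k < N") auto
  qed
  have "ex 0" using \<phi> by (auto simp: ex_def)
  \<comment> \<open>The monomial \<open>replicate k i @ w\<close> is the top of the
    \<open>i\<close>-string through \<open>w\<close>: nonzero in the module, but killed by one more
    raising operator.\<close>
  define k where "k = (GREATEST k. ex k)"
  have "ex k" unfolding k_def using \<open>ex 0\<close> bound by (intro GreatestI_nat[of ex 0 N]) (auto intro: less_imp_le)
  have top: "\<psi> (i # replicate k i @ w) = 0" if "\<psi> \<in> lowest a" for \<psi>
  proof (rule ccontr)
    assume "\<psi> (i # replicate k i @ w) \<noteq> 0"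
    then have "ex (Suc k)" using that by (auto simp: ex_def)
    then have "Suc k \<le> k" unfolding k_def using bound by (intro Greatest_le_nat[of ex _ N]) (auto intro: less_imp_le)
    then show False by simp
  qed
  let ?v = "replicate k i @ w"
  have ht_v: "ht a i ?v = - int (n + 2 * k)"
  proof -
    have "ht a i (replicate k i @ w) = ht a i w - 2 * int k" for w
      by (induction k) (auto simp: A_diag[OF i])
    then show ?thesis by (simp add: n)
  qed
  \<comment> \<open>If F_i^(n+k) kills the top vector, then so do all smaller powers, down to the
    zeroth. The starting case is the assumption \<open>neg\<close>, since n + k lowerings of the top
    vector lead to the content of \<open>w\<close> minus n letters \<open>i\<close>.\<close>
  have "\<forall>\<psi>\<in>lowest a. app (Dn a i ^ (n + k - m)) \<psi> ?v = 0" if "m \<le> n + k" for m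
    using that
  proof (induction m)
    case 0
    show ?case
    proof
      fix \<psi> assume \<psi>: "\<psi> \<in> lowest a"
      show "app (Dn a i ^ (n + k - 0)) \<psi> ?v = 0"
      proof (rule dn_pow_zero)
        fix u assume "mset ?v = mset u + replicate_mset (n + k - 0) i"
        then have "mset w = mset u + replicate_mset n i" by (simp add: replicate_mset_plus)
        then show "\<psi> u = 0" using neg \<psi> by blast
      qed
    qed
  next
    case (Suc m)
    define p where "p = n + k - Suc m"
    have p: "n + k - m = Suc p" using Suc.prems by (simp add: p_def)
    show ?case
    proof
      fix \<psi> assume \<psi>: "\<psi> \<in> lowest a"
      have "app (Dn a i ^ Suc p * Up i) \<psi> ?v = 0"
        using top[OF lowest_Dn_pow[OF \<psi> i a, of "Suc p"]] by (simp del: power_Suc)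
      moreover have "app (Up i * Dn a i ^ Suc p) \<psi> ?v = 0"
        using Suc lowest_Up[OF \<psi>, of i] p by (simp add: app_Up_fun del: power_Suc)
      ultimately have "app (Dn a i ^ Suc p * Up i - Up i * Dn a i ^ Suc p) \<psi> ?v = 0"
        by (simp del: power_Suc)
      then have "qnum (q i) (int (Suc p)) * (qnum (q i) (int p + ht a i ?v) * app (Dn a i ^ p) \<psi> ?v) = 0"
        unfolding Dn_pow_Up[OF i] app_sc_mult by (simp add: app_diag)
      \<comment> \<open>The top vector has weight n + 2k at \<open>i\<close> and p < n + k, so the
        coefficient in the sl_2 identity is nonzero.\<close>
      moreover have "int p + ht a i ?v \<noteq> 0" unfolding ht_v using Suc.prems by (simp add: p_def)
      ultimately show "app (Dn a i ^ (n + k - Suc m)) \<psi> ?v = 0"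
        using qnum_nz[OF generic_q[OF i]] by (simp add: p_def)
    qed
  qed
  from this[of "n + k"] have "\<not> ex k" by (simp add: ex_def)
  then show False using \<open>ex k\<close> by contradiction
qed

end


section \<open>Positive definite forms\<close>

text \<open>Induction on the index set by completing the square in one variable; the remaining form
  is again positive definite.\<close>

lemma posdef_bounded:
  fixes b :: "'i \<Rightarrow> 'i \<Rightarrow> real"
  assumes "finite F" "\<And>i j. i \<in> F \<Longrightarrow> j \<in> F \<Longrightarrow> b i j = b j i"
    and "\<And>x. (\<exists>i\<in>F. x i \<noteq> 0) \<Longrightarrow> (\<Sum>i\<in>F. \<Sum>j\<in>F. x i * b i j * x j) > 0"
  shows "\<exists>L. \<forall>x. (\<Sum>i\<in>F. \<Sum>j\<in>F. x i * b i j * x j) \<le> 1 \<longrightarrow> (\<forall>i\<in>F. \<bar>x i\<bar> \<le> L)"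
  using assms
proof (induction F arbitrary: b rule: finite_induct)
  case empty
  then show ?case by simp
next
  case (insert k F)
  define \<beta> where "\<beta> = b k k"
  \<comment> \<open>The Schur complement of the entry at \<open>k\<close>.\<close>
  define b' where "b' i j = b i j - b k i * b k j / \<beta>" for i j
  define Q where "Q x = (\<Sum>i\<in>insert k F. \<Sum>j\<in>insert k F. x i * b i j * x j)" for x
  define Q' where "Q' x = (\<Sum>i\<in>F. \<Sum>j\<in>F. x i * b' i j * x j)" for x
  define l where "l x = (\<Sum>j\<in>F. b k j * x j) / \<beta>" for x
  have Q: "Q x = \<beta> * (x k)\<^sup>2 + 2 * x k * (\<Sum>j\<in>F. b k j * x j) + (\<Sum>i\<in>F. \<Sum>j\<in>F. x i * b i j * x j)" for x
  proof -
    let ?S = "\<Sum>j\<in>F. b k j * x j"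
    have "(\<Sum>i\<in>F. x i * b i k * x k) = x k * ?S"
      unfolding sum_distrib_left using insert.prems(1)[of k] by (intro sum.cong) auto
    moreover have "(\<Sum>j\<in>F. x k * b k j * x j) = x k * ?S"
      unfolding sum_distrib_left by (intro sum.cong) auto
    ultimately show ?thesis
      using insert.hyps unfolding Q_def \<beta>_def by (simp add: sum.distrib power2_eq_square)
  qed
  have "Q (\<lambda>i. if i \<in> F then 0 else 1) = \<beta>"
    unfolding Q using insert.hyps(2) by (simp add: sum.neutral)
  moreover have "Q (\<lambda>i. if i \<in> F then 0 else 1) > 0"
    unfolding Q_def using insert.hyps(2) by (intro insert.prems(2) bexI[of _ k]) simp_all
  ultimately have \<beta>: "\<beta> > 0" by simp
  have split: "Q x = \<beta> * (x k + l x)\<^sup>2 + Q' x" for x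
  proof -
    let ?S = "\<Sum>j\<in>F. b k j * x j"
    have "Q' x = (\<Sum>i\<in>F. \<Sum>j\<in>F. x i * b i j * x j) - (\<Sum>i\<in>F. \<Sum>j\<in>F. (b k i * x i) * (b k j * x j)) / \<beta>"
      unfolding Q'_def b'_def sum_divide_distrib sum_subtractf[symmetric]
      by (intro sum.cong refl) (simp add: algebra_simps)
    also have "(\<Sum>i\<in>F. \<Sum>j\<in>F. (b k i * x i) * (b k j * x j)) = ?S * ?S"
      by (simp add: sum_product)
    finally have "Q' x = (\<Sum>i\<in>F. \<Sum>j\<in>F. x i * b i j * x j) - ?S * ?S / \<beta>" .
    moreover have "\<beta> * (x k + ?S / \<beta>)\<^sup>2 = \<beta> * (x k)\<^sup>2 + 2 * x k * ?S + ?S * ?S / \<beta>"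
      using \<beta> by (simp add: power2_eq_square field_simps)
    ultimately show ?thesis unfolding Q l_def by simp
  qed
  have pos': "Q' x > 0" if "\<exists>i\<in>F. x i \<noteq> 0" for x
  proof -
    \<comment> \<open>This choice makes the completed square zero, so that \<open>Q\<close> at
      \<open>?y\<close> is \<open>Q'\<close> at \<open>x\<close>.\<close>
    let ?y = "x(k := - l x)"
    have F: "i \<in> F \<Longrightarrow> ?y i = x i" for i using insert.hyps(2) by auto
    have "Q ?y > 0" unfolding Q_def using that F by (intro insert.prems(2)) auto
    moreover have "(\<Sum>j\<in>F. b k j * ?y j) = (\<Sum>j\<in>F. b k j * x j)"
      by (intro sum.cong refl) (simp only: F)
    then have "l ?y = l x" unfolding l_def by simp
    moreover have "Q' ?y = Q' x" unfolding Q'_def by (intro sum.cong refl) (simp only: F)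
    ultimately show ?thesis using split[of ?y] by simp
  qed
  have nonneg': "Q' x \<ge> 0" for x
  proof (cases "\<exists>i\<in>F. x i \<noteq> 0")
    case True
    then show ?thesis using pos' by fastforce
  next
    case False
    then show ?thesis by (simp add: Q'_def)
  qed
  have "\<exists>L. \<forall>x. Q' x \<le> 1 \<longrightarrow> (\<forall>i\<in>F. \<bar>x i\<bar> \<le> L)"
    unfolding Q'_def
  proof (rule insert.IH)
    show "b' i j = b' j i" if "i \<in> F" "j \<in> F" for i j
      using that insert.prems(1)[of i j] by (simp add: b'_def mult.commute)
    show "(\<Sum>i\<in>F. \<Sum>j\<in>F. x i * b' i j * x j) > 0" if "\<exists>i\<in>F. x i \<noteq> 0" for x
      using pos'[OF that] by (simp add: Q'_def)
  qed
  then obtain L where L: "\<And>x i. Q' x \<le> 1 \<Longrightarrow> i \<in> F \<Longrightarrow> \<bar>x i\<bar> \<le> L" by blast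
  \<comment> \<open>A bound for |l x| plus a bound for |x k + l x|; the latter comes from |t| \<le>
    t^2 + 1 and thus avoids a square root.\<close>
  define M where "M = (\<Sum>j\<in>F. \<bar>b k j\<bar> * \<bar>L\<bar>) / \<beta> + (1 / \<beta> + 1)"
  have "\<bar>x k\<bar> \<le> M" "i \<in> F \<Longrightarrow> \<bar>x i\<bar> \<le> L" if "Q x \<le> 1" for x i
  proof -
    have "\<beta> * (x k + l x)\<^sup>2 \<ge> 0" using \<beta> by simp
    then have Q'1: "Q' x \<le> 1" and sq: "\<beta> * (x k + l x)\<^sup>2 \<le> 1"
      using that split[of x] nonneg'[of x] by auto
    then show "i \<in> F \<Longrightarrow> \<bar>x i\<bar> \<le> L" using L by blast
    have "\<bar>\<Sum>j\<in>F. b k j * x j\<bar> \<le> (\<Sum>j\<in>F. \<bar>b k j\<bar> * \<bar>L\<bar>)"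
    proof (intro order_trans[OF sum_abs] sum_mono)
      fix j assume "j \<in> F"
      then have "\<bar>x j\<bar> \<le> \<bar>L\<bar>" using L[OF Q'1, of j] by linarith
      then show "\<bar>b k j * x j\<bar> \<le> \<bar>b k j\<bar> * \<bar>L\<bar>" unfolding abs_mult by (intro mult_left_mono) simp_all
    qed
    then have "\<bar>l x\<bar> \<le> (\<Sum>j\<in>F. \<bar>b k j\<bar> * \<bar>L\<bar>) / \<beta>"
      using \<beta> unfolding l_def by (simp add: abs_divide divide_right_mono)
    moreover have "\<bar>x k + l x\<bar> \<le> 1 / \<beta> + 1"
    proof -
      have *: "(x k + l x)\<^sup>2 \<le> 1 / \<beta>" using sq \<beta> by (simp add: field_simps)
      have "\<bar>t\<bar> \<le> t\<^sup>2 + 1" for t :: real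
        using zero_le_power2[of "\<bar>t\<bar> - 1 / 2"] unfolding power2_diff by (simp add: power_divide)
      from this[of "x k + l x"] show ?thesis using * by linarith
    qed
    ultimately show "\<bar>x k\<bar> \<le> M" unfolding M_def by linarith
  qed
  then have "\<forall>i\<in>insert k F. \<bar>x i\<bar> \<le> max M L" if "Q x \<le> 1" for x
    using that by (simp add: le_max_iff_disj)
  then show ?case unfolding Q_def by blast
qed

section \<open>Integer multiples in the lattices X and Y\<close>

lemma add_grp_group: "Group.group (add_grp :: 'a::ab_group_add monoid)"
proof (rule groupI)
  show "\<exists>y\<in>carrier add_grp. y \<otimes>\<^bsub>add_grp\<^esub> x = \<one>\<^bsub>add_grp\<^esub>" for x :: 'a
    by (rule bexI[of _ "- x"]) (simp_all add: add_grp_def)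
qed (simp_all add: add_grp_def add.assoc)

lemma one_add_grp [simp]: "\<one>\<^bsub>add_grp\<^esub> = (0 :: 'a::ab_group_add)"
  by (simp add: add_grp_def)

lemma zmul_add: "zmul (m + n) (x :: 'a::ab_group_add) = zmul m x + zmul n x"
  using group.int_pow_mult[OF add_grp_group, of x m n] by (simp add: add_grp_def)

lemma zmul_1 [simp]: "zmul 1 (x :: 'a::ab_group_add) = x"
  using group.int_pow_1[OF add_grp_group, of x] by (simp add: add_grp_def)

lemma zmul_minus: "zmul (- n) (x :: 'a::ab_group_add) = - zmul n x"
  using zmul_add[of x n "- n"] by (simp add: eq_neg_iff_add_eq_0 add.commute)

lemma zmul_diff: "zmul (m - n) (x :: 'a::ab_group_add) = zmul m x - zmul n x"
  using zmul_add[of x m "- n"] by (simp add: zmul_minus)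

context datum
begin

lemma pair_zmul [simp]: "pair D h (zmul n x) = n * pair D h x"
proof -
  have nat: "pair D h (zmul (int k) x) = int k * pair D h x" for k
  proof (induction k)
    case (Suc k)
    have "int (Suc k) = int k + 1" by simp
    then show ?case by (simp only: zmul_add pair_add Suc zmul_1) (simp add: algebra_simps)
  qed simp
  show ?thesis
  proof (cases "n \<ge> 0")
    case True
    then show ?thesis using nat[of "nat n"] by simp
  next
    case False
    then have "n = - int (nat (- n))" by simp
    then show ?thesis using nat[of "nat (- n)"] by (metis pair_minus(1) zmul_minus mult_minus_left)
  qed
qed

lemma pair_zmul_left [simp]: "pair D (zmul n h) x = n * pair D h x"
proof -
  have nat: "pair D (zmul (int k) h) x = int k * pair D h x" for k
  proof (induction k)
    case (Suc k)
    have "int (Suc k) = int k + 1" by simp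
    then show ?case by (simp only: zmul_add pair_add Suc zmul_1) (simp add: algebra_simps)
  qed simp
  show ?thesis
  proof (cases "n \<ge> 0")
    case True
    then show ?thesis using nat[of "nat n"] by simp
  next
    case False
    then have "n = - int (nat (- n))" by simp
    then show ?thesis using nat[of "nat (- n)"] by (metis pair_minus(2) zmul_minus mult_minus_left)
  qed
qed


section \<open>The norm on a coset of the root lattice\<close>

text \<open>For \<open>\<kappa> i = \<langle>h\<^sub>i, m\<rangle>\<close>, these are \<open>\<langle>h\<^sub>i, m + c\<rangle>\<close> and \<open>(m + c, m + c) - (m, m)\<close>, where \<open>c\<close> stands for
  the element of the root lattice with coordinates \<open>c\<close>.\<close>

definition pv :: "('i \<Rightarrow> int) \<Rightarrow> ('i \<Rightarrow> int) \<Rightarrow> 'i \<Rightarrow> int" where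
  "pv \<kappa> c i = \<kappa> i + (\<Sum>j\<in>I. A i j * c j)"

definition nrm :: "('i \<Rightarrow> int) \<Rightarrow> ('i \<Rightarrow> int) \<Rightarrow> int" where
  "nrm \<kappa> c = (\<Sum>i\<in>I. \<Sum>j\<in>I. form D i j * c i * c j) + 2 * (\<Sum>i\<in>I. d i * \<kappa> i * c i)"

lemma nrm_0 [simp]: "nrm \<kappa> (\<lambda>i. 0) = 0"
  by (simp add: nrm_def)

lemma nrm_diff: "nrm \<kappa> c - nrm \<kappa> c' = (\<Sum>i\<in>I. d i * (c i - c' i) * (pv \<kappa> c i + pv \<kappa> c' i))"
proof -
  have "(\<Sum>i\<in>I. d i * (c i - c' i) * (pv \<kappa> c i + pv \<kappa> c' i)) =
      (\<Sum>i\<in>I. (\<Sum>j\<in>I. form D i j * (c i - c' i) * (c j + c' j)) + 2 * (d i * \<kappa> i * c i) - 2 * (d i * \<kappa> i * c' i))"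
  proof (intro sum.cong refl)
    fix i assume i: "i \<in> I"
    have "(\<Sum>j\<in>I. form D i j * (c i - c' i) * (c j + c' j)) = d i * (c i - c' i) * (\<Sum>j\<in>I. A i j * c j + A i j * c' j)"
      unfolding sum_distrib_left using d_A[OF i] by (intro sum.cong refl) (simp add: algebra_simps flip: d_A)
    then show "d i * (c i - c' i) * (pv \<kappa> c i + pv \<kappa> c' i) =
        (\<Sum>j\<in>I. form D i j * (c i - c' i) * (c j + c' j)) + 2 * (d i * \<kappa> i * c i) - 2 * (d i * \<kappa> i * c' i)"
      by (simp add: pv_def sum.distrib algebra_simps)
  qed
  also have "\<dots> = (\<Sum>i\<in>I. \<Sum>j\<in>I. form D i j * (c i - c' i) * (c j + c' j))
      + 2 * (\<Sum>i\<in>I. d i * \<kappa> i * c i) - 2 * (\<Sum>i\<in>I. d i * \<kappa> i * c' i)"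
    by (simp add: sum.distrib sum_subtractf sum_distrib_left)
  also have "(\<Sum>i\<in>I. \<Sum>j\<in>I. form D i j * (c i - c' i) * (c j + c' j)) =
      (\<Sum>i\<in>I. \<Sum>j\<in>I. form D i j * c i * c j) - (\<Sum>i\<in>I. \<Sum>j\<in>I. form D i j * c' i * c' j)
      + ((\<Sum>i\<in>I. \<Sum>j\<in>I. form D i j * c i * c' j) - (\<Sum>i\<in>I. \<Sum>j\<in>I. form D i j * c' i * c j))"
    by (simp add: sum_subtractf[symmetric] sum.distrib[symmetric] algebra_simps)
  also have "(\<Sum>i\<in>I. \<Sum>j\<in>I. form D i j * c' i * c j) = (\<Sum>i\<in>I. \<Sum>j\<in>I. form D i j * c i * c' j)"
    by (subst sum.swap, intro sum.cong refl) (simp add: form_sym mult.commute mult.left_commute)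
  finally show ?thesis by (simp add: nrm_def)
qed

lemma pv_upd: "i \<in> I \<Longrightarrow> pv \<kappa> (c(i := c i + t)) j = pv \<kappa> c j + A j i * t"
proof -
  assume i: "i \<in> I"
  have "(\<Sum>k\<in>I. A j k * (c(i := c i + t)) k) = (\<Sum>k\<in>I. A j k * c k + (if k = i then A j i * t else 0))"
    by (intro sum.cong refl) (simp add: algebra_simps)
  then show ?thesis using i by (simp add: pv_def sum.distrib)
qed

text \<open>Only the coordinate at \<open>i\<close> changes, and the values of \<open>pv\<close> at
  \<open>i\<close> before and after the reflection are opposite.\<close>

lemma nrm_reflect:
  assumes i: "i \<in> I"
  shows "nrm \<kappa> (c(i := c i - pv \<kappa> c i)) = nrm \<kappa> c"
proof -
  let ?c = "c(i := c i - pv \<kappa> c i)"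
  have "nrm \<kappa> ?c - nrm \<kappa> c = (\<Sum>k\<in>I. if k = i then d i * (- pv \<kappa> c i) * (pv \<kappa> ?c i + pv \<kappa> c i) else 0)"
    unfolding nrm_diff by (intro sum.cong refl) simp
  also have "\<dots> = 0"
    using i pv_upd[OF i, of \<kappa> c "- pv \<kappa> c i" i] by (simp add: A_diag)
  finally show ?thesis by simp
qed

text \<open>With s the root of the quadratic part, each coordinate is at most a constant times s, so
  the linear part of \<open>nrm\<close> is at most K s. The quadratic part dominates it and a bound
  on \<open>nrm\<close> bounds s.\<close>

lemma nrm_bounded: "\<exists>L. \<forall>c. nrm \<kappa> c \<le> C \<longrightarrow> (\<forall>i\<in>I. \<bar>c i\<bar> \<le> L)"
proof -
  define Q where "Q x = (\<Sum>i\<in>I. \<Sum>j\<in>I. x i * real_of_int (form D i j) * x j)" for x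
  have pos: "Q x > 0" if "\<exists>i\<in>I. x i \<noteq> 0" for x
    using fin_type that unfolding finite_type_def Q_def by blast
  have "\<exists>L. \<forall>x. Q x \<le> 1 \<longrightarrow> (\<forall>i\<in>I. \<bar>x i\<bar> \<le> L)"
    unfolding Q_def
    by (rule posdef_bounded) (use form_sym pos in \<open>auto simp: Q_def\<close>)
  then obtain L where L: "\<And>x i. Q x \<le> 1 \<Longrightarrow> i \<in> I \<Longrightarrow> \<bar>x i\<bar> \<le> L" by blast
  have nonneg: "Q x \<ge> 0" for x using pos[of x] by (cases "\<exists>i\<in>I. x i \<noteq> 0") (auto simp: Q_def)
  have coord: "\<bar>x i\<bar> \<le> \<bar>L\<bar> * sqrt (Q x)" if i: "i \<in> I" for x i
  proof (cases "Q x > 0")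
    case True
    let ?s = "sqrt (Q x)"
    have s: "?s > 0" "?s * ?s = Q x" using True by simp_all
    have "Q (\<lambda>i. x i / ?s) = Q x / (?s * ?s)"
      unfolding Q_def sum_divide_distrib by (intro sum.cong refl) simp
    then have "\<bar>x i / ?s\<bar> \<le> L" using L[of "\<lambda>i. x i / ?s"] i s by simp
    then have "\<bar>x i\<bar> / ?s \<le> L" using s by (simp add: abs_divide)
    then have "\<bar>x i\<bar> \<le> L * ?s" using s by (simp add: pos_divide_le_eq)
    also have "\<dots> \<le> \<bar>L\<bar> * ?s" using s by (intro mult_right_mono) auto
    finally show ?thesis .
  next
    case False
    then have "x i = 0" using pos i by blast
    then show ?thesis using nonneg by simp
  qed
  define K where "K = 2 * (\<Sum>i\<in>I. \<bar>real_of_int (d i * \<kappa> i)\<bar> * \<bar>L\<bar>)"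
  have "K \<ge> 0" unfolding K_def by (intro mult_nonneg_nonneg sum_nonneg) auto
  have main: "\<bar>real_of_int (c i)\<bar> \<le> \<bar>L\<bar> * (K + \<bar>C\<bar> + 1)" if c: "nrm \<kappa> c \<le> C" and i: "i \<in> I" for c i
  proof -
    let ?x = "\<lambda>i. real_of_int (c i)" and ?s = "sqrt (Q (\<lambda>i. real_of_int (c i)))"
    have s: "?s \<ge> 0" "?s * ?s = Q ?x" using nonneg by simp_all
    have eq: "real_of_int (nrm \<kappa> c) = ?s * ?s + 2 * (\<Sum>i\<in>I. real_of_int (d i * \<kappa> i) * ?x i)"
      unfolding nrm_def s(2) unfolding Q_def by (simp add: mult.assoc mult.left_commute mult.commute)
    have "\<bar>\<Sum>i\<in>I. real_of_int (d i * \<kappa> i) * ?x i\<bar> \<le> (\<Sum>i\<in>I. \<bar>real_of_int (d i * \<kappa> i)\<bar> * (\<bar>L\<bar> * ?s))"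
    proof (intro order_trans[OF sum_abs] sum_mono)
      fix i assume "i \<in> I"
      then show "\<bar>real_of_int (d i * \<kappa> i) * ?x i\<bar> \<le> \<bar>real_of_int (d i * \<kappa> i)\<bar> * (\<bar>L\<bar> * ?s)"
        using coord[of i ?x] by (subst abs_mult) (rule mult_left_mono, simp_all)
    qed
    also have "2 * \<dots> = K * ?s" unfolding K_def by (simp add: sum_distrib_right sum_distrib_left mult.assoc)
    finally have "?s * ?s - K * ?s \<le> C" using eq c by linarith
    \<comment> \<open>Otherwise s - K and s exceed |C| + 1 and 1, and s (s - K) would be larger than
      \<open>C\<close>.\<close>
    have "?s \<le> K + \<bar>C\<bar> + 1"
    proof (rule ccontr)
      assume "\<not> ?thesis"
      then have gt: "?s > K + \<bar>C\<bar> + 1" by simp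
      have "(real_of_int \<bar>C\<bar> + 1) * 1 \<le> (?s - K) * ?s" 
      proof (rule mult_mono)
        have C: "real_of_int \<bar>C\<bar> \<ge> 0" by simp
        show "real_of_int \<bar>C\<bar> + 1 \<le> ?s - K" "1 \<le> ?s" "0 \<le> ?s - K"
          using gt \<open>K \<ge> 0\<close> C by linarith+
      qed simp
      then show False using \<open>?s * ?s - K * ?s \<le> C\<close> by (simp add: algebra_simps)
    qed
    then show ?thesis using coord[OF i, of ?x] by (meson abs_ge_zero mult_left_mono order_trans)
  qed
  show ?thesis
  proof (intro exI[of _ "\<lceil>\<bar>L\<bar> * (K + \<bar>C\<bar> + 1)\<rceil>"] allI impI ballI)
    fix c i assume "nrm \<kappa> c \<le> C" "i \<in> I"
    from main[OF this] have "real_of_int \<bar>c i\<bar> \<le> \<bar>L\<bar> * (K + \<bar>C\<bar> + 1)" by simp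
    then show "\<bar>c i\<bar> \<le> \<lceil>\<bar>L\<bar> * (K + \<bar>C\<bar> + 1)\<rceil>" by linarith
  qed
qed

definition content :: "'i list \<Rightarrow> 'i \<Rightarrow> int" where
  "content w i = int (count (mset w) i)"

lemma sum_list_content: "set w \<subseteq> I \<Longrightarrow> (\<Sum>j\<leftarrow>w. f j) = (\<Sum>j\<in>I. f j * content w j)" for f :: "'i \<Rightarrow> int"
proof (induction w)
  case (Cons k w)
  have "(\<Sum>j\<in>I. f j * content (k # w) j) = (\<Sum>j\<in>I. f j * content w j + (if j = k then f k else 0))"
    by (intro sum.cong refl) (simp add: content_def algebra_simps)
  then show ?case using Cons by (simp add: sum.distrib)
qed (simp add: content_def)

lemma ht_content: "set w \<subseteq> I \<Longrightarrow> ht a i w = - pv (\<lambda>i. - a i) (content w) i"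
  by (simp add: ht_def pv_def sum_list_content)

text \<open>No weight is longer than the lowest one. If the weight of \<open>w\<close> is positive
  at some \<open>i\<close>, \<open>lowest_reflect\<close> yields a shorter word whose weight has the
  same norm. Otherwise it is antidominant and lies above the antidominant weight -a, and
  \<open>nrm_diff\<close> has only nonpositive terms.\<close>

lemma lowest_nrm:
  assumes a: "\<And>i. i \<in> I \<Longrightarrow> a i \<ge> 0"
  shows "\<phi> \<in> lowest a \<Longrightarrow> \<phi> w \<noteq> 0 \<Longrightarrow> nrm (\<lambda>i. - a i) (content w) \<le> 0"
proof (induction "length w" arbitrary: w \<phi> rule: less_induct)
  case less
  let ?l = "\<lambda>i. - a i"
  have w: "set w \<subseteq> I" using less.prems by (rule lowestD(1))
  show ?case
  proof (cases "\<exists>i\<in>I. ht a i w < 0")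
    case True
    then obtain i where i: "i \<in> I" "ht a i w < 0" by blast
    define n where "n = nat (- ht a i w)"
    have n: "ht a i w = - int n" "n > 0" using i by (auto simp: n_def)
    obtain \<psi> u where u: "\<psi> \<in> lowest a" "mset w = mset u + replicate_mset n i" "\<psi> u \<noteq> 0"
      using lowest_reflect[OF a less.prems i(1) n(1)] by blast
    have "length w = length u + n" using arg_cong[OF u(2), of size] by simp
    then have "nrm ?l (content u) \<le> 0" using n(2) u by (intro less.hyps) auto
    moreover have "content u = (content w)(i := content w i - pv ?l (content w) i)"
      using ht_content[OF w, of a i] n(1) u(2) by (auto simp: content_def fun_eq_iff)
    ultimately show ?thesis by (simp add: nrm_reflect[OF i(1)])
  next
    case False
    have "nrm ?l (content w) = nrm ?l (content w) - nrm ?l (\<lambda>i. 0)" by simp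
    also have "\<dots> \<le> 0"
      unfolding nrm_diff
    proof (rule sum_nonpos)
      fix i assume i: "i \<in> I"
      have "pv ?l (content w) i + pv ?l (\<lambda>i. 0) i \<le> 0"
        using False i a[OF i] ht_content[OF w, of a i] by (auto simp: pv_def[of _ "\<lambda>i. 0"])
      moreover have "d i * (content w i - 0) \<ge> 0"
        using d_pos[OF i] by (simp add: content_def)
      ultimately show "d i * (content w i - 0) * (pv ?l (content w) i + pv ?l (\<lambda>i. 0) i) \<le> 0"
        by (rule mult_nonneg_nonpos[rotated])
    qed
    finally show ?thesis .
  qed
qed

text \<open>Bounded norm means bounded multiplicity of each letter, so only finitely many words over
  \<open>I\<close> carry nonzero values.\<close>

lemma lowest_bounded:
  assumes a: "\<And>i. i \<in> I \<Longrightarrow> a i \<ge> 0"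
  shows "\<exists>N. \<forall>\<phi>\<in>lowest a. \<forall>w. \<phi> w \<noteq> 0 \<longrightarrow> length w \<le> N"
proof -
  obtain L where L: "\<And>c i. nrm (\<lambda>i. - a i) c \<le> 0 \<Longrightarrow> i \<in> I \<Longrightarrow> \<bar>c i\<bar> \<le> L"
    using nrm_bounded[of "\<lambda>i. - a i" 0] by blast
  have "length w \<le> nat (\<Sum>i\<in>I. L)" if "\<phi> \<in> lowest a" "\<phi> w \<noteq> 0" for \<phi> w
  proof -
    have "int (length w) = (\<Sum>j\<leftarrow>w. 1)" by (simp add: sum_list_triv)
    also have "\<dots> = (\<Sum>i\<in>I. content w i)"
      using sum_list_content[OF lowestD(1)[OF that], of "\<lambda>_. 1"] by simp
    also have "\<dots> \<le> (\<Sum>i\<in>I. L)"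
      using L[OF lowest_nrm[OF a that]] by (intro sum_mono) (auto simp: abs_le_iff)
    finally show ?thesis by linarith
  qed
  then show ?thesis by blast
qed


section \<open>Weyl group orbits and saturated sets\<close>

definition rsum :: "('i \<Rightarrow> int) \<Rightarrow> 'x" where
  "rsum c = (\<Sum>i\<in>I. zmul (c i) (simple_root D i))"

definition pvm :: "'x \<Rightarrow> 'i \<Rightarrow> int" where
  "pvm m i = pair D (coroot D i) m"

lemma rsum_0 [simp]: "rsum (\<lambda>i. 0) = 0"
  by (simp add: rsum_def)

lemma rsum_diff: "rsum (\<lambda>i. c i - c' i) = rsum c - rsum c'"
  by (simp add: rsum_def zmul_diff sum_subtractf)

lemma rsum_upd: "i \<in> I \<Longrightarrow> rsum (c(i := c i + t)) = rsum c + zmul t (simple_root D i)"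
proof -
  assume i: "i \<in> I"
  have "rsum (c(i := c i + t)) = (\<Sum>k\<in>I. zmul (c k) (simple_root D k) + (if k = i then zmul t (simple_root D i) else 0))"
    unfolding rsum_def by (intro sum.cong refl) (simp add: zmul_add)
  then show ?thesis using i by (simp add: rsum_def sum.distrib)
qed

lemma pair_rsum: "pair D (coroot D i) (m + rsum c) = pv (pvm m) c i"
  by (simp add: rsum_def pair_sum pv_def pvm_def mult.commute)

lemma reflection_rsum: "i \<in> I \<Longrightarrow> reflection D i (m + rsum c) = m + rsum (c(i := c i - pv (pvm m) c i))"
  using rsum_upd[of i c "- pv (pvm m) c i"] by (simp add: reflection_def pair_rsum zmul_minus del: pair_add)

lemma finite_rsum_bounded: "finite {m + rsum c | c. nrm (pvm m) c \<le> C}"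
proof -
  obtain L where L: "\<And>c i. nrm (pvm m) c \<le> C \<Longrightarrow> i \<in> I \<Longrightarrow> \<bar>c i\<bar> \<le> L"
    using nrm_bounded[of "pvm m" C] by blast
  have "{m + rsum c | c. nrm (pvm m) c \<le> C} \<subseteq> (\<lambda>c. m + rsum c) ` (I \<rightarrow>\<^sub>E {-L..L})"
  proof
    fix x assume "x \<in> {m + rsum c | c. nrm (pvm m) c \<le> C}"
    then obtain c where c: "x = m + rsum c" "nrm (pvm m) c \<le> C" by blast
    have "rsum c = rsum (restrict c I)" unfolding rsum_def by (intro sum.cong) auto
    moreover have "restrict c I \<in> I \<rightarrow>\<^sub>E {-L..L}" using L[OF c(2)] by (auto simp: abs_le_iff) force+
    ultimately show "x \<in> (\<lambda>c. m + rsum c) ` (I \<rightarrow>\<^sub>E {-L..L})" using c(1) by auto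
  qed
  then show ?thesis by (rule finite_subset) (intro finite_imageI finite_PiE; simp)
qed

lemma reflection_invol:
  assumes "i \<in> I"
  shows "reflection D i (reflection D i l) = l"
proof -
  have "pair D (coroot D i) (reflection D i l) = - pair D (coroot D i) l"
    using assms by (simp add: reflection_def A_diag)
  then show ?thesis
    by (subst (1) reflection_def) (simp add: zmul_minus, simp add: reflection_def)
qed

lemma reflection_Bij: "i \<in> I \<Longrightarrow> reflection D i \<in> Bij UNIV"
  unfolding Bij_def by (auto intro!: o_bij[of "reflection D i"] simp: fun_eq_iff reflection_invol)

lemma weyl_Bij: "w \<in> weyl_group D \<Longrightarrow> w \<in> Bij UNIV"
  unfolding weyl_group_def
  using group.generate_incl[OF group_BijGroup, of "reflection D ` I" UNIV] reflection_Bij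
  by (auto simp: BijGroup_def)

text \<open>\<open>nrm\<close> is a function of coordinates rather than of weights, so coordinates
  are carried along through the generation of the group by reflections.\<close>

lemma weyl_rsum: "w \<in> weyl_group D \<Longrightarrow> \<exists>c'. w (m + rsum c) = m + rsum c' \<and> nrm (pvm m) c' = nrm (pvm m) c"
  unfolding weyl_group_def
proof (induction w arbitrary: c rule: generate.induct)
  case one
  then show ?case by (auto simp: BijGroup_def)
next
  case (incl h)
  then show ?case using reflection_rsum nrm_reflect by blast
next
  case (inv h)
  then obtain i where i: "i \<in> I" "h = reflection D i" by blast
  have "inv\<^bsub>BijGroup UNIV\<^esub> h = h"
    unfolding i using reflection_Bij[OF i(1)] reflection_invol[OF i(1)]
    by (intro group.inv_equality[OF group_BijGroup]) (auto simp: BijGroup_def compose_def fun_eq_iff)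
  then show ?case using i reflection_rsum nrm_reflect by metis
next
  case (eng h1 h2)
  have "h1 \<in> Bij UNIV" "h2 \<in> Bij UNIV" using eng.hyps weyl_Bij unfolding weyl_group_def by auto
  then have "(h1 \<otimes>\<^bsub>BijGroup UNIV\<^esub> h2) x = h1 (h2 x)" for x by (simp add: BijGroup_def compose_def)
  then show ?case using eng.IH by metis
qed

lemma weyl_orbits_self: "P \<subseteq> weyl_orbits D P"
proof -
  have "\<one>\<^bsub>BijGroup UNIV\<^esub> \<in> weyl_group D" unfolding weyl_group_def by (rule generate.one)
  then have "(\<lambda>x. x) \<in> weyl_group D" by (simp add: BijGroup_def restrict_def)
  then show ?thesis unfolding weyl_orbits_def by (intro subsetI UN_I[of "\<lambda>x. x"]) auto
qed

lemma weyl_orbits_reflection: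
  assumes "l \<in> weyl_orbits D P" "i \<in> I"
  shows "reflection D i l \<in> weyl_orbits D P"
proof -
  obtain w p where w: "w \<in> weyl_group D" "p \<in> P" "l = w p" using assms(1) by (auto simp: weyl_orbits_def)
  have "reflection D i \<otimes>\<^bsub>BijGroup UNIV\<^esub> w \<in> weyl_group D"
    using w(1) assms(2) unfolding weyl_group_def by (intro generate.eng[OF generate.incl]) auto
  moreover have "(reflection D i \<otimes>\<^bsub>BijGroup UNIV\<^esub> w) p = reflection D i l"
    using weyl_Bij[OF w(1)] reflection_Bij[OF assms(2)] w(3) by (simp add: BijGroup_def compose_def)
  ultimately show ?thesis using w(2) unfolding weyl_orbits_def by (metis UN_I imageI)
qed

lemma weyl_orbits_mono: "P \<subseteq> P' \<Longrightarrow> weyl_orbits D P \<subseteq> weyl_orbits D P'"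
  unfolding weyl_orbits_def by blast

lemma finite_weyl_orbits:
  assumes "finite P"
  shows "finite (weyl_orbits D P)"
proof -
  have "weyl_orbits D P \<subseteq> (\<Union>p\<in>P. {p + rsum c | c. nrm (pvm p) c \<le> 0})"
  proof
    fix l assume "l \<in> weyl_orbits D P"
    then obtain w p where w: "w \<in> weyl_group D" "p \<in> P" "l = w p" by (auto simp: weyl_orbits_def)
    obtain c where "w (p + rsum (\<lambda>i. 0)) = p + rsum c" "nrm (pvm p) c = nrm (pvm p) (\<lambda>i. 0)"
      using weyl_rsum[OF w(1)] by blast
    then show "l \<in> (\<Union>p\<in>P. {p + rsum c | c. nrm (pvm p) c \<le> 0})"
      using w(3) by (intro UN_I[OF w(2)] CollectI exI[of _ c]) auto
  qed
  then show ?thesis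
    by (rule finite_subset) (intro finite_UN_I assms finite_rsum_bounded)
qed

text \<open>The dominant part of a ball in the coset of \<open>m\<close> modulo the root lattice. A
  ball is finite and stable under reflections, and for dominant weights a smaller weight is not
  longer.\<close>

definition satset :: "'x \<Rightarrow> int \<Rightarrow> 'x set" where
  "satset m C = {l \<in> dominant D. \<exists>c. l = m + rsum c \<and> nrm (pvm m) c \<le> C}"

text \<open>Reflecting at a negative coordinate keeps the norm and increases the sum of the
  coordinates, which is bounded on the ball; the process ends at a dominant weight.\<close>

lemma satset_orbits: "nrm (pvm m) c \<le> C \<Longrightarrow> m + rsum c \<in> weyl_orbits D (satset m C)"
proof -
  obtain L where L: "\<And>c i. nrm (pvm m) c \<le> C \<Longrightarrow> i \<in> I \<Longrightarrow> \<bar>c i\<bar> \<le> L"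
    using nrm_bounded[of "pvm m" C] by blast
  show "nrm (pvm m) c \<le> C \<Longrightarrow> m + rsum c \<in> weyl_orbits D (satset m C)"
  proof (induction "nat ((\<Sum>i\<in>I. L) - (\<Sum>i\<in>I. c i))" arbitrary: c rule: less_induct)
    case less
    show ?case
    proof (cases "\<exists>i\<in>I. pv (pvm m) c i < 0")
      case True
      then obtain i where i: "i \<in> I" "pv (pvm m) c i < 0" by blast
      let ?c = "c(i := c i - pv (pvm m) c i)"
      have c': "nrm (pvm m) ?c \<le> C" using less.prems by (simp add: nrm_reflect[OF i(1)])
      have "(\<Sum>k\<in>I. ?c k) = (\<Sum>k\<in>I. c k + (if k = i then - pv (pvm m) c i else 0))"
        by (intro sum.cong) auto
      then have "(\<Sum>k\<in>I. ?c k) = (\<Sum>k\<in>I. c k) - pv (pvm m) c i" using i(1) by (simp add: sum.distrib)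
      moreover have "(\<Sum>k\<in>I. ?c k) \<le> (\<Sum>i\<in>I. L)" using L[OF c'] by (intro sum_mono) (meson abs_le_D1)
      ultimately have "m + rsum ?c \<in> weyl_orbits D (satset m C)"
        using c' i(2) by (intro less.hyps) linarith+
      from weyl_orbits_reflection[OF this i(1)] show ?thesis
        by (simp add: reflection_invol[OF i(1)] flip: reflection_rsum[OF i(1)])
    next
      case False
      then have "m + rsum c \<in> satset m C"
        using less.prems by (auto simp: satset_def dominant_def pair_rsum not_less simp del: pair_add)
      then show ?thesis using weyl_orbits_self by blast
    qed
  qed
qed

text \<open>For dominant l \<le> \<mu> all terms of \<open>nrm_diff\<close> are nonnegative, hence l
  stays in the ball. Nonemptiness holds because \<open>m\<close> itself lies in an orbit.\<close>

lemma satset_finite_saturated: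
  assumes "C \<ge> 0"
  shows "satset m C \<in> finite_saturated D"
proof -
  have "finite (satset m C)"
    by (rule finite_subset[OF _ finite_rsum_bounded[of m C]]) (auto simp: satset_def)
  moreover have "m + rsum (\<lambda>i. 0) \<in> weyl_orbits D (satset m C)" using assms by (intro satset_orbits) simp
  then have "satset m C \<noteq> {}" by (auto simp: weyl_orbits_def)
  moreover have "l \<in> satset m C" if l: "l \<in> dominant D" and \<mu>: "\<mu> \<in> satset m C" "dom_le D l \<mu>" for l \<mu>
  proof -
    obtain c where c: "\<mu> = m + rsum c" "nrm (pvm m) c \<le> C" using \<mu>(1) by (auto simp: satset_def)
    obtain k :: "'i \<Rightarrow> nat" where k: "\<mu> - l = rsum (\<lambda>i. int (k i))"
      using \<mu>(2) by (auto simp: dom_le_def rsum_def)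
    let ?c = "\<lambda>i. c i - int (k i)"
    have l_eq: "l = m + rsum ?c" using k c(1) by (simp add: rsum_diff algebra_simps)
    have "nrm (pvm m) c - nrm (pvm m) ?c \<ge> 0"
      unfolding nrm_diff
    proof (rule sum_nonneg)
      fix i assume i: "i \<in> I"
      have "pv (pvm m) c i \<ge> 0" using \<mu>(1) i unfolding satset_def dominant_def c(1) by (simp add: pair_rsum del: pair_add)
      moreover have "pv (pvm m) ?c i \<ge> 0" using l i unfolding dominant_def l_eq by (simp add: pair_rsum del: pair_add)
      ultimately show "0 \<le> d i * (c i - ?c i) * (pv (pvm m) c i + pv (pvm m) ?c i)"
        using d_pos[OF i] by simp
    qed
    then show ?thesis using l l_eq c(2) unfolding satset_def by fastforce
  qed
  ultimately show ?thesis unfolding finite_saturated_def by (auto simp: satset_def)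
qed

end


section \<open>Tensor products of dual modules\<close>

text \<open>The transposes of f \<otimes> 1 and, in \<open>slot2\<close>, of 1 \<otimes> f: the
  operator acts in one argument while the other is frozen.\<close>

definition slot1 :: "'a lop \<Rightarrow> ('a \<times> 'b) lop" where
  "slot1 f = Lop (\<lambda>\<phi> x. app f (\<lambda>u. \<phi> (u, snd x)) (fst x))"

definition slot2 :: "'b lop \<Rightarrow> ('a \<times> 'b) lop" where
  "slot2 f = Lop (\<lambda>\<phi> x. app f (\<lambda>u. \<phi> (fst x, u)) (snd x))"

lemma app_slot1: "app (slot1 f) \<phi> (u, w) = app f (\<lambda>u. \<phi> (u, w)) u"
  unfolding slot1_def by (subst app_Lop) (simp_all add: app_lin)

lemma app_slot2: "app (slot2 f) \<phi> (u, w) = app f (\<lambda>w. \<phi> (u, w)) w"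
  unfolding slot2_def by (subst app_Lop) (simp_all add: app_lin)

lemma lop_eqI2: "(\<And>\<phi> u w. app f \<phi> (u, w) = app g \<phi> (u, w)) \<Longrightarrow> f = g"
  by (rule lop_eqI) (simp add: split_paired_all)

lemma app_sc_fun: "app (sc_lop c) \<phi> = (\<lambda>x. c * \<phi> x)"
  by (rule ext) simp

lemma slot1_hom: "slot1 (f * g) = slot1 f * slot1 g" "slot1 (f - g) = slot1 f - slot1 g"
  "slot1 (sc_lop c) = sc_lop c" "slot1 0 = 0"
  by (rule lop_eqI2, simp add: app_slot1 app_sc_fun)+

lemma slot2_hom: "slot2 (f * g) = slot2 f * slot2 g" "slot2 (f - g) = slot2 f - slot2 g"
  "slot2 (sc_lop c) = sc_lop c" "slot2 0 = 0"
  by (rule lop_eqI2, simp add: app_slot2 app_sc_fun)+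

text \<open>On infinite-dimensional function spaces operators on different slots need not commute; they
  do if one of them has finite rows.\<close>

definition row_finite :: "'a lop \<Rightarrow> bool" where
  "row_finite f \<longleftrightarrow> (\<forall>w. \<exists>S k. finite S \<and> (\<forall>\<phi>. app f \<phi> w = (\<Sum>u\<in>S. k u * \<phi> u)))"

lemma app_fun_sum: "app f (\<lambda>x. \<Sum>u\<in>S. k u * \<phi> u x) = (\<lambda>x. \<Sum>u\<in>S. k u * app f (\<phi> u) x)"
proof (induction S rule: infinite_finite_induct)
  case (insert u S)
  then show ?case
    using app_lin[of f "\<lambda>x. \<Sum>u\<in>S. k u * \<phi> u x" "k u" "\<phi> u"] by (simp add: add.commute)
qed (simp_all add: app_zero)

lemma slot_commute:
  assumes "row_finite f"
  shows "slot1 f * slot2 g = slot2 g * slot1 f"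
proof (rule lop_eqI2)
  fix \<phi> :: "'a \<times> 'b \<Rightarrow> qv" and u w
  obtain S k where S: "\<And>\<phi>. app f \<phi> u = (\<Sum>s\<in>S. k s * \<phi> s)"
    using assms unfolding row_finite_def by blast
  show "app (slot1 f * slot2 g) \<phi> (u, w) = app (slot2 g * slot1 f) \<phi> (u, w)"
    by (simp add: app_slot1 app_slot2 S app_fun_sum)
qed

lemma row_finite_diag: "row_finite (diag g)"
  unfolding row_finite_def
proof
  fix w show "\<exists>S k. finite S \<and> (\<forall>\<phi>. app (diag g) \<phi> w = (\<Sum>u\<in>S. k u * \<phi> u))"
    by (rule exI[of _ "{w}"], rule exI[of _ g]) (simp add: app_diag)
qed

text \<open>Pullback of functions along \<open>h\<close> carries \<open>f\<close> to
  \<open>g\<close>. It is used for exchanging the two slots and for restricting to the empty word in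
  the second slot, in both cases to transport Serre elements.\<close>

definition intertwines :: "('b \<Rightarrow> 'a) \<Rightarrow> 'a lop \<Rightarrow> 'b lop \<Rightarrow> bool" where
  "intertwines h f g \<longleftrightarrow> (\<forall>\<phi>. (\<lambda>x. app f \<phi> (h x)) = app g (\<lambda>x. \<phi> (h x)))"

lemma intertwines_mult: "intertwines h f g \<Longrightarrow> intertwines h f' g' \<Longrightarrow> intertwines h (f * f') (g * g')"
  by (simp add: intertwines_def)

lemma intertwines_one: "intertwines h 1 1"
  by (simp add: intertwines_def)

lemma intertwines_sc: "intertwines h (sc_lop c) (sc_lop c)"
  by (simp add: intertwines_def app_sc_fun)

lemma intertwines_power: "intertwines h f g \<Longrightarrow> intertwines h (f ^ n) (g ^ n)"
  by (induction n) (simp_all add: intertwines_one intertwines_mult)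

lemma intertwines_sum: "(\<And>x. x \<in> S \<Longrightarrow> intertwines h (f x) (g x)) \<Longrightarrow> intertwines h (sum f S) (sum g S)"
  by (induction S rule: infinite_finite_induct) (simp_all add: intertwines_def fun_eq_iff)

lemma intertwines_serre:
  assumes "intertwines h e e'" "intertwines h x x'"
  shows "intertwines h (lop.serre q n e x) (lop.serre q n e' x')"
  unfolding lop.serre_def lop.dpow_def lop.sc_neg_1_power[symmetric]
  by (intro intertwines_sum intertwines_mult intertwines_sc intertwines_power assms)

context datum
begin

lemma row_finite_Dn: "row_finite (Dn a i)"
  unfolding row_finite_def
proof
  fix w
  have "\<exists>S k. finite S \<and> (\<forall>\<phi>. dn a i \<phi> w = (\<Sum>u\<in>S. k u * \<phi> u))"
  proof (induction w)
    case Nil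
    show ?case by (rule exI[of _ "{}"]) simp
  next
    case (Cons j w)
    then obtain S k where S: "finite S" "\<And>\<phi>. dn a i \<phi> w = (\<Sum>u\<in>S. k u * \<phi> u)" by blast
    let ?S = "insert w ((#) j ` S)"
    \<comment> \<open>The two contributions may evaluate at the same word, so their coefficients are
      added instead of distinguished by cases.\<close>
    let ?k = "\<lambda>u. (if u \<in> (#) j ` S then k (tl u) else 0) +
        (if u = w then (if i = j then qnum (q i) (ht a i w) else 0) else 0)"
    have "dn a i \<phi> (j # w) = (\<Sum>u\<in>?S. ?k u * \<phi> u)" for \<phi>
    proof -
      have "(\<Sum>u\<in>?S. ?k u * \<phi> u) = (\<Sum>u\<in>?S. if u \<in> (#) j ` S then k (tl u) * \<phi> u else 0) +
          (\<Sum>u\<in>?S. if u = w then (if i = j then qnum (q i) (ht a i w) else 0) * \<phi> w else 0)"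
        unfolding sum.distrib[symmetric] by (intro sum.cong refl) (simp add: distrib_right)
      also have "(\<Sum>u\<in>?S. if u \<in> (#) j ` S then k (tl u) * \<phi> u else 0) = (\<Sum>u\<in>(#) j ` S. k (tl u) * \<phi> u)"
        using S(1) by (intro sum.mono_neutral_cong_right) auto
      also have "\<dots> = (\<Sum>u\<in>S. k u * \<phi> (j # u))" by (subst sum.reindex) simp_all
      finally show ?thesis using S by simp
    qed
    moreover have "finite ?S" using S(1) by simp
    ultimately show ?case by (intro exI[of _ ?S] exI[of _ ?k]) blast
  qed
  then show "\<exists>S k. finite S \<and> (\<forall>\<phi>. app (Dn a i) \<phi> w = (\<Sum>u\<in>S. k u * \<phi> u))"
    by (simp add: app_Dn)
qed

lemma row_finite_Up: "row_finite (Up i)"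
  unfolding row_finite_def
proof
  fix w show "\<exists>S k. finite S \<and> (\<forall>\<phi>. app (Up i) \<phi> w = (\<Sum>u\<in>S. k u * \<phi> u))"
    by (rule exI[of _ "{i # w}"], rule exI[of _ "\<lambda>_. 1"]) simp
qed

text \<open>For \<open>c = -1\<close> this is K_i on the first slot, where the weight is minus
  \<open>ht\<close>, and the inverse of K_i on the second slot, where raising and lowering are
  exchanged and the weight is \<open>ht\<close>.\<close>

definition Kd :: "('i \<Rightarrow> int) \<Rightarrow> 'i \<Rightarrow> int \<Rightarrow> 'i list lop" where
  "Kd a i c = diag (\<lambda>w. q i powi (c * ht a i w))"

text \<open>\<open>TE\<close> is the coproduct \<open>E\<^sub>i \<otimes> 1 + K\<^sub>i \<otimes> E\<^sub>i\<close>, acting on functionals on the tensor product of a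
  lowest weight module of lowest weight \<open>-a\<close> and a highest weight module of highest weight \<open>b\<close>;
  \<open>TF\<close> is \<open>F\<^sub>i \<otimes> K\<^sub>i\<^sup>-\<^sup>1 + 1 \<otimes> F\<^sub>i\<close>.\<close>

definition TE :: "('i \<Rightarrow> int) \<Rightarrow> ('i \<Rightarrow> int) \<Rightarrow> 'i \<Rightarrow> ('i list \<times> 'i list) lop" where
  "TE a b i = slot1 (Up i) + slot1 (Kd a i (-1)) * slot2 (Dn b i)"

definition TF :: "('i \<Rightarrow> int) \<Rightarrow> ('i \<Rightarrow> int) \<Rightarrow> 'i \<Rightarrow> ('i list \<times> 'i list) lop" where
  "TF a b i = slot2 (Up i) + slot2 (Kd b i (-1)) * slot1 (Dn a i)"

definition tht :: "('i \<Rightarrow> int) \<Rightarrow> ('i \<Rightarrow> int) \<Rightarrow> 'i \<Rightarrow> 'i list \<times> 'i list \<Rightarrow> int" where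
  "tht a b i x = ht b i (snd x) - ht a i (fst x)"

lemma app_TE: "app (TE a b i) \<phi> (u, w) = \<phi> (i # u, w) + q i powi (- ht a i u) * dn b i (\<lambda>w. \<phi> (u, w)) w"
  by (simp add: TE_def Kd_def app_slot1 app_slot2 app_diag app_Dn dn_scale)

lemma app_TF: "app (TF a b i) \<phi> (u, w) = \<phi> (u, i # w) + q i powi (- ht b i w) * dn a i (\<lambda>u. \<phi> (u, w)) u"
  by (simp add: TF_def Kd_def app_slot1 app_slot2 app_diag app_Dn dn_scale)

lemma Kd_Dn:
  assumes "i \<in> I"
  shows "Kd a i c * Dn a j = sc_lop (q i powi (c * A i j)) * (Dn a j * Kd a i c)"
proof (rule lop_eqI, subst app_sc_mult)
  fix \<phi> w
  have "dn a j (\<lambda>u. q i powi (c * ht a i u) * \<phi> u) w = dn a j (\<lambda>u. q i powi (c * A i j + c * ht a i w) * \<phi> u) w"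
  proof (rule dn_cong)
    fix u assume "mset w = add_mset j (mset u)"
    then have "ht a i w = ht a i (j # u)" by (intro ht_mset) simp
    then have "ht a i u = A i j + ht a i w" by simp
    then have "c * ht a i u = c * A i j + c * ht a i w" by (simp only: distrib_left)
    then show "q i powi (c * ht a i u) * \<phi> u = q i powi (c * A i j + c * ht a i w) * \<phi> u" by simp
  qed
  also have "\<dots> = q i powi (c * A i j) * (q i powi (c * ht a i w) * dn a j \<phi> w)"
    using q_nz[OF assms] by (simp add: dn_scale power_int_add)
  finally show "app (Kd a i c * Dn a j) \<phi> w = q i powi (c * A i j) * app (Dn a j * Kd a i c) \<phi> w"
    by (simp add: Kd_def app_Dn app_diag[abs_def])
qed

text \<open>Exchanging the factors together with E and F is a symmetry of the construction; facts
  about \<open>TF\<close> follow from those about \<open>TE\<close>.\<close>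

lemma TE_TF_swap: "intertwines prod.swap (TF a b i) (TE b a i)"
  unfolding intertwines_def by (intro allI ext) (auto simp: app_TE app_TF)

text \<open>The coproduct respects the commutator relation: the mixed terms commute with each other,
  and the commutators left in each slot combine to the quantum number of the total weight.\<close>

lemma TE_TF:
  assumes i: "i \<in> I" and j: "j \<in> I"
  shows "TE a b i * TF a b j - TF a b j * TE a b i =
     (if i = j then lop.brk (q i) (diag (\<lambda>x. q i powi tht a b i x)) (diag (\<lambda>x. q i powi (- tht a b i x))) 0 else 0)"
proof -
  let ?X = "slot1 (Up i) :: ('i list \<times> 'i list) lop" and ?k = "slot1 (Kd a i (-1)) :: ('i list \<times> 'i list) lop"
  let ?Y = "slot2 (Dn b i) :: ('i list \<times> 'i list) lop" and ?X' = "slot2 (Up j) :: ('i list \<times> 'i list) lop"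
  let ?k' = "slot2 (Kd b j (-1)) :: ('i list \<times> 'i list) lop" and ?Y' = "slot1 (Dn a j) :: ('i list \<times> 'i list) lop"
  have rf: "row_finite (Kd a i c)" for a i c unfolding Kd_def by (rule row_finite_diag)
  have comm: "?X * ?X' = ?X' * ?X" "?X * ?k' = ?k' * ?X" "?Y' * ?k' = ?k' * ?Y'"
    "?k * ?X' = ?X' * ?k" "?k * ?k' = ?k' * ?k" "?Y' * ?Y = ?Y * ?Y'" "?k * ?Y = ?Y * ?k"
    by (intro slot_commute row_finite_Up row_finite_Dn rf)+
  define c where "c = q i powi (- A i j)"
  have c': "c = q j powi (- A j i)" using q_A_sym[OF i j] by (simp add: c_def power_int_minus)
  have kY': "?k * ?Y' = sc_lop c * (?Y' * ?k)"
    using Kd_Dn[OF i, of a "-1" j] by (simp add: c_def flip: slot1_hom)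
  have k'Y: "?k' * ?Y = sc_lop c * (?Y * ?k')"
    using Kd_Dn[OF j, of b "-1" i] by (simp add: c' flip: slot2_hom)
  \<comment> \<open>Moving \<open>?k\<close> past \<open>?Y'\<close> and \<open>?k'\<close> past
    \<open>?Y\<close> produces the same scalar, by symmetry of the form; it is introduced once and
    absorbed once.\<close>
  have cross: "?k * ?Y * (?k' * ?Y') = ?k' * ?Y' * (?k * ?Y)"
  proof -
    have "?k * ?Y * (?k' * ?Y') = ?k * ?Y' * (?Y * ?k')"
      by (simp only: mult.assoc comm(3)[symmetric]) (simp only: mult.assoc[symmetric] comm(6))
    also have "\<dots> = sc_lop c * (?Y' * (?k * (?Y * ?k')))" by (simp only: kY' mult.assoc)
    also have "\<dots> = ?Y' * (?k * (?k' * ?Y))"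
      by (simp only: k'Y lop.sc_left_comm[of ?k] lop.sc_left_comm[of ?Y'])
    also have "\<dots> = ?Y' * ?k' * (?k * ?Y)"
      by (simp only: mult.assoc) (simp only: mult.assoc[symmetric] comm(5))
    finally show ?thesis by (simp only: comm(3))
  qed
  have "TE a b i * TF a b j - TF a b j * TE a b i =
      ?k' * (?X * ?Y' - ?Y' * ?X) + ?k * (?Y * ?X' - ?X' * ?Y)"
  proof -
    have "?X * (?k' * ?Y') = ?k' * (?X * ?Y')" by (simp only: mult.assoc[symmetric] comm(2))
    moreover have "?X' * (?k * ?Y) = ?k * (?X' * ?Y)" by (simp only: mult.assoc[symmetric] comm(4))
    ultimately show ?thesis
      unfolding TE_def TF_def distrib_left distrib_right right_diff_distrib cross comm(1)
      by (simp add: mult.assoc)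
  qed
  also have "\<dots> = (if i = j then lop.brk (q i) (diag (\<lambda>x. q i powi tht a b i x)) (diag (\<lambda>x. q i powi (- tht a b i x))) 0 else 0)"
  proof (cases "i = j")
    case False
    then show ?thesis using Up_Dn_other[of i j a] Up_Dn_other[of j i b] by (simp add: slot1_hom(4) slot2_hom(4) flip: slot1_hom(1,2) slot2_hom(1,2))
  next
    case True
    have nz: "q i \<noteq> 0" using i by (rule q_nz)
    have 1: "?X * ?Y' - ?Y' * ?X = slot1 (diag (\<lambda>w. qnum (q i) (0 + - ht a i w)))"
      using Up_Dn[OF i, of a] brk_diag[OF nz, of "\<lambda>w. - ht a i w" 0] True
      by (simp only: slot1_hom[symmetric])
    have "?Y * ?X' - ?X' * ?Y = - (slot2 (Up i * Dn b i - Dn b i * Up i))"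
      using True by (simp only: slot2_hom) simp
    also have "\<dots> = - slot2 (diag (\<lambda>w. qnum (q i) (0 + - ht b i w)))"
      using Up_Dn[OF i, of b] brk_diag[OF nz, of "\<lambda>w. - ht b i w" 0] by simp
    finally have 2: "?Y * ?X' - ?X' * ?Y = - slot2 (diag (\<lambda>w. qnum (q i) (0 + - ht b i w)))" .
    \<comment> \<open>Applied with x and y the values of \<open>ht\<close> in the first and second
      slot, where y - x is the total weight.\<close>
    have key: "q i powi (- y) * qnum (q i) (- x) - q i powi (- x) * qnum (q i) (- y) = qnum (q i) (y - x)" for x y
      using nz by (simp add: qnum_def power_int_diff power_int_minus divide_simps) (simp add: algebra_simps)
    have "?k' * (?X * ?Y' - ?Y' * ?X) + ?k * (?Y * ?X' - ?X' * ?Y) = diag (\<lambda>x. qnum (q i) (0 + tht a b i x))"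
      unfolding 1 2
    proof (rule lop_eqI2)
      fix \<phi> :: "'i list \<times> 'i list \<Rightarrow> qv" and u w
      have "app (?k' * slot1 (diag (\<lambda>w. qnum (q i) (0 + - ht a i w))) +
           ?k * - slot2 (diag (\<lambda>w. qnum (q i) (0 + - ht b i w)))) \<phi> (u, w) =
         (q i powi (- ht b i w) * qnum (q i) (- ht a i u) - q i powi (- ht a i u) * qnum (q i) (- ht b i w)) * \<phi> (u, w)"
        using True by (simp add: Kd_def app_slot1 app_slot2 app_diag) (simp add: algebra_simps)
      then show "app (?k' * slot1 (diag (\<lambda>w. qnum (q i) (0 + - ht a i w))) +
           ?k * - slot2 (diag (\<lambda>w. qnum (q i) (0 + - ht b i w)))) \<phi> (u, w) =
         app (diag (\<lambda>x. qnum (q i) (0 + tht a b i x))) \<phi> (u, w)"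
        unfolding key by (simp add: app_diag tht_def)
    qed
    then show ?thesis using True brk_diag[OF nz, of "tht a b i" 0] by simp
  qed
  finally show ?thesis .
qed

text \<open>Both terms of the coproduct raise the weight by the simple root: one adds
  \<open>i\<close> to the first word, the other deletes \<open>i\<close> from the second.\<close>

lemma diag_TE:
  assumes i: "i \<in> I" and g1: "\<And>u w. g (i # u, w) = c * g (u, w)"
    and g2: "\<And>u w w'. mset w = add_mset i (mset w') \<Longrightarrow> g (u, w') = c * g (u, w)"
  shows "diag g * TE a b i = sc_lop c * (TE a b i * diag g)"
proof (rule lop_eqI2, subst app_sc_mult)
  fix \<phi> u w
  have "dn b i (\<lambda>w. g (u, w) * \<phi> (u, w)) w = dn b i (\<lambda>w'. (c * g (u, w)) * \<phi> (u, w')) w"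
    by (rule dn_cong) (simp add: g2)
  also have "\<dots> = (c * g (u, w)) * dn b i (\<lambda>w. \<phi> (u, w)) w" by (rule dn_scale)
  finally show "app (diag g * TE a b i) \<phi> (u, w) = c * app (TE a b i * diag g) \<phi> (u, w)"
    by (simp add: app_TE app_diag g1 dn_scale algebra_simps)
qed

lemma tht_TE:
  assumes "i \<in> I" "j \<in> I"
  shows "diag (\<lambda>x. q i powi (t * tht a b i x)) * TE a b j = sc_lop (q j powi (t * A j i)) * (TE a b j * diag (\<lambda>x. q i powi (t * tht a b i x)))"
proof (rule diag_TE[OF assms(2)])
  have c: "q j powi (t * A j i) = q i powi (t * A i j)"
    
    unfolding mult.commute[of t] power_int_mult q_A_sym[OF assms] ..
  fix u w w' :: "'i list"
  have "t * tht a b i (j # u, w) = t * A i j + t * tht a b i (u, w)"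
    by (simp add: tht_def algebra_simps)
  then show "q i powi (t * tht a b i (j # u, w)) = q j powi (t * A j i) * q i powi (t * tht a b i (u, w))"
    unfolding c using q_nz[OF assms(1)] by (simp add: power_int_add)
  assume "mset w = add_mset j (mset w')"
  then have "ht b i w = ht b i (j # w')" by (intro ht_mset) simp
  then have "ht b i w' = A i j + ht b i w" by simp
  then have "t * tht a b i (u, w') = t * A i j + t * tht a b i (u, w)"
    by (simp add: tht_def algebra_simps)
  then show "q i powi (t * tht a b i (u, w')) = q j powi (t * A j i) * q i powi (t * tht a b i (u, w))"
    unfolding c using q_nz[OF assms(1)] by (simp add: power_int_add)
qed

lemma serre_TF:
  assumes ij: "i \<in> I" "j \<in> I" "i \<noteq> j" and k: "k \<in> I"
  shows "lop.serre (q i) (sl i j) (TE a b i) (TE a b j) * TF a b k = TF a b k * lop.serre (q i) (sl i j) (TE a b i) (TE a b j)"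
proof -
  note gen = generic_q[OF ij(1)]
  have K: "diag (\<lambda>x. q i powi tht a b i x) * TE a b j = sc_lop (q j powi A j i) * (TE a b j * diag (\<lambda>x. q i powi tht a b i x))"
    "diag (\<lambda>x. q i powi (- tht a b i x)) * TE a b j = sc_lop (q j powi (- A j i)) * (TE a b j * diag (\<lambda>x. q i powi (- tht a b i x)))"
    if "i \<in> I" "j \<in> I" for i j
    using tht_TE[OF that, of 1 a b] tht_TE[OF that, of "-1" a b] by simp_all
  have comm: "TE a b i * TF a b j = TF a b j * TE a b i" if "i \<in> I" "j \<in> I" "i \<noteq> j" for i j
    using TE_TF[OF that(1,2), of a b] that(3) by simp
  consider "k = i" | "k = j" | "k \<noteq> i" "k \<noteq> j" by blast
  then show ?thesis
  proof cases
    case 1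
    show ?thesis
      unfolding 1 sl_Suc[OF ij]
    proof (rule lop.serre_comm_same[OF gen])
      show "TE a b i * TF a b i - TF a b i * TE a b i = lop.brk (q i) (diag (\<lambda>x. q i powi tht a b i x)) (diag (\<lambda>x. q i powi (- tht a b i x))) 0"
        using TE_TF[OF ij(1,1), of a b] by simp
    qed (use K[OF ij(1,1)] K[OF ij(1,2)] comm[OF ij(2,1)] ij(3) in
        \<open>simp_all add: A_diag[OF ij(1)] A_nonpos[OF ij] q_A_sym[OF ij(2,1)] power_int_minus\<close>)
  next
    case 2
    show ?thesis
      unfolding 2 sl_Suc[OF ij]
    proof (rule lop.serre_comm_other[OF gen])
      show "TE a b j * TF a b j - TF a b j * TE a b j = sc_lop (inverse (q j - inverse (q j))) *
          (diag (\<lambda>x. q j powi tht a b j x) - diag (\<lambda>x. q j powi (- tht a b j x)))"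
        using TE_TF[OF ij(2,2), of a b] by (simp add: lop.brk_def)
    qed (use K[OF ij(2,1)] comm[OF ij] in \<open>simp_all add: A_nonpos[OF ij] power_int_minus\<close>)
  next
    case 3
    show ?thesis
      by (rule lop.serre_comm_zero) (use 3 comm[OF ij(1) k] comm[OF ij(2) k] in auto)
  qed
qed

text \<open>The dual of the tensor product: the defining conditions of the two factors hold in each
  variable separately.\<close>

definition tmod :: "('i \<Rightarrow> int) \<Rightarrow> ('i \<Rightarrow> int) \<Rightarrow> ('i list \<times> 'i list \<Rightarrow> qv) set" where
  "tmod a b = {\<phi>. (\<forall>w. (\<lambda>u. \<phi> (u, w)) \<in> lowest a) \<and> (\<forall>u. (\<lambda>w. \<phi> (u, w)) \<in> lowest b)}"

lemma tmod_swap: "\<phi> \<in> tmod a b \<Longrightarrow> (\<lambda>x. \<phi> (prod.swap x)) \<in> tmod b a"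
  by (simp add: tmod_def)

lemma tmod_zero: "(\<lambda>x. 0) \<in> tmod a b"
  by (simp add: tmod_def lowest_zero)

lemma tmod_lin: "\<phi> \<in> tmod a b \<Longrightarrow> \<psi> \<in> tmod a b \<Longrightarrow> (\<lambda>x. \<phi> x + c * \<psi> x) \<in> tmod a b"
  unfolding tmod_def using lowest_lin by simp

lemma lowest_sum: "(\<And>s. s \<in> S \<Longrightarrow> \<phi> s \<in> lowest a) \<Longrightarrow> (\<lambda>w. \<Sum>s\<in>S. k s * \<phi> s w) \<in> lowest a"
proof (induction S rule: infinite_finite_induct)
  case (insert s S)
  then have "(\<lambda>w. (\<Sum>s\<in>S. k s * \<phi> s w) + k s * \<phi> s w) \<in> lowest a" by (intro lowest_lin) simp_all
  then show ?case using insert.hyps by (simp add: add.commute)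
qed (simp_all add: lowest_zero)

text \<open>The second term acts on the other variable through \<open>dn\<close>, which is a finite
  combination of evaluations; hence it preserves the linear conditions in the first
  variable.\<close>

lemma tmod_TE:
  assumes \<phi>: "\<phi> \<in> tmod a b" and i: "i \<in> I" and b: "\<And>i. i \<in> I \<Longrightarrow> b i \<ge> 0"
  shows "app (TE a b i) \<phi> \<in> tmod a b"
proof -
  have \<phi>1: "(\<lambda>u. \<phi> (u, w)) \<in> lowest a" and \<phi>2: "(\<lambda>w. \<phi> (u, w)) \<in> lowest b" for u w
    using \<phi> by (simp_all add: tmod_def)
  have "(\<lambda>u. app (TE a b i) \<phi> (u, w)) \<in> lowest a" for w
  proof -
    have "\<exists>S k. finite S \<and> (\<forall>\<phi>. dn b i \<phi> w = (\<Sum>u\<in>S. k u * \<phi> u))"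
      using row_finite_Dn[of b i] unfolding row_finite_def app_Dn by (rule spec)
    then obtain S k where S: "\<And>\<phi>. dn b i \<phi> w = (\<Sum>u\<in>S. k u * \<phi> u)" by (elim exE conjE) simp
    have "(\<lambda>u. dn b i (\<lambda>w. \<phi> (u, w)) w) \<in> lowest a"
      unfolding S by (intro lowest_sum \<phi>1)
    then have "(\<lambda>u. q i powi (- ht a i u) * dn b i (\<lambda>w. \<phi> (u, w)) w) \<in> lowest a"
      by (rule lowest_weight) (rule arg_cong[where f = "\<lambda>n. q i powi (- n)"], rule ht_mset)
    from lowest_lin[OF lowest_Up[OF \<phi>1[of w], of i] this, of 1] show ?thesis by (simp add: app_TE)
  qed
  moreover have "(\<lambda>w. app (TE a b i) \<phi> (u, w)) \<in> lowest b" for u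
    unfolding app_TE by (rule lowest_lin[OF \<phi>2 lowest_Dn[OF \<phi>2 i b]])
  ultimately show ?thesis by (simp add: tmod_def)
qed

lemma tmod_TF:
  assumes \<phi>: "\<phi> \<in> tmod a b" and i: "i \<in> I" and a: "\<And>i. i \<in> I \<Longrightarrow> a i \<ge> 0"
  shows "app (TF a b i) \<phi> \<in> tmod a b"
proof -
  have "(\<lambda>x. app (TF a b i) \<phi> (prod.swap x)) = app (TE b a i) (\<lambda>x. \<phi> (prod.swap x))"
    using TE_TF_swap by (simp add: intertwines_def)
  also have "\<dots> \<in> tmod b a" by (rule tmod_TE[OF tmod_swap[OF \<phi>] i a])
  finally show ?thesis using tmod_swap[of "\<lambda>x. app (TF a b i) \<phi> (prod.swap x)" b a] by simp
qed

lemma tmod_diag: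
  assumes \<phi>: "\<phi> \<in> tmod a b"
    and g: "\<And>u u' w w'. mset u = mset u' \<Longrightarrow> mset w = mset w' \<Longrightarrow> g (u, w) = g (u', w')"
  shows "(\<lambda>x. g x * \<phi> x) \<in> tmod a b"
proof -
  have "(\<lambda>u. g (u, w) * \<phi> (u, w)) \<in> lowest a" "(\<lambda>w. g (u, w) * \<phi> (u, w)) \<in> lowest b" for u w
    using \<phi> by (intro lowest_weight g; simp add: tmod_def)+
  then show ?thesis by (simp add: tmod_def)
qed

text \<open>Induction on the second word. At the empty word \<open>TE\<close> restricts to
  \<open>Up\<close> and the Serre relations are part of \<open>lowest\<close>. A further letter
  \<open>k\<close> is reached through \<open>TF a b k\<close>, which commutes with the Serre element
  and whose correction term keeps the second word.\<close>

lemma serre_TE_zero: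
  assumes ij: "i \<in> I" "j \<in> I" "i \<noteq> j"
    and a: "\<And>i. i \<in> I \<Longrightarrow> a i \<ge> 0" and b: "\<And>i. i \<in> I \<Longrightarrow> b i \<ge> 0"
    and \<phi>: "\<phi> \<in> tmod a b"
  shows "app (lop.serre (q i) (sl i j) (TE a b i) (TE a b j)) \<phi> = (\<lambda>x. 0)"
proof -
  let ?S = "lop.serre (q i) (sl i j) (TE a b i) (TE a b j)"
  have res: "intertwines (\<lambda>u. (u, [])) (TE a b i) (Up i)" for i
    unfolding intertwines_def by (simp add: app_TE app_Up_fun)
  have "app ?S \<phi> (u, w) = 0" for u w
    using \<phi>
  proof (induction w arbitrary: \<phi> u)
    case Nil
    have "app ?S \<phi> (u, []) = app (lop.serre (q i) (sl i j) (Up i) (Up j)) (\<lambda>u. \<phi> (u, [])) u"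
      using intertwines_serre[OF res res, of "q i" "sl i j" i j] unfolding intertwines_def by metis
    also have "\<dots> = 0"
      using Nil.prems lowestD(3)[OF _ ij, of "\<lambda>u. \<phi> (u, [])" a "[]" u] by (simp add: app_serre tmod_def)
    finally show ?case .
  next
    case (Cons k w)
    show ?case
    proof (cases "k \<in> I")
      case True
      have S0: "app ?S \<phi> (u, w) = 0" for u using Cons by blast
      have "app (TF a b k * ?S) \<phi> (u, w) = 0"
        using Cons.IH[OF tmod_TF[OF Cons.prems True a]] by simp
      then have "app (TF a b k) (app ?S \<phi>) (u, w) = 0"
        unfolding serre_TF[OF ij True, symmetric] by simp
      moreover have "dn a k (\<lambda>u. app ?S \<phi> (u, w)) u = 0" by (rule dn_zero) (simp add: S0)
      ultimately show ?thesis by (simp add: app_TF)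
    next
      case False
      \<comment> \<open>For a letter outside \<open>I\<close> the value vanishes for another reason:
        the Serre element maps \<open>tmod\<close> to itself, and functions there are zero on such
        words.\<close>
      have closed: "app (TE a b i ^ n) \<psi> \<in> tmod a b" if "\<psi> \<in> tmod a b" "i \<in> I" for n \<psi> i
        using that(1) by (induction n arbitrary: \<psi>) (simp_all add: tmod_TE[OF _ that(2) b])
      have sc: "app (sc_lop c) \<psi> \<in> tmod a b" if "\<psi> \<in> tmod a b" for c \<psi>
        using tmod_lin[OF tmod_zero that, of c] by (simp add: app_sc_fun)
      define T where "T r = (- 1) ^ r * lop.dpow (q i) (TE a b i) (sl i j - r) * TE a b j * lop.dpow (q i) (TE a b i) r" for r
      have T: "app (T r) \<phi> \<in> tmod a b" for r
        unfolding T_def lop.sc_neg_1_power[symmetric] lop.dpow_def app_lop_simps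
        by (intro closed sc tmod_TE Cons.prems ij b)
      have "app (\<Sum>r\<in>R. T r) \<phi> \<in> tmod a b" for R
      proof (induction R rule: infinite_finite_induct)
        case (insert r R)
        from tmod_lin[OF T[of r] insert.IH, of 1] show ?case using insert.hyps by simp
      qed (simp_all add: tmod_zero)
      then have "app ?S \<phi> \<in> tmod a b" unfolding lop.serre_def T_def .
      then have "(\<lambda>w. app ?S \<phi> (u, w)) \<in> lowest b" by (simp add: tmod_def)
      from lowestD(1)[OF this, of "k # w"] show ?thesis using False by auto
    qed
  qed
  then show ?thesis by auto
qed

lemma serre_TF_zero:
  assumes ij: "i \<in> I" "j \<in> I" "i \<noteq> j"
    and a: "\<And>i. i \<in> I \<Longrightarrow> a i \<ge> 0" and b: "\<And>i. i \<in> I \<Longrightarrow> b i \<ge> 0"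
    and \<phi>: "\<phi> \<in> tmod a b"
  shows "app (lop.serre (q i) (sl i j) (TF a b i) (TF a b j)) \<phi> = (\<lambda>x. 0)"
proof -
  let ?S = "lop.serre (q i) (sl i j) (TF a b i) (TF a b j)"
  have "(\<lambda>x. app ?S \<phi> (prod.swap x)) =
      app (lop.serre (q i) (sl i j) (TE b a i) (TE b a j)) (\<lambda>x. \<phi> (prod.swap x))"
    using intertwines_serre[OF TE_TF_swap TE_TF_swap] unfolding intertwines_def by blast
  also have "\<dots> = (\<lambda>x. 0)" by (intro serre_TE_zero ij a b tmod_swap \<phi>)
  finally have "app ?S \<phi> (prod.swap x) = 0" for x by (rule fun_cong)
  from this[of "prod.swap _"] show ?thesis by (intro ext) simp
qed

end


section \<open>The algebra \<open>U\<close> modulo weights\<close>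

interpretation fv: vector_space "\<lambda>c (p :: 'g free). scal c * p"
  by standard (simp_all add: algebra_simps scal_add scal_mult)

interpretation fvp: vector_space_pair "\<lambda>c (p :: 'g free). scal c * p" "(*) :: qv \<Rightarrow> qv \<Rightarrow> qv"
  by standard (simp_all add: algebra_simps)

text \<open>A basis of \<open>K\<close> together with \<open>t\<close> is independent, and values on
  it can be prescribed.\<close>

lemma separating_functional:
  assumes K: "fv.subspace K" and t: "t \<notin> K"
  obtains \<psi> :: "'g free \<Rightarrow> qv" where "\<And>p q. \<psi> (p + q) = \<psi> p + \<psi> q" "\<And>c p. \<psi> (scal c * p) = c * \<psi> p"
    "\<And>k. k \<in> K \<Longrightarrow> \<psi> k = 0" "\<psi> t = 1"
proof -
  obtain B where B: "B \<subseteq> K" "fv.independent B" "K \<subseteq> fv.span B"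
    by (rule fv.maximal_independent_subset)
  have "t \<notin> fv.span B" using fv.span_minimal[OF B(1) K] t by (rule contra_subsetD)
  then have "fv.independent (insert t B)" using B(2) by (simp add: fv.independent_insert)
  from fvp.linear_independent_extend[OF this, of "\<lambda>x. if x = t then 1 else 0"]
  obtain \<psi> where \<psi>: "Vector_Spaces.linear (\<lambda>c p. scal c * p) (*) \<psi>"
    "\<forall>x\<in>insert t B. \<psi> x = (if x = t then 1 else 0)" by (elim exE conjE)
  have "t \<notin> B" using \<open>t \<notin> fv.span B\<close> fv.span_base by (rule contrapos_nn)
  then have B0: "x \<in> B \<Longrightarrow> \<psi> x = 0" for x using \<psi>(2) by (cases "x = t") simp_all
  show thesis
  proof (rule that)
    show "\<psi> k = 0" if "k \<in> K" for k
      using fvp.linear_eq_0_on_span[OF \<psi>(1) B0 subsetD[OF B(3) that]] .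
    show "\<psi> t = 1" using \<psi>(2) by simp
  qed (simp_all add: fvp.linear_add[OF \<psi>(1)] fvp.linear_scale[OF \<psi>(1)])
qed

lemma presented_a_inv:
  assumes "R \<subseteq> car G" "p \<in> car G"
  shows "\<ominus>\<^bsub>presented_alg G R\<^esub> cls G R p = cls G R (- p)"
proof -
  interpret ring "presented_alg G R" by (rule ring_presented[OF assms(1)])
  show ?thesis
    using assms by (intro minus_equality) (simp_all add: carrier_presented presented_zero)
qed

context datum
begin

abbreviation "GU \<equiv> U_gens D"
abbreviation "RU \<equiv> U_rels D"
abbreviation "iU \<equiv> ideal_of GU RU"
abbreviation "clU \<equiv> cls GU RU"

abbreviation genE :: "sign \<Rightarrow> 'i \<Rightarrow> ('i, 't) gen free" where
  "genE s i \<equiv> gen_elt (E s i)"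

lemma dpow_car: "p \<in> car G \<Longrightarrow> free.dpow z p n \<in> car G"
  by (simp add: free.dpow_def)

lemma div_pow_eq: "div_pow D s i n = free.dpow (q i) (genE s i) n"
  by (simp add: div_pow_def free.dpow_def)

lemma serre_rels_eq: "serre_rels D =
    {free.serre (q i) (sl i j) (genE s i) (genE s j) | s i j. i \<in> I \<and> j \<in> I \<and> i \<noteq> j}"
  by (simp add: serre_rels_def free.serre_def div_pow_eq sl_def)

lemma serre_car: "p \<in> car G \<Longrightarrow> p' \<in> car G \<Longrightarrow> free.serre z n p p' \<in> car G"
  unfolding free.serre_def by (intro car_sum car_mult car_power car_uminus dpow_car) simp_all

lemma GU_E [simp]: "i \<in> I \<Longrightarrow> E s i \<in> GU"
  by (auto simp: U_gens_def)

lemma GU_T [simp]: "T h \<in> GU"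
  by (auto simp: U_gens_def)

lemma GU_cases [consumes 1, case_names E T]: "g \<in> GU \<Longrightarrow> (\<And>s i. g = E s i \<Longrightarrow> i \<in> I \<Longrightarrow> Q) \<Longrightarrow> (\<And>h. g = T h \<Longrightarrow> Q) \<Longrightarrow> Q"
  by (auto simp: U_gens_def)

lemma RU_car: "RU \<subseteq> car GU"
  unfolding U_rels_def serre_rels_eq by (auto intro!: serre_car)

lemmas iU_car = ideal_of_car[OF RU_car]
  and iU_add = ideal_of_add[OF RU_car]
  and iU_left = ideal_of_mult_left[OF RU_car]
  and iU_right = ideal_of_mult_right[OF RU_car]
  and iU_gen = ideal_of_gen[OF RU_car]
  and iU_diff = ideal_of_diff[OF RU_car]

definition kk :: "'y \<Rightarrow> 'x \<Rightarrow> ('i, 'y) gen free" where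
  "kk h m = gen_elt (T h) - scal (v_ind powi pair D h m)"

lemma kk_car [simp]: "kk h m \<in> car GU"
  by (simp add: kk_def)

interpretation U: ring "U_alg D"
  unfolding U_alg_def by (rule ring_presented[OF RU_car])

lemma carrier_U: "carrier (U_alg D) = clU ` car GU"
  by (simp add: U_alg_def carrier_presented)

lemma kk_cls: "U_K D h \<ominus>\<^bsub>U_alg D\<^esub> ((v_ind powi pair D h m) \<odot>\<^bsub>U_alg D\<^esub> \<one>\<^bsub>U_alg D\<^esub>) = clU (kk h m)"
  unfolding a_minus_def U_K_def U_alg_def
  by (simp add: presented_one[OF RU_car] cls_smult[OF RU_car] presented_a_inv[OF RU_car]
      cls_add[OF RU_car] kk_def)

definition kgens :: "'x \<Rightarrow> 'x \<Rightarrow> ('i, 'y) gen free set" where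
  "kgens l m = {kk h l * p | h p. p \<in> car GU} \<union> {p * kk h m | h p. p \<in> car GU}"

lemma block_ker_eq: "block_ker D l m = generate (add_monoid (U_alg D)) (clU ` kgens l m)"
proof -
  have m: "clU p \<otimes>\<^bsub>U_alg D\<^esub> clU p' = clU (p * p')" if "p \<in> car GU" "p' \<in> car GU" for p p'
    using that by (simp add: U_alg_def cls_mult[OF RU_car])
  have "{clU (kk h l) \<otimes>\<^bsub>U_alg D\<^esub> u | h u. u \<in> carrier (U_alg D)} = clU ` {kk h l * p | h p. p \<in> car GU}"
  proof (intro equalityI subsetI)
    fix x assume "x \<in> {clU (kk h l) \<otimes>\<^bsub>U_alg D\<^esub> u | h u. u \<in> carrier (U_alg D)}"
    then obtain h p where "p \<in> car GU" "x = clU (kk h l) \<otimes>\<^bsub>U_alg D\<^esub> clU p" unfolding carrier_U by blast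
    then show "x \<in> clU ` {kk h l * p | h p. p \<in> car GU}" using m[OF kk_car] by blast
  next
    fix x assume "x \<in> clU ` {kk h l * p | h p. p \<in> car GU}"
    then obtain h p where "p \<in> car GU" "x = clU (kk h l * p)" by blast
    then have "p \<in> car GU" "x = clU (kk h l) \<otimes>\<^bsub>U_alg D\<^esub> clU p" using m[OF kk_car] by simp_all
    then show "x \<in> {clU (kk h l) \<otimes>\<^bsub>U_alg D\<^esub> u | h u. u \<in> carrier (U_alg D)}" unfolding carrier_U by blast
  qed
  moreover have "{u \<otimes>\<^bsub>U_alg D\<^esub> clU (kk h m) | h u. u \<in> carrier (U_alg D)} = clU ` {p * kk h m | h p. p \<in> car GU}"
  proof (intro equalityI subsetI)
    fix x assume "x \<in> {u \<otimes>\<^bsub>U_alg D\<^esub> clU (kk h m) | h u. u \<in> carrier (U_alg D)}"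
    then obtain h p where "p \<in> car GU" "x = clU p \<otimes>\<^bsub>U_alg D\<^esub> clU (kk h m)" unfolding carrier_U by blast
    then show "x \<in> clU ` {p * kk h m | h p. p \<in> car GU}" using m[OF _ kk_car] by blast
  next
    fix x assume "x \<in> clU ` {p * kk h m | h p. p \<in> car GU}"
    then obtain h p where "p \<in> car GU" "x = clU (p * kk h m)" by blast
    then have "p \<in> car GU" "x = clU p \<otimes>\<^bsub>U_alg D\<^esub> clU (kk h m)" using m[OF _ kk_car] by simp_all
    then show "x \<in> {u \<otimes>\<^bsub>U_alg D\<^esub> clU (kk h m) | h u. u \<in> carrier (U_alg D)}" unfolding carrier_U by blast
  qed
  ultimately show ?thesis
    unfolding block_ker_def Let_def kk_cls kgens_def image_Un by simp
qed

lemma kgens_car: "p \<in> kgens l m \<Longrightarrow> p \<in> car GU"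
  by (auto simp: kgens_def)

lemma block_ker_subgroup: "additive_subgroup (block_ker D l m) (U_alg D)"
proof -
  have "clU ` kgens l m \<subseteq> carrier (U_alg D)" using kgens_car by (auto simp: carrier_U)
  then show ?thesis
    unfolding block_ker_eq by (intro additive_subgroup.intro U.add.generate_is_subgroup) simp
qed

text \<open>The kernel of the composite from the free algebra through U to the block. With it both
  quotients are handled at once by computing with representatives.\<close>

definition KU :: "'x \<Rightarrow> 'x \<Rightarrow> ('i, 'y) gen free set" where
  "KU l m = {p \<in> car GU. clU p \<in> block_ker D l m}"

lemma KU_car: "p \<in> KU l m \<Longrightarrow> p \<in> car GU"
  by (simp add: KU_def)

lemma KU_ideal: "p \<in> iU \<Longrightarrow> p \<in> KU l m"
proof -
  assume p: "p \<in> iU"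
  then have "clU p = clU 0" using iU_car by (simp add: cls_eq_iff[OF RU_car])
  also have "\<dots> = \<zero>\<^bsub>U_alg D\<^esub>" by (simp add: U_alg_def presented_zero[OF RU_car])
  finally show ?thesis
    using iU_car[OF p] additive_subgroup.zero_closed[OF block_ker_subgroup] by (simp add: KU_def)
qed

lemma KU_0 [simp]: "0 \<in> KU l m"
  by (rule KU_ideal) (rule ideal_of_0[OF RU_car])

lemma KU_add: "p \<in> KU l m \<Longrightarrow> p' \<in> KU l m \<Longrightarrow> p + p' \<in> KU l m"
  using additive_subgroup.a_closed[OF block_ker_subgroup, of "clU p" l m "clU p'"]
  by (simp add: KU_def U_alg_def cls_add[OF RU_car])

lemma KU_uminus: "p \<in> KU l m \<Longrightarrow> - p \<in> KU l m"
proof -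
  assume p: "p \<in> KU l m"
  then have "inv\<^bsub>add_monoid (U_alg D)\<^esub> clU p \<in> block_ker D l m"
    by (intro subgroup.m_inv_closed[OF additive_subgroup.a_subgroup[OF block_ker_subgroup]]) (simp add: KU_def)
  also have "inv\<^bsub>add_monoid (U_alg D)\<^esub> clU p = clU (- p)"
    using presented_a_inv[OF RU_car KU_car[OF p]] unfolding a_inv_def U_alg_def .
  finally show "- p \<in> KU l m" using KU_car[OF p] by (simp add: KU_def)
qed

lemma KU_diff: "p \<in> KU l m \<Longrightarrow> p' \<in> KU l m \<Longrightarrow> p - p' \<in> KU l m"
  using KU_add[of p l m "- p'"] KU_uminus by simp

lemma KU_gens: "p \<in> kgens l m \<Longrightarrow> p \<in> KU l m"
  unfolding KU_def block_ker_eq using kgens_car by (auto intro: generate.incl)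

lemma KU_left: "p \<in> car GU \<Longrightarrow> kk h l * p \<in> KU l m"
  and KU_right: "p \<in> car GU \<Longrightarrow> p * kk h m \<in> KU l m"
  by (rule KU_gens; auto simp: kgens_def)+

text \<open>The cases \<open>left\<close>, \<open>right\<close>, \<open>add\<close> and
  \<open>uminus\<close> follow the additive generation of \<open>block_ker\<close>; the case
  \<open>ideal\<close> accounts for the choice of a representative of a class of U.\<close>

lemma KU_induct [consumes 1, case_names ideal left right add uminus]:
  assumes "p \<in> KU l m"
    and ideal: "\<And>p. p \<in> iU \<Longrightarrow> Q p"
    and left: "\<And>h p. p \<in> car GU \<Longrightarrow> Q (kk h l * p)"
    and right: "\<And>h p. p \<in> car GU \<Longrightarrow> Q (p * kk h m)"
    and add: "\<And>p p'. p \<in> car GU \<Longrightarrow> p' \<in> car GU \<Longrightarrow> Q p \<Longrightarrow> Q p' \<Longrightarrow> Q (p + p')"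
    and uminus: "\<And>p. p \<in> car GU \<Longrightarrow> Q p \<Longrightarrow> Q (- p)"
  shows "Q p"
proof -
  have gens: "Q g" if "g \<in> kgens l m" for g using that left right by (auto simp: kgens_def)
  have "\<exists>p\<in>car GU. x = clU p \<and> Q p" if "x \<in> generate (add_monoid (U_alg D)) (clU ` kgens l m)" for x
    using that
  proof (induction rule: generate.induct)
    case one
    show ?case
      by (intro bexI[of _ 0] conjI ideal ideal_of_0[OF RU_car])
        (simp_all add: U_alg_def presented_zero[OF RU_car])
  next
    case (incl x)
    then show ?case using gens kgens_car by auto
  next
    case (inv x)
    then obtain g where g: "g \<in> kgens l m" "x = clU g" by auto
    have "inv\<^bsub>add_monoid (U_alg D)\<^esub> x = clU (- g)"
      using presented_a_inv[OF RU_car kgens_car[OF g(1)]] unfolding a_inv_def U_alg_def g(2) .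
    moreover have "Q (- g)" using g gens kgens_car by (intro uminus) auto
    ultimately show ?case using kgens_car[OF g(1)] by (intro bexI[of _ "- g"]) simp_all
  next
    case (eng x y)
    then obtain p p' where p: "p \<in> car GU" "x = clU p" "Q p" "p' \<in> car GU" "y = clU p'" "Q p'" by auto
    then show ?case
      by (intro bexI[of _ "p + p'"] conjI add) (simp_all add: U_alg_def cls_add[OF RU_car])
  qed
  then obtain p' where p': "p' \<in> car GU" "clU p = clU p'" "Q p'"
    using assms(1) unfolding KU_def block_ker_eq by auto
  have c: "p - p' \<in> iU" using p' KU_car[OF assms(1)] by (simp add: cls_eq_iff[OF RU_car, symmetric])
  have "Q (p' + (p - p'))" by (rule add[OF p'(1) iU_car[OF c] p'(3) ideal[OF c]])
  then show ?thesis by simp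
qed

text \<open>\<open>block_ker\<close> is generated as an additive group; it is a subspace because its
  generating set is closed under scalars.\<close>

lemma KU_scal: "p \<in> KU l m \<Longrightarrow> scal c * p \<in> KU l m"
proof (induction rule: KU_induct)
  case (ideal p)
  then show ?case by (intro KU_ideal iU_left) simp_all
next
  case (left h p)
  then show ?case using KU_left[of "scal c * p" h l m] by (simp add: free.sc_left_comm)
next
  case (right h p)
  then show ?case using KU_right[of "scal c * p" h m l] by (simp add: mult.assoc)
next
  case (add p p')
  then show ?case by (simp add: distrib_left KU_add)
next
  case (uminus p)
  then show ?case by (simp add: KU_uminus)
qed

lemma KU_subspace: "fv.subspace (KU l m)"
  by (rule fv.subspaceI) (auto intro: KU_add KU_scal)

lemma KU_sum: "(\<And>x. x \<in> X \<Longrightarrow> f x \<in> KU l m) \<Longrightarrow> sum f X \<in> KU l m"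
  by (induction X rule: infinite_finite_induct) (auto intro: KU_add)

section \<open>Homogeneous elements and their behaviour in the blocks\<close>

abbreviation wsum :: "('i, 'y) gen list \<Rightarrow> 'x" where
  "wsum xs \<equiv> sum_list (map (gen_weight D) xs)"

abbreviation wd :: "('i, 't) gen list \<Rightarrow> ('i, 't) gen free" where
  "wd xs \<equiv> prod_list (map gen_elt xs)"

lemma wd_car: "set xs \<subseteq> G \<Longrightarrow> wd xs \<in> car G"
  by (induction xs) simp_all

lemma rel_TE: "i \<in> I \<Longrightarrow> gen_elt (T h) * genE s i - scal (v_ind powi signed s (pair D h (simple_root D i))) * genE s i * gen_elt (T h) \<in> iU"
  by (rule iU_gen) (unfold U_rels_def, blast)

lemma rel_TT: "gen_elt (T h) * gen_elt (T h') - gen_elt (T (h + h')) \<in> iU"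
  by (rule iU_gen) (unfold U_rels_def, blast)

lemma rel_EF: "i \<in> I \<Longrightarrow> j \<in> I \<Longrightarrow> genE Plus i * genE Minus j - genE Minus j * genE Plus i
        - (if i = j then scal (inverse (q i - inverse (q i)))
             * (gen_elt (T (zmul (d i) (coroot D i))) - gen_elt (T (- zmul (d i) (coroot D i)))) else 0) \<in> iU"
  by (rule iU_gen) (unfold U_rels_def, blast)

lemma rel_serre: "i \<in> I \<Longrightarrow> j \<in> I \<Longrightarrow> i \<noteq> j \<Longrightarrow> free.serre (q i) (sl i j) (genE s i) (genE s j) \<in> iU"
  by (rule iU_gen) (unfold U_rels_def serre_rels_eq, blast)

lemma pair_signed: "pair D h (signed s x) = signed s (pair D h x)"
  by (cases s) simp_all

lemma T_gen:
  assumes "g \<in> GU"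
  shows "gen_elt (T h) * gen_elt g - scal (v_ind powi pair D h (gen_weight D g)) * gen_elt g * gen_elt (T h) \<in> iU"
  using assms
proof (cases rule: GU_cases)
  case (E s i)
  then show ?thesis using rel_TE[of i h s] by (simp add: pair_signed)
next
  case (T h')
  have "gen_elt (T h) * gen_elt (T h') - gen_elt (T (h + h')) - (gen_elt (T h') * gen_elt (T h) - gen_elt (T (h' + h))) \<in> iU"
    by (intro iU_diff rel_TT)
  then show ?thesis using T by (simp add: add.commute)
qed

lemma T_word:
  assumes "set xs \<subseteq> GU"
  shows "gen_elt (T h) * wd xs - scal (v_ind powi pair D h (wsum xs)) * wd xs * gen_elt (T h) \<in> iU"
  using assms
proof (induction xs)
  case Nil
  then show ?case using ideal_of_0[OF RU_car] by simp
next
  case (Cons g xs)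
  let ?t = "gen_elt (T h)" and ?c = "v_ind powi pair D h (gen_weight D g)" and ?c' = "v_ind powi pair D h (wsum xs)"
  have 1: "(?t * gen_elt g - scal ?c * gen_elt g * ?t) * wd xs \<in> iU"
    using Cons.prems by (intro iU_right T_gen wd_car) simp_all
  have 2: "(scal ?c * gen_elt g) * (?t * wd xs - scal ?c' * wd xs * ?t) \<in> iU"
    using Cons by (intro iU_left) simp_all
  have cc: "v_ind powi pair D h (wsum (g # xs)) = ?c * ?c'"
    using v_ind_nz by (simp add: power_int_add)
  have "(x * y - scal c * y * x) * z + (scal c * y) * (x * z - scal c' * z * x) =
      x * (y * z) - scal (c * c') * (y * z) * x" for x y z :: "('i, 'y) gen free" and c c'
  proof -
    have "(scal c * y) * (scal c' * z * x) = scal (c * c') * (y * z) * x"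
      by (simp only: mult.assoc scal_mult free.sc_left_comm[of y])
    then show ?thesis by (simp only: left_diff_distrib right_diff_distrib) (simp only: mult.assoc, simp)
  qed
  from this[of ?t "gen_elt g" ?c "wd xs" ?c'] show ?case
    using iU_add[OF 1 2] unfolding cc by (simp only: list.map prod_list.Cons)
qed

definition homog :: "'x \<Rightarrow> ('i, 'y) gen free set" where
  "homog \<nu> = {p \<in> car GU. \<forall>w\<in>Poly_Mapping.keys p. wsum (letters w) = \<nu>}"

lemma U_graded_eq: "U_graded D \<nu> = clU ` homog \<nu>"
  by (simp add: U_graded_def homog_def)

lemma homog_car: "p \<in> homog \<nu> \<Longrightarrow> p \<in> car GU"
  by (simp add: homog_def)

lemma homog_0 [simp]: "0 \<in> homog \<nu>"
  by (simp add: homog_def)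

lemma homog_1: "1 \<in> homog 0"
  by (simp add: homog_def)

lemma homog_genE: "i \<in> I \<Longrightarrow> genE s i \<in> homog (signed s (simple_root D i))"
  by (simp add: homog_def gen_elt_def car_single)

lemma homog_add: "p \<in> homog \<nu> \<Longrightarrow> p' \<in> homog \<nu> \<Longrightarrow> p + p' \<in> homog \<nu>"
  using keys_add[of p p'] unfolding homog_def by auto

lemma homog_sum: "(\<And>x. x \<in> X \<Longrightarrow> f x \<in> homog \<nu>) \<Longrightarrow> sum f X \<in> homog \<nu>"
  by (induction X rule: infinite_finite_induct) (auto intro: homog_add)

lemma homog_mult: "p \<in> homog \<nu> \<Longrightarrow> p' \<in> homog \<mu> \<Longrightarrow> p * p' \<in> homog (\<nu> + \<mu>)"
  using keys_mult[of p p'] unfolding homog_def by auto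

lemma homog_scal: "p \<in> homog \<nu> \<Longrightarrow> scal c * p \<in> homog \<nu>"
proof -
  assume p: "p \<in> homog \<nu>"
  have "scal c \<in> homog 0" by (simp add: homog_def scal_def car_single)
  from homog_mult[OF this p] show ?thesis by simp
qed

lemma homog_single: "p \<in> car GU \<Longrightarrow> w \<in> Poly_Mapping.keys p \<Longrightarrow>
    Poly_Mapping.single w c \<in> homog (wsum (letters w))"
  by (auto simp: homog_def car_iff)

lemma T_homog:
  assumes "p \<in> homog \<nu>"
  shows "gen_elt (T h) * p - scal (v_ind powi pair D h \<nu>) * p * gen_elt (T h) \<in> iU"
proof -
  let ?t = "gen_elt (T h)" and ?c = "scal (v_ind powi pair D h \<nu>)"
  have "?t * p - ?c * p * ?t = (\<Sum>w\<in>Poly_Mapping.keys p. ?t * Poly_Mapping.single w (Poly_Mapping.lookup p w)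
      - ?c * Poly_Mapping.single w (Poly_Mapping.lookup p w) * ?t)"
    by (subst (1 2) poly_mapping_sum_single[of p]) (simp add: sum_distrib_left sum_distrib_right sum_subtractf)
  also have "\<dots> \<in> iU"
  proof (rule ideal_of_sum[OF RU_car])
    fix w assume w: "w \<in> Poly_Mapping.keys p"
    then have w': "set (letters w) \<subseteq> GU" "wsum (letters w) = \<nu>" using assms by (auto simp: homog_def car_iff)
    let ?a = "scal (Poly_Mapping.lookup p w)"
    have "?a * (?t * wd (letters w) - ?c * wd (letters w) * ?t) \<in> iU"
      using T_word[OF w'(1), of h] w'(2) by (intro iU_left) simp_all
    then show "?t * Poly_Mapping.single w (Poly_Mapping.lookup p w) - ?c * Poly_Mapping.single w (Poly_Mapping.lookup p w) * ?t \<in> iU"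
      by (simp add: single_conv right_diff_distrib free.sc_left_comm[of ?t] mult.assoc mult.commute[of "v_ind powi pair D h \<nu>"] flip: scal_mult)
  qed
  finally show ?thesis .
qed

lemma T_homog_KU:
  assumes "p \<in> homog \<nu>"
  shows "gen_elt (T h) * p - scal (v_ind powi pair D h (\<nu> + m)) * p \<in> KU l m"
proof -
  let ?t = "gen_elt (T h)" and ?c = "v_ind powi pair D h \<nu>" and ?c' = "v_ind powi pair D h m"
  have "(?t * p - scal ?c * p * ?t) + scal ?c * (p * kk h m) \<in> KU l m"
    using assms homog_car by (intro KU_add KU_ideal T_homog KU_scal KU_right) simp_all
  also have "(?t * p - scal ?c * p * ?t) + scal ?c * (p * kk h m) = ?t * p - scal (?c * ?c') * p"
    by (simp add: kk_def right_diff_distrib mult.assoc scal_mult scal_comm[of ?c' p])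
  also have "?c * ?c' = v_ind powi pair D h (\<nu> + m)" using v_ind_nz by (simp add: power_int_add)
  finally show ?thesis .
qed

text \<open>Modulo the block relations K_h times \<open>p\<close> is both \<open>v\<close> to the
  pairing with \<open>l\<close> and \<open>v\<close> to the pairing with \<nu> + m times
  \<open>p\<close>. Some \<open>h\<close> separates the two weights, and the difference of the
  scalars is invertible.\<close>

lemma homog_KU:
  assumes "p \<in> homog \<nu>" "\<nu> \<noteq> l - m"
  shows "p \<in> KU l m"
proof -
  have "\<nu> + m \<noteq> l" using assms(2) by auto
  then obtain h where h: "pair D h (\<nu> + m) \<noteq> pair D h l" using pair_separates by blast
  let ?x = "v_ind powi pair D h (\<nu> + m)" and ?y = "v_ind powi pair D h l"
  have "?x - ?y \<noteq> 0" using h generic_powi_eq_iff[OF generic_v, of "pair D h (\<nu> + m)" "pair D h l"] by simp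
  have "kk h l * p - (gen_elt (T h) * p - scal ?x * p) \<in> KU l m"
    using assms(1) homog_car by (intro KU_diff KU_left T_homog_KU)
  then have "scal (?x - ?y) * p \<in> KU l m"
    by (simp add: kk_def left_diff_distrib free.sc_diff)
  then have "scal (inverse (?x - ?y)) * (scal (?x - ?y) * p) \<in> KU l m" by (rule KU_scal)
  then show ?thesis using \<open>?x - ?y \<noteq> 0\<close> by (simp flip: mult.assoc scal_mult)
qed

lemma homog_repr:
  assumes "p \<in> car GU"
  obtains r where "r \<in> homog (l - m)" "p - r \<in> KU l m"
proof
  let ?f = "\<lambda>w. Poly_Mapping.single w (Poly_Mapping.lookup p w)"
  let ?r = "\<Sum>w\<in>Poly_Mapping.keys p. if wsum (letters w) = l - m then ?f w else 0"
  show "?r \<in> homog (l - m)"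
  proof (rule homog_sum)
    fix w assume "w \<in> Poly_Mapping.keys p"
    from homog_single[OF assms this, of "Poly_Mapping.lookup p w"]
    show "(if wsum (letters w) = l - m then ?f w else 0) \<in> homog (l - m)"
      by (cases "wsum (letters w) = l - m") simp_all
  qed
  have "p - ?r = (\<Sum>w\<in>Poly_Mapping.keys p. ?f w - (if wsum (letters w) = l - m then ?f w else 0))"
    unfolding sum_subtractf using poly_mapping_sum_single[of p] by simp
  also have "\<dots> \<in> KU l m"
  proof (rule KU_sum)
    fix w assume "w \<in> Poly_Mapping.keys p"
    from homog_KU[OF homog_single[OF assms this, of "Poly_Mapping.lookup p w"]]
    show "?f w - (if wsum (letters w) = l - m then ?f w else 0) \<in> KU l m"
      by (cases "wsum (letters w) = l - m") simp_all
  qed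
  finally show "p - ?r \<in> KU l m" .
qed

text \<open>Together with \<open>KU_mult_left\<close> this makes the product of blocks independent
  of representatives. Homogeneity of \<open>s\<close> is what turns the relation for weight
  \<open>m\<close> on its left into the one for weight \<open>n\<close> on its right.\<close>

lemma KU_mult_right:
  assumes "p \<in> KU l m" and s: "s \<in> homog (m - n)"
  shows "p * s \<in> KU l n"
  using assms(1)
proof (induction rule: KU_induct)
  case (ideal p)
  then show ?case using s homog_car by (intro KU_ideal iU_right)
next
  case (left h p)
  then show ?case using KU_left[of "p * s" h l n] homog_car[OF s] by (simp add: mult.assoc)
next
  case (right h p)
  let ?c = "v_ind powi pair D h (m - n)"
  have c: "v_ind powi pair D h m = ?c * v_ind powi pair D h n"
    using v_ind_nz by (simp flip: power_int_add)
  have "p * (gen_elt (T h) * s - scal ?c * s * gen_elt (T h)) + scal ?c * ((p * s) * kk h n) \<in> KU l n"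
    using right homog_car[OF s] by (intro KU_add KU_ideal iU_left T_homog s KU_scal KU_right) simp_all
  also have "p * (gen_elt (T h) * s - scal ?c * s * gen_elt (T h)) + scal ?c * ((p * s) * kk h n) = p * kk h m * s"
    unfolding kk_def c
    by (simp add: right_diff_distrib left_diff_distrib mult.assoc free.sc_left_comm[of p] scal_mult scal_comm[of "v_ind powi pair D h n" s])
  finally show ?case .
next
  case (add p p')
  then show ?case by (simp add: distrib_right KU_add)
next
  case (uminus p)
  then show ?case by (simp add: KU_uminus)
qed

lemma KU_mult_left:
  assumes "p \<in> KU m n" and t: "t \<in> homog (l - m)"
  shows "t * p \<in> KU l n"
  using assms(1)
proof (induction rule: KU_induct)
  case (ideal p)
  then show ?case using t homog_car by (intro KU_ideal iU_left)
next
  case (left h p)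
  define c e where "c = v_ind powi pair D h (l - m)" and "e = v_ind powi pair D h m"
  have nz: "c \<noteq> 0" using v_ind_nz by (simp add: c_def)
  have kl: "kk h l = gen_elt (T h) - scal (c * e)"
    using v_ind_nz by (simp add: kk_def c_def e_def flip: power_int_add)
  have "(x - scal (c * e)) * (t * p) - (x * t - scal c * t * x) * p = scal c * (t * ((x - scal e) * p))" for x
    by (simp only: left_diff_distrib right_diff_distrib mult.assoc free.sc_left_comm[of t] scal_mult) simp
  then have eq: "kk h l * (t * p) - (gen_elt (T h) * t - scal c * t * gen_elt (T h)) * p = scal c * (t * (kk h m * p))"
    unfolding kl by (simp only: kk_def e_def)
  have "gen_elt (T h) * t - scal c * t * gen_elt (T h) \<in> iU"
    unfolding c_def by (rule T_homog[OF t])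
  then have "kk h l * (t * p) - (gen_elt (T h) * t - scal c * t * gen_elt (T h)) * p \<in> KU l n"
    using left homog_car[OF t] by (intro KU_diff KU_left KU_ideal iU_right) simp_all
  then have "scal (inverse c) * (scal c * (t * (kk h m * p))) \<in> KU l n"
    unfolding eq by (rule KU_scal)
  moreover have "scal (inverse c) * (scal c * y) = y" for y :: "('i, 'y) gen free"
    using nz by (simp add: scal_mult[symmetric] mult.assoc[symmetric])
  ultimately show ?case by simp
next
  case (right h p)
  then show ?case using KU_right[of "t * p" h n l] homog_car[OF t] by (simp add: mult.assoc)
next
  case (add p p')
  then show ?case by (simp add: distrib_left KU_add)
next
  case (uminus p)
  then show ?case by (simp add: KU_uminus)
qed

text \<open>Lowering letters stand on the left, so that in the reversed product of
  \<open>lop\<close> they are applied first. The family indexed by \<open>pbw\<close> spans the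
  blocks; it is in general linearly dependent because of the Serre relations.\<close>

definition fe :: "'i list \<times> 'i list \<Rightarrow> ('i, 'y) gen free" where
  "fe x = wd (map (E Minus) (snd x)) * wd (map (E Plus) (fst x))"

definition pbw :: "('i list \<times> 'i list) set" where
  "pbw = {x. set (fst x) \<subseteq> I \<and> set (snd x) \<subseteq> I}"

lemma wdE_homog: "set u \<subseteq> I \<Longrightarrow> wd (map (E s) u) \<in> homog (\<Sum>j\<leftarrow>u. signed s (simple_root D j))"
  by (induction u) (simp_all add: homog_1 homog_mult homog_genE)

lemma fe_homog: "x \<in> pbw \<Longrightarrow> fe x \<in> homog ((\<Sum>j\<leftarrow>snd x. - simple_root D j) + (\<Sum>j\<leftarrow>fst x. simple_root D j))"
  using wdE_homog[of "snd x" Minus] wdE_homog[of "fst x" Plus] by (simp add: fe_def pbw_def homog_mult)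

lemma fe_car: "x \<in> pbw \<Longrightarrow> fe x \<in> car GU"
  using fe_homog homog_car by blast

lemma T_fe:
  assumes "x \<in> pbw"
  shows "\<exists>c. gen_elt (T h) * fe x - scal c * fe x \<in> KU l m"
  using T_homog_KU[OF fe_homog[OF assms]] by blast

definition pspan :: "'x \<Rightarrow> 'x \<Rightarrow> ('i, 'y) gen free set" where
  "pspan l m = fv.span (fe ` pbw \<union> KU l m)"

lemma pspan_KU: "p - p' \<in> KU l m \<Longrightarrow> p' \<in> pspan l m \<Longrightarrow> p \<in> pspan l m"
proof -
  assume "p - p' \<in> KU l m" "p' \<in> pspan l m"
  then have "(p - p') + p' \<in> pspan l m" unfolding pspan_def by (intro fv.span_add) (auto intro: fv.span_base)
  then show ?thesis by simp
qed

lemma pspan_fe: "x \<in> pbw \<Longrightarrow> scal c * fe x \<in> pspan l m"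
  unfolding pspan_def by (intro fv.span_scale fv.span_base) auto

text \<open>Straightening of E_i through the lowering letters; the torus terms act by scalars on a
  homogeneous element of a block. The left weight \<open>l\<close> has to vary in the induction,
  because removing a lowering letter changes it.\<close>

lemma E_fe: "i \<in> I \<Longrightarrow> x \<in> pbw \<Longrightarrow> genE s i * fe x \<in> pspan l m"
proof (cases s)
  case Minus
  assume "i \<in> I" "x \<in> pbw"
  then show ?thesis
    using pspan_fe[of "(fst x, i # snd x)" 1 l m] Minus by (simp add: fe_def pbw_def mult.assoc)
next
  case Plus
  obtain u w where x: "x = (u, w)" by (cases x)
  assume i: "i \<in> I" and "x \<in> pbw"
  then have "genE Plus i * fe (u, w) \<in> pspan l m"
    unfolding x
  proof (induction w arbitrary: l m)
    case Nil
    then show ?case using pspan_fe[of "(i # u, [])" 1 l m] by (simp add: fe_def pbw_def)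
  next
    case (Cons j w)
    then have uw: "(u, w) \<in> pbw" and j: "j \<in> I" by (auto simp: pbw_def)
    let ?y = "fe (u, w)" and ?F = "gen_elt (E Minus j) :: ('i, 'y) gen free"
    let ?C = "if i = j then scal (inverse (q i - inverse (q i))) *
       (gen_elt (T (zmul (d i) (coroot D i))) - gen_elt (T (- zmul (d i) (coroot D i)))) else 0"
    have fe: "fe (u, j # w) = ?F * ?y" by (simp add: fe_def mult.assoc)
    have "(genE Plus i * ?F - ?F * genE Plus i - ?C) * ?y \<in> KU l m"
      using fe_car[OF uw] by (intro KU_ideal iU_right rel_EF i j)
    then have 1: "genE Plus i * fe (u, j # w) - (?F * (genE Plus i * ?y) + ?C * ?y) \<in> KU l m"
      unfolding fe by (simp add: left_diff_distrib mult.assoc algebra_simps)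
    have "?C * ?y \<in> pspan l m"
    proof (cases "i = j")
      case True
      obtain c c' where c: "gen_elt (T (zmul (d i) (coroot D i))) * ?y - scal c * ?y \<in> KU l m"
        "gen_elt (T (- zmul (d i) (coroot D i))) * ?y - scal c' * ?y \<in> KU l m"
        using T_fe[OF uw] by blast
      have "gen_elt (T (zmul (d i) (coroot D i))) * ?y - gen_elt (T (- zmul (d i) (coroot D i))) * ?y \<in> pspan l m"
        using pspan_KU[OF c(1) pspan_fe[OF uw]] pspan_KU[OF c(2) pspan_fe[OF uw]]
        unfolding pspan_def by (rule fv.span_diff)
      then have "scal (inverse (q i - inverse (q i))) * (gen_elt (T (zmul (d i) (coroot D i))) * ?y
          - gen_elt (T (- zmul (d i) (coroot D i))) * ?y) \<in> pspan l m"
        unfolding pspan_def by (rule fv.span_scale)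
      then show ?thesis using True by (simp add: left_diff_distrib mult.assoc)
    next
      case False
      then show ?thesis unfolding pspan_def by (simp add: fv.span_zero)
    qed
    moreover have "?F * (genE Plus i * ?y) \<in> pspan l m"
    proof -
      \<comment> \<open>Left multiplication by the lowering letter \<open>j\<close> carries the span
        for the left weight l + alpha_j into that for \<open>l\<close>, including the kernel
        part.\<close>
      have "p \<in> pspan l' m \<Longrightarrow> l' = l + simple_root D j \<Longrightarrow> ?F * p \<in> pspan l m" for p l'
        unfolding pspan_def[of l']
      proof (induction rule: fv.span_induct_alt)
        case base
        then show ?case unfolding pspan_def by (simp add: fv.span_zero)
      next
        case (step c p p')
        have "?F * p \<in> pspan l m"
          using step.hyps
        proof
          assume "p \<in> fe ` pbw"
          then obtain z where z: "p = fe z" "z \<in> pbw" by blast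
          then show ?thesis
            using pspan_fe[of "(fst z, j # snd z)" 1 l m] j by (simp add: fe_def pbw_def mult.assoc)
        next
          assume "p \<in> KU l' m"
          moreover have "?F \<in> homog (l - l')" using homog_genE[OF j, of Minus] step.prems by simp
          ultimately have "?F * p \<in> KU l m" by (rule KU_mult_left)
          then show ?thesis unfolding pspan_def by (intro fv.span_base) simp
        qed
        then have "scal c * (?F * p) + ?F * p' \<in> pspan l m"
          using step.IH[OF step.prems] unfolding pspan_def by (intro fv.span_add fv.span_scale)
        then show ?case by (simp add: distrib_left free.sc_left_comm[of ?F])
      qed
      then show ?thesis using Cons.IH[OF i uw, of "l + simple_root D j" m] by blast
    qed
    ultimately have "?F * (genE Plus i * ?y) + ?C * ?y \<in> pspan l m"
      unfolding pspan_def by (rule fv.span_add[rotated])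
    from pspan_KU[OF 1 this] show ?case .
  qed
  then show ?thesis using x Plus by simp
qed

text \<open>The claim is proved for all \<open>l\<close> together: a generator on the left shifts
  the weight of the block from which the kernel part comes.\<close>

lemma car_pspan:
  assumes "p \<in> car GU"
  shows "p \<in> pspan l m"
proof -
  have gen_fe: "gen_elt g * p \<in> pspan l m" if g: "g \<in> GU" and p: "p \<in> fv.span (fe ` pbw)" for g p l
    using p
  proof (induction rule: fv.span_induct_alt)
    case base
    show ?case unfolding pspan_def by (simp add: fv.span_zero)
  next
    case (step c p p')
    then obtain x where x: "p = fe x" "x \<in> pbw" by blast
    have "gen_elt g * fe x \<in> pspan l m"
      using g
    proof (cases rule: GU_cases)
      case (E s i)
      then show ?thesis using E_fe[OF _ x(2)] by simp
    next
      case (T h)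
      obtain c where "gen_elt (T h) * fe x - scal c * fe x \<in> KU l m" using T_fe[OF x(2)] by blast
      from pspan_KU[OF this pspan_fe[OF x(2)]] show ?thesis using T by simp
    qed
    then have "scal c * (gen_elt g * fe x) + gen_elt g * p' \<in> pspan l m"
      using step.IH unfolding pspan_def by (intro fv.span_add fv.span_scale)
    then show ?case using x by (simp add: distrib_left free.sc_left_comm[of "gen_elt g"])
  qed
  have KUg: "gen_elt g * k \<in> KU l m" if "k \<in> KU (l - gen_weight D g) m" "g \<in> GU" for g k l
  proof (rule KU_mult_left[OF that(1)])
    show "gen_elt g \<in> homog (l - (l - gen_weight D g))"
      using that(2) by (simp add: homog_def gen_elt_def car_single)
  qed
  from assms have "\<forall>l. p \<in> pspan l m"
  proof (induction rule: car_induct)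
    case (add p p')
    then show ?case unfolding pspan_def by (auto intro: fv.span_add)
  next
    case (scal c p)
    then show ?case unfolding pspan_def by (auto intro: fv.span_scale)
  next
    case one
    show ?case using pspan_fe[of "([], [])" 1] by (simp add: fe_def pbw_def)
  next
    case (gen g p)
    show ?case
    proof
      fix l
      have "p \<in> fv.span (fe ` pbw \<union> KU (l - gen_weight D g) m)" using gen.IH by (simp add: pspan_def)
      then obtain x y where xy: "p = x + y" "x \<in> fv.span (fe ` pbw)" "y \<in> fv.span (KU (l - gen_weight D g) m)"
        unfolding fv.span_Un by blast
      have "y \<in> KU (l - gen_weight D g) m"
        using xy(3) fv.span_minimal[OF order_refl KU_subspace] by blast
      then have "gen_elt g * y \<in> KU l m" using gen.hyps(1) by (rule KUg)
      moreover have "gen_elt g * x \<in> pspan l m" using gen.hyps(1) xy(2) by (rule gen_fe)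
      ultimately show "gen_elt g * p \<in> pspan l m"
        unfolding xy(1) distrib_left pspan_def by (intro fv.span_add) (auto intro: fv.span_base)
    qed
  qed
  then show ?thesis by blast
qed

end


section \<open>The maps between \<open>U\<close> and the \<open>S(\<pi>)\<close>\<close>

lemma (in central_scalars) lift_serre: "lift sc \<phi> (free.serre q n p p') = serre q n (lift sc \<phi> p) (lift sc \<phi> p')"
  by (simp add: serre_def free.serre_def dpow_def free.dpow_def lift_sum lift_mult lift_power)

context datum
begin

abbreviation "GS P \<equiv> S_gens D P"
abbreviation "RS P \<equiv> S_rels D P"
abbreviation "iS P \<equiv> ideal_of (GS P) (RS P)"
abbreviation "W P \<equiv> weyl_orbits D P"
abbreviation "idm P l \<equiv> idem D P l"

lemma GS_E [simp]: "i \<in> I \<Longrightarrow> E s i \<in> GS P"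
  by (auto simp: S_gens_def)

lemma GS_T [simp]: "l \<in> W P \<Longrightarrow> T l \<in> GS P"
  by (auto simp: S_gens_def)

lemma GS_cases [consumes 1, case_names E T]:
  "g \<in> GS P \<Longrightarrow> (\<And>s i. g = E s i \<Longrightarrow> i \<in> I \<Longrightarrow> Q) \<Longrightarrow> (\<And>l. g = T l \<Longrightarrow> l \<in> W P \<Longrightarrow> Q) \<Longrightarrow> Q"
  by (auto simp: S_gens_def)

lemma idem_car [simp]: "idm P l \<in> car (GS P)"
  by (simp add: idem_def)

lemma idem_zero: "l \<notin> W P \<Longrightarrow> idm P l = 0"
  by (simp add: idem_def)

lemma RS_cases [consumes 1, case_names idem one weight comm serre]:
  assumes "r \<in> RS P"
    and "\<And>l l'. r = idm P l * idm P l' - (if l = l' then idm P l else 0) \<Longrightarrow> Q"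
    and "r = (\<Sum>l\<in>W P. idm P l) - 1 \<Longrightarrow> Q"
    and "\<And>s i l. i \<in> I \<Longrightarrow> r = genE s i * idm P l - idm P (l + signed s (simple_root D i)) * genE s i \<Longrightarrow> Q"
    and "\<And>i j. i \<in> I \<Longrightarrow> j \<in> I \<Longrightarrow> r = genE Plus i * genE Minus j - genE Minus j * genE Plus i
        - (if i = j then \<Sum>l\<in>W P. scal (qnum (q i) (pair D (coroot D i) l)) * idm P l else 0) \<Longrightarrow> Q"
    and "\<And>s i j. i \<in> I \<Longrightarrow> j \<in> I \<Longrightarrow> i \<noteq> j \<Longrightarrow> r = free.serre (q i) (sl i j) (genE s i) (genE s j) \<Longrightarrow> Q"
  shows Q
  using assms unfolding S_rels_def serre_rels_eq by (elim UnE CollectE exE conjE singletonE) blast+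

lemma RS_car: "RS P \<subseteq> car (GS P)"
proof
  fix r assume "r \<in> RS P"
  then show "r \<in> car (GS P)"
    by (cases rule: RS_cases) (simp_all add: serre_car)
qed

lemmas iS_add = ideal_of_add[OF RS_car]
  and iS_left = ideal_of_mult_left[OF RS_car]
  and iS_right = ideal_of_mult_right[OF RS_car]
  and iS_gen = ideal_of_gen[OF RS_car]
  and iS_diff = ideal_of_diff[OF RS_car]
  and iS_uminus = ideal_of_uminus[OF RS_car]
  and iS_sum = ideal_of_sum[OF RS_car]
  and iS_0 = ideal_of_0[OF RS_car]

definition eqS :: "'x set \<Rightarrow> ('i, 'x) gen free \<Rightarrow> ('i, 'x) gen free \<Rightarrow> bool" where
  "eqS P x y \<longleftrightarrow> x - y \<in> iS P"

lemma eqS_refl: "eqS P x x"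
  by (simp add: eqS_def iS_0)

lemma eqS_sym: "eqS P x y \<Longrightarrow> eqS P y x"
  using iS_uminus[of "x - y" P] by (simp add: eqS_def)

lemma eqS_trans [trans]: "eqS P x y \<Longrightarrow> eqS P y z \<Longrightarrow> eqS P x z"
  using iS_add[of "x - y" P "y - z"] by (simp add: eqS_def)

lemma eqS_left: "eqS P x y \<Longrightarrow> z \<in> car (GS P) \<Longrightarrow> eqS P (z * x) (z * y)"
  using iS_left[of "x - y" P z] by (simp add: eqS_def right_diff_distrib)

lemma eqS_right: "eqS P x y \<Longrightarrow> z \<in> car (GS P) \<Longrightarrow> eqS P (x * z) (y * z)"
  using iS_right[of "x - y" P z] by (simp add: eqS_def left_diff_distrib)

lemma eqS_sum: "(\<And>s. s \<in> X \<Longrightarrow> eqS P (f s) (g s)) \<Longrightarrow> eqS P (sum f X) (sum g X)"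
  unfolding eqS_def sum_subtractf[symmetric] by (rule iS_sum)

lemma idem_idem: "eqS P (idm P l * idm P l') (if l = l' then idm P l else 0)"
  unfolding eqS_def by (rule iS_gen) (unfold S_rels_def, blast)

lemma idem_one: "eqS P (\<Sum>l\<in>W P. idm P l) 1"
  unfolding eqS_def by (rule iS_gen) (unfold S_rels_def, blast)

lemma E_idem: "i \<in> I \<Longrightarrow> eqS P (genE s i * idm P l) (idm P (l + signed s (simple_root D i)) * genE s i)"
  unfolding eqS_def by (rule iS_gen) (unfold S_rels_def, blast)

lemma S_comm: "i \<in> I \<Longrightarrow> j \<in> I \<Longrightarrow> eqS P (genE Plus i * genE Minus j - genE Minus j * genE Plus i)
    (if i = j then \<Sum>l\<in>W P. scal (qnum (q i) (pair D (coroot D i) l)) * idm P l else 0)"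
  unfolding eqS_def by (rule iS_gen) (unfold S_rels_def, blast)

lemma S_serre: "i \<in> I \<Longrightarrow> j \<in> I \<Longrightarrow> i \<noteq> j \<Longrightarrow> free.serre (q i) (sl i j) (genE s i) (genE s j) \<in> iS P"
  by (rule iS_gen) (unfold S_rels_def serre_rels_eq, blast)

definition SK :: "'x set \<Rightarrow> 'y \<Rightarrow> ('i, 'x) gen free" where
  "SK P h = (\<Sum>l\<in>W P. scal (v_ind powi pair D h l) * idm P l)"

lemma SK_car [simp]: "SK P h \<in> car (GS P)"
  unfolding SK_def by (intro car_sum car_mult) simp_all

lemma SK_superset: "finite B \<Longrightarrow> W P \<subseteq> B \<Longrightarrow> SK P h = (\<Sum>l\<in>B. scal (v_ind powi pair D h l) * idm P l)"
  unfolding SK_def by (intro sum.mono_neutral_left) (auto simp: idem_zero)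

lemma SK_idem:
  assumes "finite (W P)"
  shows "eqS P (SK P h * idm P l) (scal (v_ind powi pair D h l) * idm P l)"
    and "eqS P (idm P l * SK P h) (scal (v_ind powi pair D h l) * idm P l)"
proof -
  let ?c = "\<lambda>k. scal (v_ind powi pair D h k) :: ('i, 'x) gen free"
  have sum: "(\<Sum>k\<in>W P. ?c k * (if k = l then idm P k else 0)) = ?c l * idm P l"
  proof -
    have "(\<Sum>k\<in>W P. ?c k * (if k = l then idm P k else 0)) = (\<Sum>k\<in>W P. if k = l then ?c l * idm P l else 0)"
      by (intro sum.cong refl) simp
    then show ?thesis using assms by (simp add: idem_zero)
  qed
  have "eqS P (\<Sum>k\<in>W P. ?c k * (idm P k * idm P l)) (\<Sum>k\<in>W P. ?c k * (if k = l then idm P k else 0))"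
    by (intro eqS_sum eqS_left idem_idem) simp
  then show "eqS P (SK P h * idm P l) (?c l * idm P l)"
    unfolding sum by (simp add: SK_def sum_distrib_right mult.assoc)
  have "eqS P (idm P l * idm P k) (if k = l then idm P k else 0)" for k
    using idem_idem[of P l k] by (cases "k = l") simp_all
  then have "eqS P (\<Sum>k\<in>W P. ?c k * (idm P l * idm P k)) (\<Sum>k\<in>W P. ?c k * (if k = l then idm P k else 0))"
    by (intro eqS_sum eqS_left) simp_all
  then show "eqS P (idm P l * SK P h) (?c l * idm P l)"
    unfolding sum by (simp add: SK_def sum_distrib_left free.sc_left_comm[of "idm P l"])
qed

primrec sig :: "'x set \<Rightarrow> ('i, 'y) gen \<Rightarrow> ('i, 'x) gen free" where
  "sig P (E s i) = genE s i"
| "sig P (T h) = SK P h"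

definition lS :: "'x set \<Rightarrow> ('i, 'y) gen free \<Rightarrow> ('i, 'x) gen free" where
  "lS P = lift scal (sig P)"

lemma sig_car: "g \<in> GU \<Longrightarrow> sig P g \<in> car (GS P)"
  by (erule GU_cases) simp_all

lemma lS_car [simp]: "p \<in> car GU \<Longrightarrow> lS P p \<in> car (GS P)"
  unfolding lS_def by (rule car_lift[OF sig_car])

lemma lS_simps: "lS P (p + p') = lS P p + lS P p'" "lS P (p - p') = lS P p - lS P p'" "lS P (- p) = - lS P p"
  "lS P (p * p') = lS P p * lS P p'" "lS P (scal c) = scal c" "lS P 1 = 1" "lS P 0 = 0"
  "lS P (genE s i) = genE s i" "lS P (gen_elt (T h)) = SK P h" "lS P (sum f X) = (\<Sum>x\<in>X. lS P (f x))"
  by (simp_all add: lS_def free.lift_add free.lift_diff free.lift_mult free.lift_sum)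

text \<open>In S(P) the element K_h is a combination of orthogonal idempotents, so each relation of
  U reduces to the corresponding relation of S(P) weight by weight.\<close>

lemma sig_rels:
  assumes fin: "finite (W P)" and r: "r \<in> RU"
  shows "lS P r \<in> iS P"
proof -
  have c1: "lS P (gen_elt (T h) * gen_elt (T h') - gen_elt (T (h + h'))) \<in> iS P" for h h'
  proof -
    have "eqS P (SK P h * SK P h') (\<Sum>l\<in>W P. scal (v_ind powi pair D h' l) * (scal (v_ind powi pair D h l) * idm P l))"
      unfolding SK_def[of P h'] sum_distrib_left free.sc_left_comm[of "SK P h"]
      by (intro eqS_sum eqS_left SK_idem fin) simp
    also have "(\<Sum>l\<in>W P. scal (v_ind powi pair D h' l) * (scal (v_ind powi pair D h l) * idm P l)) = SK P (h + h')"
      unfolding SK_def using v_ind_nz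
      by (intro sum.cong refl) (simp add: power_int_add scal_mult mult.assoc scal_comm[of "v_ind powi pair D h' _"])
    finally show ?thesis by (simp add: eqS_def lS_simps)
  qed
  have c2: "lS P (gen_elt (T 0) - 1) \<in> iS P"
    using idem_one[of P] by (simp add: eqS_def lS_simps SK_def)
  have c3: "lS P (gen_elt (T h) * genE s i - scal (v_ind powi signed s (pair D h (simple_root D i))) * genE s i * gen_elt (T h)) \<in> iS P"
    if i: "i \<in> I" for h s i
  proof -
    let ?\<alpha> = "signed s (simple_root D i)"
    let ?v = "\<lambda>l. scal (v_ind powi pair D h l) :: ('i, 'x) gen free"
    \<comment> \<open>Large enough that both \<open>B\<close> and its shift by the root contain the
      support of the idempotents; the sums for K_h on the two sides can then be matched after
      reindexing.\<close>
    define B where "B = W P \<union> (\<lambda>l. l - ?\<alpha>) ` W P"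
    have B: "finite B" "W P \<subseteq> B" using fin by (simp_all add: B_def)
    have B3: "W P \<subseteq> (\<lambda>l. l + ?\<alpha>) ` B"
    proof
      fix l assume "l \<in> W P"
      then have "l - ?\<alpha> \<in> B" by (simp add: B_def)
      then show "l \<in> (\<lambda>l. l + ?\<alpha>) ` B" by (rule rev_image_eqI) simp
    qed
    have "scal (v_ind powi signed s (pair D h (simple_root D i))) * genE s i * SK P h =
        (\<Sum>l\<in>B. ?v (l + ?\<alpha>) * (genE s i * idm P l))"
    proof -
      have v: "?v (l + ?\<alpha>) = scal (v_ind powi signed s (pair D h (simple_root D i))) * ?v l" for l
        using v_ind_nz by (simp add: power_int_add pair_signed scal_mult[symmetric] mult.commute)
      show ?thesis
        unfolding SK_superset[OF B(1,2)] sum_distrib_left v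
        by (simp only: mult.assoc free.sc_left_comm[of "genE s i"])
    qed
    moreover have "eqS P (\<Sum>l\<in>B. ?v (l + ?\<alpha>) * (genE s i * idm P l)) (\<Sum>l\<in>B. ?v (l + ?\<alpha>) * (idm P (l + ?\<alpha>) * genE s i))"
      by (intro eqS_sum eqS_left E_idem i) simp
    moreover have "(\<Sum>l\<in>B. ?v (l + ?\<alpha>) * (idm P (l + ?\<alpha>) * genE s i)) = SK P h * genE s i"
    proof -
      have "(\<Sum>l\<in>B. ?v (l + ?\<alpha>) * idm P (l + ?\<alpha>)) = (\<Sum>l\<in>(\<lambda>l. l + ?\<alpha>) ` B. ?v l * idm P l)"
        by (subst sum.reindex) (auto intro: inj_onI)
      also have "\<dots> = SK P h" using SK_superset[OF finite_imageI[OF B(1)] B3] by simp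
      finally show ?thesis using sum_distrib_right[of "\<lambda>l. ?v (l + ?\<alpha>) * idm P (l + ?\<alpha>)" B "genE s i"]
        by (simp only: mult.assoc)
    qed
    ultimately have "eqS P (scal (v_ind powi signed s (pair D h (simple_root D i))) * genE s i * SK P h) (SK P h * genE s i)"
      by simp
    from eqS_sym[OF this] show ?thesis by (simp add: eqS_def lS_simps)
  qed
  have c4: "lS P (genE Plus i * genE Minus j - genE Minus j * genE Plus i - (if i = j then scal (inverse (q i - inverse (q i)))
             * (gen_elt (T (zmul (d i) (coroot D i))) - gen_elt (T (- zmul (d i) (coroot D i)))) else 0)) \<in> iS P"
    if ij: "i \<in> I" "j \<in> I" for i j
  proof -
    have "scal (inverse (q i - inverse (q i))) * (SK P (zmul (d i) (coroot D i)) - SK P (- zmul (d i) (coroot D i))) =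
        (\<Sum>l\<in>W P. scal (qnum (q i) (pair D (coroot D i) l)) * idm P l)"
      unfolding SK_def sum_subtractf[symmetric] sum_distrib_left
      by (intro sum.cong refl)
        (simp add: q_powi qnum_def divide_inverse free.sc_diff[symmetric] scal_mult[symmetric] mult.commute
          flip: left_diff_distrib mult.assoc)
    then show ?thesis using S_comm[OF ij, of P] by (cases "i = j") (simp_all add: eqS_def lS_simps)
  qed
  have c5: "lS P (free.serre (q i) (sl i j) (genE s i) (genE s j)) \<in> iS P" if "i \<in> I" "j \<in> I" "i \<noteq> j" for i j s
    using S_serre[OF that] by (simp add: lS_def free.lift_serre)
  show ?thesis
    using r c1 c2 c3 c4 c5 unfolding U_rels_def serre_rels_eq
    by (elim UnE CollectE exE conjE singletonE) simp_all
qed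

lemma S_K_eq:
  assumes "finite (W P)"
  shows "S_K D P h = cls (GS P) (RS P) (SK P h)"
proof -
  have "S_K D P h = (\<Oplus>\<^bsub>presented_alg (GS P) (RS P)\<^esub>l\<in>W P. cls (GS P) (RS P) (scal (v_ind powi pair D h l) * idm P l))"
    unfolding S_K_def S_alg_def S_one_def by (simp add: cls_smult[OF RS_car])
  also have "\<dots> = cls (GS P) (RS P) (SK P h)"
    unfolding SK_def by (rule cls_finsum[OF RS_car assms]) simp
  finally show ?thesis .
qed

lemma p_map_cls:
  assumes fin: "finite (W P)" and p: "p \<in> car GU"
  shows "p_map D P (clU p) = cls (GS P) (RS P) (lS P p)"
    and "\<And>p. p \<in> iU \<Longrightarrow> lS P p \<in> iS P"
proof -
  have g: "(case g of E s i \<Rightarrow> S_E D P s i | T h \<Rightarrow> S_K D P h) = cls (GS P) (RS P) (sig P g)" for g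
    by (cases g) (simp_all add: S_E_def S_K_eq[OF fin])
  have rel: "lift scal (sig P) r \<in> iS P" if "r \<in> RU" for r
    using sig_rels[OF fin that] by (simp add: lS_def)
  show "p_map D P (clU p) = cls (GS P) (RS P) (lS P p)"
    using induced_map_presented(1)[OF RS_car sig_car g RU_car rel p]
    by (simp add: p_map_def S_alg_def lS_def cls_def[of GU])
  show "lS P p \<in> iS P" if "p \<in> iU" for p
    using induced_map_presented(2)[OF RS_car sig_car g RU_car rel car_0 that] by (simp add: lS_def)
qed

text \<open>Between the idempotents K_h becomes the scalar prescribed by the block; hence the map
  from the block to S(P) is well defined.\<close>

lemma lS_KU:
  assumes fin: "finite (W P)" and p: "p \<in> KU l m"
  shows "idm P l * lS P p * idm P m \<in> iS P"
  using p
proof (induction rule: KU_induct)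
  case (ideal p)
  then show ?case using p_map_cls(2)[OF fin car_0] by (intro iS_left iS_right) simp_all
next
  case (left h p)
  have "eqS P (idm P l * SK P h * (lS P p * idm P m)) (scal (v_ind powi pair D h l) * idm P l * (lS P p * idm P m))"
    using left by (intro eqS_right SK_idem fin) simp
  then show ?case
    by (simp add: eqS_def lS_simps kk_def left_diff_distrib right_diff_distrib mult.assoc free.sc_left_comm[of "idm P l"])
next
  case (right h p)
  have "eqS P ((idm P l * lS P p) * (SK P h * idm P m)) ((idm P l * lS P p) * (scal (v_ind powi pair D h m) * idm P m))"
    using right by (intro eqS_left SK_idem fin) simp
  then show ?case
    by (simp add: eqS_def lS_simps kk_def left_diff_distrib right_diff_distrib mult.assoc)
next
  case (add p p')
  then show ?case by (simp add: lS_simps distrib_left distrib_right iS_add)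
next
  case (uminus p)
  then show ?case by (simp add: lS_simps iS_uminus)
qed

lemma lS_homog_idem:
  assumes fin: "finite (W P)" and p: "p \<in> homog \<nu>"
  shows "eqS P (lS P p * idm P n) (idm P (\<nu> + n) * lS P p)"
proof -
  have word: "eqS P (lS P (wd xs) * idm P n) (idm P (wsum xs + n) * lS P (wd xs))" if "set xs \<subseteq> GU" for xs
    using that
  proof (induction xs)
    case Nil
    then show ?case by (simp add: lS_simps eqS_refl)
  next
    case (Cons g xs)
    let ?k = "wsum xs + n"
    have g: "g \<in> GU" using Cons.prems by simp
    have car: "lS P (wd xs) \<in> car (GS P)" "lS P (gen_elt g) \<in> car (GS P)"
      using Cons.prems by (simp_all add: wd_car)
    have step: "eqS P (lS P (gen_elt g) * idm P ?k) (idm P (gen_weight D g + ?k) * lS P (gen_elt g))"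
      using g
    proof (cases rule: GU_cases)
      case (E s i)
      then show ?thesis using E_idem[of i P s ?k] by (simp add: lS_simps add.commute)
    next
      case (T h)
      then show ?thesis using eqS_trans[OF SK_idem(1)[OF fin] eqS_sym[OF SK_idem(2)[OF fin]]] by (simp add: lS_simps)
    qed
    have "eqS P (lS P (gen_elt g) * (lS P (wd xs) * idm P n)) (lS P (gen_elt g) * (idm P ?k * lS P (wd xs)))"
      using Cons car by (intro eqS_left) simp_all
    also have "eqS P (lS P (gen_elt g) * (idm P ?k * lS P (wd xs))) (idm P (gen_weight D g + ?k) * lS P (gen_elt g) * lS P (wd xs))"
      using eqS_right[OF step car(1)] by (simp add: mult.assoc)
    finally show ?case by (simp add: lS_simps mult.assoc add.assoc)
  qed
  have keys: "set (letters w) \<subseteq> GU" "wsum (letters w) = \<nu>" if "w \<in> Poly_Mapping.keys p" for w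
    using p that by (auto simp: homog_def car_iff)
  let ?f = "\<lambda>w. Poly_Mapping.single w (Poly_Mapping.lookup p w)"
  have "eqS P (\<Sum>w\<in>Poly_Mapping.keys p. lS P (?f w) * idm P n) (\<Sum>w\<in>Poly_Mapping.keys p. idm P (\<nu> + n) * lS P (?f w))"
  proof (rule eqS_sum)
    fix w assume w: "w \<in> Poly_Mapping.keys p"
    let ?c = "scal (Poly_Mapping.lookup p w) :: ('i, 'x) gen free"
    have "eqS P (?c * (lS P (wd (letters w)) * idm P n)) (?c * (idm P (\<nu> + n) * lS P (wd (letters w))))"
      using word[OF keys(1)[OF w]] keys(2)[OF w] by (intro eqS_left) simp_all
    then show "eqS P (lS P (?f w) * idm P n) (idm P (\<nu> + n) * lS P (?f w))"
      by (simp add: single_conv lS_simps mult.assoc free.sc_left_comm[of "idm P (\<nu> + n)"])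
  qed
  then have "eqS P (lS P (\<Sum>w\<in>Poly_Mapping.keys p. ?f w) * idm P n) (idm P (\<nu> + n) * lS P (\<Sum>w\<in>Poly_Mapping.keys p. ?f w))"
    by (simp add: lS_simps sum_distrib_left sum_distrib_right)
  then show ?thesis by (simp flip: poly_mapping_sum_single)
qed

primrec tau :: "'x set \<Rightarrow> ('i, 'x) gen \<Rightarrow> ('i, 'x) gen free" where
  "tau P (E s i) = genE s i"
| "tau P (T l) = idm P l"

lemma tau_idem: "P \<subseteq> P' \<Longrightarrow> lift scal (tau P) (idm P' l) = idm P l"
  using weyl_orbits_mono[of P P'] by (auto simp: idem_def)

lemma sum_orbits_mono:
  assumes "P \<subseteq> P'" "finite (W P')"
  shows "(\<Sum>l\<in>W P'. scal (c l) * idm P l) = (\<Sum>l\<in>W P. scal (c l) * idm P l)"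
  using weyl_orbits_mono[OF assms(1)] assms(2)
  by (intro sum.mono_neutral_right) (auto simp: idem_zero)

text \<open>Idempotents outside \<open>W P\<close> are sent to 0, and under this convention the
  relations for the larger set become those for the smaller one.\<close>

lemma S_trans_cls:
  assumes P: "P \<subseteq> P'" and fin: "finite (W P')" and p: "p \<in> car (GS P')"
  shows "S_trans D P (cls (GS P') (RS P') p) = cls (GS P) (RS P) (lift scal (tau P) p)"
proof -
  have t: "tau P g \<in> car (GS P)" if "g \<in> GS P'" for g
    using that by (cases rule: GS_cases) simp_all
  have g: "(case g of E s i \<Rightarrow> S_E D P s i | T h \<Rightarrow> S_one D P h) = cls (GS P) (RS P) (tau P g)" for g
    by (cases g) (simp_all add: S_E_def S_one_def)
  have rel: "lift scal (tau P) r \<in> iS P" if "r \<in> RS P'" for r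
    using that
  proof (cases rule: RS_cases)
    case (idem l l')
    then show ?thesis using idem_idem[of P l l'] by (auto simp: free.lift_diff free.lift_mult tau_idem[OF P] eqS_def)
  next
    case one
    then show ?thesis
      using idem_one[of P] sum_orbits_mono[OF P fin, of "\<lambda>_. 1"]
      by (simp add: free.lift_diff free.lift_sum tau_idem[OF P] eqS_def)
  next
    case (weight s i l)
    then show ?thesis using E_idem[of i P s l] by (simp add: free.lift_diff free.lift_mult tau_idem[OF P] eqS_def)
  next
    case (comm i j)
    then show ?thesis
      using S_comm[of i j P] sum_orbits_mono[OF P fin]
      by (cases "i = j") (simp_all add: free.lift_diff free.lift_mult free.lift_sum tau_idem[OF P] eqS_def)
  next
    case (serre s i j)
    then show ?thesis using S_serre[of i j s P] by (simp add: free.lift_serre)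
  qed
  show ?thesis
    using induced_map_presented(1)[OF RS_car t g RS_car rel p]
    by (simp add: S_trans_def S_alg_def cls_def[of "GS P'"])
qed

text \<open>The compatibility of the maps out of U with the transition maps already holds for
  representatives, not merely modulo the relations.\<close>

lemma tau_lS:
  assumes P: "P \<subseteq> P'" and fin: "finite (W P')"
  shows "lift scal (tau P) (lS P' p) = lS P p"
proof -
  have "lift scal (tau P) (sig P' g) = sig P g" for g
    using sum_orbits_mono[OF P fin]
    by (cases g) (simp_all add: SK_def free.lift_sum free.lift_mult tau_idem[OF P])
  then show ?thesis by (simp add: lS_def free.lift_lift)
qed

end


section \<open>The tensor modules as modules over \<open>S(\<pi>)\<close>\<close>

context datum
begin

primrec wt :: "'x \<Rightarrow> 'i list \<times> 'i list \<Rightarrow> 'x" where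
  "wt m (u, w) = m + (\<Sum>j\<leftarrow>u. simple_root D j) - (\<Sum>j\<leftarrow>w. simple_root D j)"

lemma wt_mset: "mset u = mset u' \<Longrightarrow> mset w = mset w' \<Longrightarrow> wt m (u, w) = wt m (u', w')"
  unfolding wt.simps sum_mset_sum_list[symmetric] mset_map by simp

lemma wt_Cons1: "wt m (i # u, w) = wt m (u, w) + simple_root D i"
  and wt_Cons2: "wt m (u, i # w) = wt m (u, w) - simple_root D i"
  by (simp_all add: algebra_simps)

lemma wt_rsum:
  assumes "set u \<subseteq> I" "set w \<subseteq> I"
  shows "wt m (u, w) = m + rsum (\<lambda>i. content u i - content w i)"
proof -
  have "(\<Sum>j\<leftarrow>u. simple_root D j) = rsum (content u)" if "set u \<subseteq> I" for u
    using that
  proof (induction u)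
    case Nil
    show ?case by (simp add: content_def rsum_def)
  next
    case (Cons k u)
    have eq: "content (k # u) = (content u)(k := content u k + 1)" by (auto simp: content_def fun_eq_iff)
    have "rsum (content (k # u)) = rsum (content u) + simple_root D k"
      unfolding eq using rsum_upd[of k "content u" 1] Cons.prems by simp
    then show ?case using Cons by (simp add: add.commute)
  qed
  then show ?thesis using assms by (simp add: rsum_diff)
qed

text \<open>The transposed action of the idempotent 1_l: restriction of a function to the pairs of
  weight \<open>l\<close>.\<close>

definition mask :: "'x \<Rightarrow> 'x \<Rightarrow> ('i list \<times> 'i list) lop" where
  "mask m l = diag (\<lambda>x. if wt m x = l then 1 else 0)"

primrec rop :: "('i \<Rightarrow> int) \<Rightarrow> ('i \<Rightarrow> int) \<Rightarrow> 'x \<Rightarrow> ('i, 'x) gen \<Rightarrow> ('i list \<times> 'i list) lop" where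
  "rop a b m (E s i) = (case s of Plus \<Rightarrow> TE a b i | Minus \<Rightarrow> TF a b i)"
| "rop a b m (T l) = mask m l"

definition rho :: "('i \<Rightarrow> int) \<Rightarrow> ('i \<Rightarrow> int) \<Rightarrow> 'x \<Rightarrow> ('i, 'x) gen free \<Rightarrow> ('i list \<times> 'i list) lop" where
  "rho a b m = lift sc_lop (rop a b m)"

lemma rho_simps: "rho a b m (p + p') = rho a b m p + rho a b m p'" "rho a b m (p - p') = rho a b m p - rho a b m p'"
  "rho a b m (p * p') = rho a b m p * rho a b m p'" "rho a b m (scal c) = sc_lop c" "rho a b m 1 = 1" "rho a b m 0 = 0"
  "rho a b m (genE s i) = (case s of Plus \<Rightarrow> TE a b i | Minus \<Rightarrow> TF a b i)"
  "rho a b m (gen_elt (T l)) = mask m l" "rho a b m (sum f X) = (\<Sum>x\<in>X. rho a b m (f x))"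
  by (simp_all add: rho_def lop.lift_add lop.lift_diff lop.lift_mult lop.lift_sum)

lemma app_mask: "app (mask m l) \<phi> x = (if wt m x = l then \<phi> x else 0)"
  by (simp add: mask_def app_diag)

lemma mask_TE: "TE a b i * mask m l = mask m (l + simple_root D i) * TE a b i"
proof (rule lop_eqI2)
  fix \<phi> u w
  have "dn b i (\<lambda>w. app (mask m (l + simple_root D i)) \<phi> (u, w)) w =
      dn b i (\<lambda>w'. (if wt m (u, w) = l then 1 else 0) * \<phi> (u, w')) w"
  proof (rule dn_cong)
    fix w' assume "mset w = add_mset i (mset w')"
    then have "wt m (u, w) = wt m (u, i # w')" by (intro wt_mset) simp_all
    then have "wt m (u, w') = wt m (u, w) + simple_root D i" using wt_Cons2[of m u i w'] by simp
    then show "app (mask m (l + simple_root D i)) \<phi> (u, w') = (if wt m (u, w) = l then 1 else 0) * \<phi> (u, w')"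
      by (simp add: app_mask del: wt.simps)
  qed
  also have "\<dots> = (if wt m (u, w) = l then 1 else 0) * dn b i (\<lambda>w. \<phi> (u, w)) w" by (rule dn_scale)
  finally show "app (TE a b i * mask m l) \<phi> (u, w) = app (mask m (l + simple_root D i) * TE a b i) \<phi> (u, w)"
    using wt_Cons1[of m i u w]
    by (cases "wt m (u, w) = l") (simp_all add: app_TE app_mask del: wt.simps)
qed

lemma mask_TF: "TF a b i * mask m l = mask m (l - simple_root D i) * TF a b i"
proof (rule lop_eqI2)
  fix \<phi> u w
  have "dn a i (\<lambda>u. app (mask m (l - simple_root D i)) \<phi> (u, w)) u =
      dn a i (\<lambda>u'. (if wt m (u, w) = l then 1 else 0) * \<phi> (u', w)) u"
  proof (rule dn_cong)
    fix u' assume "mset u = add_mset i (mset u')"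
    then have "wt m (u, w) = wt m (i # u', w)" by (intro wt_mset) simp_all
    then have "wt m (u', w) = wt m (u, w) - simple_root D i" using wt_Cons1[of m i u' w] by simp
    then show "app (mask m (l - simple_root D i)) \<phi> (u', w) = (if wt m (u, w) = l then 1 else 0) * \<phi> (u', w)"
      by (simp add: app_mask del: wt.simps)
  qed
  also have "\<dots> = (if wt m (u, w) = l then 1 else 0) * dn a i (\<lambda>u. \<phi> (u, w)) u" by (rule dn_scale)
  finally show "app (TF a b i * mask m l) \<phi> (u, w) = app (mask m (l - simple_root D i) * TF a b i) \<phi> (u, w)"
    using wt_Cons2[of m u i w]
    by (cases "wt m (u, w) = l") (simp_all add: app_TF app_mask del: wt.simps)
qed

lemma tht_wt:
  assumes "b i - a i = pvm m i"
  shows "tht a b i x = pair D (coroot D i) (wt m x)"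
  using assms by (cases x) (simp add: tht_def ht_def pvm_def pair_sum_list o_def)

lemma tmod_mask: "\<phi> \<in> tmod a b \<Longrightarrow> app (mask m l) \<phi> \<in> tmod a b"
proof -
  assume \<phi>: "\<phi> \<in> tmod a b"
  have "(\<lambda>x. (if wt m x = l then 1 else 0) * \<phi> x) \<in> tmod a b"
  proof (rule tmod_diag[OF \<phi>])
    fix u u' w w' :: "'i list" assume "mset u = mset u'" "mset w = mset w'"
    then have "wt m (u, w) = wt m (u', w')" by (rule wt_mset)
    then show "(if wt m (u, w) = l then 1 else 0 :: qv) = (if wt m (u', w') = l then 1 else 0)"
      by (simp del: wt.simps)
  qed
  moreover have "app (mask m l) \<phi> = (\<lambda>x. (if wt m x = l then 1 else 0) * \<phi> x)"
    by (rule ext) (simp add: app_mask)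
  ultimately show ?thesis by simp
qed

context
  fixes a b :: "'i \<Rightarrow> int" and m :: 'x and P :: "'x set"
  assumes a: "\<And>i. i \<in> I \<Longrightarrow> a i \<ge> 0" and b: "\<And>i. i \<in> I \<Longrightarrow> b i \<ge> 0"
    and ab: "\<And>i. i \<in> I \<Longrightarrow> b i - a i = pvm m i"
    and fin: "finite (W P)"
    and supp: "\<And>\<phi> x. \<phi> \<in> tmod a b \<Longrightarrow> \<phi> x \<noteq> 0 \<Longrightarrow> wt m x \<in> W P"
begin

lemma tmod_rop:
  assumes "g \<in> GS P" and \<phi>: "\<phi> \<in> tmod a b"
  shows "app (rop a b m g) \<phi> \<in> tmod a b"
  using assms(1)
proof (cases rule: GS_cases)
  case (E s i)
  show ?thesis using E \<phi> a b by (cases s) (simp_all add: tmod_TE tmod_TF)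
qed (simp add: tmod_mask \<phi>)

lemma tmod_rho: "p \<in> car (GS P) \<Longrightarrow> \<phi> \<in> tmod a b \<Longrightarrow> app (rho a b m p) \<phi> \<in> tmod a b"
proof (induction arbitrary: \<phi> rule: car_induct)
  case (add p p')
  then show ?case using tmod_lin[of "app (rho a b m p) \<phi>" a b "app (rho a b m p') \<phi>" 1] by (simp add: rho_simps)
next
  case (scal c p)
  have "(\<lambda>x. 0 + c * \<phi> x) \<in> tmod a b" using scal.prems by (intro tmod_lin tmod_zero)
  then have "app (rho a b m p) (\<lambda>x. c * \<phi> x) \<in> tmod a b" using scal.IH by simp
  then show ?case by (simp add: rho_simps app_sc_fun)
next
  case one
  then show ?case by (simp add: rho_simps)
next
  case (gen g p)
  have "rho a b m (gen_elt g) = rop a b m g" by (simp add: rho_def)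
  then show ?case using gen tmod_rop by (simp add: rho_simps)
qed

text \<open>For \<open>l\<close> outside \<open>W P\<close> the left side is zero by convention, the
  right side because \<open>supp\<close> excludes such weights.\<close>

lemma rho_idem: "\<phi> \<in> tmod a b \<Longrightarrow> app (rho a b m (idm P l)) \<phi> = (\<lambda>x. if wt m x = l then \<phi> x else 0)"
proof (cases "l \<in> W P")
  case True
  then show ?thesis by (simp add: idem_def rho_simps app_mask fun_eq_iff)
next
  case False
  assume "\<phi> \<in> tmod a b"
  then have "wt m x = l \<Longrightarrow> \<phi> x = 0" for x using supp[of \<phi> x] False by (cases "\<phi> x = 0") simp_all
  then show ?thesis using False by (simp add: idem_def rho_simps fun_eq_iff)
qed

lemma app_rho_sum: "app (rho a b m (sum f X)) \<phi> x = (\<Sum>y\<in>X. app (rho a b m (f y)) \<phi> x)"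
  by (simp add: rho_simps app_sum)

lemma sum_idem_supp:
  assumes "\<phi> \<in> tmod a b"
  shows "(\<Sum>l\<in>W P. c l * (if wt m x = l then \<phi> x else 0)) = c (wt m x) * \<phi> x"
proof -
  have "(\<Sum>l\<in>W P. c l * (if wt m x = l then \<phi> x else 0)) = (\<Sum>l\<in>W P. if wt m x = l then c (wt m x) * \<phi> x else 0)"
    by (intro sum.cong refl) simp
  also have "\<dots> = c (wt m x) * \<phi> x"
    using fin supp[OF assms, of x] by (cases "\<phi> x = 0") simp_all
  finally show ?thesis .
qed

lemma rho_rels:
  assumes "r \<in> RS P" and \<phi>: "\<phi> \<in> tmod a b"
  shows "app (rho a b m r) \<phi> = (\<lambda>x. 0)"
  using assms(1)
proof (cases rule: RS_cases)
  case (idem l l')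
  have 1: "(\<lambda>x. if wt m x = l then \<phi> x else 0) \<in> tmod a b"
    using tmod_rho[OF idem_car \<phi>, of l] by (simp only: rho_idem[OF \<phi>])
  have "app (rho a b m (idm P l * idm P l')) \<phi> x = (if l = l' then app (rho a b m (idm P l)) \<phi> x else 0)" for x
    by (simp add: rho_simps rho_idem[OF \<phi>] rho_idem[OF 1])
  then show ?thesis unfolding idem by (auto simp: rho_simps(2,6) fun_eq_iff)
next
  case one
  have "app (rho a b m (\<Sum>l\<in>W P. idm P l)) \<phi> x = \<phi> x" for x
    using sum_idem_supp[OF \<phi>, of "\<lambda>_. 1" x] by (simp add: app_rho_sum rho_idem[OF \<phi>])
  then show ?thesis unfolding one by (simp add: rho_simps(2,5) fun_eq_iff)
next
  case (weight s i l)
  let ?l = "l + signed s (simple_root D i)"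
  have E\<phi>: "app (rho a b m (genE s i)) \<phi> \<in> tmod a b" by (rule tmod_rho[OF _ \<phi>]) (simp add: weight)
  have "app (rho a b m (genE s i * idm P l)) \<phi> = app (mask m l) (app (rho a b m (genE s i)) \<phi>)"
    by (simp add: rho_simps(3) rho_idem[OF E\<phi>] app_mask fun_eq_iff)
  also have "\<dots> = app (rho a b m (genE s i) * mask m l) \<phi>" by simp
  also have "rho a b m (genE s i) * mask m l = mask m ?l * rho a b m (genE s i)"
    by (cases s) (simp_all add: rho_simps(7) mask_TE mask_TF)
  also have "app (mask m ?l * rho a b m (genE s i)) \<phi> = app (rho a b m (idm P ?l * genE s i)) \<phi>"
  proof -
    have "app (mask m ?l) \<phi> = app (rho a b m (idm P ?l)) \<phi>" by (simp add: rho_idem[OF \<phi>] app_mask fun_eq_iff)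
    then show ?thesis by (simp add: rho_simps(3))
  qed
  finally show ?thesis unfolding weight(2) by (simp add: rho_simps(2))
next
  case (comm i j)
  have "app (rho a b m (genE Plus i * genE Minus j - genE Minus j * genE Plus i)) \<phi> x =
     (if i = j then qnum (q i) (pair D (coroot D i) (wt m x)) * \<phi> x else 0)" for x
    using TE_TF[OF comm(1,2), of a b] brk_diag[OF q_nz[OF comm(1)], of "tht a b i" 0] tht_wt[of b i a m] ab[OF comm(1)]
    by (simp only: rho_simps(2,3,7) sign.case) (simp add: app_diag)
  moreover have "app (rho a b m (\<Sum>l\<in>W P. scal (qnum (q i) (pair D (coroot D i) l)) * idm P l)) \<phi> x =
      qnum (q i) (pair D (coroot D i) (wt m x)) * \<phi> x" for x
  proof -
    have "app (rho a b m (scal c * idm P l)) \<phi> x = c * (if wt m x = l then \<phi> x else 0)" for c l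
      by (simp only: rho_simps(3,4) app_sc_mult rho_idem[OF \<phi>])
    then show ?thesis unfolding app_rho_sum using sum_idem_supp[OF \<phi>] by simp
  qed
  ultimately show ?thesis unfolding comm(3) by (auto simp: rho_simps(2,6) fun_eq_iff)
next
  case (serre s i j)
  have "rho a b m (free.serre (q i) (sl i j) (genE s i) (genE s j)) =
      lop.serre (q i) (sl i j) (rho a b m (genE s i)) (rho a b m (genE s j))"
    by (simp add: rho_def lop.lift_serre)
  then show ?thesis
    unfolding serre(4)
    using serre_TE_zero[OF serre(1-3) a b \<phi>] serre_TF_zero[OF serre(1-3) a b \<phi>]
    by (cases s) (simp_all add: rho_simps(7))
qed

text \<open>The relations of S(P) hold on \<open>tmod\<close> and not on all functions, so the
  elements that act as zero form an ideal only because \<open>tmod\<close> is stable under the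
  action.\<close>

lemma rho_ideal: "p \<in> iS P \<Longrightarrow> \<phi> \<in> tmod a b \<Longrightarrow> app (rho a b m p) \<phi> = (\<lambda>x. 0)"
proof -
  let ?J = "{p \<in> car (GS P). \<forall>\<phi>\<in>tmod a b. app (rho a b m p) \<phi> = (\<lambda>x. 0)}"
  have "iS P \<subseteq> ?J"
  proof (rule ideal_of_subset[OF RS_car])
    show "RS P \<subseteq> ?J" using RS_car rho_rels by blast
    show "p + p' \<in> ?J" if "p \<in> ?J" "p' \<in> ?J" for p p'
      using that by (simp add: rho_simps)
    show "p' * p \<in> ?J \<and> p * p' \<in> ?J" if "p \<in> ?J" "p' \<in> car (GS P)" for p p'
      using that tmod_rho[OF that(2)] by (simp add: rho_simps app_zero)
  qed (auto simp: rho_simps)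
  then show "p \<in> iS P \<Longrightarrow> \<phi> \<in> tmod a b \<Longrightarrow> app (rho a b m p) \<phi> = (\<lambda>x. 0)" by blast
qed

end

end

section \<open>Separation of the blocks by the \<open>S(\<pi>)\<close>\<close>

context datum
begin

lemma satset_supports:
  assumes a: "\<And>i. i \<in> I \<Longrightarrow> a i \<ge> 0" and b: "\<And>i. i \<in> I \<Longrightarrow> b i \<ge> 0"
  obtains P where "P \<in> finite_saturated D" "\<And>\<phi> x. \<phi> \<in> tmod a b \<Longrightarrow> \<phi> x \<noteq> 0 \<Longrightarrow> wt m x \<in> W P"
proof -
  have "\<exists>N. \<forall>\<phi>\<in>lowest a. \<forall>w. \<phi> w \<noteq> 0 \<longrightarrow> length w \<le> N" by (rule lowest_bounded) (rule a)
  then obtain N1 where N1: "\<And>\<phi> w. \<phi> \<in> lowest a \<Longrightarrow> \<phi> w \<noteq> 0 \<Longrightarrow> length w \<le> N1" by blast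
  have "\<exists>N. \<forall>\<phi>\<in>lowest b. \<forall>w. \<phi> w \<noteq> 0 \<longrightarrow> length w \<le> N" by (rule lowest_bounded) (rule b)
  then obtain N2 where N2: "\<And>\<phi> w. \<phi> \<in> lowest b \<Longrightarrow> \<phi> w \<noteq> 0 \<Longrightarrow> length w \<le> N2" by blast
  define X where "X = {u. set u \<subseteq> I \<and> length u \<le> N1} \<times> {w. set w \<subseteq> I \<and> length w \<le> N2}"
  define f where "f x = nrm (pvm m) (\<lambda>i. content (fst x) i - content (snd x) i)" for x :: "'i list \<times> 'i list"
  \<comment> \<open>Only finitely many pairs of words carry nonzero values, so their weights lie in
    one ball; including 0 makes the radius admissible for \<open>satset\<close>.\<close>
  define C where "C = Max (insert 0 (f ` X))"
  have "finite X" unfolding X_def by (intro finite_cartesian_product finite_lists_length_le finite_I)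
  then have C: "C \<ge> 0" "x \<in> X \<Longrightarrow> f x \<le> C" for x unfolding C_def by (intro Max_ge; simp)+
  show thesis
  proof (rule that)
    show "satset m C \<in> finite_saturated D" by (rule satset_finite_saturated[OF C(1)])
    fix \<phi> :: "'i list \<times> 'i list \<Rightarrow> qv" and x assume \<phi>: "\<phi> \<in> tmod a b" "\<phi> x \<noteq> 0"
    obtain u w where x: "x = (u, w)" by (cases x)
    have l1: "(\<lambda>u. \<phi> (u, w)) \<in> lowest a" and l2: "(\<lambda>w. \<phi> (u, w)) \<in> lowest b"
      using \<phi>(1) by (simp_all add: tmod_def)
    have u: "set u \<subseteq> I" "length u \<le> N1" using lowestD(1)[OF l1, of u] N1[OF l1, of u] \<phi>(2) x by simp_all
    have w: "set w \<subseteq> I" "length w \<le> N2" using lowestD(1)[OF l2, of w] N2[OF l2, of w] \<phi>(2) x by simp_all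
    have "f x \<le> C" using u w by (intro C(2)) (simp add: X_def x)
    then show "wt m x \<in> W (satset m C)"
      unfolding x wt_rsum[OF u(1) w(1)] by (intro satset_orbits) (simp add: f_def x)
  qed
qed

text \<open>Lets a functional that kills all multiples of Serre elements satisfy the
  \<open>ser\<close> condition of \<open>lowest\<close> at any position in a word.\<close>

lemma ser_functional:
  fixes x y :: "('i, 't) gen free"
  assumes add: "\<And>p p'. \<psi> (p + p') = \<psi> p + \<psi> p'" and scal: "\<And>c p. \<psi> (scal c * p) = c * \<psi> p"
  shows "ser i j (\<lambda>v. \<psi> (x * wd (map (E s) v) * y)) = \<psi> (x * free.serre (q i) (sl i j) (genE s i) (genE s j) * y)"
proof -
  have "\<psi> 0 = 0" using scal[of 0 0] by simp
  then have sum: "\<psi> (sum f X) = (\<Sum>k\<in>X. \<psi> (f k))" for f and X :: "nat set"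
    by (induction X rule: infinite_finite_induct) (simp_all add: add)
  have wd: "wd (map (E s) (replicate k i @ [j] @ replicate r i)) =
      (genE s i ^ k * (genE s j * genE s i ^ r) :: ('i, 't) gen free)" for k r
    by (simp add: map_replicate_const)
  have T: "\<psi> (x * ((- 1) ^ r * free.dpow (q i) (genE s i) k * genE s j * free.dpow (q i) (genE s i) r) * y) =
      (- 1) ^ r * (inverse (qfact (q i) k) * (inverse (qfact (q i) r) * \<psi> (x * wd (map (E s) (replicate k i @ [j] @ replicate r i)) * y)))" for k r
  proof -
    have "x * (scal c * (scal c' * e) * f * (scal c'' * g)) * y = scal c * (scal c' * (scal c'' * (x * (e * (f * g)) * y)))"
      for c c' c'' and e f g :: "('i, 't) gen free"
    proof -
      have "x * (scal c * (scal c' * e) * f * (scal c'' * g)) * y = x * (scal c * (scal c' * (e * (f * (scal c'' * (g * y))))))"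
        by (simp only: mult.assoc)
      also have "f * (scal c'' * (g * y)) = scal c'' * (f * (g * y))" by (rule free.sc_left_comm)
      also have "e * (scal c'' * (f * (g * y))) = scal c'' * (e * (f * (g * y)))" by (rule free.sc_left_comm)
      also have "x * (scal c * (scal c' * (scal c'' * (e * (f * (g * y)))))) =
          scal c * (x * (scal c' * (scal c'' * (e * (f * (g * y))))))" by (rule free.sc_left_comm)
      also have "x * (scal c' * (scal c'' * (e * (f * (g * y))))) = scal c' * (x * (scal c'' * (e * (f * (g * y)))))"
        by (rule free.sc_left_comm)
      also have "x * (scal c'' * (e * (f * (g * y)))) = scal c'' * (x * (e * (f * (g * y))))" by (rule free.sc_left_comm)
      finally show ?thesis by (simp only: mult.assoc)
    qed
    moreover have "(- 1) ^ r * free.dpow (q i) (genE s i) k * genE s j * free.dpow (q i) (genE s i) r =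
        scal ((- 1) ^ r) * (scal (inverse (qfact (q i) k)) * genE s i ^ k) * genE s j *
          (scal (inverse (qfact (q i) r)) * genE s i ^ r :: ('i, 't) gen free)"
      by (simp only: free.dpow_def free.sc_neg_1_power)
    ultimately show ?thesis by (simp only: scal wd)
  qed
  have "x * free.serre (q i) (sl i j) (genE s i) (genE s j) * y =
     (\<Sum>r\<le>sl i j. x * ((- 1) ^ r * free.dpow (q i) (genE s i) (sl i j - r) * genE s j * free.dpow (q i) (genE s i) r) * y)"
    unfolding free.serre_def by (simp only: sum_distrib_left sum_distrib_right)
  then show ?thesis by (simp only: sum T ser_def)
qed

lemma app_TE_list: "app (prod_list (map (TE a b) u)) \<phi> (v, []) = \<phi> (u @ v, [])"
  by (induction u arbitrary: \<phi>) (simp_all add: app_TE)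

text \<open>The correction term of \<open>TF\<close> evaluates at first words shorter by one letter,
  of length less than \<open>N\<close>, where the function vanishes. This property passes to the
  function after each step.\<close>

lemma app_TF_list:
  assumes "\<And>u w. length u < N \<Longrightarrow> \<phi> (u, w) = 0" "length u \<le> N"
  shows "app (prod_list (map (TF a b) w)) \<phi> (u, x) = \<phi> (u, w @ x)"
  using assms(1)
proof (induction w arbitrary: \<phi>)
  case (Cons i w)
  have TF: "app (TF a b i) \<phi> (u', y) = \<phi> (u', i # y)" if "length u' \<le> N" for u' y
  proof -
    have "dn a i (\<lambda>u. \<phi> (u, y)) u' = 0"
    proof (rule dn_zero)
      fix u0 assume "mset u' = add_mset i (mset u0)"
      then have "length u' = Suc (length u0)" by (metis size_add_mset size_mset)
      then show "\<phi> (u0, y) = 0" using that by (intro Cons.prems) simp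
    qed
    then show ?thesis by (simp add: app_TF)
  qed
  have "app (prod_list (map (TF a b) w)) (app (TF a b i) \<phi>) (u, x) = app (TF a b i) \<phi> (u, w @ x)"
    using Cons.prems by (intro Cons.IH) (simp add: TF)
  then show ?case using TF[OF assms(2)] by simp
qed simp

lemma rho_fe: "rho a b m (lS P (fe x)) = prod_list (map (TF a b) (snd x)) * prod_list (map (TE a b) (fst x))"
proof -
  have "rho a b m (lS P (wd (map (E s) u))) = prod_list (map (\<lambda>i. case s of Plus \<Rightarrow> TE a b i | Minus \<Rightarrow> TF a b i) u)" for s u
    by (induction u) (simp_all add: lS_simps rho_simps)
  then show ?thesis by (simp add: fe_def lS_simps rho_simps)
qed

text \<open>Cutting off at the lengths \<open>N\<close> and \<open>M\<close> respects the Serre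
  conditions, since these compare words with the same letters. The integrability conditions concern
  words that are too long to carry a value, because \<open>a\<close> and \<open>b\<close> are at
  least the cut-offs.\<close>

lemma functional_tmod:
  assumes add: "\<And>p p'. \<psi> (p + p') = \<psi> p + \<psi> p'" and scal: "\<And>c p. \<psi> (scal c * p) = c * \<psi> p"
    and ideal: "\<And>p. p \<in> iU \<Longrightarrow> \<psi> p = 0"
    and a: "\<And>i. i \<in> I \<Longrightarrow> a i \<ge> int N" and b: "\<And>i. i \<in> I \<Longrightarrow> b i \<ge> int M"
  shows "(\<lambda>x. if x \<in> pbw \<and> length (fst x) = N \<and> length (snd x) \<le> M then \<psi> (fe x) else 0) \<in> tmod a b"
    (is "?\<phi> \<in> _")
proof -
  have Serre: "ser i j (\<lambda>v. \<psi> (x * wd (map (E s) v) * y)) = 0"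
    if "i \<in> I" "j \<in> I" "i \<noteq> j" "x \<in> car GU" "y \<in> car GU" for i j x y s
    unfolding ser_functional[of \<psi>, OF add scal]
    by (intro ideal iU_right iU_left rel_serre that)
  have wdE: "wd (map (E s) u) \<in> car GU" if "set u \<subseteq> I" for s u
    using that by (intro wd_car) auto
  have v: "set v = insert j (set (replicate (sl i j) i))" "length v = Suc (sl i j)"
    if "mset v = add_mset j (replicate_mset (sl i j) i)" for v i j
  proof -
    have eq: "mset v = mset (j # replicate (sl i j) i)" using that by simp
    from arg_cong[OF eq, of set_mset] show "set v = insert j (set (replicate (sl i j) i))" by simp
    from arg_cong[OF eq, of size] show "length v = Suc (sl i j)" by simp
  qed
  have "(\<lambda>u. ?\<phi> (u, w)) \<in> lowest a" for w
    unfolding lowest_def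
  proof (intro CollectI conjI allI ballI impI)
    show "?\<phi> (u @ replicate (Suc (nat (a i))) i, w) = 0" if "i \<in> I" for u i
    proof -
      have "N \<le> nat (a i)" using a[OF that] by simp
      then show ?thesis by simp
    qed
    fix u u' i j assume ij: "i \<in> I" "j \<in> I" "i \<noteq> j"
    let ?G = "set u \<subseteq> I \<and> set u' \<subseteq> I \<and> set w \<subseteq> I \<and> length u + Suc (sl i j) + length u' = N \<and> length w \<le> M"
    have "ser i j (\<lambda>v. ?\<phi> (u @ v @ u', w)) = (if ?G then 1 else 0) *
        ser i j (\<lambda>v. \<psi> ((wd (map (E Minus) w) * wd (map (E Plus) u)) * wd (map (E Plus) v) * wd (map (E Plus) u')))"
    proof (rule ser_homogeneous)
      fix v assume "mset v = add_mset j (replicate_mset (sl i j) i)"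
      note v = v[OF this]
      have "((u @ v @ u', w) \<in> pbw \<and> length (fst (u @ v @ u', w)) = N \<and> length (snd (u @ v @ u', w)) \<le> M) = ?G"
        using ij by (auto simp: pbw_def v)
      then show "?\<phi> (u @ v @ u', w) = (if ?G then 1 else 0) *
          \<psi> ((wd (map (E Minus) w) * wd (map (E Plus) u)) * wd (map (E Plus) v) * wd (map (E Plus) u'))"
        by (simp add: fe_def mult.assoc)
    qed
    also have "\<dots> = 0"
    proof (cases ?G)
      case True
      then show ?thesis using ij by (subst Serre) (simp_all add: wdE[unfolded list.map_comp])
    next
      case False
      show ?thesis unfolding if_not_P[OF False] by simp
    qed
    finally show "ser i j (\<lambda>v. ?\<phi> (u @ v @ u', w)) = 0" .
  qed (auto simp: pbw_def split: if_splits)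
  moreover have "(\<lambda>w. ?\<phi> (u, w)) \<in> lowest b" for u
    unfolding lowest_def
  proof (intro CollectI conjI allI ballI impI)
    show "?\<phi> (u, w @ replicate (Suc (nat (b i))) i) = 0" if "i \<in> I" for w i
    proof -
      have "M \<le> nat (b i)" using b[OF that] by simp
      then show ?thesis by simp
    qed
    fix w w' i j assume ij: "i \<in> I" "j \<in> I" "i \<noteq> j"
    let ?G = "set w \<subseteq> I \<and> set w' \<subseteq> I \<and> set u \<subseteq> I \<and> length w + Suc (sl i j) + length w' \<le> M \<and> length u = N"
    have "ser i j (\<lambda>v. ?\<phi> (u, w @ v @ w')) = (if ?G then 1 else 0) *
        ser i j (\<lambda>v. \<psi> (wd (map (E Minus) w) * wd (map (E Minus) v) * (wd (map (E Minus) w') * wd (map (E Plus) u))))"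
    proof (rule ser_homogeneous)
      fix v assume "mset v = add_mset j (replicate_mset (sl i j) i)"
      note v = v[OF this]
      have "((u, w @ v @ w') \<in> pbw \<and> length (fst (u, w @ v @ w')) = N \<and> length (snd (u, w @ v @ w')) \<le> M) = ?G"
        using ij by (auto simp: pbw_def v)
      then show "?\<phi> (u, w @ v @ w') = (if ?G then 1 else 0) *
          \<psi> (wd (map (E Minus) w) * wd (map (E Minus) v) * (wd (map (E Minus) w') * wd (map (E Plus) u)))"
        by (simp add: fe_def mult.assoc)
    qed
    also have "\<dots> = 0"
    proof (cases ?G)
      case True
      then show ?thesis using ij by (subst Serre) (simp_all add: wdE[unfolded list.map_comp])
    next
      case False
      show ?thesis unfolding if_not_P[OF False] by simp
    qed
    finally show "ser i j (\<lambda>v. ?\<phi> (u, w @ v @ w')) = 0" .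
  qed (auto simp: pbw_def split: if_splits)
  ultimately show ?thesis by (simp add: tmod_def)
qed

definition killed :: "'x \<Rightarrow> 'x \<Rightarrow> ('i, 'y) gen free \<Rightarrow> bool" where
  "killed l m p \<longleftrightarrow> (\<forall>P\<in>finite_saturated D. idm P l * lS P p * idm P m \<in> iS P)"

lemma finite_orbits: "P \<in> finite_saturated D \<Longrightarrow> finite (W P)"
  by (intro finite_weyl_orbits) (simp add: finite_saturated_def)

lemma killed_KU: "p \<in> KU l m \<Longrightarrow> killed l m p"
  by (simp add: killed_def lS_KU finite_orbits)

lemma killed_diff: "killed l m p \<Longrightarrow> killed l m p' \<Longrightarrow> killed l m (p - p')"
  unfolding killed_def by (simp add: lS_simps left_diff_distrib right_diff_distrib iS_diff)

lemma wt_fe: "x \<in> pbw \<Longrightarrow> wt m x \<noteq> l \<Longrightarrow> fe x \<in> KU l m"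
proof -
  assume x: "x \<in> pbw" "wt m x \<noteq> l"
  have neg: "(\<Sum>j\<leftarrow>w. - simple_root D j) = - (\<Sum>j\<leftarrow>w. simple_root D j)" for w
    by (induction w) simp_all
  show ?thesis
    by (rule homog_KU[OF fe_homog[OF x(1)]])
      (use x(2) in \<open>cases x; auto simp: neg algebra_simps\<close>)
qed

text \<open>Only the part of top length \<open>N\<close> in the raising operators survives on a functional that is
  supported in length \<open>N\<close> on the first slot.\<close>

lemma top_part_KU:
  assumes t: "t \<in> fv.span (fe ` {x \<in> pbw. length (fst x) = N})"
    and r: "r \<in> fv.span (fe ` {x \<in> pbw. length (fst x) < N} \<union> KU l m)"
    and killed: "killed l m (t + r)"
  shows "t \<in> KU l m"
proof (rule ccontr)
  assume "t \<notin> KU l m"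
  obtain \<psi> where \<psi>: "\<And>p p'. \<psi> (p + p') = \<psi> p + \<psi> p'" "\<And>c p. \<psi> (scal c * p) = c * \<psi> p"
    "\<And>k. k \<in> KU l m \<Longrightarrow> \<psi> k = 0" "\<psi> t = 1"
    by (rule separating_functional[OF KU_subspace \<open>t \<notin> KU l m\<close>]) (rule that)
  \<comment> \<open>Only finitely many monomials occur in \<open>t\<close>; the bound on their
    lowering lengths is needed for the size of \<open>b\<close>.\<close>
  have "\<exists>M. t \<in> fv.span (fe ` {x \<in> pbw. length (fst x) = N \<and> length (snd x) \<le> M})"
    using t
  proof (induction rule: fv.span_induct_alt)
    case base
    show ?case by (simp add: fv.span_zero)
  next
    case (step c p p')
    let ?T = "\<lambda>M. fe ` {x \<in> pbw. length (fst x) = N \<and> length (snd x) \<le> M}"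
    obtain M where M: "p' \<in> fv.span (?T M)" using step.IH by blast
    obtain x where x: "p = fe x" "x \<in> pbw" "length (fst x) = N" using step.hyps by blast
    let ?M = "max M (length (snd x))"
    have p: "p \<in> ?T ?M" using x by auto
    have p': "p' \<in> fv.span (?T ?M)" by (rule subsetD[OF fv.span_mono M]) auto
    have "scal c * p + p' \<in> fv.span (?T ?M)"
      by (rule fv.span_add[OF fv.span_scale[OF fv.span_base[OF p]] p'])
    then show ?case by blast
  qed
  then obtain M where M: "t \<in> fv.span (fe ` {x \<in> pbw. length (fst x) = N \<and> length (snd x) \<le> M})" by blast
  define \<phi> where "\<phi> x = (if x \<in> pbw \<and> length (fst x) = N \<and> length (snd x) \<le> M then \<psi> (fe x) else 0)" for x
  \<comment> \<open>The absolute value ensures that both \<open>a\<close> and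
    \<open>b = a + pvm m\<close> are at least \<open>N + M\<close>.\<close>
  define a where "a i = int (N + M) + \<bar>pvm m i\<bar>" for i
  define b where "b i = a i + pvm m i" for i
  have a: "a i \<ge> int N" "a i \<ge> 0" and b: "b i \<ge> int M" "b i \<ge> 0" and ab: "b i - a i = pvm m i" for i
    by (auto simp: a_def b_def)
  have \<phi>: "\<phi> \<in> tmod a b"
    unfolding \<phi>_def using KU_ideal \<psi>(3) by (intro functional_tmod \<psi>(1,2) a b) blast
  \<comment> \<open>Monomials of a weight other than \<open>l\<close> lie in the kernel of the
    block, where \<open>\<psi>\<close> vanishes. So the idempotent for \<open>l\<close> fixes
    \<open>\<phi>\<close>.\<close>
  have \<phi>_wt: "(\<lambda>x. if wt m x = l then \<phi> x else 0) = \<phi>"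
    using wt_fe \<psi>(3) by (auto simp: \<phi>_def fun_eq_iff)
  obtain P where P: "P \<in> finite_saturated D" "\<And>\<phi> x. \<phi> \<in> tmod a b \<Longrightarrow> \<phi> x \<noteq> 0 \<Longrightarrow> wt m x \<in> W P"
    using satset_supports[of a b m] a(2) b(2) by metis
  note fin = finite_orbits[OF P(1)]
  have ctx: "\<And>i. i \<in> I \<Longrightarrow> a i \<ge> 0" "\<And>i. i \<in> I \<Longrightarrow> b i \<ge> 0" "\<And>i. i \<in> I \<Longrightarrow> b i - a i = pvm m i"
    using a b ab by blast+
  have tmod_rho': "app (rho a b m p) \<xi> \<in> tmod a b" if "p \<in> car (GS P)" "\<xi> \<in> tmod a b" for p \<xi>
    using that by (intro tmod_rho[of a b m P] ctx fin P(2))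
  have rho_idem': "app (rho a b m (idm P k)) \<xi> = (\<lambda>x. if wt m x = k then \<xi> x else 0)" if "\<xi> \<in> tmod a b" for k \<xi>
    using that by (intro rho_idem[of a b m P] ctx fin P(2))
  have rho_ideal': "app (rho a b m p) \<xi> = (\<lambda>x. 0)" if "p \<in> iS P" "\<xi> \<in> tmod a b" for p \<xi>
    using that by (intro rho_ideal[of a b m P] ctx fin P(2))
  \<comment> \<open>The matrix coefficient of \<open>z\<close> at the tensor product of the lowest
    and the highest weight vector. That vector has weight \<open>m\<close>, so the idempotents on
    both sides of \<open>z\<close> do not change it.\<close>
  define \<Lambda> where "\<Lambda> z = app (rho a b m (lS P z)) \<phi> ([], [])" for z
  have \<Lambda>_eq: "\<Lambda> z = app (rho a b m (idm P l * lS P z * idm P m)) \<phi> ([], [])" if "z \<in> car GU" for z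
  proof -
    have "app (rho a b m (idm P l)) \<phi> = \<phi>" using rho_idem'[OF \<phi>, of l] \<phi>_wt by simp
    moreover have "app (rho a b m (lS P z)) \<phi> \<in> tmod a b" using that by (intro tmod_rho' \<phi>) simp
    ultimately show ?thesis by (simp add: \<Lambda>_def rho_simps(3) rho_idem')
  qed
  have \<Lambda>_add: "\<Lambda> (scal c * z + z') = c * \<Lambda> z + \<Lambda> z'" for c z z'
    by (simp only: \<Lambda>_def lS_simps rho_simps(1,3,4) app_lop_simps(3) app_sc_mult)
  have \<Lambda>_0: "\<Lambda> 0 = 0" by (simp add: \<Lambda>_def lS_simps rho_simps)
  have \<Lambda>_fe: "\<Lambda> (fe x) = \<phi> x" if "x \<in> pbw" "length (fst x) \<le> N" for x
  proof -
    have "app (prod_list (map (TF a b) (snd x))) \<phi> (fst x, []) = \<phi> (fst x, snd x @ [])"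
      by (rule app_TF_list[of N]) (use that in \<open>auto simp: \<phi>_def\<close>)
    then show ?thesis by (simp add: \<Lambda>_def rho_fe app_TE_list)
  qed
  have "\<Lambda> t = \<psi> t"
    using M
  proof (induction rule: fv.span_induct_alt)
    case base
    show ?case using \<psi>(2)[of 0 0] \<Lambda>_0 by simp
  next
    case (step c p p')
    then obtain x where x: "p = fe x" "x \<in> pbw" "length (fst x) = N" "length (snd x) \<le> M" by blast
    then have "\<Lambda> p = \<psi> p" using \<Lambda>_fe[of x] by (simp add: \<phi>_def)
    then show ?case using step.IH by (simp add: \<Lambda>_add \<psi>(1,2))
  qed
  moreover have "\<Lambda> r = 0"
    using r
  proof (induction rule: fv.span_induct_alt)
    case base
    show ?case by (rule \<Lambda>_0)
  next
    case (step c p p')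
    from step.hyps have "\<Lambda> p = 0"
    proof
      assume "p \<in> fe ` {x \<in> pbw. length (fst x) < N}"
      then obtain x where "p = fe x" "x \<in> pbw" "length (fst x) < N" by blast
      then show ?thesis using \<Lambda>_fe[of x] by (simp add: \<phi>_def)
    next
      assume k: "p \<in> KU l m"
      show ?thesis unfolding \<Lambda>_eq[OF KU_car[OF k]] rho_ideal'[OF lS_KU[OF fin k] \<phi>] ..
    qed
    then show ?case using step.IH by (simp add: \<Lambda>_add)
  qed
  moreover have "\<Lambda> (t + r) = 0"
  proof -
    have sub: "fv.span S \<subseteq> car GU" if "S \<subseteq> car GU" for S
      by (rule fv.span_minimal[OF that]) (rule fv.subspaceI; simp)
    have "t \<in> car GU" "r \<in> car GU"
    proof -
      show "t \<in> car GU" using fe_car by (intro subsetD[OF sub t]) blast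
      show "r \<in> car GU" using fe_car KU_car by (intro subsetD[OF sub r]) blast
    qed
    moreover have "idm P l * lS P (t + r) * idm P m \<in> iS P" using killed P(1) by (simp add: killed_def)
    ultimately show ?thesis by (simp add: \<Lambda>_eq rho_ideal' \<phi>)
  qed
  ultimately show False using \<Lambda>_add[of 1 t r] \<psi>(4) by simp
qed

text \<open>Induction on a bound for the raising length: the top part lies in the kernel by
  \<open>top_part_KU\<close>, hence is itself killed everywhere, and subtracting it lowers the
  bound.\<close>

lemma killed_imp_KU:
  assumes "p \<in> car GU" "killed l m p"
  shows "p \<in> KU l m"
proof -
  have step: "p \<in> fv.span (fe ` {x \<in> pbw. length (fst x) < N} \<union> KU l m) \<Longrightarrow> killed l m p \<Longrightarrow> p \<in> KU l m" for N p
  proof (induction N arbitrary: p)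
    case 0
    then show ?case using fv.span_minimal[OF order_refl KU_subspace] by (simp add: subset_iff)
  next
    case (Suc N)
    have "fe ` {x \<in> pbw. length (fst x) < Suc N} \<union> KU l m =
        fe ` {x \<in> pbw. length (fst x) = N} \<union> (fe ` {x \<in> pbw. length (fst x) < N} \<union> KU l m)"
      by (auto simp: less_Suc_eq)
    with Suc.prems(1) have "p \<in> {x + y | x y. x \<in> fv.span (fe ` {x \<in> pbw. length (fst x) = N}) \<and>
        y \<in> fv.span (fe ` {x \<in> pbw. length (fst x) < N} \<union> KU l m)}"
      by (simp only: fv.span_Un[of "fe ` {x \<in> pbw. length (fst x) = N}" "fe ` {x \<in> pbw. length (fst x) < N} \<union> KU l m"])
    then obtain t r where tr: "p = t + r" "t \<in> fv.span (fe ` {x \<in> pbw. length (fst x) = N})"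
      "r \<in> fv.span (fe ` {x \<in> pbw. length (fst x) < N} \<union> KU l m)" by blast
    have t: "t \<in> KU l m" using tr(2,3) Suc.prems(2) unfolding tr(1) by (rule top_part_KU)
    have "killed l m (p - t)" by (intro killed_diff Suc.prems(2) killed_KU t)
    then have "r \<in> KU l m" using tr by (intro Suc.IH) simp_all
    then show ?case unfolding tr(1) by (rule KU_add[OF t])
  qed
  have "\<exists>N. p \<in> fv.span (fe ` {x \<in> pbw. length (fst x) < N} \<union> KU l m)"
    using car_pspan[OF assms(1), of l m] unfolding pspan_def
  proof (induction rule: fv.span_induct_alt)
    case base
    show ?case by (simp add: fv.span_zero)
  next
    case (step c p p')
    let ?S = "\<lambda>N. fe ` {x \<in> pbw. length (fst x) < N} \<union> KU l m"
    obtain N where N: "p' \<in> fv.span (?S N)" using step.IH by blast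
    have "\<exists>N'. p \<in> ?S N'"
      using step.hyps
    proof
      assume "p \<in> fe ` pbw"
      then obtain x where "x \<in> pbw" "p = fe x" by blast
      then have "p \<in> ?S (Suc (length (fst x)))" by simp
      then show ?thesis by blast
    qed blast
    then obtain N' where N': "p \<in> ?S N'" by blast
    have p: "p \<in> ?S (max N N')" using N' by auto
    have p': "p' \<in> fv.span (?S (max N N'))" by (rule subsetD[OF fv.span_mono N]) auto
    have "scal c * p + p' \<in> fv.span (?S (max N N'))"
      by (rule fv.span_add[OF fv.span_scale[OF fv.span_base[OF p]] p'])
    then show ?case by blast
  qed
  then show ?thesis using step assms(2) by blast
qed

end


section \<open>The blocks of the modified form\<close>

context datum
begin

abbreviation "N l m \<equiv> block_ker D l m"
abbreviation "FS \<equiv> finite_saturated D"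
abbreviation "clS P \<equiv> cls (GS P) (RS P)"

definition bp :: "'x \<Rightarrow> 'x \<Rightarrow> ('i, 'y) gen free \<Rightarrow> ('i, 'y) gen free set set" where
  "bp l m p = block_proj D l m (clU p)"

context
  fixes l m :: 'x
begin

interpretation U: ring "U_alg D"
  unfolding U_alg_def by (rule ring_presented[OF RU_car])

interpretation additive_subgroup "N l m" "U_alg D"
  by (rule block_ker_subgroup)

interpretation abelian_subgroup "N l m" "U_alg D"
  by (rule abelian_subgroupI3[OF additive_subgroup_axioms U.is_abelian_group])

lemma clU_closed [simp]: "p \<in> car GU \<Longrightarrow> clU p \<in> carrier (U_alg D)"
  by (simp add: carrier_U)

lemma clU_minus: "p \<in> car GU \<Longrightarrow> p' \<in> car GU \<Longrightarrow> clU p \<ominus>\<^bsub>U_alg D\<^esub> clU p' = clU (p - p')"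
  unfolding a_minus_def U_alg_def by (simp add: presented_a_inv[OF RU_car] cls_add[OF RU_car])

lemma bp_memD:
  assumes "p \<in> car GU" "u \<in> bp l m p"
  obtains p' where "p' \<in> car GU" "u = clU p'" "p' - p \<in> KU l m"
proof -
  have u: "u \<in> N l m +>\<^bsub>U_alg D\<^esub> clU p" using assms(2) by (simp add: bp_def block_proj_def)
  have "u \<in> carrier (U_alg D)" by (rule a_elemrcos_carrier[OF _ u]) (simp add: assms(1))
  then obtain p' where p': "p' \<in> car GU" "u = clU p'" unfolding carrier_U by blast
  then have "clU p' \<ominus>\<^bsub>U_alg D\<^esub> clU p \<in> N l m"
    using a_rcos_module_minus[OF U.ring_axioms, of "clU p" "clU p'"] u assms(1) by simp
  then show thesis using p' assms(1) by (intro that) (auto simp: clU_minus KU_def intro!: car_diff)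
qed

lemma bp_self: "p \<in> car GU \<Longrightarrow> clU p \<in> bp l m p"
  unfolding bp_def block_proj_def by (rule a_rcos_self) simp

lemma bp_eq_iff:
  assumes "p \<in> car GU" "p' \<in> car GU"
  shows "bp l m p = bp l m p' \<longleftrightarrow> p - p' \<in> KU l m"
proof
  assume "bp l m p = bp l m p'"
  then have "clU p \<in> bp l m p'" using bp_self[OF assms(1)] by simp
  from bp_memD[OF assms(2) this] obtain z where z: "z \<in> car GU" "clU p = clU z" "z - p' \<in> KU l m" by blast
  then have "p - z \<in> KU l m" using assms by (intro KU_ideal) (simp add: cls_eq_iff[OF RU_car, symmetric])
  from KU_add[OF this z(3)] show "p - p' \<in> KU l m" by simp
next
  assume "p - p' \<in> KU l m"
  then have "clU p \<in> bp l m p'"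
    using a_rcos_module_minus[OF U.ring_axioms, of "clU p'" "clU p"] assms
    by (simp add: bp_def block_proj_def clU_minus KU_def)
  then show "bp l m p = bp l m p'"
    using a_repr_independence'[of "clU p" "clU p'"] assms by (simp add: bp_def block_proj_def)
qed

lemma carrier_block: "carrier (block D l m) = bp l m ` car GU"
  by (auto simp: block_def A_RCOSETS_def' carrier_U bp_def block_proj_def)

lemma bp_add:
  "p \<in> car GU \<Longrightarrow> p' \<in> car GU \<Longrightarrow> bp l m p \<oplus>\<^bsub>block D l m\<^esub> bp l m p' = bp l m (p + p')"
  using a_rcos_sum[of "clU p" "clU p'"]
  by (simp add: bp_def block_proj_def block_def) (simp add: U_alg_def cls_add[OF RU_car])

lemma block_zero: "\<zero>\<^bsub>block D l m\<^esub> = bp l m 0"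
  using U.a_coset_add_zero[OF a_subset]
  by (simp add: bp_def block_proj_def block_def) (simp add: U_alg_def presented_zero[OF RU_car])

lemma bp_smult:
  assumes "p \<in> car GU"
  shows "c \<odot>\<^bsub>block D l m\<^esub> bp l m p = bp l m (scal c * p)"
proof -
  have "N l m +>\<^bsub>U_alg D\<^esub> (c \<odot>\<^bsub>U_alg D\<^esub> u) = bp l m (scal c * p)" if u: "u \<in> bp l m p" for u
  proof -
    obtain p' where p': "p' \<in> car GU" "u = clU p'" "p' - p \<in> KU l m" by (rule bp_memD[OF assms u])
    have "bp l m (scal c * p') = bp l m (scal c * p)"
      using p' assms KU_scal[OF p'(3), of c] by (subst bp_eq_iff) (simp_all add: right_diff_distrib)
    moreover have "c \<odot>\<^bsub>U_alg D\<^esub> u = clU (scal c * p')"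
      using p' by (simp add: U_alg_def cls_smult[OF RU_car])
    ultimately show ?thesis by (simp add: bp_def block_proj_def)
  qed
  then have "(\<Union>u\<in>bp l m p. N l m +>\<^bsub>U_alg D\<^esub> (c \<odot>\<^bsub>U_alg D\<^esub> u)) = bp l m (scal c * p)"
    using bp_self[OF assms] by blast
  then show ?thesis by (simp add: block_def)
qed

lemma block_monoid: "abelian_monoid (block D l m)"
proof (rule abelian_monoidI)
  show "x \<oplus>\<^bsub>block D l m\<^esub> y \<in> carrier (block D l m)" if "x \<in> carrier (block D l m)" "y \<in> carrier (block D l m)" for x y
    using that unfolding carrier_block by (auto simp: bp_add)
  show "\<zero>\<^bsub>block D l m\<^esub> \<in> carrier (block D l m)"
    unfolding carrier_block block_zero by simp
  show "x \<oplus>\<^bsub>block D l m\<^esub> y \<oplus>\<^bsub>block D l m\<^esub> z = x \<oplus>\<^bsub>block D l m\<^esub> (y \<oplus>\<^bsub>block D l m\<^esub> z)"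
    if "x \<in> carrier (block D l m)" "y \<in> carrier (block D l m)" "z \<in> carrier (block D l m)" for x y z
    using that unfolding carrier_block by (auto simp: bp_add add.assoc)
  show "\<zero>\<^bsub>block D l m\<^esub> \<oplus>\<^bsub>block D l m\<^esub> x = x" if "x \<in> carrier (block D l m)" for x
    using that unfolding carrier_block block_zero by (auto simp: bp_add)
  show "x \<oplus>\<^bsub>block D l m\<^esub> y = y \<oplus>\<^bsub>block D l m\<^esub> x"
    if "x \<in> carrier (block D l m)" "y \<in> carrier (block D l m)" for x y
    using that unfolding carrier_block by (auto simp: bp_add add.commute)
qed

lemma bp_finsum:
  assumes "finite X" "\<And>x. x \<in> X \<Longrightarrow> f x \<in> car GU"
  shows "(\<Oplus>\<^bsub>block D l m\<^esub>x\<in>X. bp l m (f x)) = bp l m (sum f X)"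
  using assms
proof (induction X rule: finite_induct)
  case empty
  show ?case by (simp add: abelian_monoid.finsum_empty[OF block_monoid] block_zero)
next
  case (insert x X)
  then show ?case
    by (subst abelian_monoid.finsum_insert[OF block_monoid]) (simp_all add: carrier_block bp_add car_sum)
qed

end

text \<open>By \<open>KU_mult_left\<close> and \<open>KU_mult_right\<close> all homogeneous
  representatives give the same class, so the set inside \<open>block_mult\<close> is a
  singleton.\<close>

lemma block_mult_bp:
  assumes t: "t \<in> homog (l - m)" and s: "s \<in> homog (m - n)"
  shows "block_mult D l m n (bp l m t) (bp m n s) = bp l n (t * s)"
proof -
  have prod: "clU t' \<otimes>\<^bsub>U_alg D\<^esub> clU s' = clU (t' * s')" if "t' \<in> car GU" "s' \<in> car GU" for t' s'
    using that by (simp add: U_alg_def cls_mult[OF RU_car])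
  have "block_proj D l n (t' \<otimes>\<^bsub>U_alg D\<^esub> s') = bp l n (t * s)"
    if ts: "t' \<in> U_graded D (l - m)" "s' \<in> U_graded D (m - n)"
      "block_proj D l m t' = bp l m t" "block_proj D m n s' = bp m n s" for t' s'
  proof -
    obtain t1 s1 where 1: "t1 \<in> homog (l - m)" "t' = clU t1" "s1 \<in> homog (m - n)" "s' = clU s1"
      using ts(1,2) unfolding U_graded_eq by blast
    note cars = 1(1,3)[THEN homog_car] t[THEN homog_car] s[THEN homog_car]
    have "t1 - t \<in> KU l m" "s1 - s \<in> KU m n"
      using ts(3,4) cars unfolding 1 by (simp_all add: bp_def[symmetric] bp_eq_iff)
    then have "(t1 - t) * s1 + t * (s1 - s) \<in> KU l n"
      by (intro KU_add KU_mult_right[OF _ 1(3)] KU_mult_left[OF _ t])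
    then have "t1 * s1 - t * s \<in> KU l n" by (simp add: left_diff_distrib right_diff_distrib)
    then have "bp l n (t1 * s1) = bp l n (t * s)" using cars by (simp add: bp_eq_iff)
    then show ?thesis using cars by (simp add: 1 prod bp_def)
  qed
  moreover have "bp l n (t * s) = block_proj D l n (clU t \<otimes>\<^bsub>U_alg D\<^esub> clU s)"
    using t s homog_car by (simp add: prod bp_def)
  moreover have "clU t \<in> U_graded D (l - m)" "clU s \<in> U_graded D (m - n)" "block_proj D l m (clU t) = bp l m t"
      "block_proj D m n (clU s) = bp m n s"
    using t s unfolding U_graded_eq bp_def by blast+
  ultimately have "{block_proj D l n (t' \<otimes>\<^bsub>U_alg D\<^esub> s') | t' s'.
        t' \<in> U_graded D (l - m) \<and> s' \<in> U_graded D (m - n) \<and>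
        block_proj D l m t' = bp l m t \<and> block_proj D m n s' = bp m n s} = {bp l n (t * s)}"
    by blast
  then show ?thesis by (simp add: block_mult_def)
qed

text \<open>An element of the direct sum as a matrix of homogeneous representatives. One finite set
  \<open>B\<close> for rows and columns turns the product into the product of matrices.\<close>

definition represents :: "('i, 'x, 'y) udot \<Rightarrow> ('x \<Rightarrow> 'x \<Rightarrow> ('i, 'y) gen free) \<Rightarrow> 'x set \<Rightarrow> bool" where
  "represents f r B \<longleftrightarrow> finite B \<and> (\<forall>l m. r l m \<in> homog (l - m) \<and> f l m = bp l m (r l m)) \<and>
     (\<forall>l m. l \<notin> B \<or> m \<notin> B \<longrightarrow> r l m = 0)"

lemma representsD:
  assumes "represents f r B"
  shows "finite B" "r l m \<in> homog (l - m)" "r l m \<in> car GU" "f l m = bp l m (r l m)"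
    "l \<notin> B \<or> m \<notin> B \<Longrightarrow> r l m = 0"
  using assms homog_car[of "r l m" "l - m"] unfolding represents_def by blast+

lemma represents_mono: "represents f r B \<Longrightarrow> B \<subseteq> B' \<Longrightarrow> finite B' \<Longrightarrow> represents f r B'"
  unfolding represents_def by blast

lemma represents_carrier:
  assumes "represents f r B"
  shows "f \<in> carrier (Udot D)"
proof -
  note r = representsD[OF assms]
  have "{(l, m). f l m \<noteq> \<zero>\<^bsub>block D l m\<^esub>} \<subseteq> B \<times> B"
  proof
    fix x assume "x \<in> {(l, m). f l m \<noteq> \<zero>\<^bsub>block D l m\<^esub>}"
    then obtain l m where x: "x = (l, m)" "bp l m (r l m) \<noteq> bp l m 0" by (auto simp: r(4) block_zero)
    then have "r l m \<noteq> 0" by auto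
    then show "x \<in> B \<times> B" using r(5)[of l m] x(1) by blast
  qed
  then have "finite {(l, m). f l m \<noteq> \<zero>\<^bsub>block D l m\<^esub>}" by (rule finite_subset) (simp add: r(1))
  then show ?thesis using r(3,4) by (simp add: Udot_def carrier_block)
qed

lemma represents_exists:
  assumes f: "f \<in> carrier (Udot D)"
  obtains r B where "represents f r B"
proof -
  let ?S = "{(l, m). f l m \<noteq> \<zero>\<^bsub>block D l m\<^esub>}"
  have f': "f l m \<in> bp l m ` car GU" "finite ?S" for l m
    using f by (simp_all add: Udot_def carrier_block)
  have ex: "\<exists>r. r \<in> homog (l - m) \<and> f l m = bp l m r \<and> ((l, m) \<notin> ?S \<longrightarrow> r = 0)" for l m
  proof (cases "(l, m) \<in> ?S")
    case True
    obtain p where p: "p \<in> car GU" "f l m = bp l m p" using f'(1)[of l m] by blast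
    obtain r where r: "r \<in> homog (l - m)" "p - r \<in> KU l m" by (rule homog_repr[OF p(1)])
    have "bp l m p = bp l m r" using p r homog_car by (simp add: bp_eq_iff)
    then show ?thesis using r(1) p(2) True by auto
  next
    case False
    then show ?thesis using homog_0 by (intro exI[of _ 0]) (simp add: block_zero)
  qed
  define r where "r l m = (SOME r. r \<in> homog (l - m) \<and> f l m = bp l m r \<and> ((l, m) \<notin> ?S \<longrightarrow> r = 0))" for l m
  have r: "r l m \<in> homog (l - m) \<and> f l m = bp l m (r l m) \<and> ((l, m) \<notin> ?S \<longrightarrow> r l m = 0)" for l m
    unfolding r_def by (rule someI_ex[OF ex])
  have "represents f r (fst ` ?S \<union> snd ` ?S)"
    unfolding represents_def
  proof (intro conjI allI impI)
    fix l m assume "l \<notin> fst ` ?S \<union> snd ` ?S \<or> m \<notin> fst ` ?S \<union> snd ` ?S"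
    then have "(l, m) \<notin> ?S" by force
    then show "r l m = 0" using r by blast
  qed (use r f'(2) in \<open>blast+\<close>)
  then show thesis by (rule that)
qed

lemma represents_add:
  assumes "represents f r B" "represents g r' B"
  shows "represents (f \<oplus>\<^bsub>Udot D\<^esub> g) (\<lambda>l m. r l m + r' l m) B"
  using representsD[OF assms(1)] representsD[OF assms(2)]
  unfolding represents_def by (simp add: Udot_def bp_add homog_add)

lemma represents_smult:
  assumes "represents f r B"
  shows "represents (c \<odot>\<^bsub>Udot D\<^esub> f) (\<lambda>l m. scal c * r l m) B"
  using representsD[OF assms] unfolding represents_def by (simp add: Udot_def bp_smult homog_scal)

lemma represents_zero: "represents \<zero>\<^bsub>Udot D\<^esub> (\<lambda>l m. 0) {}"
  unfolding represents_def by (simp add: Udot_def block_zero)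

lemma represents_proj:
  assumes "p \<in> homog (l - m)"
  shows "represents (udot_proj D l m (clU p)) (\<lambda>l' m'. if l' = l \<and> m' = m then p else 0) {l, m}"
  unfolding represents_def using assms by (auto simp: udot_proj_def bp_def[symmetric] block_zero)

lemma represents_mult:
  assumes f: "represents f r B" and g: "represents g r' B"
  shows "represents (f \<otimes>\<^bsub>Udot D\<^esub> g) (\<lambda>l n. \<Sum>m\<in>B. r l m * r' m n) B"
proof -
  note F = representsD[OF f] and G = representsD[OF g]
  have hom: "r l m * r' m n \<in> homog (l - n)" for l m n
    using homog_mult[OF F(2)[of l m] G(2)[of m n]] by simp
  have eq: "(f \<otimes>\<^bsub>Udot D\<^esub> g) l n = bp l n (\<Sum>m\<in>B. r l m * r' m n)" for l n
  proof -
    let ?M = "{m. f l m \<noteq> \<zero>\<^bsub>block D l m\<^esub> \<and> g m n \<noteq> \<zero>\<^bsub>block D m n\<^esub>}"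
    have M: "?M \<subseteq> B"
    proof
      fix m assume "m \<in> ?M"
      then have "bp l m (r l m) \<noteq> bp l m 0" by (simp add: F(4) block_zero)
      then have "r l m \<noteq> 0" by auto
      then show "m \<in> B" using F(5)[of l m] by blast
    qed
    have "(f \<otimes>\<^bsub>Udot D\<^esub> g) l n = (\<Oplus>\<^bsub>block D l n\<^esub>m\<in>?M. block_mult D l m n (f l m) (g m n))"
      by (simp add: Udot_def)
    also have "\<dots> = (\<Oplus>\<^bsub>block D l n\<^esub>m\<in>?M. bp l n (r l m * r' m n))"
      unfolding F(4) G(4) using block_mult_bp[OF F(2) G(2)] by simp
    also have "\<dots> = bp l n (\<Sum>m\<in>?M. r l m * r' m n)"
      using finite_subset[OF M F(1)] F(3) G(3) by (intro bp_finsum) auto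
    also have "\<dots> = bp l n (\<Sum>m\<in>B. r l m * r' m n)"
    proof (rule sym, subst bp_eq_iff)
      \<comment> \<open>An entry may be a nonzero representative of the zero class; the product in
        \<open>Udot\<close> omits such indices, and their contribution lies in the kernel.\<close>
      have "(\<Sum>m\<in>B. r l m * r' m n) - (\<Sum>m\<in>?M. r l m * r' m n) = (\<Sum>m\<in>B - ?M. r l m * r' m n)"
        by (rule sum_diff[symmetric, OF F(1) M])
      also have "\<dots> \<in> KU l n"
      proof (rule KU_sum)
        fix m assume "m \<in> B - ?M"
        then have "bp l m (r l m) = bp l m 0 \<or> bp m n (r' m n) = bp m n 0"
          by (auto simp: F(4) G(4) block_zero)
        then have "r l m \<in> KU l m \<or> r' m n \<in> KU m n" using F(3) G(3) by (simp add: bp_eq_iff)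
        then show "r l m * r' m n \<in> KU l n"
          using KU_mult_right[OF _ G(2)] KU_mult_left[OF _ F(2)] by blast
      qed
      finally show "(\<Sum>m\<in>B. r l m * r' m n) - (\<Sum>m\<in>?M. r l m * r' m n) \<in> KU l n" .
    qed (use F(3) G(3) in auto)
    finally show ?thesis .
  qed
  show ?thesis
    unfolding represents_def using F(1) eq hom F(5) G(5) by (auto intro!: homog_sum sum.neutral)
qed


section \<open>The map \<open>\<theta>\<close>\<close>

definition tt :: "'x set \<Rightarrow> ('x \<Rightarrow> 'x \<Rightarrow> ('i, 'y) gen free) \<Rightarrow> 'x set \<Rightarrow> ('i, 'x) gen free" where
  "tt P r B = (\<Sum>l\<in>B. \<Sum>m\<in>B. idm P l * lS P (r l m) * idm P m)"

lemma tt_car: "(\<And>l m. r l m \<in> car GU) \<Longrightarrow> tt P r B \<in> car (GS P)"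
  unfolding tt_def by (intro car_sum car_mult) simp_all

lemma clS_eq: "x \<in> car (GS P) \<Longrightarrow> y \<in> car (GS P) \<Longrightarrow> clS P x = clS P y \<longleftrightarrow> eqS P x y"
  by (simp add: cls_eq_iff[OF RS_car] eqS_def)

lemma pdot_rep:
  assumes f: "represents f r B" and fin: "finite (W P)"
  shows "pdot_map D P f = clS P (tt P r B)"
proof -
  note F = representsD[OF f]
  let ?S = "{(l, m). f l m \<noteq> \<zero>\<^bsub>block D l m\<^esub>}"
  let ?g = "\<lambda>x. idm P (fst x) * lS P (r (fst x) (snd x)) * idm P (snd x)"
  have g: "?g x \<in> car (GS P)" for x using F(3) by (intro car_mult) simp_all
  interpret Q: ring "S_alg D P" unfolding S_alg_def by (rule ring_presented[OF RS_car])
  have S: "?S \<subseteq> B \<times> B"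
  proof
    fix x assume "x \<in> ?S"
    then obtain l m where x: "x = (l, m)" "bp l m (r l m) \<noteq> bp l m 0" by (auto simp: F(4) block_zero)
    then have "r l m \<noteq> 0" by auto
    then show "x \<in> B \<times> B" using F(5)[of l m] x(1) by blast
  qed
  have elem: "the_elem ((\<lambda>u. S_one D P l \<otimes>\<^bsub>S_alg D P\<^esub> p_map D P u \<otimes>\<^bsub>S_alg D P\<^esub> S_one D P m) ` f l m) = clS P (?g (l, m))" for l m
  proof -
    have "S_one D P l \<otimes>\<^bsub>S_alg D P\<^esub> p_map D P u \<otimes>\<^bsub>S_alg D P\<^esub> S_one D P m = clS P (?g (l, m))" if u: "u \<in> f l m" for u
    proof -
      obtain p where p: "p \<in> car GU" "u = clU p" "p - r l m \<in> KU l m"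
        by (rule bp_memD[OF F(3) u[unfolded F(4)]])
      have "S_one D P l \<otimes>\<^bsub>S_alg D P\<^esub> p_map D P u \<otimes>\<^bsub>S_alg D P\<^esub> S_one D P m = clS P (idm P l * lS P p * idm P m)"
        using p by (simp add: p_map_cls(1)[OF fin] S_one_def S_alg_def cls_mult[OF RS_car])
      also have "\<dots> = clS P (?g (l, m))"
        using lS_KU[OF fin p(3)] p(1) F(3)
        by (subst clS_eq) (simp_all add: eqS_def lS_simps left_diff_distrib right_diff_distrib)
      finally show ?thesis .
    qed
    moreover have "f l m \<noteq> {}" unfolding F(4) using bp_self[OF F(3)] by fast
    ultimately have "(\<lambda>u. S_one D P l \<otimes>\<^bsub>S_alg D P\<^esub> p_map D P u \<otimes>\<^bsub>S_alg D P\<^esub> S_one D P m) ` f l m = {clS P (?g (l, m))}"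
      by (simp add: image_constant_conv)
    then show ?thesis by simp
  qed
  have "pdot_map D P f = (\<Oplus>\<^bsub>S_alg D P\<^esub>x\<in>?S. clS P (?g x))"
    unfolding pdot_map_def
  proof (rule Q.finsum_cong'[OF refl])
    show "(\<lambda>x. clS P (?g x)) \<in> ?S \<rightarrow> carrier (S_alg D P)"
      using g by (simp add: S_alg_def carrier_presented)
    fix x :: "'x \<times> 'x"
    show "(case x of (l, m) \<Rightarrow> the_elem
        ((\<lambda>u. S_one D P l \<otimes>\<^bsub>S_alg D P\<^esub> p_map D P u \<otimes>\<^bsub>S_alg D P\<^esub> S_one D P m) ` f l m)) = clS P (?g x)"
      unfolding case_prod_beta elem by simp
  qed
  also have "\<dots> = clS P (sum ?g ?S)"
    unfolding S_alg_def using finite_subset[OF S] F(1) g by (intro cls_finsum[OF RS_car]) simp_all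
  also have "\<dots> = clS P (sum ?g (B \<times> B))"
  proof (rule sym, subst clS_eq)
    have "sum ?g (B \<times> B) - sum ?g ?S = sum ?g (B \<times> B - ?S)"
      using sum_diff[of "B \<times> B" ?S ?g] F(1) S by simp
    also have "\<dots> \<in> iS P"
    proof (rule iS_sum)
      fix x assume "x \<in> B \<times> B - ?S"
      then have "bp (fst x) (snd x) (r (fst x) (snd x)) = bp (fst x) (snd x) 0"
        by (auto simp: F(4) block_zero)
      then have "r (fst x) (snd x) \<in> KU (fst x) (snd x)" using F(3) by (simp add: bp_eq_iff)
      then show "?g x \<in> iS P" by (rule lS_KU[OF fin])
    qed
    finally show "eqS P (sum ?g (B \<times> B)) (sum ?g ?S)" by (simp add: eqS_def)
  qed (use g in auto)
  also have "sum ?g (B \<times> B) = tt P r B" by (simp add: tt_def sum.cartesian_product case_prod_beta)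
  finally show ?thesis .
qed

text \<open>Orthogonality of the idempotents isolates a single entry of the matrix.\<close>

lemma idem_sandwich:
  assumes "z \<in> car (GS P)" "l \<in> B" "m \<in> B" "finite B" "\<And>l m. x l m \<in> car (GS P)"
  shows "eqS P (idm P l * (\<Sum>l'\<in>B. \<Sum>m'\<in>B. idm P l' * x l' m' * idm P m') * idm P m) (idm P l * x l m * idm P m)"
proof -
  have "eqS P (idm P l * (idm P l' * x l' m' * idm P m') * idm P m)
      (if l' = l then if m' = m then idm P l * x l m * idm P m else 0 else 0)" for l' m'
  proof -
    have "eqS P ((idm P l * idm P l') * (x l' m' * (idm P m' * idm P m)))
        ((if l = l' then idm P l else 0) * (x l' m' * (idm P m' * idm P m)))"
      using assms(5) by (intro eqS_right idem_idem car_mult) simp_all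
    also have "eqS P \<dots> ((if l = l' then idm P l else 0) * (x l' m' * (if m' = m then idm P m' else 0)))"
      using assms(5) by (intro eqS_left idem_idem) simp_all
    also have "(if l = l' then idm P l else 0) * (x l' m' * (if m' = m then idm P m' else 0)) =
        (if l' = l then if m' = m then idm P l * x l m * idm P m else 0 else 0)"
      by (simp add: mult.assoc)
    finally show ?thesis by (simp only: mult.assoc)
  qed
  then have "eqS P (\<Sum>l'\<in>B. \<Sum>m'\<in>B. idm P l * (idm P l' * x l' m' * idm P m') * idm P m)
      (\<Sum>l'\<in>B. \<Sum>m'\<in>B. if l' = l then if m' = m then idm P l * x l m * idm P m else 0 else 0)"
    by (intro eqS_sum)
  also have "(\<Sum>l'\<in>B. \<Sum>m'\<in>B. if l' = l then if m' = m then idm P l * x l m * idm P m else 0 else 0) =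
      (\<Sum>l'\<in>B. if l' = l then \<Sum>m'\<in>B. if m' = m then idm P l * x l m * idm P m else 0 else 0)"
    by (intro sum.cong refl) simp
  also have "\<dots> = idm P l * x l m * idm P m" using assms(2-4) by simp
  finally show ?thesis by (simp add: sum_distrib_left sum_distrib_right)
qed

lemma idem_lS:
  assumes fin: "finite (W P)" and p: "p \<in> homog (l - m)"
  shows "eqS P (idm P l * lS P p * idm P m) (lS P p * idm P m)"
proof -
  have h: "eqS P (lS P p * idm P m) (idm P l * lS P p)"
    using lS_homog_idem[OF fin p, of m] by simp
  have c: "lS P p \<in> car (GS P)" using homog_car[OF p] by simp
  have "eqS P (idm P l * lS P p * idm P m) (idm P l * (idm P l * lS P p))"
    using eqS_left[OF h, of "idm P l"] by (simp add: mult.assoc)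
  also have "eqS P \<dots> (idm P l * lS P p)"
    using eqS_right[OF idem_idem[of P l l] c] by (simp add: mult.assoc)
  also have "eqS P \<dots> (lS P p * idm P m)" by (rule eqS_sym[OF h])
  finally show ?thesis .
qed

lemma tt_mult:
  assumes f: "represents f r B" and g: "represents g r' B" and fin: "finite (W P)"
  shows "eqS P (tt P r B * tt P r' B) (tt P (\<lambda>l n. \<Sum>m\<in>B. r l m * r' m n) B)"
proof -
  note F = representsD[OF f] and G = representsD[OF g]
  let ?x = "\<lambda>l m. lS P (r l m)" and ?y = "\<lambda>m n. lS P (r' m n)"
  have c: "?x l m \<in> car (GS P)" "?y l m \<in> car (GS P)" for l m using F(3) G(3) by simp_all
  have term_eq: "eqS P ((idm P l * ?x l m * idm P m) * (idm P m' * ?y m' n * idm P n))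
      (if m' = m then idm P l * (?x l m * ?y m n) * idm P n else 0)" for l m m' n
  proof -
    have "eqS P ((idm P l * ?x l m) * ((idm P m * idm P m') * (?y m' n * idm P n)))
        ((idm P l * ?x l m) * ((if m = m' then idm P m else 0) * (?y m' n * idm P n)))"
      using c by (intro eqS_left eqS_right idem_idem car_mult) simp_all
    also have "eqS P \<dots> ((idm P l * ?x l m) * (if m' = m then ?y m n * idm P n else 0))"
    proof (cases "m' = m")
      case True
      then show ?thesis
        using eqS_left[OF idem_lS[OF fin G(2)[of m n]], of "idm P l * ?x l m"] c by (simp add: mult.assoc)
    next
      case False
      then show ?thesis by (simp add: eqS_refl)
    qed
    finally show ?thesis by (simp add: mult.assoc split: if_splits)
  qed
  have "eqS P (\<Sum>l\<in>B. \<Sum>m\<in>B. \<Sum>m'\<in>B. \<Sum>n\<in>B. (idm P l * ?x l m * idm P m) * (idm P m' * ?y m' n * idm P n))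
      (\<Sum>l\<in>B. \<Sum>m\<in>B. \<Sum>m'\<in>B. \<Sum>n\<in>B. if m' = m then idm P l * (?x l m * ?y m n) * idm P n else 0)"
    by (intro eqS_sum term_eq)
  also have "(\<Sum>l\<in>B. \<Sum>m\<in>B. \<Sum>m'\<in>B. \<Sum>n\<in>B. if m' = m then idm P l * (?x l m * ?y m n) * idm P n else 0) =
      (\<Sum>l\<in>B. \<Sum>m\<in>B. \<Sum>n\<in>B. idm P l * (?x l m * ?y m n) * idm P n)"
  proof (rule sum.cong[OF refl], rule sum.cong[OF refl])
    fix l m assume m: "m \<in> B"
    have "(\<Sum>m'\<in>B. \<Sum>n\<in>B. if m' = m then idm P l * (?x l m * ?y m n) * idm P n else 0) =
        (\<Sum>m'\<in>B. if m' = m then \<Sum>n\<in>B. idm P l * (?x l m * ?y m n) * idm P n else 0)"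
      by (intro sum.cong refl) simp
    then show "(\<Sum>m'\<in>B. \<Sum>n\<in>B. if m' = m then idm P l * (?x l m * ?y m n) * idm P n else 0) =
        (\<Sum>n\<in>B. idm P l * (?x l m * ?y m n) * idm P n)"
      using m F(1) by simp
  qed
  also have "\<dots> = (\<Sum>l\<in>B. \<Sum>n\<in>B. \<Sum>m\<in>B. idm P l * (?x l m * ?y m n) * idm P n)"
    by (rule sum.cong[OF refl sum.swap])
  also have "\<dots> = tt P (\<lambda>l n. \<Sum>m\<in>B. r l m * r' m n) B"
    by (simp add: tt_def lS_simps sum_distrib_left sum_distrib_right)
  finally show ?thesis
    unfolding tt_def sum_distrib_right unfolding sum_distrib_left .
qed

definition hat :: "('x set \<Rightarrow> ('i, 'x) gen free) \<Rightarrow> 'x set \<Rightarrow> ('i, 'x) gen free set" where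
  "hat x = (\<lambda>P\<in>FS. clS P (x P))"

lemma hat_eqI:
  assumes "\<And>P. P \<in> FS \<Longrightarrow> x P \<in> car (GS P)" "\<And>P. P \<in> FS \<Longrightarrow> y P \<in> car (GS P)"
    "\<And>P. P \<in> FS \<Longrightarrow> finite (W P) \<Longrightarrow> eqS P (x P) (y P)"
  shows "hat x = hat y"
  unfolding hat_def using assms finite_orbits by (intro restrict_ext) (simp add: clS_eq)

lemma hat_ops:
  assumes "\<And>P. P \<in> FS \<Longrightarrow> x P \<in> car (GS P)" "\<And>P. P \<in> FS \<Longrightarrow> y P \<in> car (GS P)"
  shows "hat x \<oplus>\<^bsub>Uhat D\<^esub> hat y = hat (\<lambda>P. x P + y P)" "hat x \<otimes>\<^bsub>Uhat D\<^esub> hat y = hat (\<lambda>P. x P * y P)"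
    "c \<odot>\<^bsub>Uhat D\<^esub> hat x = hat (\<lambda>P. scal c * x P)"
  unfolding hat_def Uhat_def using assms
  by (auto intro!: restrict_ext simp: S_alg_def cls_add[OF RS_car] cls_mult[OF RS_car] cls_smult[OF RS_car])

lemma Uhat_zero: "\<zero>\<^bsub>Uhat D\<^esub> = hat (\<lambda>P. 0)"
  unfolding hat_def Uhat_def by (auto intro!: restrict_ext simp: S_alg_def presented_zero[OF RS_car])

lemma hat_E_eq: "hat_E D s i = hat (\<lambda>P. genE s i)"
  by (simp add: hat_E_def hat_def S_E_def)

lemma hat_one_eq: "hat_one D l = hat (\<lambda>P. idm P l)"
  by (simp add: hat_one_def hat_def S_one_def)

text \<open>The restriction to \<open>FS\<close> matches the extensional families in
  \<open>Uhat\<close>; the restriction to the carrier makes the map extensional, as uniqueness in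
  the theorem demands.\<close>

definition theta :: "('i, 'x, 'y) udot \<Rightarrow> 'x set \<Rightarrow> ('i, 'x) gen free set" where
  "theta = (\<lambda>f\<in>carrier (Udot D). \<lambda>P\<in>FS. pdot_map D P f)"

lemma theta_rep: "represents f r B \<Longrightarrow> theta f = hat (\<lambda>P. tt P r B)"
  unfolding theta_def hat_def using represents_carrier
  by (auto intro!: restrict_ext pdot_rep finite_orbits)

lemma tt_car': "represents f r B \<Longrightarrow> tt P r B \<in> car (GS P)"
  using representsD(3) by (intro tt_car) blast

lemma tau_tt:
  assumes "P \<subseteq> P'" "finite (W P')"
  shows "lift scal (tau P) (tt P' r B) = tt P r B"
  by (simp add: tt_def free.lift_sum free.lift_mult tau_idem[OF assms(1)] tau_lS[OF assms])

lemma theta_closed: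
  assumes "represents f r B"
  shows "theta f \<in> carrier (Uhat D)"
proof -
  have "hat (\<lambda>P. tt P r B) P \<in> carrier (S_alg D P)" if "P \<in> FS" for P
    using that tt_car'[OF assms] by (simp add: hat_def S_alg_def carrier_presented)
  moreover have "hat (\<lambda>P. tt P r B) P = S_trans D P (hat (\<lambda>P. tt P r B) P')"
    if "P \<in> FS" "P' \<in> FS" "P \<subseteq> P'" for P P'
    using that S_trans_cls[OF that(3) finite_orbits[OF that(2)] tt_car'[OF assms]]
      tau_tt[OF that(3) finite_orbits[OF that(2)]] by (simp add: hat_def)
  moreover have "hat (\<lambda>P. tt P r B) \<in> extensional FS" by (simp add: hat_def)
  ultimately show ?thesis
    unfolding theta_rep[OF assms] Uhat_def partial_object.simps PiE_def Pi_def by blast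
qed

lemma represents_pair:
  assumes "f \<in> carrier (Udot D)" "g \<in> carrier (Udot D)"
  obtains r r' B where "represents f r B" "represents g r' B"
proof -
  obtain r B where r: "represents f r B" by (rule represents_exists[OF assms(1)])
  obtain r' B' where r': "represents g r' B'" by (rule represents_exists[OF assms(2)])
  have "finite (B \<union> B')" using representsD(1)[OF r] representsD(1)[OF r'] by simp
  then show thesis using represents_mono[OF r, of "B \<union> B'"] represents_mono[OF r', of "B \<union> B'"] that by blast
qed

lemma tt_add: "tt P (\<lambda>l m. r l m + r' l m) B = tt P r B + tt P r' B"
  by (simp add: tt_def lS_simps distrib_left distrib_right sum.distrib)

lemma tt_scal: "tt P (\<lambda>l m. scal c * r l m) B = scal c * tt P r B"
  by (simp add: tt_def lS_simps sum_distrib_left mult.assoc free.sc_left_comm[of "idm P _"])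

lemma theta_hom: "theta \<in> alg_hom (Udot D) (Uhat D)"
  unfolding alg_hom_def
proof (intro CollectI conjI ballI allI funcsetI)
  fix f assume f: "f \<in> carrier (Udot D)"
  obtain r B where r: "represents f r B" by (rule represents_exists[OF f])
  show "theta f \<in> carrier (Uhat D)" by (rule theta_closed[OF r])
  show "theta (c \<odot>\<^bsub>Udot D\<^esub> f) = c \<odot>\<^bsub>Uhat D\<^esub> theta f" for c
    unfolding theta_rep[OF r] theta_rep[OF represents_smult[OF r]] tt_scal
    by (rule hat_ops(3)[symmetric]) (rule tt_car'[OF r])+
  fix g assume g: "g \<in> carrier (Udot D)"
  obtain r r' B where r: "represents f r B" and r': "represents g r' B" by (rule represents_pair[OF f g])
  show "theta (f \<oplus>\<^bsub>Udot D\<^esub> g) = theta f \<oplus>\<^bsub>Uhat D\<^esub> theta g"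
    unfolding theta_rep[OF r] theta_rep[OF r'] theta_rep[OF represents_add[OF r r']] tt_add
    by (rule hat_ops(1)[symmetric]) (rule tt_car'[OF r] tt_car'[OF r'])+
  have "hat (\<lambda>P. tt P r B) \<otimes>\<^bsub>Uhat D\<^esub> hat (\<lambda>P. tt P r' B) = hat (\<lambda>P. tt P r B * tt P r' B)"
    by (rule hat_ops(2)) (rule tt_car'[OF r] tt_car'[OF r'])+
  also have "\<dots> = hat (\<lambda>P. tt P (\<lambda>l n. \<Sum>m\<in>B. r l m * r' m n) B)"
    by (intro hat_eqI tt_mult[OF r r'] car_mult tt_car'[OF r] tt_car'[OF r'] tt_car'[OF represents_mult[OF r r']])
  finally show "theta (f \<otimes>\<^bsub>Udot D\<^esub> g) = theta f \<otimes>\<^bsub>Uhat D\<^esub> theta g"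
    unfolding theta_rep[OF r] theta_rep[OF r'] theta_rep[OF represents_mult[OF r r']] by simp
qed

lemma theta_is_theta: "is_theta_dot D theta"
  unfolding is_theta_dot_def using theta_hom by (simp add: phat_def theta_def)

lemma is_theta_eq:
  assumes "is_theta_dot D \<theta>" "f \<in> carrier (Udot D)"
  shows "\<theta> f = theta f"
proof
  fix P
  have "\<theta> f \<in> carrier (Uhat D)" using assms unfolding is_theta_dot_def alg_hom_def by auto
  then have "\<theta> f \<in> extensional FS" by (simp add: Uhat_def PiE_def)
  then show "\<theta> f P = theta f P"
    using assms unfolding is_theta_dot_def
    by (cases "P \<in> FS") (auto simp: theta_def phat_def extensional_def)
qed

text \<open>Multiplying equal images by idempotents on both sides compares them entry by entry; each
  difference of entries is killed in every S(P) and so is zero in its block.\<close>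

lemma theta_inj: "inj_on theta (carrier (Udot D))"
proof (rule inj_onI)
  fix f g assume f: "f \<in> carrier (Udot D)" and g: "g \<in> carrier (Udot D)" and eq: "theta f = theta g"
  obtain r r' B where r: "represents f r B" and r': "represents g r' B" by (rule represents_pair[OF f g])
  note F = representsD[OF r] and G = representsD[OF r']
  show "f = g"
  proof (intro ext)
    fix l m
    show "f l m = g l m"
    proof (cases "l \<in> B \<and> m \<in> B")
      case True
      have "killed l m (r l m - r' l m)"
        unfolding killed_def
      proof
        fix P assume P: "P \<in> FS"
        have "clS P (tt P r B) = clS P (tt P r' B)"
          using fun_cong[OF eq, of P] P by (simp add: theta_rep[OF r] theta_rep[OF r'] hat_def)
        then have e: "eqS P (tt P r B) (tt P r' B)" using tt_car'[OF r] tt_car'[OF r'] by (simp add: clS_eq)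
        have "eqS P (idm P l * lS P (r l m) * idm P m) (idm P l * tt P r B * idm P m)"
          unfolding tt_def using True F(1,3) by (intro eqS_sym[OF idem_sandwich[of 0]]) simp_all
        also have "eqS P \<dots> (idm P l * tt P r' B * idm P m)"
          by (intro eqS_right eqS_left e) simp_all
        also have "eqS P \<dots> (idm P l * lS P (r' l m) * idm P m)"
          unfolding tt_def using True G(1,3) by (intro idem_sandwich[of 0]) simp_all
        finally show "idm P l * lS P (r l m - r' l m) * idm P m \<in> iS P"
          by (simp add: eqS_def lS_simps left_diff_distrib right_diff_distrib)
      qed
      then have "r l m - r' l m \<in> KU l m" using F(3) G(3) by (intro killed_imp_KU) simp_all
      then show ?thesis using F(3) G(3) by (simp add: F(4) G(4) bp_eq_iff)
    next
      case False
      then show ?thesis using F(5)[of l m] G(5)[of l m] by (auto simp: F(4) G(4))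
    qed
  qed
qed

lemma theta_proj:
  assumes p: "p \<in> homog (l - m)"
  shows "theta (udot_proj D l m (clU p)) = hat (\<lambda>P. lS P p * idm P m)"
proof -
  let ?r = "\<lambda>l' m'. if l' = l \<and> m' = m then p else 0"
  have "eqS P (tt P ?r {l, m}) (lS P p * idm P m)" if "finite (W P)" for P
  proof -
    have "tt P ?r {l, m} = (\<Sum>l'\<in>{l, m}. \<Sum>m'\<in>{l, m}. if l' = l then if m' = m then idm P l * lS P p * idm P m else 0 else 0)"
      unfolding tt_def by (intro sum.cong refl) (simp add: lS_simps)
    also have "\<dots> = (\<Sum>l'\<in>{l, m}. if l' = l then \<Sum>m'\<in>{l, m}. if m' = m then idm P l * lS P p * idm P m else 0 else 0)"
      by (intro sum.cong refl) simp
    also have "\<dots> = idm P l * lS P p * idm P m" by (simp only: sum.delta finite.intros) simp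
    finally show ?thesis using idem_lS[OF that p] by simp
  qed
  then show ?thesis
    unfolding theta_rep[OF represents_proj[OF p]] using homog_car[OF p]
    by (intro hat_eqI tt_car'[OF represents_proj[OF p]]) simp_all
qed

lemma theta_E1:
  assumes "i \<in> I"
  shows "theta (udot_E1 D s i l) = hat_E D s i \<otimes>\<^bsub>Uhat D\<^esub> hat_one D l"
proof -
  have "genE s i \<in> homog (l + signed s (simple_root D i) - l)" using homog_genE[OF assms] by simp
  from theta_proj[OF this] have "theta (udot_E1 D s i l) = hat (\<lambda>P. genE s i * idm P l)"
    by (simp add: udot_E1_def U_E_def lS_simps)
  also have "\<dots> = hat_E D s i \<otimes>\<^bsub>Uhat D\<^esub> hat_one D l"
    unfolding hat_E_eq hat_one_eq using assms by (intro hat_ops(2)[symmetric]) simp_all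
  finally show ?thesis .
qed

lemma homog_1': "1 \<in> homog (l - l)"
  using homog_1 by simp

lemma theta_one: "theta (udot_proj D l l (clU 1)) = hat_one D l"
  using theta_proj[OF homog_1'] by (simp add: lS_simps hat_one_eq)

lemma theta_image_subalg: "subalg (Uhat D) (theta ` carrier (Udot D))"
proof -
  have hom: "theta f \<in> carrier (Uhat D)" "theta (f \<oplus>\<^bsub>Udot D\<^esub> g) = theta f \<oplus>\<^bsub>Uhat D\<^esub> theta g"
    "theta (f \<otimes>\<^bsub>Udot D\<^esub> g) = theta f \<otimes>\<^bsub>Uhat D\<^esub> theta g" "theta (c \<odot>\<^bsub>Udot D\<^esub> f) = c \<odot>\<^bsub>Uhat D\<^esub> theta f"
    if "f \<in> carrier (Udot D)" "g \<in> carrier (Udot D)" for f g c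
    using theta_hom that unfolding alg_hom_def by auto
  have closed: "f \<oplus>\<^bsub>Udot D\<^esub> g \<in> carrier (Udot D)" "f \<otimes>\<^bsub>Udot D\<^esub> g \<in> carrier (Udot D)"
    "c \<odot>\<^bsub>Udot D\<^esub> f \<in> carrier (Udot D)" if f: "f \<in> carrier (Udot D)" and g: "g \<in> carrier (Udot D)" for f g c
  proof -
    obtain r r' B where r: "represents f r B" "represents g r' B" by (rule represents_pair[OF f g])
    show "f \<oplus>\<^bsub>Udot D\<^esub> g \<in> carrier (Udot D)" by (rule represents_carrier[OF represents_add[OF r]])
    show "f \<otimes>\<^bsub>Udot D\<^esub> g \<in> carrier (Udot D)" by (rule represents_carrier[OF represents_mult[OF r]])
    show "c \<odot>\<^bsub>Udot D\<^esub> f \<in> carrier (Udot D)" by (rule represents_carrier[OF represents_smult[OF r(1)]])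
  qed
  have "\<zero>\<^bsub>Uhat D\<^esub> = theta \<zero>\<^bsub>Udot D\<^esub>"
    unfolding theta_rep[OF represents_zero] by (simp add: Uhat_zero tt_def)
  moreover have "\<zero>\<^bsub>Udot D\<^esub> \<in> carrier (Udot D)" by (rule represents_carrier[OF represents_zero])
  ultimately show ?thesis
    unfolding subalg_def
  proof (intro conjI ballI allI)
    fix x y assume "x \<in> theta ` carrier (Udot D)" "y \<in> theta ` carrier (Udot D)"
    then obtain f g where fg: "f \<in> carrier (Udot D)" "g \<in> carrier (Udot D)" "x = theta f" "y = theta g" by blast
    show "x \<oplus>\<^bsub>Uhat D\<^esub> y \<in> theta ` carrier (Udot D)" "x \<otimes>\<^bsub>Uhat D\<^esub> y \<in> theta ` carrier (Udot D)"
      unfolding fg(3,4) hom(2,3)[OF fg(1,2), symmetric] using closed(1,2)[OF fg(1,2)] by simp_all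
  next
    fix c x assume "x \<in> theta ` carrier (Udot D)"
    then obtain f where f: "f \<in> carrier (Udot D)" "x = theta f" by blast
    show "c \<odot>\<^bsub>Uhat D\<^esub> x \<in> theta ` carrier (Udot D)"
      unfolding f(2) hom(4)[OF f(1,1), symmetric] using closed(3)[OF f(1,1)] by simp
  qed (use hom(1) in auto)
qed

section \<open>The subalgebra generated by the products and the invariant idempotents\<close>

context
  fixes H :: "('x set \<Rightarrow> ('i, 'x) gen free set) set"
  assumes H: "subalg (Uhat D) H" and gens: "hat_products D \<union> hat_invariant_ones D \<subseteq> H"
begin

lemma H_add: "(\<And>P. x P \<in> car (GS P)) \<Longrightarrow> (\<And>P. y P \<in> car (GS P)) \<Longrightarrow> hat x \<in> H \<Longrightarrow> hat y \<in> H \<Longrightarrow> hat (\<lambda>P. x P + y P) \<in> H"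
  using H unfolding subalg_def by (simp flip: hat_ops(1))

lemma H_mult: "(\<And>P. x P \<in> car (GS P)) \<Longrightarrow> (\<And>P. y P \<in> car (GS P)) \<Longrightarrow> hat x \<in> H \<Longrightarrow> hat y \<in> H \<Longrightarrow> hat (\<lambda>P. x P * y P) \<in> H"
  using H unfolding subalg_def by (simp flip: hat_ops(2))

lemma H_scal: "(\<And>P. x P \<in> car (GS P)) \<Longrightarrow> hat x \<in> H \<Longrightarrow> hat (\<lambda>P. scal c * x P) \<in> H"
  using H unfolding subalg_def by (simp add: hat_ops(3)[of x x, symmetric])

lemma H_0: "hat (\<lambda>P. 0) \<in> H"
  using H unfolding subalg_def by (simp add: Uhat_zero)

lemma H_sum:
  assumes "\<And>s P. s \<in> X \<Longrightarrow> x s P \<in> car (GS P)" "\<And>s. s \<in> X \<Longrightarrow> hat (x s) \<in> H"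
  shows "hat (\<lambda>P. \<Sum>s\<in>X. x s P) \<in> H"
  using assms
proof (induction X rule: infinite_finite_induct)
  case (insert s X)
  have "hat (\<lambda>P. x s P + (\<Sum>s\<in>X. x s P)) \<in> H"
    using insert by (intro H_add) auto
  then show ?case using insert.hyps by simp
qed (simp_all add: H_0)

lemma H_E: "i \<in> I \<Longrightarrow> hat (\<lambda>P. genE s i * idm P l) \<in> H"
proof -
  assume i: "i \<in> I"
  have "hat_E D s i \<otimes>\<^bsub>Uhat D\<^esub> hat_one D l \<in> H" using gens i unfolding hat_products_def by blast
  then show ?thesis unfolding hat_E_eq hat_one_eq using i by (simp add: hat_ops(2))
qed

lemma H_one: "hat (\<lambda>P. idm P l) \<in> H"
proof (cases "\<forall>i\<in>I. pair D (coroot D i) l = 0")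
  case True
  then have "hat_one D l \<in> H" using gens unfolding hat_invariant_ones_def by blast
  then show ?thesis by (simp add: hat_one_eq)
next
  case False
  then obtain i where i: "i \<in> I" and nz: "pair D (coroot D i) l \<noteq> 0" by blast
  define c where "c = qnum (q i) (pair D (coroot D i) l)"
  have c: "c \<noteq> 0" unfolding c_def by (rule qnum_nz[OF generic_q[OF i] nz])
  let ?A = "\<lambda>s k. \<lambda>P. genE s i * idm P k"
  let ?x = "\<lambda>P. ?A Plus (l - simple_root D i) P * ?A Minus l P"
  let ?y = "\<lambda>P. ?A Minus (l + simple_root D i) P * ?A Plus l P"
  have carA: "?A s k P \<in> car (GS P)" for s k P using i by simp
  \<comment> \<open>The commutator at weight \<open>l\<close> divided by its nonzero quantum number.
    The difference is written with \<open>scal (- 1)\<close> because the closure of \<open>H\<close>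
    is available for sums and multiples.\<close>
  have "hat (\<lambda>P. scal (inverse c) * (?x P + scal (- 1) * ?y P)) \<in> H"
    using i by (intro H_scal H_add H_mult H_E) simp_all
  also have "hat (\<lambda>P. scal (inverse c) * (?x P + scal (- 1) * ?y P)) = hat (\<lambda>P. idm P l)"
  proof (rule hat_eqI)
    fix P assume fin: "finite (W P)"
    have step: "eqS P (genE s i * idm P k * (genE s' i * idm P l)) (genE s i * genE s' i * idm P l)"
      if k: "k = l + signed s' (simple_root D i)" for s s' k
    proof -
      have "eqS P (idm P k * (genE s' i * idm P l)) (genE s' i * idm P l)"
        using idem_lS[OF fin, of "genE s' i" k l] homog_genE[OF i, of s'] by (simp add: k lS_simps mult.assoc)
      from eqS_left[OF this, of "genE s i"] show ?thesis using i by (simp add: mult.assoc)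
    qed
    have "eqS P (?x P + scal (- 1) * ?y P) ((genE Plus i * genE Minus i) * idm P l - (genE Minus i * genE Plus i) * idm P l)"
    proof -
      have "?x P - (genE Plus i * genE Minus i) * idm P l - (?y P - (genE Minus i * genE Plus i) * idm P l) \<in> iS P"
        using iS_diff[OF step[of "l - simple_root D i" Minus Plus, unfolded eqS_def]
            step[of "l + simple_root D i" Plus Minus, unfolded eqS_def]] by simp
      then show ?thesis by (simp add: eqS_def free.sc_minus algebra_simps)
    qed
    also have "eqS P \<dots> ((\<Sum>k\<in>W P. scal (qnum (q i) (pair D (coroot D i) k)) * idm P k) * idm P l)"
      using eqS_right[OF S_comm[OF i i, of P], of "idm P l"] by (simp add: left_diff_distrib)
    also have "eqS P \<dots> (\<Sum>k\<in>W P. if k = l then scal c * idm P l else 0)"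
      unfolding sum_distrib_right
    proof (rule eqS_sum)
      fix k
      show "eqS P (scal (qnum (q i) (pair D (coroot D i) k)) * idm P k * idm P l) (if k = l then scal c * idm P l else 0)"
        using eqS_left[OF idem_idem[of P k l], of "scal (qnum (q i) (pair D (coroot D i) k))"]
        by (cases "k = l") (simp_all add: mult.assoc c_def)
    qed
    also have "(\<Sum>k\<in>W P. if k = l then scal c * idm P l else 0) = scal c * idm P l"
      using fin by (simp add: idem_zero)
    finally have "eqS P (scal (inverse c) * (?x P + scal (- 1) * ?y P)) (scal (inverse c) * (scal c * idm P l))"
      by (rule eqS_left) simp
    then show "eqS P (scal (inverse c) * (?x P + scal (- 1) * ?y P)) (idm P l)"
      using c by (simp flip: mult.assoc[of "scal _" "scal _"] scal_mult)
  qed (use i in simp_all)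
  finally show ?thesis .
qed

text \<open>The rest of the word ends in the weight \<open>?k\<close>, so the idempotent of that
  weight can be inserted behind the next letter: a letter E then becomes one of the given products,
  and a letter K_h a scalar.\<close>

lemma H_word: "set xs \<subseteq> GU \<Longrightarrow> hat (\<lambda>P. lS P (wd xs) * idm P m) \<in> H"
proof (induction xs)
  case Nil
  then show ?case using H_one by (simp add: lS_simps)
next
  case (Cons g xs)
  let ?k = "wsum xs + m"
  have xs: "set xs \<subseteq> GU" and g: "g \<in> GU" using Cons.prems by simp_all
  note IH = Cons.IH[OF xs]
  have car: "lS P (wd xs) \<in> car (GS P)" for P using wd_car[OF xs] by simp
  have hom: "wd xs \<in> homog (?k - m)"
  proof -
    have "wd ys \<in> homog (wsum ys)" if "set ys \<subseteq> GU" for ys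
      using that by (induction ys) (simp_all add: homog_1 homog_mult homog_def[of "gen_weight D _"] gen_elt_def car_single)
    from this[OF xs] show ?thesis by simp
  qed
  from g show ?case
  proof (cases rule: GU_cases)
    case (E s i)
    have "hat (\<lambda>P. (genE s i * idm P ?k) * (lS P (wd xs) * idm P m)) \<in> H"
      using E car by (intro H_mult H_E IH) simp_all
    also have "hat (\<lambda>P. (genE s i * idm P ?k) * (lS P (wd xs) * idm P m)) = hat (\<lambda>P. lS P (wd (g # xs)) * idm P m)"
    proof (rule hat_eqI)
      fix P assume fin: "finite (W P)"
      show "eqS P ((genE s i * idm P ?k) * (lS P (wd xs) * idm P m)) (lS P (wd (g # xs)) * idm P m)"
        using eqS_left[OF idem_lS[OF fin hom], of "genE s i"] E by (simp add: lS_simps mult.assoc)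
    qed (use E car in \<open>simp_all add: lS_simps\<close>)
    finally show ?thesis .
  next
    case (T h)
    have "hat (\<lambda>P. scal (v_ind powi pair D h ?k) * (lS P (wd xs) * idm P m)) \<in> H"
      using car by (intro H_scal IH) simp_all
    also have "hat (\<lambda>P. scal (v_ind powi pair D h ?k) * (lS P (wd xs) * idm P m)) = hat (\<lambda>P. lS P (wd (g # xs)) * idm P m)"
    proof (rule hat_eqI)
      fix P assume fin: "finite (W P)"
      let ?y = "lS P (wd xs) * idm P m" and ?c = "scal (v_ind powi pair D h ?k) :: ('i, 'x) gen free"
      have e: "eqS P (idm P ?k * ?y) ?y" using idem_lS[OF fin hom] by (simp add: mult.assoc)
      have "eqS P (SK P h * ?y) (SK P h * (idm P ?k * ?y))" by (rule eqS_left[OF eqS_sym[OF e]]) simp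
      also have "eqS P \<dots> (?c * (idm P ?k * ?y))"
        using eqS_right[OF SK_idem(1)[OF fin, of h ?k], of ?y] car by (simp add: mult.assoc)
      also have "eqS P \<dots> (?c * ?y)" by (rule eqS_left[OF e]) simp
      finally show "eqS P (?c * ?y) (lS P (wd (g # xs)) * idm P m)"
        using eqS_sym T by (simp add: lS_simps mult.assoc)
    qed (use T car in \<open>simp_all add: lS_simps\<close>)
    finally show ?thesis .
  qed
qed

lemma theta_in_H:
  assumes "f \<in> carrier (Udot D)"
  shows "theta f \<in> H"
proof -
  obtain r B where r: "represents f r B" by (rule represents_exists[OF assms])
  note F = representsD[OF r]
  have "hat (\<lambda>P. lS P p * idm P m) \<in> H" if p: "p \<in> car GU" for p m
  proof -
    let ?f = "\<lambda>w. scal (Poly_Mapping.lookup p w) * wd (letters w)"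
    have keys: "set (letters w) \<subseteq> GU" if "w \<in> Poly_Mapping.keys p" for w
      using p that by (auto simp: car_iff)
    have "hat (\<lambda>P. \<Sum>w\<in>Poly_Mapping.keys p. scal (Poly_Mapping.lookup p w) * (lS P (wd (letters w)) * idm P m)) \<in> H"
      using keys wd_car[OF keys] by (intro H_sum H_scal H_word) simp_all
    moreover have "lS P p * idm P m = (\<Sum>w\<in>Poly_Mapping.keys p. scal (Poly_Mapping.lookup p w) * (lS P (wd (letters w)) * idm P m))" for P
    proof -
      have "lS P (\<Sum>w\<in>Poly_Mapping.keys p. ?f w) * idm P m =
          (\<Sum>w\<in>Poly_Mapping.keys p. scal (Poly_Mapping.lookup p w) * (lS P (wd (letters w)) * idm P m))"
        by (simp add: lS_simps sum_distrib_right mult.assoc)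
      moreover have "(\<Sum>w\<in>Poly_Mapping.keys p. ?f w) = p"
        using poly_mapping_sum_single[of p] by (simp add: single_conv)
      ultimately show ?thesis by simp
    qed
    ultimately show ?thesis by simp
  qed
  then have "hat (\<lambda>P. lS P (r l m) * idm P m) \<in> H" for l m using F(3) by blast
  moreover have "hat (\<lambda>P. idm P l * lS P (r l m) * idm P m) = hat (\<lambda>P. lS P (r l m) * idm P m)" for l m
    using F(3) by (intro hat_eqI idem_lS F(2)) simp_all
  ultimately have "hat (\<lambda>P. idm P l * lS P (r l m) * idm P m) \<in> H" for l m by simp
  then have "hat (\<lambda>P. \<Sum>l\<in>B. \<Sum>m\<in>B. idm P l * lS P (r l m) * idm P m) \<in> H"
    using F(3) by (intro H_sum car_sum car_mult) simp_all
  then show ?thesis unfolding theta_rep[OF r] tt_def .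
qed

end

lemma generated_eq: "carrier (generated_subalg (Uhat D) (hat_products D \<union> hat_invariant_ones D)) = theta ` carrier (Udot D)"
proof -
  have "hat_products D \<union> hat_invariant_ones D \<subseteq> theta ` carrier (Udot D)"
  proof
    fix x assume "x \<in> hat_products D \<union> hat_invariant_ones D"
    then show "x \<in> theta ` carrier (Udot D)"
    proof
      assume "x \<in> hat_products D"
      then obtain s i l where x: "i \<in> I" "x = hat_E D s i \<otimes>\<^bsub>Uhat D\<^esub> hat_one D l" by (auto simp: hat_products_def)
      have "genE s i \<in> homog (l + signed s (simple_root D i) - l)" using homog_genE[OF x(1)] by simp
      from represents_carrier[OF represents_proj[OF this]]
      have "udot_E1 D s i l \<in> carrier (Udot D)" by (simp add: udot_E1_def U_E_def)
      then show ?thesis using theta_E1[OF x(1)] x(2) by (metis imageI)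
    next
      assume "x \<in> hat_invariant_ones D"
      then obtain l where "x = hat_one D l" by (auto simp: hat_invariant_ones_def)
      then show ?thesis
        using theta_one[of l] represents_carrier[OF represents_proj[OF homog_1', of l]] by (metis imageI)
    qed
  qed
  then show ?thesis
    unfolding generated_subalg_def using theta_image_subalg theta_in_H by auto
qed

lemma theta_iso: "alg_isomorphic (Udot D) (generated_subalg (Uhat D) (hat_products D \<union> hat_invariant_ones D))"
proof -
  let ?G = "generated_subalg (Uhat D) (hat_products D \<union> hat_invariant_ones D)"
  have ops: "x \<oplus>\<^bsub>?G\<^esub> y = x \<oplus>\<^bsub>Uhat D\<^esub> y" "x \<otimes>\<^bsub>?G\<^esub> y = x \<otimes>\<^bsub>Uhat D\<^esub> y" "c \<odot>\<^bsub>?G\<^esub> x = c \<odot>\<^bsub>Uhat D\<^esub> x" for x y c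
    by (simp_all add: generated_subalg_def)
  have "theta \<in> alg_hom (Udot D) ?G"
    using theta_hom unfolding alg_hom_def ops generated_eq by auto
  moreover have "bij_betw theta (carrier (Udot D)) (carrier ?G)"
    unfolding generated_eq using theta_inj by (simp add: bij_betw_def)
  ultimately show ?thesis unfolding alg_isomorphic_def by blast
qed

end

text \<open>\<open>is_theta_dot\<close> does not constrain values outside the carrier of
  \<open>Udot D\<close>, hence uniqueness among extensional functions. The further claims hold for
  every such map because it agrees with \<open>theta\<close> on the carrier.\<close>

theorem theorem3p3:
  fixes D :: "('i, 'x::ab_group_add, 'y::ab_group_add) root_datum"
  assumes "root_datum_finite_type D"
  shows "(\<exists>!\<theta>. \<theta> \<in> extensional (carrier (Udot D)) \<and> is_theta_dot D \<theta>) \<and>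
    (\<forall>\<theta>. is_theta_dot D \<theta> \<longrightarrow>
       \<theta> \<in> alg_embedding (Udot D) (Uhat D) \<and>
       (\<forall>s. \<forall>i\<in>simples D. \<forall>l.
          \<theta> (udot_E1 D s i l) = hat_E D s i \<otimes>\<^bsub>Uhat D\<^esub> hat_one D l)) \<and>
    alg_isomorphic (Udot D) (generated_subalg (Uhat D) (hat_products D \<union> hat_invariant_ones D))"
proof -
  interpret datum D by standard (rule assms)
  have E1: "udot_E1 D s i l \<in> carrier (Udot D)" if "i \<in> simples D" for s i l
  proof -
    have "genE s i \<in> homog (l + signed s (simple_root D i) - l)" using homog_genE[OF that] by simp
    from represents_carrier[OF represents_proj[OF this]]
    show ?thesis by (simp add: udot_E1_def U_E_def)
  qed
  show ?thesis
  proof (intro conjI allI impI ballI)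
    show "\<exists>!\<theta>. \<theta> \<in> extensional (carrier (Udot D)) \<and> is_theta_dot D \<theta>"
    proof (rule ex1I[of _ theta])
      show "theta \<in> extensional (carrier (Udot D)) \<and> is_theta_dot D theta"
        using theta_is_theta by (simp add: theta_def)
      fix \<theta> assume \<theta>: "\<theta> \<in> extensional (carrier (Udot D)) \<and> is_theta_dot D \<theta>"
      show "\<theta> = theta"
      proof (rule extensionalityI[of _ "carrier (Udot D)"])
        show "theta \<in> extensional (carrier (Udot D))" by (simp add: theta_def)
      qed (use \<theta> is_theta_eq in blast)+
    qed
    show "alg_isomorphic (Udot D) (generated_subalg (Uhat D) (hat_products D \<union> hat_invariant_ones D))"
      by (rule theta_iso)
    fix \<theta> assume \<theta>: "is_theta_dot D \<theta>"
    have "inj_on \<theta> (carrier (Udot D))"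
      using theta_inj is_theta_eq[OF \<theta>] by (simp cong: inj_on_cong)
    then show "\<theta> \<in> alg_embedding (Udot D) (Uhat D)"
      using \<theta> unfolding alg_embedding_def is_theta_dot_def by blast
    show "\<theta> (udot_E1 D s i l) = hat_E D s i \<otimes>\<^bsub>Uhat D\<^esub> hat_one D l" if "i \<in> simples D" for s i l
      using is_theta_eq[OF \<theta> E1[OF that]] theta_E1[OF that] by simp
  qed
qed


end
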